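(* Let $(X_t)_{t\in\mathbb{Z}}$ be a stationary real-valued process satisfying Assumptions (RV) and (AC+MX) below, with tail index $\kappa\in(0,1)\cup(1,2)$, and set $\mu:=\mathbb{E}[X_0]\mathbf{1}(\kappa>1)$. Then, with $(a_n)$ as defined below, $$a_n^{-1}\Big(\sum_{t=1}^n (X_t-\mu),\ \sqrt{\textstyle\sum_{t=1}^n (X_t-\mu)^2}\Big)\xrightarrow{d}(\xi_\kappa,\zeta_{\kappa/2}),\qquad n\to\infty,$$ where $\xi_\kappa$ is a $\kappa$-stable random variable, $\mathbb{P}(\zeta_{\kappa/2}>0)=1$, and $\zeta_{\kappa/2}^2$ is a $(\kappa/2)$-stable random variable.
   Context: Strong mixing coefficients of a stationary process $(X_t)_{t\in\mathbb{Z}}$: $\alpha_k=\sup|\mathrm{cov}(g_1(\dots,X_{-1},X_0),g_2(X_k,X_{k+1},\dots))|$, $k\ge0$, the supremum over measurable functions $g_1,g_2$ with $|g_1|,|g_2|\le1$. A real random variable $X$ is regularly varying with index $\kappa>0$ if $\mathbb{P}(X>x)\sim p_+L(x)x^{-\kappa}$ and $\mathbb{P}(X<-x)\sim p_-L(x)x^{-\kappa}$ as $x\to\infty$, for a slowly varying function $L$ and constants $p_\pm\ge0$ with $p_++p_-=1$ (tail-balance coefficients). A stationary real process is regularly varying with index $\kappa$ if $X_0$ is regularly varying with index $\kappa$ and there is a process $(\Theta_t)_{t\in\mathbb{Z}}$ (the spectral tail process) such that for every integer $h\ge0$, $\mathbb{P}(|X_0|^{-1}(X_{-h},\dots,X_h)\in\cdot\mid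 |X_0|>x)\to\mathbb{P}((\Theta_{-h},\dots,\Theta_h)\in\cdot)$ weakly as $x\to\infty$. Assumption (RV): $(X_t)$ is regularly varying with index $\kappa\in(0,1)\cup(1,2)$. Let $(a_n)_{n\ge1}$ be deterministic with $a_n\to\infty$ and $n\mathbb{P}(|X_0|>a_n)\to1$. Assumption (AC+MX): there is an integer sequence $r_n\to\infty$ with $r_n=o(n)$ such that $\lim_{k\to\infty}\limsup_{n\to\infty} n\sum_{t=k}^{r_n}\mathbb{E}[\min\{|a_n^{-1}X_t|,1\}\min\{|a_n^{-1}X_0|,1\}]=0$, and there is a sequence $\ell_n\to\infty$ with $\ell_n=o(r_n)$ such that $(n/r_n)\alpha_{\ell_n}\to0$. *)

theory Defs
  imports "HOL-Probability.Probability"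
begin

definition stationary_process :: "'a measure \<Rightarrow> (int \<Rightarrow> 'a \<Rightarrow> real) \<Rightarrow> bool" where
  "stationary_process M X \<longleftrightarrow>
     (\<forall>s::int. \<forall>k::nat.
        distr M (PiM {..<k} (\<lambda>_. borel)) (\<lambda>\<omega>. \<lambda>i\<in>{..<k}. X (s + int i) \<omega>) =
        distr M (PiM {..<k} (\<lambda>_. borel)) (\<lambda>\<omega>. \<lambda>i\<in>{..<k}. X (int i) \<omega>))"

definition strong_mixing_coeff :: "'a measure \<Rightarrow> (int \<Rightarrow> 'a \<Rightarrow> real) \<Rightarrow> nat \<Rightarrow> real" where
  "strong_mixing_coeff M X k =
     Sup {\<bar>(\<integral>\<omega>. g1 (\<lambda>j. X (- int j) \<omega>) * g2 (\<lambda>j. X (int k + int j) \<omega>) \<partial>M)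
            - (\<integral>\<omega>. g1 (\<lambda>j. X (- int j) \<omega>) \<partial>M) * (\<integral>\<omega>. g2 (\<lambda>j. X (int k + int j) \<omega>) \<partial>M)\<bar>
          | g1 g2. g1 \<in> borel_measurable (PiM UNIV (\<lambda>_::nat. borel :: real measure))
                 \<and> g2 \<in> borel_measurable (PiM UNIV (\<lambda>_::nat. borel :: real measure))
                 \<and> (\<forall>x. \<bar>g1 x\<bar> \<le> 1) \<and> (\<forall>x. \<bar>g2 x\<bar> \<le> 1)}"

definition slowly_varying :: "(real \<Rightarrow> real) \<Rightarrow> bool" where
  "slowly_varying L \<longleftrightarrow> L \<in> borel_measurable borel \<and> (\<forall>\<^sub>F x in at_top. L x > 0) \<and>
     (\<forall>c>0. ((\<lambda>x. L (c * x) / L x) \<longlongrightarrow> 1) at_top)"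

definition rv_variable :: "'a measure \<Rightarrow> ('a \<Rightarrow> real) \<Rightarrow> real \<Rightarrow> bool" where
  "rv_variable M Y \<kappa> \<longleftrightarrow> \<kappa> > 0 \<and>
     (\<exists>L pp pm. slowly_varying L \<and> pp \<ge> 0 \<and> pm \<ge> 0 \<and> pp + pm = 1 \<and>
        ((\<lambda>x. measure M {\<omega>\<in>space M. Y \<omega> > x} / (L x * x powr (-\<kappa>))) \<longlongrightarrow> pp) at_top \<and>
        ((\<lambda>x. measure M {\<omega>\<in>space M. Y \<omega> < - x} / (L x * x powr (-\<kappa>))) \<longlongrightarrow> pm) at_top)"

text \<open>Regularly varying stationary process with index kappa and a spectral tail
  process: Q is the law of (Theta_t)_{t \<in> Z} on R^Z. Weak convergence of the
  conditional law of |X_0|^{-1}(X_{-h},...,X_h) given |X_0|>x is expressed by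
  bounded continuous test functions on R^Z (product topology) applied to the
  zero-padded vector, which is an embedding of R^{2h+1} into R^Z.\<close>
definition rv_process :: "'a measure \<Rightarrow> (int \<Rightarrow> 'a \<Rightarrow> real) \<Rightarrow> real \<Rightarrow> bool" where
  "rv_process M X \<kappa> \<longleftrightarrow> rv_variable M (X 0) \<kappa> \<and>
     (\<exists>Q. prob_space Q \<and> sets Q = sets (PiM UNIV (\<lambda>_::int. borel :: real measure)) \<and>
        (\<forall>h::nat. \<forall>g :: (int \<Rightarrow> real) \<Rightarrow> real. continuous_on UNIV g \<and> bounded (range g) \<longrightarrow>
           ((\<lambda>x. (\<integral>\<omega>. indicator {\<omega>\<in>space M. \<bar>X 0 \<omega>\<bar> > x} \<omega> *
                        g (\<lambda>i. if - int h \<le> i \<and> i \<le> int h then X i \<omega> / \<bar>X 0 \<omega>\<bar> else 0) \<partial>M)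
                  / measure M {\<omega>\<in>space M. \<bar>X 0 \<omega>\<bar> > x})
             \<longlongrightarrow> (\<integral>\<theta>. g (\<lambda>i. if - int h \<le> i \<and> i \<le> int h then \<theta> i else 0) \<partial>Q)) at_top))"

definition stable_law :: "real \<Rightarrow> real measure \<Rightarrow> bool" where
  "stable_law \<alpha> \<nu> \<longleftrightarrow> 0 < \<alpha> \<and> \<alpha> \<le> 2 \<and> prob_space \<nu> \<and> sets \<nu> = sets borel \<and>
     (\<exists>\<sigma> \<beta> m. \<sigma> \<ge> 0 \<and> -1 \<le> \<beta> \<and> \<beta> \<le> 1 \<and>
        (\<forall>t. char \<nu> t =
           (if \<alpha> = 1 then
              exp (- complex_of_real (\<sigma> * \<bar>t\<bar>) *
                   (1 + \<i> * complex_of_real (\<beta> * (2 / pi) * sgn t * ln \<bar>t\<bar>))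
                   + \<i> * complex_of_real (m * t))
            else
              exp (- complex_of_real (\<sigma> powr \<alpha> * \<bar>t\<bar> powr \<alpha>) *
                   (1 - \<i> * complex_of_real (\<beta> * sgn t * tan (pi * \<alpha> / 2)))
                   + \<i> * complex_of_real (m * t)))))"

definition conv_distr_R2 :: "'a measure \<Rightarrow> (nat \<Rightarrow> 'a \<Rightarrow> real \<times> real) \<Rightarrow> (real \<times> real) measure \<Rightarrow> bool" where
  "conv_distr_R2 M Y \<nu> \<longleftrightarrow>
     (\<forall>f :: real \<times> real \<Rightarrow> real. continuous_on UNIV f \<and> bounded (range f) \<longrightarrow>
        (\<lambda>n. \<integral>\<omega>. f (Y n \<omega>) \<partial>M) \<longlonglongrightarrow> (\<integral>z. f z \<partial>\<nu>))"

end

theory Submission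
  imports Defs "HOL-Real_Asymp.Real_Asymp"
begin

text \<open>Let \<open>q\<close> be the function \<open>y \<mapsto> exp (\<i> (u y + v y\<^sup>2))\<close>. By stationarity, removing the factors of a block one at a time
  from the left writes the characteristic function of the block, minus one, as a telescoping sum of expectations of
  \<open>(q (X 0 / a) - 1) (\<Prod>t=1..j. q (X t / a))\<close>. Anti-clustering makes the factors with large \<open>t\<close> negligible and the spectral
  tail process gives the limit of \<open>n\<close> times such an expectation for fixed \<open>j\<close> (for \<open>\<kappa> > 1\<close> after subtracting the
  linear term of the mean). Hence a block of length \<open>b\<close> has characteristic function \<open>1 + (b / n) \<psi> u v + o (b / n)\<close>, and mixing
  between separated blocks gives the limit \<open>exp (\<psi> u v)\<close> of the joint characteristic functions, where
  \<open>\<psi> (s u) (s\<^sup>2 v) = s powr \<kappa> * \<psi> u v\<close> for \<open>s > 0\<close>. Continuity at the origin yields a limit law by Levy's theorem, transported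
  from the line to the plane along Schoenberg's space-filling curve. Both marginals are stable since their exponents
  are homogeneous (the skewness bound comes from computing a fractional moment), and the second one has no atom
  at zero because \<open>Re (\<psi> 0 1) < 0\<close>.\<close>

subsection \<open>Gaussian averages of characteristic functions\<close>

text \<open>Sum and sum of squares are treated jointly because the pair is additive over blocks; the
  square root enters only through a continuous map of the limit. Three obstacles shape the argument.
  For \<open>\<kappa> > 1\<close> the linear term of the mean cannot be ignored, as
  \<open>n / a n\<close> diverges; it is distributed over the single factors, and its quadratic
  error is negligible because \<open>n * r n * (drift u n)\<^sup>2\<close> tends to 0, which is
  drawn from anti-clustering through a second moment inequality and not from a rate on
  \<open>r\<close>. The spectral tail process controls bounded continuous functionals of the
  normalised path only; hence the amplitude is discretised and the linear compensator is replaced by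
  a bounded sine. Finally, the exponent is known through its homogeneity alone: the skewness bound
  appears as the order of the moment increases to the index, and the sign of the real part is read
  off from the probability that a block contains a large observation. Averages over a Gaussian
  argument serve as the truncation inequality, for tightness, for the absence of an atom and for
  that sign.\<close>

lemma char_gauss_average:
  assumes "real_distribution N"
  shows "(LINT g|std_normal_distribution. char N (s * g)) = complex_of_real (LINT x|N. exp (- (s * x)\<^sup>2 / 2))"
proof -
  interpret N: real_distribution N by fact
  interpret S: real_distribution std_normal_distribution by (rule real_dist_normal_dist)
  interpret P: pair_prob_space std_normal_distribution N ..
  \<comment> \<open>Fubini: integrating out the Gaussian variable first leaves its own
    characteristic function at \<open>s * x\<close>.\<close>
  have "integrable (std_normal_distribution \<Otimes>\<^sub>M N) (\<lambda>(g, x). iexp (s * g * x))"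
    by (rule P.integrable_const_bound[where B = 1]) auto
  then have "(LINT g|std_normal_distribution. char N (s * g))
      = (LINT x|N. LINT g|std_normal_distribution. iexp (s * g * x))"
    unfolding char_def by (subst P.Fubini_integral) auto
  also have "(\<lambda>x. LINT g|std_normal_distribution. iexp (s * g * x)) = (\<lambda>x. char std_normal_distribution (s * x))"
    unfolding char_def by (simp add: ac_simps)
  also have "(LINT x|N. char std_normal_distribution (s * x)) = complex_of_real (LINT x|N. exp (- (s * x)\<^sup>2 / 2))"
    unfolding char_std_normal_distribution by (simp add: integral_complex_of_real)
  finally show ?thesis .
qed

text \<open>The truncation inequality for tails, with a Gaussian in place of the uniform average:
  \<open>1 - exp (- y\<^sup>2 / 2)\<close> is nonnegative, and at least
  \<open>1 - exp (- 1 / 2)\<close> once \<open>\<bar>y\<bar> \<ge> 1\<close>, so with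
  \<open>y = s * x\<close> it dominates a multiple of the tail indicator.\<close>

lemma tail_le_gauss_average:
  assumes "real_distribution N" "s > 0"
  shows "(1 - exp (- 1 / 2)) * measure N {x. 1 / s \<le> \<bar>x\<bar>} \<le> 1 - Re (LINT g|std_normal_distribution. char N (s * g))"
proof -
  interpret N: real_distribution N by fact
  have "(1 - exp (- 1 / 2)) * measure N {x. 1 / s \<le> \<bar>x\<bar>}
      = (LINT x|N. (1 - exp (- 1 / 2)) * indicator {x. 1 / s \<le> \<bar>x\<bar>} x)"
    by simp
  also have "\<dots> \<le> (LINT x|N. 1 - exp (- (s * x)\<^sup>2 / 2))"
  proof (rule integral_mono)
    show "integrable N (\<lambda>x. (1 - exp (- 1 / 2)) * indicator {x. 1 / s \<le> \<bar>x\<bar>} x :: real)"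
      by (rule N.integrable_const_bound[where B = 1]) (auto simp: indicator_def)
    show "integrable N (\<lambda>x. 1 - exp (- (s * x)\<^sup>2 / 2))"
      by (rule N.integrable_const_bound[where B = 1]) auto
    fix x
    have "1 \<le> (s * x)\<^sup>2" if "1 / s \<le> \<bar>x\<bar>"
    proof -
      have "1 \<le> \<bar>s * x\<bar>" using that assms by (simp add: abs_mult field_simps)
      then show ?thesis by (metis one_le_power power2_abs)
    qed
    then show "(1 - exp (- 1 / 2)) * indicator {x. 1 / s \<le> \<bar>x\<bar>} x \<le> 1 - exp (- (s * x)\<^sup>2 / 2)"
      by (auto simp: indicator_def)
  qed
  also have "\<dots> = 1 - (LINT x|N. exp (- (s * x)\<^sup>2 / 2))"
    by (subst Bochner_Integration.integral_diff)
      (use N.prob_space in \<open>auto intro!: N.integrable_const_bound[where B = 1]\<close>)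
  finally show ?thesis using char_gauss_average[OF assms(1), of s] by simp
qed

text \<open>Pointwise convergence may fail at 0, because the Gaussian law gives no mass to a point;
  limits along \<open>g \<noteq> 0\<close> are enough.\<close>

lemma gauss_average_conv:
  fixes F :: "nat \<Rightarrow> real \<Rightarrow> complex"
  assumes "\<And>n. F n \<in> borel_measurable borel" "\<And>n g. cmod (F n g) \<le> B" "\<And>g. g \<noteq> 0 \<Longrightarrow> (\<lambda>n. F n g) \<longlonglongrightarrow> f g"
    "f \<in> borel_measurable borel"
  shows "(\<lambda>n. LINT g|std_normal_distribution. F n g) \<longlonglongrightarrow> (LINT g|std_normal_distribution. f g)"
proof (rule integral_dominated_convergence[where w = "\<lambda>_. B"])
  interpret S: real_distribution std_normal_distribution by (rule real_dist_normal_dist)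
  show "integrable std_normal_distribution (\<lambda>_. B)" by simp
  have "AE g in lborel. g \<noteq> (0::real)" by (rule AE_lborel_singleton)
  then have "AE g in std_normal_distribution. g \<noteq> 0"
    by (subst AE_density) auto
  then show "AE g in std_normal_distribution. (\<lambda>n. F n g) \<longlonglongrightarrow> f g"
    by (rule eventually_mono) (use assms(3) in auto)
qed (use assms in auto)

text \<open>The tightness half of Levy's theorem. Continuity of the limit at 0 makes its Gaussian
  average at a small scale \<open>s\<close> close to 1; dominated convergence carries this to the
  averages for large \<open>n\<close>, and these bound the tails beyond
  \<open>1 / s\<close>.\<close>

lemma eventually_tail_bound_of_char_conv:
  fixes N :: "nat \<Rightarrow> real measure"
  assumes N: "\<And>n. real_distribution (N n)" and conv: "\<And>t. (\<lambda>n. char (N n) t) \<longlonglongrightarrow> \<phi> t"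
    and cont: "(\<phi> \<longlongrightarrow> 1) (at 0)" and e: "\<epsilon> > 0"
  shows "\<exists>K>0. \<forall>\<^sub>F n in sequentially. measure (N n) {x. K \<le> \<bar>x\<bar>} < \<epsilon>"
proof -
  define S where "S = std_normal_distribution"
  interpret S: real_distribution S unfolding S_def by (rule real_dist_normal_dist)
  interpret N: real_distribution "N n" for n by fact
  have meas: "char (N n) \<in> borel_measurable borel" for n by simp
  have \<phi>m: "\<phi> \<in> borel_measurable borel"
    by (rule borel_measurable_LIMSEQ_metric[OF meas]) (use conv in auto)
  have \<phi>b: "cmod (\<phi> t) \<le> 1" for t
    using conv[of t, THEN tendsto_norm] by (rule tendsto_upperbound) (auto simp: N.cmod_char_le_1)
  have 0: "(\<lambda>k. LINT g|S. \<phi> (1 / Suc k * g)) \<longlonglongrightarrow> (LINT g|S. 1)"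
    unfolding S_def
  proof (rule gauss_average_conv)
    fix g :: real assume "g \<noteq> 0"
    have "filterlim (\<lambda>k. 1 / Suc k * g) (at 0) sequentially"
      unfolding filterlim_at
      using tendsto_mult[OF LIMSEQ_inverse_real_of_nat tendsto_const[of g]] \<open>g \<noteq> 0\<close> by (auto simp: field_simps)
    then show "(\<lambda>k. \<phi> (1 / Suc k * g)) \<longlonglongrightarrow> 1"
      using cont by (rule filterlim_compose[rotated])
  qed (use \<phi>m \<phi>b in auto)
  define c where "c = 1 - exp (- 1 / 2 :: real)"
  have c: "c > 0" unfolding c_def by simp
  have "(\<lambda>k. 1 - Re (LINT g|S. \<phi> (1 / Suc k * g))) \<longlonglongrightarrow> 1 - Re (LINT g|S. 1)"
    using 0 by (intro tendsto_intros)
  then have "(\<lambda>k. 1 - Re (LINT g|S. \<phi> (1 / Suc k * g))) \<longlonglongrightarrow> 0" using S.prob_space by simp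
  then have "\<forall>\<^sub>F k in sequentially. 1 - Re (LINT g|S. \<phi> (1 / Suc k * g)) < \<epsilon> * c"
    by (rule order_tendstoD) (use e c in auto)
  then obtain k where k: "1 - Re (LINT g|S. \<phi> (1 / Suc k * g)) < \<epsilon> * c"
    by (auto simp: eventually_sequentially)
  define s where "s = 1 / real (Suc k)"
  have s: "s > 0" unfolding s_def by simp
  have "(\<lambda>n. LINT g|S. char (N n) (s * g)) \<longlonglongrightarrow> (LINT g|S. \<phi> (s * g))"
    unfolding S_def by (rule gauss_average_conv) (use \<phi>m conv N.cmod_char_le_1 in auto)
  then have "(\<lambda>n. 1 - Re (LINT g|S. char (N n) (s * g))) \<longlonglongrightarrow> 1 - Re (LINT g|S. \<phi> (s * g))"
    by (intro tendsto_intros)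
  then have "\<forall>\<^sub>F n in sequentially. 1 - Re (LINT g|S. char (N n) (s * g)) < \<epsilon> * c"
    by (rule order_tendstoD) (use k s_def in auto)
  then have "\<forall>\<^sub>F n in sequentially. measure (N n) {x. 1 / s \<le> \<bar>x\<bar>} < \<epsilon>"
  proof eventually_elim
    case (elim n)
    then have "c * measure (N n) {x. 1 / s \<le> \<bar>x\<bar>} < c * \<epsilon>"
      using tail_le_gauss_average[OF N s, of n] unfolding c_def[symmetric] S_def by (simp add: mult.commute)
    then show ?case using c by simp
  qed
  then show ?thesis using s by (intro exI[of _ "1/s"]) auto
qed

text \<open>\<open>exp (- (k * x)\<^sup>2 / 2)\<close> is 1 at the origin, so its mean bounds the
  atom for every \<open>k\<close>; that mean is the Gaussian average of the characteristic function
  at scale \<open>k\<close>, which tends to 0.\<close>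

lemma no_atom_of_char_vanishing:
  assumes "real_distribution N" "(char N \<longlongrightarrow> 0) at_top" "(char N \<longlongrightarrow> 0) at_bot"
  shows "measure N {0} = 0"
proof -
  interpret N: real_distribution N by fact
  define S where "S = std_normal_distribution"
  have "(\<lambda>k. LINT g|S. char N (real k * g)) \<longlonglongrightarrow> (LINT g|S. 0)"
    unfolding S_def
  proof (rule gauss_average_conv)
    fix g :: real assume "g \<noteq> 0"
    show "(\<lambda>k. char N (real k * g)) \<longlonglongrightarrow> 0"
    proof (cases "g > 0")
      case True
      have "filterlim (\<lambda>k. real k * g) at_top sequentially"
        using True filterlim_tendsto_pos_mult_at_top[OF tendsto_const True filterlim_real_sequentially]
        by (simp add: mult.commute)
      then show ?thesis using assms(2) by (rule filterlim_compose[rotated])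
    next
      case False
      then have "g < 0" using \<open>g \<noteq> 0\<close> by simp
      have "filterlim (\<lambda>k. real k * g) at_bot sequentially"
        using \<open>g < 0\<close> filterlim_tendsto_neg_mult_at_bot[OF tendsto_const \<open>g < 0\<close> filterlim_real_sequentially]
        by (simp add: mult.commute)
      then show ?thesis using assms(3) by (rule filterlim_compose[rotated])
    qed
  qed (auto intro: N.cmod_char_le_1)
  then have lim: "(\<lambda>k. Re (LINT g|S. char N (real k * g))) \<longlonglongrightarrow> Re 0"
    by (intro tendsto_intros) simp
  have "measure N {0} \<le> Re (LINT g|S. char N (real k * g))" for k
  proof -
    have "measure N {0} = (LINT x|N. indicator {0} x)" by simp
    also have "\<dots> \<le> (LINT x|N. exp (- (real k * x)\<^sup>2 / 2))"
      by (rule integral_mono) (auto simp: indicator_def intro!: N.integrable_const_bound[where B = 1])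
    finally show ?thesis using char_gauss_average[OF assms(1), of "real k"] by (simp add: S_def)
  qed
  then have "measure N {0} \<le> Re 0"
    by (intro tendsto_lowerbound[OF lim]) auto
  then show ?thesis by (simp add: measure_le_0_iff)
qed

section \<open>Characteristic functions determine laws on the plane\<close>

lemma weighted_law_unique:
  fixes f w :: "'b \<Rightarrow> real"
  assumes N: "finite_measure N1" "finite_measure N2"
    and f[measurable]: "f \<in> borel_measurable N1" "f \<in> borel_measurable N2"
    and w[measurable]: "w \<in> borel_measurable N1" "w \<in> borel_measurable N2"
    and wb: "\<And>x. 0 \<le> w x" "\<And>x. w x \<le> C"
    and eq: "\<And>u. (LINT x|N1. w x * iexp (u * f x)) = (LINT x|N2. w x * iexp (u * f x))"
    and B: "B \<in> sets borel"
  shows "(LINT x|N1. w x * indicator B (f x)) = (LINT x|N2. w x * indicator B (f x))"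
proof -
  have int: "integrable N w" if "finite_measure N" "w \<in> borel_measurable N" for N
    by (rule finite_measure.integrable_const_bound[OF that(1), where B = C]) (use that wb in auto)
  define c where "c = (LINT x|N1. w x)"
  have c2: "c = (LINT x|N2. w x)"
    using eq[of 0] unfolding c_def by (simp add: of_real_eq_iff)
  have c0: "c \<ge> 0" unfolding c_def using wb by simp
  note B[measurable]
  show ?thesis
  proof (cases "c = 0")
    case True
    have *: "(LINT x|N. w x * indicator B (f x)) = 0"
      if "finite_measure N" and [measurable]: "w \<in> borel_measurable N" "f \<in> borel_measurable N" and "(LINT x|N. w x) = 0" for N
    proof -
      have "AE x in N. w x = 0"
        using that integral_nonneg_eq_0_iff_AE[OF int[of N]] wb by auto
      then have "AE x in N. w x * indicator B (f x) = 0" by eventually_elim simp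
      then show ?thesis by (rule integral_eq_zero_AE)
    qed
    show ?thesis using * N f w c_def c2 True by simp
  next
    case False
    then have c: "c > 0" using c0 by simp
    \<comment> \<open>The law of \<open>f\<close> under the measure tilted by \<open>w\<close> and
      normalised to a probability. Its characteristic function is the weighted integral in
      \<open>eq\<close> divided by \<open>c\<close>, so one-dimensional uniqueness applies.\<close>
    define D where "D N = distr (density N (\<lambda>x. ennreal (w x / c))) borel f" for N
    have rd: "real_distribution (D N)"
      if "finite_measure N" and [measurable]: "w \<in> borel_measurable N" "f \<in> borel_measurable N" and "(LINT x|N. w x) = c" for N
    proof -
      have "emeasure (density N (\<lambda>x. ennreal (w x / c))) (space N) = (\<integral>\<^sup>+x. ennreal (w x / c) \<partial>N)"
        by (subst emeasure_density) (auto intro!: nn_integral_cong)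
      also have "\<dots> = ennreal (LINT x|N. w x / c)"
        by (rule nn_integral_eq_integral) (use int[of N] that wb c in auto)
      also have "\<dots> = 1" using that c by simp
      finally have "prob_space (density N (\<lambda>x. ennreal (w x / c)))" by (intro prob_spaceI) simp
      then show ?thesis unfolding D_def by (rule prob_space.real_distribution_distr) simp
    qed
    have ch: "char (D N) u = (LINT x|N. w x * iexp (u * f x)) / c"
      if [measurable]: "w \<in> borel_measurable N" "f \<in> borel_measurable N" for N u
    proof -
      have "char (D N) u = (LINT x|N. (w x / c) *\<^sub>R iexp (u * f x))"
        unfolding D_def char_def using wb c by (simp add: integral_distr integral_density)
      also have "\<dots> = (LINT x|N. w x * iexp (u * f x) / c)"
        by (intro Bochner_Integration.integral_cong) (auto simp: scaleR_conv_of_real)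
      finally show ?thesis by simp
    qed
    have "D N1 = D N2"
      by (rule Levy_uniqueness) (use rd ch eq N f w c_def c2 in auto)
    moreover have "(LINT x|N. w x * indicator B (f x)) = c * (LINT y|D N. indicator B y)"
      if [measurable]: "w \<in> borel_measurable N" "f \<in> borel_measurable N" for N
    proof -
      have "(LINT y|D N. indicator B y :: real) = (LINT x|density N (\<lambda>x. ennreal (w x / c)). indicator B (f x))"
        unfolding D_def by (rule integral_distr) auto
      also have "\<dots> = (LINT x|N. (w x / c) *\<^sub>R indicator B (f x))"
        by (rule integral_density) (use wb c in auto)
      also have "\<dots> = (LINT x|N. w x * indicator B (f x) / c)"
        by (intro Bochner_Integration.integral_cong) auto
      finally show ?thesis using c by simp
    qed
    ultimately show ?thesis using f w by metis
  qed
qed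

lemma measurable_fst_snd_borel [measurable]:
  "fst \<in> borel_measurable (borel :: (real \<times> real) measure)" "snd \<in> borel_measurable (borel :: (real \<times> real) measure)"
  by (intro borel_measurable_continuous_onI continuous_intros)+

text \<open>Two passes of one-dimensional uniqueness under weights. A nonnegative weight in the
  second coordinate identifies the tilted law of the first; the resulting identities, read as
  transforms in the second coordinate with indicator weights in the first, identify the measures of
  all rectangles.\<close>

lemma char_R2_unique:
  fixes N1 N2 :: "(real \<times> real) measure"
  assumes N: "prob_space N1" "prob_space N2" and s: "sets N1 = sets borel" "sets N2 = sets borel"
    and eq: "\<And>u v. (LINT z|N1. iexp (u * fst z + v * snd z)) = (LINT z|N2. iexp (u * fst z + v * snd z))"
  shows "N1 = N2"
proof -
  interpret N1: prob_space N1 by fact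
  interpret N2: prob_space N2 by fact
  note s[measurable_cong]
  have fin: "finite_measure N1" "finite_measure N2" by unfold_locales
  have i1: "integrable N1 (\<lambda>z. iexp (u * fst z + v * snd z))" for u v
    by (rule N1.integrable_const_bound[where B = 1]) auto
  have i2: "integrable N2 (\<lambda>z. iexp (u * fst z + v * snd z))" for u v
    by (rule N2.integrable_const_bound[where B = 1]) auto
  \<comment> \<open>The summand 1 keeps the weight nonnegative; the free phase \<open>q\<close>
    later yields sines as well as cosines.\<close>
  have cos_eq: "(LINT z|N1. (1 + cos (v * snd z + q)) * indicator B (fst z)) = (LINT z|N2. (1 + cos (v * snd z + q)) * indicator B (fst z))"
    if B: "B \<in> sets borel" for v q B
  proof (rule weighted_law_unique[OF fin, where C = 2])
    fix u
    have *: "(1 + cos (v * snd z + q)) * iexp (u * fst z) =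
       iexp (u * fst z + 0 * snd z) + iexp q / 2 * iexp (u * fst z + v * snd z) + iexp (-q) / 2 * iexp (u * fst z + (-v) * snd z)" for z :: "real \<times> real"
    proof -
      have c: "complex_of_real (cos y) = (iexp y + iexp (- y)) / 2" for y
        using cos_exp_eq[of "complex_of_real y"] unfolding cos_of_real by simp
      have e1: "iexp q * iexp (u * fst z + v * snd z) = iexp (u * fst z) * iexp (v * snd z + q)"
        unfolding exp_add[symmetric] by (simp add: algebra_simps)
      have e2: "iexp (-q) * iexp (u * fst z + (-v) * snd z) = iexp (u * fst z) * iexp (- (v * snd z + q))"
        unfolding exp_add[symmetric] by (simp add: algebra_simps)
      have "iexp (u * fst z + 0 * snd z) + iexp q / 2 * iexp (u * fst z + v * snd z) + iexp (-q) / 2 * iexp (u * fst z + (-v) * snd z)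
          = iexp (u * fst z) + (iexp q * iexp (u * fst z + v * snd z) + iexp (-q) * iexp (u * fst z + (-v) * snd z)) / 2"
        by (simp add: add_divide_distrib)
      also have "\<dots> = iexp (u * fst z) * (1 + complex_of_real (cos (v * snd z + q)))"
        unfolding e1 e2 c by (simp add: distrib_left add_divide_distrib)
      finally show ?thesis by (simp add: mult.commute)
    qed
    have lin: "(LINT z|N. f z + k1 * g z + k2 * h z) = (LINT z|N. f z) + k1 * (LINT z|N. g z) + k2 * (LINT z|N. h z)"
      if "integrable N f" "integrable N g" "integrable N h" for N and f g h :: "real \<times> real \<Rightarrow> complex" and k1 k2
      using that by simp
    show "(LINT z|N1. (1 + cos (v * snd z + q)) * iexp (u * fst z)) = (LINT z|N2. (1 + cos (v * snd z + q)) * iexp (u * fst z))"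
      unfolding * lin[OF i1 i1 i1] lin[OF i2 i2 i2] eq ..
  next
    show "0 \<le> 1 + cos (v * snd x + q)" for x using cos_ge_minus_one[of "v * snd x + q"] by linarith
  qed (use B s in auto)
  \<comment> \<open>With \<open>v = 0\<close> and \<open>q = pi / 2\<close> the cosine vanishes and
    the weight is 1.\<close>
  have one: "(LINT z|N1. indicator B (fst z)) = (LINT z|N2. indicator B (fst z) :: real)" if B: "B \<in> sets borel" for B
    using cos_eq[OF B, of 0 "pi/2"] by simp
  have cq: "(LINT z|N1. cos (v * snd z + q) * indicator B (fst z)) = (LINT z|N2. cos (v * snd z + q) * indicator B (fst z))"
    if B: "B \<in> sets borel" for v q B
  proof -
    have "(LINT z|N. (1 + cos (v * snd z + q)) * indicator B (fst z)) =
        (LINT z|N. indicator B (fst z)) + (LINT z|N. cos (v * snd z + q) * indicator B (fst z))"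
      if "prob_space N" and [measurable_cong]: "sets N = sets borel" for N
    proof -
      interpret prob_space N by fact
      have "integrable N (\<lambda>z. indicator B (fst z) :: real)" "integrable N (\<lambda>z. cos (v * snd z + q) * indicator B (fst z))"
        using B by (auto intro!: integrable_const_bound[where B = 1] simp: indicator_def)
      then show ?thesis by (simp add: distrib_right)
    qed
    then show ?thesis using cos_eq[OF B, of v q] one[OF B] N s by simp
  qed
  have ex: "(LINT z|N1. indicator B (fst z) * iexp (v * snd z)) = (LINT z|N2. indicator B (fst z) * iexp (v * snd z))"
    if B: "B \<in> sets borel" for v B
  proof -
    \<comment> \<open>Shifting the phase by \<open>- pi / 2\<close> turns the cosine into the sine,
      the imaginary part.\<close>
    have "(LINT z|N. indicator B (fst z) * iexp (v * snd z)) =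
        (LINT z|N. cos (v * snd z + 0) * indicator B (fst z)) + \<i> * (LINT z|N. cos (v * snd z + (-pi/2)) * indicator B (fst z))"
      if "prob_space N" and [measurable_cong]: "sets N = sets borel" for N
    proof -
      interpret prob_space N by fact
      have "integrable N (\<lambda>z. cos (v * snd z + q) * indicator B (fst z))" for q
        using B by (auto intro!: integrable_const_bound[where B = 1] simp: indicator_def)
      from integrable_of_real[OF this, where 'a = complex]
      have I: "integrable N (\<lambda>z. complex_of_real (cos (v * snd z + q) * indicator B (fst z)))" for q .
      have *: "indicator B (fst z) * iexp (v * snd z) =
         complex_of_real (cos (v * snd z + 0) * indicator B (fst z)) + \<i> * complex_of_real (cos (v * snd z + (-pi/2)) * indicator B (fst z))" for z :: "real \<times> real"
      proof -
        have c: "cos (v * snd z + (-pi/2)) = sin (v * snd z)"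
          using cos_add[of "v * snd z" "-pi/2"] by simp
        show ?thesis unfolding c cis_conv_exp[symmetric] by (auto simp: complex_eq_iff indicator_def)
      qed
      have "integral\<^sup>L N (\<lambda>z. complex_of_real (f z) + \<i> * complex_of_real (g z)) = complex_of_real (integral\<^sup>L N f) + \<i> * complex_of_real (integral\<^sup>L N g)"
        if "integrable N (\<lambda>z. complex_of_real (f z))" "integrable N (\<lambda>z. complex_of_real (g z))" for f g
        using that by (simp add: integral_complex_of_real)
      from this[OF I I] show ?thesis unfolding * .
    qed
    note spl = this
    show ?thesis unfolding spl[OF N(1) s(1)] spl[OF N(2) s(2)] cq[OF B] ..
  qed
  have box: "(LINT z|N1. indicator B (fst z) * indicator C (snd z)) = (LINT z|N2. indicator B (fst z) * indicator C (snd z) :: real)"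
    if "B \<in> sets borel" "C \<in> sets borel" for B C
  proof (rule weighted_law_unique[OF fin, where C = 1])
    show "(LINT z|N1. complex_of_real (indicator B (fst z)) * iexp (u * snd z)) = (LINT z|N2. complex_of_real (indicator B (fst z)) * iexp (u * snd z))" for u
      using ex[OF that(1), of u] by (simp only: of_real_indicator)
  qed (use that s in \<open>auto simp: indicator_le_1\<close>)
  have em: "emeasure N1 (B \<times> C) = emeasure N2 (B \<times> C)" if "B \<in> sets borel" "C \<in> sets borel" for B C :: "real set"
  proof -
    have BC: "B \<times> C \<in> sets borel"
      using that by (metis borel_prod pair_measureI)
    have "measure N (B \<times> C) = (LINT z|N. indicator B (fst z) * indicator C (snd z))" if "sets N = sets borel" for N
    proof -
      have sp: "space N = UNIV" using that sets_eq_imp_space_eq by fastforce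
      have "measure N (B \<times> C) = (LINT z|N. indicator (B \<times> C) z)" using sp by simp
      then show ?thesis by (simp add: indicator_times)
    qed
    then have "measure N1 (B \<times> C) = measure N2 (B \<times> C)" using box[OF that] s by simp
    then show ?thesis by (simp add: N1.emeasure_eq_measure N2.emeasure_eq_measure)
  qed
  show ?thesis
  proof (rule measure_eqI_generator_eq[where E = "{a \<times> b | a b. a \<in> sets borel \<and> b \<in> sets borel}" and \<Omega> = UNIV and A = "\<lambda>_. UNIV"])
    show "Int_stable {a \<times> b |a b. a \<in> sets (borel::real measure) \<and> b \<in> sets (borel :: real measure)}"
      by (rule Int_stable_pair_measure_generator)
    have "sets (borel :: (real \<times> real) measure) = sigma_sets UNIV {a \<times> b |a b. a \<in> sets borel \<and> b \<in> sets borel}"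
      by (simp add: sets_pair_measure flip: borel_prod)
    then show "sets N1 = sigma_sets UNIV {a \<times> b |a b. a \<in> sets borel \<and> b \<in> sets borel}"
      "sets N2 = sigma_sets UNIV {a \<times> b |a b. a \<in> sets borel \<and> b \<in> sets borel}" using s by simp_all
    have "UNIV \<times> UNIV \<in> {a \<times> b |a b. a \<in> sets (borel::real measure) \<and> b \<in> sets (borel :: real measure)}"
      by (rule CollectI, rule exI[of _ UNIV], rule exI[of _ UNIV]) simp
    then show "range (\<lambda>_. UNIV) \<subseteq> {a \<times> b |a b. a \<in> sets (borel::real measure) \<and> b \<in> sets (borel :: real measure)}"
      by simp
    show "emeasure N1 X = emeasure N2 X" if "X \<in> {a \<times> b |a b. a \<in> sets borel \<and> b \<in> sets borel}" for X
      using that em by blast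
  qed auto
qed

subsection \<open>Levy's continuity theorem in the plane\<close>

text \<open>The distance to the even integers, as a manifestly continuous function on the interval [0, 1].\<close>
definition even_dist :: "real \<Rightarrow> real" where
  "even_dist t = arccos (cos (pi * t)) / pi"

text \<open>Schoenberg's function: 0 up to distance 1/3 from the even integers, 1 from distance 2/3
  on, linear in between. A point of the Cantor set lies in the first or the last third, so the value
  is half of its leading ternary digit.\<close>

definition plateau :: "real \<Rightarrow> real" where
  "plateau t = max 0 (min 1 (3 * even_dist t - 1))"

lemma even_dist_periodic: "even_dist (2 * of_int k + t) = even_dist t"
proof -
  have "cos (pi * (2 * of_int k + t)) = cos (2 * pi * of_int k + pi * t)" by (simp add: algebra_simps)
  also have "\<dots> = cos (pi * t)" using cos_int_2pin[of k] sin_int_2pin[of k] by (simp add: cos_add)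
  finally show ?thesis by (simp add: even_dist_def)
qed

lemma even_dist_id: "0 \<le> t \<Longrightarrow> t \<le> 1 \<Longrightarrow> even_dist t = t"
  by (simp add: even_dist_def arccos_cos)

lemma continuous_even_dist: "continuous_on UNIV even_dist"
  unfolding even_dist_def by (intro continuous_intros) auto

lemma continuous_plateau: "continuous_on UNIV plateau"
  unfolding plateau_def by (intro continuous_intros continuous_even_dist)

lemma plateau_bounds: "0 \<le> plateau t" "plateau t \<le> 1"
  by (auto simp: plateau_def)

definition cantor_sum :: "(nat \<Rightarrow> real) \<Rightarrow> real" where
  "cantor_sum c = (\<Sum>m. 2 * c m / 3 ^ Suc m)"

lemma summable_cantor:
  assumes "\<And>m. c m \<in> {0, 1::real}"
  shows "summable (\<lambda>m. 2 * c m / 3 ^ Suc m)"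
proof (rule summable_comparison_test')
  show "summable (\<lambda>m. (1 / 3 :: real) ^ m)" by (simp add: summable_geometric)
  show "norm (2 * c m / 3 ^ Suc m) \<le> (1 / 3) ^ m" for m
    using assms[of m] by (auto simp: field_simps)
qed

lemma cantor_sum_shift:
  assumes "\<And>m. c m \<in> {0, 1::real}"
  shows "cantor_sum c = 2 * c 0 / 3 + cantor_sum (\<lambda>m. c (Suc m)) / 3"
proof -
  have "cantor_sum c = 2 * c 0 / 3 + (\<Sum>m. 2 * c (Suc m) / 3 ^ Suc m / 3)"
    unfolding cantor_sum_def using suminf_split_head[OF summable_cantor[of c, OF assms]]
    by (simp add: algebra_simps)
  also have "(\<Sum>m. 2 * c (Suc m) / 3 ^ Suc m / 3) = cantor_sum (\<lambda>m. c (Suc m)) / 3"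
    unfolding cantor_sum_def by (rule suminf_divide[OF summable_cantor]) (rule assms)
  finally show ?thesis .
qed

lemma cantor_sum_bounds:
  assumes "\<And>m. c m \<in> {0, 1::real}"
  shows "0 \<le> cantor_sum c" "cantor_sum c \<le> 1"
proof -
  have c: "0 \<le> c m" "c m \<le> 1" for m using assms[of m] by auto
  show "0 \<le> cantor_sum c"
    unfolding cantor_sum_def by (rule suminf_nonneg[OF summable_cantor[OF assms]]) (simp add: c)
  have "(\<lambda>m. 2 / 3 * (1 / 3 :: real) ^ m) sums (2 / 3 * (1 / (1 - 1 / 3)))"
    by (intro sums_mult geometric_sums) simp
  then have g: "(\<lambda>m. 2 / 3 * (1 / 3 :: real) ^ m) sums 1" by simp
  have "cantor_sum c \<le> (\<Sum>m. 2 / 3 * (1 / 3 :: real) ^ m)"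
    unfolding cantor_sum_def
    by (rule suminf_le[OF _ summable_cantor[OF assms] sums_summable[OF g]])
      (use c in \<open>auto simp: field_simps\<close>)
  then show "cantor_sum c \<le> 1" using sums_unique[OF g] by simp
qed

text \<open>Multiplying by 3 pushes one digit in front of the point, where it contributes the even
  integer \<open>2 * c j\<close>. Even integers are invisible to \<open>even_dist\<close>, hence the
  form \<open>2 * of_int k\<close> of the integral part.\<close>

lemma pow_cantor_sum:
  assumes "\<And>m. c m \<in> {0, 1::real}"
  shows "\<exists>k::int. 3 ^ j * cantor_sum c = 2 * of_int k + cantor_sum (\<lambda>m. c (m + j))"
proof (induction j)
  case 0
  show ?case by (intro exI[of _ 0]) simp
next
  case (Suc j)
  then obtain k :: int where k: "3 ^ j * cantor_sum c = 2 * of_int k + cantor_sum (\<lambda>m. c (m + j))" by blast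
  obtain d :: int where d: "c j = of_int d" using assms[of j] by (metis insert_iff of_int_0 of_int_1 singletonD)
  have "3 ^ Suc j * cantor_sum c = 3 * (2 * of_int k + cantor_sum (\<lambda>m. c (m + j)))" using k by simp
  also have "\<dots> = 2 * of_int (3 * k + d) + cantor_sum (\<lambda>m. c (m + Suc j))"
    using cantor_sum_shift[of "\<lambda>m. c (m + j)"] assms d by simp
  finally show ?case by blast
qed

text \<open>After removing an even integer the argument is \<open>2 * c j / 3 + q / 3\<close> with
  \<open>q\<close> between 0 and 1: a point of the first or the last third of the unit interval,
  where \<open>plateau\<close> is constant. The shift \<open>2 * of_int k\<close> makes room for the
  unbounded parameter of the plane curve.\<close>

lemma plateau_digit:
  assumes "\<And>m. c m \<in> {0, 1::real}"
  shows "plateau (3 ^ j * (2 * of_int k + cantor_sum c)) = c j"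
proof -
  obtain l :: int where l: "3 ^ j * cantor_sum c = 2 * of_int l + cantor_sum (\<lambda>m. c (m + j))"
    using pow_cantor_sum[of c, OF assms] by blast
  define q where "q = cantor_sum (\<lambda>m. c (Suc m + j))"
  have q: "0 \<le> q" "q \<le> 1" unfolding q_def using cantor_sum_bounds assms by auto
  have s: "cantor_sum (\<lambda>m. c (m + j)) = 2 * c j / 3 + q / 3"
    using cantor_sum_shift[of "\<lambda>m. c (m + j)"] assms by (simp add: q_def)
  have "3 ^ j * (2 * of_int k + cantor_sum c) = 2 * of_int (3 ^ j * k + l) + (2 * c j / 3 + q / 3)"
    using l s by (simp add: algebra_simps)
  then have "even_dist (3 ^ j * (2 * of_int k + cantor_sum c)) = even_dist (2 * c j / 3 + q / 3)"
    by (metis even_dist_periodic)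
  also have "\<dots> = 2 * c j / 3 + q / 3"
    by (rule even_dist_id) (use q assms[of j] in auto)
  finally show ?thesis unfolding plateau_def using q assms[of j] by auto
qed

text \<open>The binary digit of weight \<open>1 / 2 ^ Suc i\<close>, as a difference of floors, so
  that Borel measurability is immediate and partial sums telescope.\<close>

definition bit :: "nat \<Rightarrow> real \<Rightarrow> real" where
  "bit i x = of_int (\<lfloor>2 ^ Suc i * x\<rfloor> - 2 * \<lfloor>2 ^ i * x\<rfloor>)"

lemma bit_cases: "bit i x \<in> {0, 1}"
proof -
  have "\<lfloor>2 ^ Suc i * x\<rfloor> - 2 * \<lfloor>2 ^ i * x\<rfloor> \<in> {0, 1}"
  proof -
    define y where "y = 2 ^ i * x"
    have "\<lfloor>2 * y\<rfloor> - 2 * \<lfloor>y\<rfloor> \<in> {0, 1}" by (simp, linarith)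
    then show ?thesis by (simp add: y_def mult.assoc)
  qed
  then show ?thesis unfolding bit_def by auto
qed

lemma bit_sums:
  assumes "0 \<le> x" "x < 1"
  shows "(\<lambda>i. bit i x / 2 ^ Suc i) sums x"
proof -
  \<comment> \<open>The digits telescope to the dyadic truncation of \<open>x\<close>; the range of
    \<open>x\<close> matters for the empty sum, where the floor of \<open>x\<close> must be
    0.\<close>
  have part: "(\<Sum>i<n. bit i x / 2 ^ Suc i) = of_int \<lfloor>2 ^ n * x\<rfloor> / 2 ^ n" for n
  proof (induction n)
    case 0
    then show ?case using assms by (simp add: floor_eq_iff)
  next
    case (Suc n)
    then show ?case by (simp add: bit_def field_simps)
  qed
  have "(\<lambda>n. of_int \<lfloor>2 ^ n * x\<rfloor> / 2 ^ n) \<longlonglongrightarrow> x"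
  proof (rule real_tendsto_sandwich[where f = "\<lambda>n. x - (1 / 2) ^ n" and h = "\<lambda>n. x"])
    show "\<forall>\<^sub>F n in sequentially. x - (1 / 2) ^ n \<le> of_int \<lfloor>2 ^ n * x\<rfloor> / 2 ^ n"
    proof (rule always_eventually, rule allI)
      fix n
      have "2 ^ n * x - 1 \<le> of_int \<lfloor>2 ^ n * x\<rfloor>" by linarith
      then have "(2 ^ n * x - 1) / 2 ^ n \<le> of_int \<lfloor>2 ^ n * x\<rfloor> / 2 ^ n" by (rule divide_right_mono) simp
      then show "x - (1 / 2) ^ n \<le> of_int \<lfloor>2 ^ n * x\<rfloor> / 2 ^ n" by (simp add: diff_divide_distrib power_divide)
    qed
    show "\<forall>\<^sub>F n in sequentially. of_int \<lfloor>2 ^ n * x\<rfloor> / 2 ^ n \<le> x"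
      by (intro always_eventually allI) (simp add: divide_le_eq mult.commute)
    have "(\<lambda>n. x - (1 / 2) ^ n) \<longlonglongrightarrow> x - 0" by (intro tendsto_intros LIMSEQ_power_zero) simp
    then show "(\<lambda>n. x - (1 / 2) ^ n) \<longlonglongrightarrow> x" by simp
  qed simp
  then show ?thesis unfolding sums_def part .
qed

text \<open>Coordinates of Schoenberg's space-filling curve, extended periodically to the real line.\<close>
definition schoenberg :: "nat \<Rightarrow> real \<Rightarrow> real" where
  "schoenberg k t = (\<Sum>i. plateau (3 ^ (2 * i + k) * t) / 2 ^ Suc i)"

lemma continuous_schoenberg: "continuous_on UNIV (schoenberg k)"
proof -
  have "uniform_limit UNIV (\<lambda>n t. \<Sum>i<n. plateau (3 ^ (2 * i + k) * t) / 2 ^ Suc i) (schoenberg k) sequentially"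
    unfolding schoenberg_def
  proof (rule Weierstrass_m_test)
    show "norm (plateau (3 ^ (2 * i + k) * t) / 2 ^ Suc i) \<le> (1 / 2) ^ i" for i t
      using plateau_bounds[of "3 ^ (2 * i + k) * t"] by (simp add: field_simps)
    show "summable (\<lambda>i. (1 / 2 :: real) ^ i)" by (simp add: summable_geometric)
  qed
  then show ?thesis
  proof (rule uniform_limit_theorem[rotated])
    show "\<forall>\<^sub>F n in sequentially. continuous_on UNIV (\<lambda>t. \<Sum>i<n. plateau (3 ^ (2 * i + k) * t) / 2 ^ Suc i)"
      by (intro always_eventually allI continuous_intros continuous_on_compose2[OF continuous_plateau]) auto
  qed simp
qed

text \<open>Between \<open>2 * N\<close> and \<open>2 * N + 1\<close> the factor
  \<open>(t - even_dist t) / 2\<close> is the integer \<open>N\<close>, so that this piece fills the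
  square of half-side \<open>N\<close>; on the pieces in between the factor moves continuously to
  the next integer. The distance to the even integers, unlike a fractional part, keeps the curve
  continuous.\<close>

definition plane_curve :: "real \<Rightarrow> real \<times> real" where
  "plane_curve t = ((t - even_dist t) / 2 * (2 * schoenberg 0 t - 1), (t - even_dist t) / 2 * (2 * schoenberg 1 t - 1))"

text \<open>A Borel right inverse of the curve: the binary digits of the two coordinates, rescaled
  to the unit interval, are interleaved at the even and odd ternary places. Adding 1 to the floor
  makes \<open>N\<close> positive and strictly larger than both coordinates in modulus, so the
  rescaled values stay below 1, as the binary expansion requires.\<close>

definition plane_section :: "real \<times> real \<Rightarrow> real" where
  "plane_section z = (let N = of_int (\<lfloor>max \<bar>fst z\<bar> \<bar>snd z\<bar>\<rfloor> + 1) in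
     2 * N + cantor_sum (\<lambda>m. bit (m div 2) (((if even m then fst z else snd z) / N + 1) / 2)))"

lemma continuous_plane_curve: "continuous_on UNIV plane_curve"
  unfolding plane_curve_def by (intro continuous_intros continuous_even_dist continuous_schoenberg) auto

lemma plane_curve_section: "plane_curve (plane_section z) = z"
proof -
  define N :: int where "N = \<lfloor>max \<bar>fst z\<bar> \<bar>snd z\<bar>\<rfloor> + 1"
  define c where "c m = bit (m div 2) (((if even m then fst z else snd z) / of_int N + 1) / 2)" for m
  have c: "c m \<in> {0, 1}" for m unfolding c_def by (rule bit_cases)
  have N: "\<bar>fst z\<bar> < of_int N" "\<bar>snd z\<bar> < of_int N" "of_int N > (0::real)" unfolding N_def by linarith+
  define t where "t = 2 * of_int N + cantor_sum c"
  have t: "plane_section z = t" unfolding plane_section_def t_def c_def N_def Let_def by simp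
  have "even_dist t = cantor_sum c"
    unfolding t_def even_dist_periodic by (intro even_dist_id cantor_sum_bounds c)
  then have A: "(t - even_dist t) / 2 = of_int N" by (simp add: t_def)
  have sch: "schoenberg k t = (y / of_int N + 1) / 2"
    if "\<And>i. c (2 * i + k) = bit i ((y / of_int N + 1) / 2)" "\<bar>y\<bar> < of_int N" for k y
  proof -
    have y: "-1 < y / of_int N" "y / of_int N < 1" using that(2) N(3) by (auto simp: field_simps)
    have "schoenberg k t = (\<Sum>i. bit i ((y / of_int N + 1) / 2) / 2 ^ Suc i)"
      unfolding schoenberg_def t_def plateau_digit[OF c] that(1) by simp
    also have "\<dots> = (y / of_int N + 1) / 2"
      by (rule sums_unique[symmetric], rule bit_sums) (use y in auto)
    finally show ?thesis .
  qed
  have s0: "schoenberg 0 t = (fst z / of_int N + 1) / 2" by (rule sch) (use N in \<open>auto simp: c_def\<close>)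
  have s1: "schoenberg 1 t = (snd z / of_int N + 1) / 2" by (rule sch) (use N in \<open>auto simp: c_def\<close>)
  have inv: "of_int N * (2 * ((y / of_int N + 1) / 2) - 1) = y" for y :: real
  proof -
    have "of_int N * (2 * ((y / of_int N + 1) / 2) - 1) = of_int N * (y / of_int N)" by (rule arg_cong[where f = "(*) (of_int N)"]) argo
    then show ?thesis using N(3) by simp
  qed
  show ?thesis unfolding t plane_curve_def A s0 s1 unfolding inv by simp
qed

text \<open>Carries tightness from the plane to the line: bounded boxes go to bounded
  intervals.\<close>

lemma plane_section_bound:
  assumes "\<bar>fst z\<bar> \<le> K" "\<bar>snd z\<bar> \<le> K"
  shows "0 \<le> plane_section z" "plane_section z \<le> 2 * K + 3"
proof -
  define N :: int where "N = \<lfloor>max \<bar>fst z\<bar> \<bar>snd z\<bar>\<rfloor> + 1"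
  define c where "c m = bit (m div 2) (((if even m then fst z else snd z) / of_int N + 1) / 2)" for m
  have c: "c m \<in> {0, 1}" for m unfolding c_def by (rule bit_cases)
  have N: "of_int N \<le> K + 1" "of_int N > (0::real)" unfolding N_def using assms by linarith+
  have "plane_section z = 2 * of_int N + cantor_sum c"
    unfolding plane_section_def c_def N_def Let_def by simp
  then show "0 \<le> plane_section z" "plane_section z \<le> 2 * K + 3"
    using cantor_sum_bounds[of c, OF c] N by auto
qed

lemma measurable_plane_section [measurable]: "plane_section \<in> borel_measurable borel"
proof -
  have [measurable]: "bit i \<in> borel_measurable borel" for i unfolding bit_def by measurable
  show ?thesis unfolding plane_section_def cantor_sum_def Let_def by measurable
qed

section \<open>Tightness, selection and identification of the limit\<close>

lemma tendsto_if_subseq_tendsto: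
  fixes x :: "nat \<Rightarrow> 'b::metric_space"
  assumes "\<And>s :: nat \<Rightarrow> nat. strict_mono s \<Longrightarrow> \<exists>r. strict_mono r \<and> (\<lambda>n. x (s (r n))) \<longlonglongrightarrow> l"
  shows "x \<longlonglongrightarrow> l"
proof (rule ccontr)
  assume "\<not> x \<longlonglongrightarrow> l"
  then obtain \<epsilon> where "\<epsilon> > 0" and "infinite {n. \<not> dist (x n) l < \<epsilon>}"
    by (auto simp: tendsto_iff not_eventually INFM_iff_infinite cofinite_eq_sequentially[symmetric])
  then obtain s :: "nat \<Rightarrow> nat" where s: "\<And>n. \<not> dist (x (s n)) l < \<epsilon>" and "strict_mono s"
    using enumerate_in_set enumerate_mono by (fastforce simp: strict_mono_def)
  then obtain r where "(\<lambda>n. x (s (r n))) \<longlonglongrightarrow> l" using assms by blast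
  then have "\<forall>\<^sub>F n in sequentially. dist (x (s (r n))) l < \<epsilon>" using \<open>\<epsilon> > 0\<close> by (rule tendstoD)
  then show False using s by (auto simp: eventually_sequentially)
qed

text \<open>\<open>tight\<close> asks for one interval that serves all \<open>n\<close>. Each of the
  finitely many initial laws is tight by itself, so an eventual bound is enough.\<close>

lemma tight_of_eventually_bounded:
  assumes N: "\<And>n. real_distribution (N n)"
    and ev: "\<And>\<epsilon>. \<epsilon> > 0 \<Longrightarrow> \<exists>K. \<forall>\<^sub>F n in sequentially. measure (N n) {x. K < \<bar>x\<bar>} < \<epsilon>"
  shows "tight N"
  unfolding tight_def
proof (intro conjI allI impI N)
  fix \<epsilon> :: real assume e: "\<epsilon> > 0"
  interpret N: real_distribution "N n" for n by fact
  obtain K n0 where K: "\<And>n. n \<ge> n0 \<Longrightarrow> measure (N n) {x. K < \<bar>x\<bar>} < \<epsilon>"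
    using ev[OF e] by (auto simp: eventually_sequentially)
  have "\<exists>K. measure (N n) {x. K < \<bar>x\<bar>} < \<epsilon>" for n
  proof -
    have "(\<lambda>k::nat. measure (N n) {x. real k < \<bar>x\<bar>}) \<longlonglongrightarrow> measure (N n) (\<Inter>k. {x. real k < \<bar>x\<bar>})"
      by (rule N.finite_Lim_measure_decseq) (auto simp: decseq_def)
    also have "(\<Inter>k. {x. real k < \<bar>x\<bar>}) = {}"
    proof -
      have "\<exists>k. \<not> real k < \<bar>x\<bar>" for x :: real
        using reals_Archimedean2[of "\<bar>x\<bar>"] by (meson less_asym)
      then show ?thesis by blast
    qed
    finally have "(\<lambda>k::nat. measure (N n) {x. real k < \<bar>x\<bar>}) \<longlonglongrightarrow> 0" by simp
    then have "\<forall>\<^sub>F k in sequentially. measure (N n) {x. real k < \<bar>x\<bar>} < \<epsilon>" by (rule order_tendstoD) fact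
    then show ?thesis by (auto simp: eventually_sequentially)
  qed
  then obtain k where k: "\<And>n. measure (N n) {x. k n < \<bar>x\<bar>} < \<epsilon>" by metis
  define R where "R = Max (insert 1 (insert K (k ` {..<n0})))"
  have R: "1 \<le> R" "K \<le> R" "\<And>n. n < n0 \<Longrightarrow> k n \<le> R"
    unfolding R_def by (auto intro!: Max_ge simp del: Max_insert)
  have b: "measure (N n) {x. R < \<bar>x\<bar>} < \<epsilon>" for n
  proof (cases "n < n0")
    case True
    have "measure (N n) {x. R < \<bar>x\<bar>} \<le> measure (N n) {x. k n < \<bar>x\<bar>}"
      by (rule N.finite_measure_mono) (use R(3)[OF True] in auto)
    then show ?thesis using k[of n] by simp
  next
    case False
    have "measure (N n) {x. R < \<bar>x\<bar>} \<le> measure (N n) {x. K < \<bar>x\<bar>}"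
      by (rule N.finite_measure_mono) (use R(2) in auto)
    then show ?thesis using K[of n] False by simp
  qed
  \<comment> \<open>The interval is open on the left, hence the extra 1: the point
    \<open>- R\<close> must belong to it.\<close>
  show "\<exists>a b. a < b \<and> (\<forall>n. measure (N n) {a<..b} > 1 - \<epsilon>)"
  proof (rule exI[of _ "- R - 1"], rule exI[of _ R], intro conjI allI)
    show "- R - 1 < R" using R by simp
    fix n
    have "measure (N n) (UNIV - {x. R < \<bar>x\<bar>}) = 1 - measure (N n) {x. R < \<bar>x\<bar>}"
      using N.prob_compl[of "{x. R < \<bar>x\<bar>}" n] by simp
    moreover have "measure (N n) (UNIV - {x. R < \<bar>x\<bar>}) \<le> measure (N n) {- R - 1<..R}"
      by (rule N.finite_measure_mono) auto
    ultimately show "measure (N n) {- R - 1<..R} > 1 - \<epsilon>" using b[of n] by linarith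
  qed
qed

text \<open>The laws are moved to the line by \<open>plane_section\<close>, where selection applies,
  and moved back by \<open>plane_curve\<close>, which is continuous and undoes the section; weak
  convergence on the line thus gives convergence of means of bounded continuous functions of
  \<open>Y n\<close> itself. Every subsequential limit has transform \<open>\<phi>\<close>, so all
  of them coincide. Continuity of \<open>\<phi>\<close> along the two axes suffices, as tightness is
  a matter of the coordinates.\<close>

theorem levy_continuity_R2:
  fixes Y :: "nat \<Rightarrow> 'a \<Rightarrow> real \<times> real"
  assumes M: "prob_space M" and Y: "\<And>n. Y n \<in> borel_measurable M"
    and conv: "\<And>u v. (\<lambda>n. \<integral>\<omega>. iexp (u * fst (Y n \<omega>) + v * snd (Y n \<omega>)) \<partial>M) \<longlonglongrightarrow> \<phi> u v"
    and cont: "((\<lambda>u. \<phi> u 0) \<longlongrightarrow> 1) (at 0)" "((\<lambda>v. \<phi> 0 v) \<longlongrightarrow> 1) (at 0)"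
  obtains \<nu> where "prob_space \<nu>" "sets \<nu> = sets borel"
    "\<And>u v. (LINT z|\<nu>. iexp (u * fst z + v * snd z)) = \<phi> u v" "conv_distr_R2 M Y \<nu>"
proof -
  interpret prob_space M by fact
  note Y[measurable]
  define T where "T n = distr M borel (\<lambda>\<omega>. plane_section (Y n \<omega>))" for n
  have T: "real_distribution (T n)" for n unfolding T_def by (rule real_distribution_distr) simp
  have tight: "tight T"
  proof (rule tight_of_eventually_bounded[OF T])
    fix \<epsilon> :: real assume e: "\<epsilon> > 0"
    have one: "\<exists>K>0. \<forall>\<^sub>F n in sequentially. measure M {\<omega> \<in> space M. K \<le> \<bar>g (Y n \<omega>)\<bar>} < \<epsilon> / 2"
      if [measurable]: "g \<in> borel_measurable borel"
        and c: "\<And>t. (\<lambda>n. \<integral>\<omega>. iexp (t * g (Y n \<omega>)) \<partial>M) \<longlonglongrightarrow> f t" "(f \<longlongrightarrow> 1) (at 0)" for g f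
    proof -
      have "\<exists>K>0. \<forall>\<^sub>F n in sequentially. measure (distr M borel (\<lambda>\<omega>. g (Y n \<omega>))) {x. K \<le> \<bar>x\<bar>} < \<epsilon> / 2"
        by (rule eventually_tail_bound_of_char_conv[OF _ _ c(2)])
          (use e c(1) in \<open>auto intro!: real_distribution_distr simp: char_def integral_distr\<close>)
      then show ?thesis by (simp add: measure_distr vimage_def Int_def conj_commute)
    qed
    obtain K1 where K1: "K1 > 0" "\<forall>\<^sub>F n in sequentially. measure M {\<omega> \<in> space M. K1 \<le> \<bar>fst (Y n \<omega>)\<bar>} < \<epsilon> / 2"
      using one[of fst "\<lambda>u. \<phi> u 0", OF _ _ cont(1)] conv[of _ 0] by fastforce
    obtain K2 where K2: "K2 > 0" "\<forall>\<^sub>F n in sequentially. measure M {\<omega> \<in> space M. K2 \<le> \<bar>snd (Y n \<omega>)\<bar>} < \<epsilon> / 2"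
      using one[of snd "\<lambda>u. \<phi> 0 u", OF _ _ cont(2)] conv[of 0] by fastforce
    \<comment> \<open>The bound of \<open>plane_section_bound\<close> for the box of half-side
      \<open>max K1 K2\<close>.\<close>
    define K where "K = 2 * max K1 K2 + 3"
    have "\<forall>\<^sub>F n in sequentially. measure (T n) {x. K < \<bar>x\<bar>} < \<epsilon>"
      using K1(2) K2(2)
    proof eventually_elim
      case (elim n)
      have "measure (T n) {x. K < \<bar>x\<bar>} = measure M {\<omega> \<in> space M. K < \<bar>plane_section (Y n \<omega>)\<bar>}"
        unfolding T_def by (simp add: measure_distr vimage_def Int_def conj_commute)
      also have "\<dots> \<le> measure M ({\<omega> \<in> space M. K1 \<le> \<bar>fst (Y n \<omega>)\<bar>} \<union> {\<omega> \<in> space M. K2 \<le> \<bar>snd (Y n \<omega>)\<bar>})"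
      proof (rule finite_measure_mono)
        show "{\<omega> \<in> space M. K < \<bar>plane_section (Y n \<omega>)\<bar>} \<subseteq> {\<omega> \<in> space M. K1 \<le> \<bar>fst (Y n \<omega>)\<bar>} \<union> {\<omega> \<in> space M. K2 \<le> \<bar>snd (Y n \<omega>)\<bar>}"
        proof
          fix \<omega> assume w: "\<omega> \<in> {\<omega> \<in> space M. K < \<bar>plane_section (Y n \<omega>)\<bar>}"
          have "K1 \<le> \<bar>fst (Y n \<omega>)\<bar> \<or> K2 \<le> \<bar>snd (Y n \<omega>)\<bar>"
            using w plane_section_bound[of "Y n \<omega>" "max K1 K2"] unfolding K_def by (simp, linarith)
          then show "\<omega> \<in> {\<omega> \<in> space M. K1 \<le> \<bar>fst (Y n \<omega>)\<bar>} \<union> {\<omega> \<in> space M. K2 \<le> \<bar>snd (Y n \<omega>)\<bar>}"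
            using w by auto
        qed
      qed simp
      also have "\<dots> \<le> measure M {\<omega> \<in> space M. K1 \<le> \<bar>fst (Y n \<omega>)\<bar>} + measure M {\<omega> \<in> space M. K2 \<le> \<bar>snd (Y n \<omega>)\<bar>}"
        by (rule measure_Un_le) auto
      finally show ?case using elim by linarith
    qed
    then show "\<exists>K. \<forall>\<^sub>F n in sequentially. measure (T n) {x. K < \<bar>x\<bar>} < \<epsilon>" by blast
  qed
  have sub: "\<exists>r \<nu>. strict_mono r \<and> prob_space \<nu> \<and> sets \<nu> = sets borel
      \<and> (\<forall>f :: real \<times> real \<Rightarrow> real. continuous_on UNIV f \<and> bounded (range f) \<longrightarrow> (\<lambda>n. \<integral>\<omega>. f (Y (s (r n)) \<omega>) \<partial>M) \<longlonglongrightarrow> (\<integral>z. f z \<partial>\<nu>))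
      \<and> (\<forall>u v. (LINT z|\<nu>. iexp (u * fst z + v * snd z)) = \<phi> u v)"
    if s: "strict_mono s" for s :: "nat \<Rightarrow> nat"
  proof -
    obtain r N where r: "strict_mono (r :: nat \<Rightarrow> nat)" and N: "real_distribution N" and w: "weak_conv_m (T \<circ> s \<circ> r) N"
      using tight_imp_convergent_subsubsequence[OF tight s] by blast
    interpret N: real_distribution N by fact
    have cm[measurable]: "plane_curve \<in> borel_measurable borel"
      by (rule borel_measurable_continuous_onI[OF continuous_plane_curve])
    define \<nu> where "\<nu> = distr N borel plane_curve"
    \<comment> \<open>The codomain is left general, since real test functions and complex
      exponentials are both needed.\<close>
    have lim: "(\<lambda>n. \<integral>\<omega>. f (Y (s (r n)) \<omega>) \<partial>M) \<longlonglongrightarrow> (\<integral>z. f z \<partial>\<nu>)"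
      if f: "continuous_on UNIV f" and b: "\<And>z. norm (f z) \<le> B" for B and f :: "real \<times> real \<Rightarrow> 'c::{banach, second_countable_topology}"
    proof -
      have [measurable]: "f \<in> borel_measurable borel" by (rule borel_measurable_continuous_onI[OF f])
      have "(\<lambda>n. integral\<^sup>L ((T \<circ> s \<circ> r) n) (\<lambda>t. f (plane_curve t))) \<longlonglongrightarrow> integral\<^sup>L N (\<lambda>t. f (plane_curve t))"
      proof (rule weak_conv_imp_integral_bdd_continuous_conv[OF _ N w])
        show "real_distribution ((T \<circ> s \<circ> r) n)" for n using T by simp
        have "continuous_on UNIV (\<lambda>t. f (plane_curve t))"
          by (rule continuous_on_compose2[OF f continuous_plane_curve]) simp
        then show "isCont (\<lambda>t. f (plane_curve t)) x" for x
          by (simp add: continuous_on_eq_continuous_at)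
        show "norm (f (plane_curve x)) \<le> B" for x by (rule b)
      qed
      then show ?thesis unfolding \<nu>_def T_def by (simp add: integral_distr plane_curve_section)
    qed
    have "(LINT z|\<nu>. iexp (u * fst z + v * snd z)) = \<phi> u v" for u v
    proof (rule LIMSEQ_unique)
      show "(\<lambda>n. \<integral>\<omega>. iexp (u * fst (Y (s (r n)) \<omega>) + v * snd (Y (s (r n)) \<omega>)) \<partial>M) \<longlonglongrightarrow> (LINT z|\<nu>. iexp (u * fst z + v * snd z))"
        by (rule lim[of _ 1]) (auto intro!: continuous_intros)
      show "(\<lambda>n. \<integral>\<omega>. iexp (u * fst (Y (s (r n)) \<omega>) + v * snd (Y (s (r n)) \<omega>)) \<partial>M) \<longlonglongrightarrow> \<phi> u v"
        using LIMSEQ_subseq_LIMSEQ[OF LIMSEQ_subseq_LIMSEQ[OF conv s] r] by (simp add: comp_def)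
    qed
    moreover have "prob_space \<nu>" "sets \<nu> = sets borel" unfolding \<nu>_def by (auto intro!: N.prob_space_distr)
    moreover have "(\<lambda>n. \<integral>\<omega>. f (Y (s (r n)) \<omega>) \<partial>M) \<longlonglongrightarrow> (\<integral>z. f z \<partial>\<nu>)"
      if f: "continuous_on UNIV f" "bounded (range f)" for f :: "real \<times> real \<Rightarrow> real"
    proof -
      obtain B where "\<And>z. norm (f z) \<le> B" using f(2) by (auto simp: bounded_iff)
      then show ?thesis by (rule lim[OF f(1)])
    qed
    ultimately show ?thesis using r by blast
  qed
  obtain \<nu> where \<nu>: "prob_space \<nu>" "sets \<nu> = sets borel" "\<And>u v. (LINT z|\<nu>. iexp (u * fst z + v * snd z)) = \<phi> u v"
    using sub[of id] by (auto simp: strict_mono_def)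
  have "conv_distr_R2 M Y \<nu>"
    unfolding conv_distr_R2_def
  proof (intro allI impI)
    fix f :: "real \<times> real \<Rightarrow> real" assume f: "continuous_on UNIV f \<and> bounded (range f)"
    show "(\<lambda>n. \<integral>\<omega>. f (Y n \<omega>) \<partial>M) \<longlonglongrightarrow> (\<integral>z. f z \<partial>\<nu>)"
    proof (rule tendsto_if_subseq_tendsto)
      fix s :: "nat \<Rightarrow> nat" assume "strict_mono s"
      from sub[OF this] obtain r \<nu>' where r: "strict_mono r" "prob_space \<nu>'" "sets \<nu>' = sets borel"
        "(\<lambda>n. \<integral>\<omega>. f (Y (s (r n)) \<omega>) \<partial>M) \<longlonglongrightarrow> (\<integral>z. f z \<partial>\<nu>')"
        "\<And>u v. (LINT z|\<nu>'. iexp (u * fst z + v * snd z)) = \<phi> u v" using f by blast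
      have "\<nu>' = \<nu>" by (rule char_R2_unique) (use r \<nu> in auto)
      then show "\<exists>r. strict_mono r \<and> (\<lambda>n. \<integral>\<omega>. f (Y (s (r n)) \<omega>) \<partial>M) \<longlonglongrightarrow> (\<integral>z. f z \<partial>\<nu>)"
        using r by blast
    qed
  qed
  with \<nu> that show ?thesis by blast
qed

subsection \<open>Stable laws from homogeneous characteristic functions\<close>

text \<open>The weight of the fractional moment formula: by scaling, the integral of
  \<open>wt p u * (1 - cos (u * s))\<close> in \<open>u\<close> is a constant times
  \<open>\<bar>s\<bar> powr p\<close>. It is extended by 0, so that integrals run over the whole
  line.\<close>

definition wt :: "real \<Rightarrow> real \<Rightarrow> real" where
  "wt p u = (if u > 0 then u powr (- 1 - p) else 0)"

lemma measurable_wt [measurable]: "wt p \<in> borel_measurable borel"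
  unfolding wt_def by measurable

lemma wt_nonneg [simp]: "0 \<le> wt p u"
  by (simp add: wt_def)

lemma has_bochner_integral_powr_0_1:
  fixes e :: real
  assumes "e > -1"
  shows "has_bochner_integral lborel (\<lambda>u. indicator {0<..1} u * u powr e) (1 / (e + 1))"
proof -
  have "((\<lambda>x. if x \<in> {0..1} then x powr e else 0) has_integral 1 / (e + 1)) UNIV"
    unfolding has_integral_restrict_UNIV using has_integral_powr_from_0[OF assms, of 1] by simp
  also have "(\<lambda>x. if x \<in> {0..1} then x powr e else 0) = (\<lambda>u. indicator {0<..1} u * u powr e)"
    by (auto simp: indicator_def fun_eq_iff)
  finally have "(\<integral>\<^sup>+u. ennreal (indicator {0<..1} u * u powr e) \<partial>lborel) = ennreal (1 / (e + 1))"
    by (intro nn_integral_has_integral_lborel) auto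
  then show ?thesis using assms by (intro has_bochner_integral_nn_integral) auto
qed

lemma has_bochner_integral_powr_1_inf:
  fixes e :: real
  assumes "e < -1"
  shows "has_bochner_integral lborel (\<lambda>u. indicator {1<..} u * u powr e) (- 1 / (e + 1))"
proof -
  have "((\<lambda>x. if x \<in> {1..} then x powr e else 0) has_integral - 1 / (e + 1)) UNIV"
    unfolding has_integral_restrict_UNIV using has_integral_powr_to_inf[OF assms, of 1] by simp
  then have "(\<integral>\<^sup>+u. ennreal (if u \<in> {1..} then u powr e else 0) \<partial>lborel) = ennreal (- 1 / (e + 1))"
    by (intro nn_integral_has_integral_lborel) auto
  then have "has_bochner_integral lborel (\<lambda>u. if u \<in> {1..} then u powr e else 0) (- 1 / (e + 1))"
    using assms by (intro has_bochner_integral_nn_integral) (auto simp: divide_nonpos_neg)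
  then show ?thesis
  proof (rule has_bochner_integral_cong_AE[THEN iffD1, rotated -1])
    have "AE u in lborel. u \<noteq> (1::real)" by (rule AE_lborel_singleton)
    then show "AE x in lborel. (if x \<in> {1..} then x powr e else 0) = indicator {1<..} x * x powr e"
      by eventually_elim (auto simp: indicator_def)
  qed auto
qed

lemma integrable_wt_dominated:
  fixes h :: "real \<Rightarrow> 'b::{banach, second_countable_topology}"
  assumes [measurable]: "h \<in> borel_measurable borel"
    and near: "\<And>u. 0 < u \<Longrightarrow> u \<le> 1 \<Longrightarrow> norm (h u) \<le> A * u powr a"
    and far: "\<And>u. 1 < u \<Longrightarrow> norm (h u) \<le> B * u powr b"
    and p: "b < p" "p < a"
  shows "integrable lborel (\<lambda>u. wt p u *\<^sub>R h u)"
proof (rule Bochner_Integration.integrable_bound)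
  show "integrable lborel (\<lambda>u. A * (indicator {0<..1} u * u powr (a - 1 - p)) + B * (indicator {1<..} u * u powr (b - 1 - p)))"
    using has_bochner_integral_powr_0_1[of "a - 1 - p"] has_bochner_integral_powr_1_inf[of "b - 1 - p"] p
    by (intro Bochner_Integration.integrable_add integrable_mult_right) (auto simp: has_bochner_integral_iff)
  show "AE u in lborel. norm (wt p u *\<^sub>R h u)
      \<le> norm (A * (indicator {0<..1} u * u powr (a - 1 - p)) + B * (indicator {1<..} u * u powr (b - 1 - p)))"
  proof (rule AE_I2)
    fix u :: real
    consider "u \<le> 0" | "0 < u" "u \<le> 1" | "1 < u" by linarith
    then show "norm (wt p u *\<^sub>R h u)
      \<le> norm (A * (indicator {0<..1} u * u powr (a - 1 - p)) + B * (indicator {1<..} u * u powr (b - 1 - p)))"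
    proof cases
      case 1
      then show ?thesis by (simp add: wt_def)
    next
      case 2
      have "norm (wt p u *\<^sub>R h u) \<le> u powr (- 1 - p) * (A * u powr a)"
        using 2 near[of u] by (simp add: wt_def mult_left_mono)
      also have "\<dots> = A * u powr (a - 1 - p)"
        using 2 by (simp add: powr_add[symmetric] algebra_simps)
      also have "\<dots> = A * (indicator {0<..1} u * u powr (a - 1 - p)) + B * (indicator {1<..} u * u powr (b - 1 - p))"
        using 2 by simp
      finally show ?thesis unfolding real_norm_def by linarith
    next
      case 3
      have "norm (wt p u *\<^sub>R h u) \<le> u powr (- 1 - p) * (B * u powr b)"
        using 3 far[of u] by (simp add: wt_def mult_left_mono)
      also have "\<dots> = B * u powr (b - 1 - p)"
        using 3 by (simp add: powr_add[symmetric] algebra_simps)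
      also have "\<dots> = A * (indicator {0<..1} u * u powr (a - 1 - p)) + B * (indicator {1<..} u * u powr (b - 1 - p))"
        using 3 by simp
      finally show ?thesis unfolding real_norm_def by linarith
    qed
  qed
qed simp

text \<open>The compensated exponential; the compensator is present for c = 1 only.\<close>
definition cexp :: "real \<Rightarrow> complex \<Rightarrow> complex" where
  "cexp c w = 1 - exp (- w) - of_real c * w"

text \<open>Mean value inequality on the right half-plane, which is convex and on which the
  derivative of \<open>exp (- w)\<close> has modulus at most 1.\<close>

lemma norm_one_minus_exp_le: "Re w \<ge> 0 \<Longrightarrow> cmod (1 - exp (- w)) \<le> cmod w"
proof -
  assume w: "Re w \<ge> 0"
  have "cmod (exp (- 0) - exp (- w)) \<le> 1 * cmod (0 - w)"
  proof (rule field_differentiable_bound[where S = "{w. Re w \<ge> 0}" and f' = "\<lambda>w. - exp (- w)"])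
    show "convex {w. 0 \<le> Re w}" by (rule convex_halfspace_Re_ge)
    show "((\<lambda>w. exp (- w)) has_field_derivative - exp (- z)) (at z within {w. 0 \<le> Re w})" for z
      by (auto intro!: derivative_eq_intros)
  qed (use w in auto)
  then show ?thesis by simp
qed

text \<open>For \<open>c = 1\<close> the derivative is \<open>exp (- z) - 1\<close>, of modulus at
  most \<open>cmod z\<close> by \<open>norm_one_minus_exp_le\<close>; intersecting the half-plane
  with the disc of radius \<open>cmod w\<close> keeps the set convex and makes that bound
  uniform.\<close>

lemma norm_cexp_near:
  assumes "c \<in> {0, 1}" "Re w \<ge> 0"
  shows "cmod (cexp c w) \<le> cmod w powr (c + 1)"
proof (cases "c = 0")
  case True
  then show ?thesis using norm_one_minus_exp_le[OF assms(2)] by (simp add: cexp_def)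
next
  case False
  then have c: "c = 1" using assms by simp
  have "cmod (cexp 1 w - cexp 1 0) \<le> cmod w * cmod (w - 0)"
  proof (rule field_differentiable_bound[where S = "{w. Re w \<ge> 0} \<inter> cball 0 (cmod w)" and f' = "\<lambda>w. exp (- w) - 1"])
    show "convex ({w. 0 \<le> Re w} \<inter> cball 0 (cmod w))" by (intro convex_Int convex_halfspace_Re_ge convex_cball)
    show "(cexp 1 has_field_derivative exp (- z) - 1) (at z within {w. 0 \<le> Re w} \<inter> cball 0 (cmod w))" for z
      unfolding cexp_def by (auto intro!: derivative_eq_intros)
    show "cmod (exp (- z) - 1) \<le> cmod w" if "z \<in> {w. 0 \<le> Re w} \<inter> cball 0 (cmod w)" for z
      using norm_one_minus_exp_le[of z] that by (simp add: norm_minus_commute)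
  qed (use assms in auto)
  then show ?thesis using c by (simp add: cexp_def power2_eq_square)
qed

lemma norm_cexp_far:
  assumes "c \<in> {0, 1}" "Re w \<ge> 0" "cmod w \<ge> 1"
  shows "cmod (cexp c w) \<le> 3 * cmod w powr c"
proof -
  have e: "cmod (exp (- w)) \<le> 1" using assms by simp
  have "cmod (cexp c w) \<le> cmod 1 + cmod (exp (- w)) + cmod (of_real c * w)"
    unfolding cexp_def using norm_triangle_ineq4 by (meson add_mono norm_triangle_le_diff order_refl)
  moreover have "cmod (of_real c * w) = c * cmod w" using assms by (auto simp: norm_mult)
  moreover have "c * cmod w + 2 \<le> 3 * cmod w powr c" using assms by auto
  ultimately show ?thesis using e unfolding norm_one by linarith
qed

lemma cexp_ray_bounds:
  assumes "c \<in> {0, 1}" "Re z \<ge> 0" "cmod z = 1"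
  shows "0 < u \<Longrightarrow> cmod (cexp c (z * of_real u)) \<le> u powr (c + 1)"
    "1 \<le> u \<Longrightarrow> cmod (cexp c (z * of_real u)) \<le> 3 * u powr c"
  using norm_cexp_near[OF assms(1), of "z * of_real u"] norm_cexp_far[OF assms(1), of "z * of_real u"] assms
  by (auto simp: norm_mult)

lemma integrable_wt_cexp:
  assumes "c \<in> {0, 1}" "Re z \<ge> 0" "cmod z = 1" "c < p" "p < c + 1"
  shows "integrable lborel (\<lambda>u. wt p u *\<^sub>R cexp c (z * of_real u))"
proof (rule integrable_wt_dominated[where A = 1 and B = 3 and a = "c + 1" and b = c])
  show "(\<lambda>u. cexp c (z * of_real u)) \<in> borel_measurable borel"
    unfolding cexp_def by measurable
qed (use cexp_ray_bounds[OF assms(1-3)] assms in auto)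

text \<open>Passes from the Lebesgue integral to integrals over compact intervals away from 0 and
  infinity, where differentiation under the integral sign and the fundamental theorem of calculus
  are available.\<close>

lemma truncated_integral_tendsto:
  fixes h :: "real \<Rightarrow> complex"
  assumes "integrable lborel (\<lambda>u. wt p u *\<^sub>R h u)"
  shows "(\<lambda>n. integral {1 / real (Suc n)..real (Suc n)} (\<lambda>u. u powr (- 1 - p) *\<^sub>R h u)) \<longlonglongrightarrow> (LINT u|lborel. wt p u *\<^sub>R h u)"
proof -
  define g where "g u = wt p u *\<^sub>R h u" for u
  have g: "integrable lborel g" using assms unfolding g_def .
  have "(\<lambda>n. LINT u|lborel. indicator {1 / real (Suc n)..real (Suc n)} u *\<^sub>R g u) \<longlonglongrightarrow> (LINT u|lborel. g u)"
  proof (rule integral_dominated_convergence[where w = "\<lambda>u. norm (g u)"])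
    show "AE u in lborel. (\<lambda>n. indicator {1 / real (Suc n)..real (Suc n)} u *\<^sub>R g u) \<longlonglongrightarrow> g u"
    proof (rule AE_I2)
      fix u :: real
      show "(\<lambda>n. indicator {1 / real (Suc n)..real (Suc n)} u *\<^sub>R g u) \<longlonglongrightarrow> g u"
      proof (cases "u > 0")
        case True
        obtain n0 where n0: "max u (1 / u) < real n0" using reals_Archimedean2 by blast
        have "\<forall>\<^sub>F n in sequentially. indicator {1 / real (Suc n)..real (Suc n)} u *\<^sub>R g u = g u"
        proof (rule eventually_sequentiallyI[of n0])
          fix n assume "n \<ge> n0"
          then have "u \<le> real (Suc n)" "1 / u \<le> real (Suc n)" using n0 by auto
          then show "indicator {1 / real (Suc n)..real (Suc n)} u *\<^sub>R g u = g u"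
            using True by (auto simp: indicator_def field_simps)
        qed
        then show ?thesis by (rule tendsto_eventually)
      next
        case False
        then show ?thesis by (simp add: g_def wt_def)
      qed
    qed
  qed (use g in \<open>auto simp: indicator_def\<close>)
  moreover have "(LINT u|lborel. indicator {1 / real (Suc n)..real (Suc n)} u *\<^sub>R g u)
      = integral {1 / real (Suc n)..real (Suc n)} (\<lambda>u. u powr (- 1 - p) *\<^sub>R h u)" for n
  proof -
    have "set_integrable lborel {1 / real (Suc n)..real (Suc n)} g"
      unfolding set_integrable_def by (rule integrable_mult_indicator) (use g in auto)
    then have "(LINT u|lborel. indicator {1 / real (Suc n)..real (Suc n)} u *\<^sub>R g u) = integral {1 / real (Suc n)..real (Suc n)} g"
      using set_borel_integral_eq_integral(2) unfolding set_lebesgue_integral_def by blast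
    also have "\<dots> = integral {1 / real (Suc n)..real (Suc n)} (\<lambda>u. u powr (- 1 - p) *\<^sub>R h u)"
    proof (rule integral_cong)
      fix u assume "u \<in> {1 / real (Suc n)..real (Suc n)}"
      then have "u > 0" by (auto intro: less_le_trans[rotated])
      then show "g u = u powr (- 1 - p) *\<^sub>R h u" by (simp add: g_def wt_def)
    qed
    finally show ?thesis .
  qed
  ultimately show ?thesis unfolding g_def by simp
qed

lemma has_vector_derivative_exp_linear:
  "((\<lambda>t. exp (k * complex_of_real t)) has_vector_derivative k * exp (k * of_real t)) (at t within S)"
proof -
  have "((\<lambda>t. k * complex_of_real t) has_vector_derivative k * of_real 1) (at t within S)"
    by (intro has_vector_derivative_mult_right has_vector_derivative_of_real DERIV_ident)
  from field_vector_diff_chain_within[OF this, of exp "exp (k * of_real t)"]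
  show ?thesis by (simp add: comp_def DERIV_exp has_field_derivative_at_within)
qed

text \<open>Rotating the ray of integration: by homogeneity the rotated integral G satisfies
  G' = i p G up to boundary terms, so exp (- i p \<theta>) G is almost constant.\<close>
lemma cexp_integral_rotate:
  assumes c: "c \<in> {0, 1::real}" and p: "c < p" "p < c + 1"
  shows "(LINT u|lborel. wt p u *\<^sub>R cexp c (\<i> * of_real u))
      = exp (\<i> * of_real (p * pi / 2)) * (LINT u|lborel. wt p u *\<^sub>R cexp c (of_real u))"
proof -
  define z where "z \<theta> = iexp \<theta>" for \<theta>
  have zRe: "Re (z \<theta>) \<ge> 0" if "\<theta> \<in> {0..pi/2}" for \<theta>
    unfolding z_def using that by (simp add: Re_exp cos_ge_zero)
  have zn: "cmod (z \<theta>) = 1" for \<theta> unfolding z_def by simp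
  define G where "G R \<theta> = integral {1 / R..R} (\<lambda>u. u powr (- 1 - p) *\<^sub>R cexp c (z \<theta> * of_real u))" for R \<theta>
  define H where "H R \<theta> = exp (- \<i> * of_real (p * \<theta>)) * G R \<theta>" for R \<theta>
  \<comment> \<open>The two terms come from the endpoints \<open>R\<close> and \<open>1 / R\<close>;
    both exponents are negative because \<open>c < p < c + 1\<close>.\<close>
  have bound: "cmod (H R (pi / 2) - H R 0) \<le> (3 * R powr (c - p) + R powr (p - c - 1)) * (pi / 2)" if R: "R \<ge> 1" for R
  proof -
    have lR: "1 / R \<le> R" using R by (metis divide_le_eq_1 dual_order.trans le_numeral_extra(4) zero_less_one divide_self_if div_by_1 frac_le zero_le_one)
    define bnd where "bnd \<theta> = R powr (- p) *\<^sub>R cexp c (z \<theta> * of_real R) - (1 / R) powr (- p) *\<^sub>R cexp c (z \<theta> * of_real (1 / R))" for \<theta>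
    define g where "g \<theta> u = u powr (- 1 - p) *\<^sub>R ((exp (- (z \<theta> * of_real u)) - of_real c) * (\<i> * z \<theta> * of_real u))" for \<theta> u
    have pos: "u > 0" if "u \<in> {1 / R..R}" for u
      using that R by (auto intro: less_le_trans[rotated])
    have dz: "(z has_vector_derivative \<i> * z \<theta>) (at \<theta> within S)" for \<theta> S
      unfolding z_def by (rule has_vector_derivative_exp_linear)
    have dc: "(cexp c has_field_derivative exp (- w) - of_real c) (at w within S)" for w S
      unfolding cexp_def by (auto intro!: derivative_eq_intros)
    have der1: "((\<lambda>\<theta>. u powr (- 1 - p) *\<^sub>R cexp c (z \<theta> * of_real u)) has_vector_derivative g \<theta> u) (at \<theta> within S)" for \<theta> u S
    proof -
      have "((\<lambda>\<theta>. z \<theta> * of_real u) has_vector_derivative (\<i> * z \<theta>) * of_real u) (at \<theta> within S)"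
        by (rule has_vector_derivative_mult_left[OF dz])
      from field_vector_diff_chain_within[OF this dc]
      have "((\<lambda>\<theta>. cexp c (z \<theta> * of_real u)) has_vector_derivative ((\<i> * z \<theta>) * of_real u) * (exp (- (z \<theta> * of_real u)) - of_real c)) (at \<theta> within S)"
        by (simp add: comp_def)
      then have "((\<lambda>\<theta>. u powr (- 1 - p) *\<^sub>R cexp c (z \<theta> * of_real u)) has_vector_derivative u powr (- 1 - p) *\<^sub>R (((\<i> * z \<theta>) * of_real u) * (exp (- (z \<theta> * of_real u)) - of_real c))) (at \<theta> within S)"
        by (rule has_vector_derivative_scaleR[OF DERIV_const, simplified])
      then show ?thesis unfolding g_def by (simp add: ac_simps)
    qed
    have cexp_cont: "continuous_on S (\<lambda>x. cexp c (f x))" if "continuous_on S f" for S :: "real set" and f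
      unfolding cexp_def by (intro continuous_intros that)
    have int: "(\<lambda>u. u powr (- 1 - p) *\<^sub>R cexp c (z \<theta> * of_real u)) integrable_on {1 / R..R}" for \<theta>
      by (rule integrable_continuous_real) (auto intro!: continuous_intros cexp_cont dest: pos)
    have cont: "continuous_on ({0..pi/2} \<times> cbox (1/R) R) (\<lambda>(\<theta>, u). g \<theta> u)"
      unfolding g_def z_def split_def by (intro continuous_intros) (auto dest: pos)
    have dG: "(G R has_vector_derivative \<i> * (bnd \<theta> + of_real p * G R \<theta>)) (at \<theta> within {0..pi/2})" if \<theta>: "\<theta> \<in> {0..pi/2}" for \<theta>
    proof -
      have "G R = (\<lambda>\<theta>. integral (cbox (1/R) R) (\<lambda>u. u powr (- 1 - p) *\<^sub>R cexp c (z \<theta> * of_real u)))"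
        by (simp add: G_def fun_eq_iff)
      moreover have "((\<lambda>\<theta>. integral (cbox (1/R) R) (\<lambda>u. u powr (- 1 - p) *\<^sub>R cexp c (z \<theta> * of_real u))) has_vector_derivative integral (cbox (1/R) R) (g \<theta>)) (at \<theta> within {0..pi/2})"
        by (rule leibniz_rule_vector_derivative[OF der1 _ cont]) (use int \<theta> in auto)
      moreover have "(g \<theta> has_integral \<i> * (bnd \<theta> + of_real p * G R \<theta>)) {1 / R..R}"
      proof -
        \<comment> \<open>The derivative in \<open>u\<close> of
          \<open>u powr (- p) *\<^sub>R cexp c (z \<theta> * of_real u)\<close>. Rotating and
          scaling act on the variable alike up to the factor \<open>\<i>\<close>, so
          \<open>\<i> * F'\<close> is the derivative in \<open>\<theta>\<close> of the integrand
          less \<open>\<i> * p\<close> times the integrand.\<close>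
        define F' where "F' u = (- p * u powr (- p - 1)) *\<^sub>R cexp c (z \<theta> * of_real u) + u powr (- p) *\<^sub>R (z \<theta> * (exp (- (z \<theta> * of_real u)) - of_real c))" for u
        have 1: "(F' has_integral (R powr (- p) *\<^sub>R cexp c (z \<theta> * of_real R) - (1 / R) powr (- p) *\<^sub>R cexp c (z \<theta> * of_real (1 / R)))) {1 / R..R}"
        proof (rule fundamental_theorem_of_calculus[OF lR])
          fix u assume u: "u \<in> {1 / R..R}"
          have "((\<lambda>u. z \<theta> * of_real u) has_vector_derivative z \<theta> * 1) (at u within {1 / R..R})"
            by (intro has_vector_derivative_mult_right) (auto simp: has_vector_derivative_def intro!: derivative_eq_intros simp: scaleR_conv_of_real)
          from field_vector_diff_chain_within[OF this dc]
          have a: "((\<lambda>u. cexp c (z \<theta> * of_real u)) has_vector_derivative z \<theta> * (exp (- (z \<theta> * of_real u)) - of_real c)) (at u within {1 / R..R})"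
            by (simp add: comp_def)
          have b: "((\<lambda>u. u powr (- p)) has_real_derivative - p * u powr (- p - 1)) (at u within {1 / R..R})"
            using has_real_derivative_powr[OF pos[OF u], of "- p"] by (rule has_field_derivative_at_within)
          show "((\<lambda>u. u powr (- p) *\<^sub>R cexp c (z \<theta> * of_real u)) has_vector_derivative F' u) (at u within {1 / R..R})"
            unfolding F'_def using has_vector_derivative_scaleR[OF b a] by (simp add: add.commute)
        qed
        have 2: "((\<lambda>u. u powr (- 1 - p) *\<^sub>R cexp c (z \<theta> * of_real u)) has_integral G R \<theta>) {1 / R..R}"
          unfolding G_def using int by (rule integrable_integral)
        have "((\<lambda>u. \<i> * (F' u + of_real p * (u powr (- 1 - p) *\<^sub>R cexp c (z \<theta> * of_real u)))) has_integral \<i> * (bnd \<theta> + of_real p * G R \<theta>)) {1 / R..R}"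
          unfolding bnd_def by (intro has_integral_mult_right has_integral_add 1 2)
        then show ?thesis
        proof (rule has_integral_eq[rotated])
          fix u assume u: "u \<in> {1 / R..R}"
          have "u powr (- p) = u powr (- 1 - p) * u"
            using pos[OF u] by (simp add: powr_mult_base mult.commute)
          then show "\<i> * (F' u + of_real p * (u powr (- 1 - p) *\<^sub>R cexp c (z \<theta> * of_real u))) = g \<theta> u"
            unfolding F'_def g_def minus_diff_commute[of p 1] by (simp add: scaleR_conv_of_real algebra_simps)
        qed
      qed
      ultimately show ?thesis by (simp add: integral_unique)
    qed
    have dH: "(H R has_vector_derivative \<i> * exp (- \<i> * of_real (p * \<theta>)) * bnd \<theta>) (at \<theta> within {0..pi/2})" if \<theta>: "\<theta> \<in> {0..pi/2}" for \<theta>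
    proof -
      have "((\<lambda>\<theta>. exp (- \<i> * of_real (p * \<theta>))) has_vector_derivative - \<i> * of_real p * exp (- \<i> * of_real (p * \<theta>))) (at \<theta> within {0..pi/2})"
        using has_vector_derivative_exp_linear[of "- \<i> * of_real p" \<theta>] by (simp add: mult.assoc)
      from has_vector_derivative_mult[OF this dG[OF \<theta>]]
      show ?thesis unfolding H_def by (simp add: algebra_simps)
    qed
    have bb: "cmod (bnd \<theta>) \<le> 3 * R powr (c - p) + R powr (p - c - 1)" if \<theta>: "\<theta> \<in> {0..pi/2}" for \<theta>
    proof -
      have "cmod (bnd \<theta>) \<le> R powr (- p) * cmod (cexp c (z \<theta> * of_real R)) + (1 / R) powr (- p) * cmod (cexp c (z \<theta> * of_real (1 / R)))"
        unfolding bnd_def by (rule order_trans[OF norm_triangle_ineq4]) simp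
      also have "\<dots> \<le> R powr (- p) * (3 * R powr c) + (1 / R) powr (- p) * (1 / R) powr (c + 1)"
        using cexp_ray_bounds[OF c zRe[OF \<theta>] zn, of R] cexp_ray_bounds[OF c zRe[OF \<theta>] zn, of "1 / R"] R
        by (intro add_mono mult_left_mono) auto
      also have "\<dots> = 3 * R powr (c - p) + (1 / R) powr (c + 1 - p)"
        using R by (simp add: powr_add[symmetric])
      also have "(1 / R) powr (c + 1 - p) = R powr (p - c - 1)"
        using R by (simp add: powr_divide powr_minus_divide[symmetric] diff_diff_eq)
      finally show ?thesis .
    qed
    have "cmod (H R (pi/2) - H R 0) \<le> (3 * R powr (c - p) + R powr (p - c - 1)) * cmod (of_real (pi / 2 - 0))"
    proof -
      have "norm (H R (pi/2) - H R 0) \<le> (3 * R powr (c - p) + R powr (p - c - 1)) * norm (pi / 2 - 0)"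
      proof (rule differentiable_bound[where S = "{0..pi/2}" and f' = "\<lambda>\<theta> h. h *\<^sub>R (\<i> * exp (- \<i> * of_real (p * \<theta>)) * bnd \<theta>)"])
        show "(H R has_derivative (\<lambda>h. h *\<^sub>R (\<i> * exp (- \<i> * of_real (p * \<theta>)) * bnd \<theta>))) (at \<theta> within {0..pi/2})"
          if "\<theta> \<in> {0..pi/2}" for \<theta>
          using dH[OF that] unfolding has_vector_derivative_def .
        show "onorm (\<lambda>h. h *\<^sub>R (\<i> * exp (- \<i> * of_real (p * \<theta>)) * bnd \<theta>)) \<le> 3 * R powr (c - p) + R powr (p - c - 1)"
          if "\<theta> \<in> {0..pi/2}" for \<theta>
        proof (rule onorm_le)
          fix h :: real
          have "cmod (exp (- \<i> * of_real (p * \<theta>))) = 1" by simp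
          then have "cmod (\<i> * exp (- \<i> * of_real (p * \<theta>)) * bnd \<theta>) = cmod (bnd \<theta>)" unfolding norm_mult by simp
          then show "norm (h *\<^sub>R (\<i> * exp (- \<i> * of_real (p * \<theta>)) * bnd \<theta>)) \<le> (3 * R powr (c - p) + R powr (p - c - 1)) * norm h"
            using mult_left_mono[OF bb[OF that], of "\<bar>h\<bar>"] by (simp add: mult.commute del: of_real_mult)
        qed
      qed auto
      then show ?thesis by simp
    qed
    then show ?thesis by simp
  qed
  have lim0: "(\<lambda>n. H (real (Suc n)) 0) \<longlonglongrightarrow> (LINT u|lborel. wt p u *\<^sub>R cexp c (of_real u))"
    using truncated_integral_tendsto[OF integrable_wt_cexp[OF c _ _ p, of 1]] by (simp add: H_def G_def z_def)
  have "z (pi / 2) = \<i>" unfolding z_def using exp_pi_i' cis_conv_exp[of "pi/2"] by simp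
  then have lim1: "(\<lambda>n. H (real (Suc n)) (pi / 2)) \<longlonglongrightarrow> exp (- \<i> * of_real (p * (pi / 2))) * (LINT u|lborel. wt p u *\<^sub>R cexp c (\<i> * of_real u))"
    unfolding H_def G_def using integrable_wt_cexp[OF c _ _ p, of \<i>]
    by (intro tendsto_mult tendsto_const) (simp only:, rule truncated_integral_tendsto, simp)
  have "(\<lambda>n. (3 * real (Suc n) powr (c - p) + real (Suc n) powr (p - c - 1)) * (pi / 2)) \<longlonglongrightarrow> (3 * 0 + 0) * (pi / 2)"
    using p by (intro tendsto_intros tendsto_neg_powr filterlim_compose[OF filterlim_real_sequentially filterlim_Suc]) auto
  then have h0: "(\<lambda>n. (3 * real (Suc n) powr (c - p) + real (Suc n) powr (p - c - 1)) * (pi / 2)) \<longlonglongrightarrow> 0"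
    by (simp only: mult_zero_left mult_zero_right add_0_left)
  have "(\<lambda>n. H (real (Suc n)) (pi / 2) - H (real (Suc n)) 0) \<longlonglongrightarrow> 0"
  proof (rule Lim_null_comparison[OF always_eventually, OF allI])
    show "norm (H (real (Suc n)) (pi / 2) - H (real (Suc n)) 0) \<le> (3 * real (Suc n) powr (c - p) + real (Suc n) powr (p - c - 1)) * (pi / 2)" for n
      by (rule bound) simp
  qed (rule h0)
  from LIMSEQ_unique[OF this tendsto_diff[OF lim1 lim0]]
  have e: "exp (- \<i> * of_real (p * (pi / 2))) * (LINT u|lborel. wt p u *\<^sub>R cexp c (\<i> * of_real u)) = (LINT u|lborel. wt p u *\<^sub>R cexp c (of_real u))"
    by (rule eq_iff_diff_eq_0[THEN iffD2, OF sym])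
  have "exp (\<i> * of_real (p * pi / 2)) * exp (- \<i> * of_real (p * (pi / 2))) = 1"
    unfolding exp_add[symmetric] by simp
  then show ?thesis unfolding e[symmetric] mult.assoc[symmetric] by (simp only: mult_1_left)
qed

section \<open>Fractional moments and the skewness bound\<close>

lemma integrable_wt_trig:
  assumes "c \<in> {0, 1}" "c < p" "p < c + 1"
  shows "integrable lborel (\<lambda>u. wt p u * (1 - cos u))" "integrable lborel (\<lambda>u. wt p u * (sin u - c * u))"
proof -
  have i: "integrable lborel (\<lambda>u. wt p u *\<^sub>R cexp c (\<i> * of_real u))"
    by (rule integrable_wt_cexp) (use assms in auto)
  have e: "cexp c (\<i> * of_real u) = Complex (1 - cos u) (sin u - c * u)" for u
    by (simp add: cexp_def complex_eq_iff Re_exp Im_exp)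
  show "integrable lborel (\<lambda>u. wt p u * (1 - cos u))" using integrable_Re[OF i] by (simp add: e)
  show "integrable lborel (\<lambda>u. wt p u * (sin u - c * u))" using integrable_Im[OF i] by (simp add: e)
qed

text \<open>On the positive axis the compensated integral is a real number \<open>K\<close>;
  rotating to the imaginary axis multiplies it by \<open>exp (\<i> * p * pi / 2)\<close>. Real and
  imaginary parts are then \<open>cos (p * pi / 2) * K\<close> and
  \<open>sin (p * pi / 2) * K\<close>.\<close>

lemma trig_integral_ratio:
  assumes c: "c \<in> {0, 1}" and p: "c < p" "p < c + 1"
  shows "(LINT u|lborel. wt p u * (sin u - c * u)) = tan (p * pi / 2) * (LINT u|lborel. wt p u * (1 - cos u))"
proof -
  have i: "integrable lborel (\<lambda>u. wt p u *\<^sub>R cexp c (\<i> * of_real u))"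
    by (rule integrable_wt_cexp) (use assms in auto)
  have e: "cexp c (\<i> * of_real u) = Complex (1 - cos u) (sin u - c * u)" for u
    by (simp add: cexp_def complex_eq_iff Re_exp Im_exp)
  have r: "wt p u *\<^sub>R cexp c (of_real u) = complex_of_real (wt p u * (1 - exp (- u) - c * u))" for u
    using exp_of_real[of "- u", where 'a = complex] by (simp add: cexp_def scaleR_conv_of_real)
  define K where "K = (LINT u|lborel. wt p u * (1 - exp (- u) - c * u))"
  have K: "(LINT u|lborel. wt p u *\<^sub>R cexp c (of_real u)) = complex_of_real K"
    unfolding r K_def by (rule integral_complex_of_real)
  have main: "(LINT u|lborel. wt p u *\<^sub>R cexp c (\<i> * of_real u)) = exp (\<i> * of_real (p * pi / 2)) * of_real K"
    using cexp_integral_rotate[OF c p] unfolding K .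
  have "Re (LINT u|lborel. wt p u *\<^sub>R cexp c (\<i> * of_real u)) = (LINT u|lborel. wt p u * (1 - cos u))"
    using integral_Re[OF i] by (simp add: e)
  then have C: "(LINT u|lborel. wt p u * (1 - cos u)) = cos (p * pi / 2) * K"
    unfolding main by (simp add: Re_exp)
  have "Im (LINT u|lborel. wt p u *\<^sub>R cexp c (\<i> * of_real u)) = (LINT u|lborel. wt p u * (sin u - c * u))"
    using integral_Im[OF i] by (simp add: e)
  then have S: "(LINT u|lborel. wt p u * (sin u - c * u)) = sin (p * pi / 2) * K"
    unfolding main by (simp add: Im_exp)
  \<comment> \<open>The order \<open>p\<close> is not 1: the angle lies in (0, pi/2) for
    \<open>c = 0\<close> and in (pi/2, pi) for \<open>c = 1\<close>.\<close>
  have "cos (p * pi / 2) \<noteq> 0"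
  proof (cases "c = 0")
    case True
    then have "0 < p * pi / 2" "p * pi / 2 < pi / 2" using p by auto
    then show ?thesis using cos_gt_zero_pi[of "p * pi / 2"] by auto
  next
    case False
    then have "pi / 2 < p * pi / 2" "p * pi / 2 < pi" using p c by auto
    then have "cos (p * pi / 2) < cos (pi / 2)" by (intro cos_monotone_0_pi) auto
    then show ?thesis by simp
  qed
  then show ?thesis unfolding C S tan_def by simp
qed

lemma wt_scale:
  assumes "s > 0"
  shows "(LINT u|lborel. wt p u * h (u * s)) = s powr p * (LINT u|lborel. wt p u * h u)"
    "integrable lborel (\<lambda>u. wt p u * h u) \<Longrightarrow> integrable lborel (\<lambda>u. wt p u * h (u * s))"
proof -
  have w: "wt p (s * u) = s powr (- 1 - p) * wt p u" for u
    using assms by (auto simp: wt_def powr_mult zero_less_mult_iff)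
  have sp: "s powr p * s powr (- p) = 1" "s * s powr (- 1 - p) = s powr (- p)" "s powr (-1 - p) \<noteq> 0"
    using assms by (auto simp: powr_add[symmetric] powr_mult_base)
  have "(LINT u|lborel. wt p u * h u) = s * (LINT u|lborel. wt p (0 + s * u) * h (0 + s * u))"
    using lborel_integral_real_affine[of s "\<lambda>u. wt p u * h u" 0] assms by simp
  also have "\<dots> = s * (s powr (- 1 - p) * (LINT u|lborel. wt p u * h (u * s)))"
    by (simp add: w mult.commute[of _ s] mult.assoc)
  also have "\<dots> = s powr (- p) * (LINT u|lborel. wt p u * h (u * s))"
    using sp(2) by (simp add: mult.assoc[symmetric])
  finally show "(LINT u|lborel. wt p u * h (u * s)) = s powr p * (LINT u|lborel. wt p u * h u)"
    using sp(1) by (simp add: mult.assoc[symmetric])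
  show "integrable lborel (\<lambda>u. wt p u * h (u * s))" if "integrable lborel (\<lambda>u. wt p u * h u)"
  proof -
    have "integrable lborel (\<lambda>u. wt p (0 + s * u) * h (0 + s * u))"
      using lborel_integrable_real_affine[OF that, of s 0] assms by simp
    then have "integrable lborel (\<lambda>u. s powr (- 1 - p) * (wt p u * h (u * s)))"
      by (simp add: w mult.commute[of _ s] mult.assoc)
    then show ?thesis using sp(3) by simp
  qed
qed

lemma integral_one_minus_cos_pos:
  assumes "0 < p" "p < 2"
  shows "0 < (LINT u|lborel. wt p u * (1 - cos u))"
proof -
  have i: "integrable lborel (\<lambda>u. wt p u *\<^sub>R (1 - cos u))"
  proof (rule integrable_wt_dominated[where A = 1 and B = 2 and a = 2 and b = 0])
    show "norm (1 - cos u) \<le> 1 * u powr 2" if "0 < u" for u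
    proof -
      have "1 - cos u = 2 * (sin (u / 2))\<^sup>2" using cos_double_sin[of "u / 2"] by simp
      also have "\<dots> \<le> 2 * (u / 2)\<^sup>2"
        using abs_sin_x_le_abs_x[of "u / 2"] by (intro mult_left_mono) (auto simp only: abs_le_square_iff)
      also have "\<dots> \<le> u\<^sup>2" by (simp add: power_divide)
      finally show ?thesis using that by (simp add: powr_numeral)
    qed
    show "norm (1 - cos u) \<le> 2 * u powr 0" if "1 < u" for u :: real
      using that cos_ge_minus_one[of u] by simp
  qed (use assms in auto)
  have "(LINT u|lborel. wt p u * (1 - cos u)) \<noteq> 0"
  proof
    assume "(LINT u|lborel. wt p u * (1 - cos u)) = 0"
    then have "AE u in lborel. wt p u * (1 - cos u) = 0"
      using integral_nonneg_eq_0_iff_AE[of lborel "\<lambda>u. wt p u * (1 - cos u)"] i by simp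
    then have "AE u in lborel. \<not> (1 < u \<and> u < (2::real))"
    proof eventually_elim
      case (elim u)
      show ?case
      proof
        assume u: "1 < u \<and> u < 2"
        then have "wt p u > 0" by (simp add: wt_def)
        moreover have "cos u < cos 0" using u pi_gt3 by (intro cos_monotone_0_pi) auto
        ultimately show False using elim by simp
      qed
    qed
    then have "emeasure lborel {1<..<2::real} = 0"
      by (subst (asm) AE_iff_measurable[OF _ refl]) (auto simp: greaterThanLessThan_def greaterThan_def lessThan_def Int_def)
    then show False by simp
  qed
  moreover have "0 \<le> (LINT u|lborel. wt p u * (1 - cos u))" by (rule Bochner_Integration.integral_nonneg) simp
  ultimately show ?thesis by linarith
qed

lemma Re_Im_char:
  assumes "real_distribution N"
  shows "Re (char N u) = (LINT x|N. cos (u * x))" "Im (char N u) = (LINT x|N. sin (u * x))"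
proof -
  interpret N: real_distribution N by fact
  have i: "integrable N (\<lambda>x. iexp (u * x))" by (rule N.integrable_const_bound[where B = 1]) auto
  show "Re (char N u) = (LINT x|N. cos (u * x))" "Im (char N u) = (LINT x|N. sin (u * x))"
    unfolding char_def integral_Re[OF i, symmetric] integral_Im[OF i, symmetric] by (simp_all add: Re_exp Im_exp)
qed

text \<open>Fubini: integrating \<open>wt p u * (1 - cos (u * s))\<close> first in \<open>u\<close>
  gives a positive constant times \<open>\<bar>s\<bar> powr p\<close>, and first in \<open>s\<close>
  it gives the integrand of the hypothesis. As the kernel is nonnegative, integrability passes from
  one to the other.\<close>

lemma integrable_abs_powr_of_char:
  assumes N: "real_distribution N" and p: "0 < p" "p < 2"
    and i: "integrable lborel (\<lambda>u. wt p u * (1 - Re (char N u)))"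
  shows "integrable N (\<lambda>s. \<bar>s\<bar> powr p)"
proof -
  interpret N: real_distribution N by fact
  interpret P: pair_sigma_finite lborel N ..
  have ic: "integrable N (\<lambda>x. cos (u * x))" for u by (rule N.integrable_const_bound[where B = 1]) auto
  have inner: "(LINT s|N. wt p u * (1 - cos (u * s))) = wt p u * (1 - Re (char N u))" for u
    using ic[of u] N.prob_space by (simp add: Re_Im_char[OF N])
  define C where "C = (LINT u|lborel. wt p u * (1 - cos u))"
  have C: "C > 0" unfolding C_def by (rule integral_one_minus_cos_pos[OF p])
  have "integrable (lborel \<Otimes>\<^sub>M N) (\<lambda>(u, s). wt p u * (1 - cos (u * s)))"
  proof (rule P.Fubini_integrable)
    show "integrable lborel (\<lambda>u. LINT s|N. norm (case (u, s) of (u, s) \<Rightarrow> wt p u * (1 - cos (u * s))))"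
      using i inner by (simp del: Bochner_Integration.integral_mult_right_zero integral_mult_right)
    show "AE u in lborel. integrable N (\<lambda>s. case (u, s) of (u, s) \<Rightarrow> wt p u * (1 - cos (u * s)))"
      using ic by (intro AE_I2) simp
  qed measurable
  then have "integrable N (\<lambda>s. LINT u|lborel. wt p u * (1 - cos (u * s)))" by (rule P.integrable_snd)
  also have "(\<lambda>s. LINT u|lborel. wt p u * (1 - cos (u * s))) = (\<lambda>s. C * \<bar>s\<bar> powr p)"
  proof
    fix s :: real
    have "(LINT u|lborel. wt p u * (1 - cos (u * s))) = (LINT u|lborel. wt p u * (1 - cos (u * \<bar>s\<bar>)))"
      by (cases "s \<ge> 0") auto
    also have "\<dots> = C * \<bar>s\<bar> powr p"
    proof (cases "s = 0")
      case False
      then show ?thesis using wt_scale(1)[of "\<bar>s\<bar>" p "\<lambda>x. 1 - cos x"] by (simp add: C_def)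
    qed simp
    finally show "(LINT u|lborel. wt p u * (1 - cos (u * s))) = C * \<bar>s\<bar> powr p" .
  qed
  finally show ?thesis using C by simp
qed

text \<open>The kernel \<open>k \<sigma>\<close> is built so that its weighted integral over
  \<open>u\<close> at scale \<open>s\<close> is \<open>\<bar>s\<bar> powr p\<close> times a
  nonnegative constant, whatever the sign of \<open>s\<close>; Fubini turns this into a statement on
  the characteristic function. A vanishing mean removes the compensator, which is present for
  \<open>c = 1\<close>.\<close>

lemma char_moment_ineq:
  assumes N: "real_distribution N" and c: "c \<in> {0, 1}" and p: "c < p" "p < c + 1"
    and i: "integrable lborel (\<lambda>u. wt p u * (1 - Re (char N u)))"
    and m: "c \<noteq> 0 \<Longrightarrow> (LINT s|N. s) = 0" and \<sigma>: "\<sigma> \<in> {1, -1::real}"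
  shows "0 \<le> (LINT u|lborel. wt p u * (\<bar>tan (p * pi / 2)\<bar> * (1 - Re (char N u)) + \<sigma> * Im (char N u)))"
proof -
  interpret N: real_distribution N by fact
  interpret P: pair_sigma_finite N lborel ..
  have p2: "0 < p" "p < 2" using c p by auto
  define \<tau> where "\<tau> = \<bar>tan (p * pi / 2)\<bar>"
  define k where "k \<sigma> x = \<tau> * (1 - cos x) + \<sigma> * (sin x - c * x)" for \<sigma> x :: real
  define K where "K \<sigma> = (LINT u|lborel. wt p u * k \<sigma> u)" for \<sigma>
  define K' where "K' \<sigma> = (LINT u|lborel. wt p u * \<bar>k \<sigma> u\<bar>)" for \<sigma>
  have km[measurable]: "k \<sigma> \<in> borel_measurable borel" for \<sigma> unfolding k_def by measurable
  \<comment> \<open>The odd part of the kernel changes sign with \<open>s\<close>, which amounts to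
    replacing \<open>\<sigma>\<close> by \<open>- \<sigma>\<close>.\<close>
  have kflip: "k \<sigma> (u * s) = k (sgn s * \<sigma>) (u * \<bar>s\<bar>)" if "s \<noteq> 0" for \<sigma> u s
    using that by (cases "s > 0") (auto simp: k_def algebra_simps)
  have Cpos: "0 < (LINT u|lborel. wt p u * (1 - cos u))" by (rule integral_one_minus_cos_pos[OF p2])
  have ki: "integrable lborel (\<lambda>u. wt p u * k \<sigma> u)" for \<sigma>
  proof -
    have "integrable lborel (\<lambda>u. \<tau> * (wt p u * (1 - cos u)) + \<sigma> * (wt p u * (sin u - c * u)))"
      using integrable_wt_trig[OF c p] by (intro Bochner_Integration.integrable_add integrable_mult_right)
    then show ?thesis by (simp add: k_def algebra_simps)
  qed
  \<comment> \<open>The integral is \<open>(\<tau> + \<sigma> * tan (p * pi / 2)) * C\<close>, and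
    \<open>\<tau>\<close> is the smallest number that makes this nonnegative for both signs; in the
    limit it becomes the bound on the skewness.\<close>
  have K0: "0 \<le> K \<sigma>" if "\<bar>\<sigma>\<bar> = 1" for \<sigma>
  proof -
    define C where "C = (LINT u|lborel. wt p u * (1 - cos u))"
    have "K \<sigma> = (LINT u|lborel. \<tau> * (wt p u * (1 - cos u)) + \<sigma> * (wt p u * (sin u - c * u)))"
      unfolding K_def k_def by (rule arg_cong[where f = "integral\<^sup>L lborel"]) (simp add: fun_eq_iff algebra_simps)
    also have "\<dots> = \<tau> * C + \<sigma> * (LINT u|lborel. wt p u * (sin u - c * u))"
      unfolding C_def using integrable_wt_trig[OF c p] by simp
    also have "\<dots> = (\<tau> + \<sigma> * tan (p * pi / 2)) * C"
      unfolding trig_integral_ratio[OF c p] C_def by (simp add: algebra_simps)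
    finally have *: "K \<sigma> = (\<tau> + \<sigma> * tan (p * pi / 2)) * C" .
    have "0 \<le> \<tau> + \<sigma> * tan (p * pi / 2)" unfolding \<tau>_def using that by (auto simp: abs_if split: if_splits)
    then show ?thesis unfolding * using Cpos C_def by simp
  qed
  have si: "integrable N (\<lambda>s. \<bar>s\<bar> powr p)" by (rule integrable_abs_powr_of_char[OF N p2 i])
  have s1: "integrable N (\<lambda>s. c * s)"
  proof (cases "c = 0")
    case False
    then have "p > 1" using c p by auto
    have "integrable N (\<lambda>s. 1 + \<bar>s\<bar> powr p)" using si by simp
    then have "integrable N (\<lambda>s. s)"
    proof (rule Bochner_Integration.integrable_bound)
      show "AE s in N. norm s \<le> norm (1 + \<bar>s\<bar> powr p)"
      proof (rule AE_I2)
        fix s :: real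
        show "norm s \<le> norm (1 + \<bar>s\<bar> powr p)"
        proof (cases "\<bar>s\<bar> \<le> 1")
          case False
          then have "\<bar>s\<bar> powr 1 \<le> \<bar>s\<bar> powr p" using \<open>p > 1\<close> by (intro powr_mono) auto
          then show ?thesis using False by simp
        qed (simp add: add_increasing2)
      qed
    qed simp
    then show ?thesis by simp
  qed simp
  have prod: "integrable (N \<Otimes>\<^sub>M lborel) (\<lambda>(s, u). wt p u * k \<sigma> (u * s))"
  proof (rule P.Fubini_integrable)
    have "(\<lambda>s. LINT u|lborel. norm (case (s, u) of (s, u) \<Rightarrow> wt p u * k \<sigma> (u * s))) = (\<lambda>s. \<bar>s\<bar> powr p * (if s > 0 then K' \<sigma> else K' (- \<sigma>)))"
    proof
      fix s :: real
      show "(LINT u|lborel. norm (case (s, u) of (s, u) \<Rightarrow> wt p u * k \<sigma> (u * s))) = \<bar>s\<bar> powr p * (if s > 0 then K' \<sigma> else K' (- \<sigma>))"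
      proof (cases "s = 0")
        case True
        then show ?thesis by (simp add: k_def)
      next
        case False
        then have "(LINT u|lborel. norm (case (s, u) of (s, u) \<Rightarrow> wt p u * k \<sigma> (u * s))) = (LINT u|lborel. wt p u * \<bar>k (sgn s * \<sigma>) (u * \<bar>s\<bar>)\<bar>)"
          by (simp add: abs_mult kflip[OF False])
        also have "\<dots> = \<bar>s\<bar> powr p * K' (sgn s * \<sigma>)"
          unfolding K'_def by (rule wt_scale(1)) (use False in simp)
        finally show ?thesis using False by (auto simp: sgn_if)
      qed
    qed
    moreover have "integrable N (\<lambda>s. \<bar>s\<bar> powr p * (if s > 0 then K' \<sigma> else K' (- \<sigma>)))"
    proof (rule Bochner_Integration.integrable_bound[OF integrable_mult_right[OF si, of "max \<bar>K' \<sigma>\<bar> \<bar>K' (- \<sigma>)\<bar>"]])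
      show "AE s in N. norm (\<bar>s\<bar> powr p * (if s > 0 then K' \<sigma> else K' (- \<sigma>))) \<le> norm (max \<bar>K' \<sigma>\<bar> \<bar>K' (- \<sigma>)\<bar> * \<bar>s\<bar> powr p)"
        by (rule AE_I2) (auto simp: abs_mult mult.commute[of _ "_ powr _"] intro!: mult_left_mono)
    qed simp
    ultimately show "integrable N (\<lambda>s. LINT u|lborel. norm (case (s, u) of (s, u) \<Rightarrow> wt p u * k \<sigma> (u * s)))" by simp
    have "integrable lborel (\<lambda>u. wt p u * k \<sigma> (u * s))" for s
    proof (cases "s = 0")
      case True
      then show ?thesis by (simp add: k_def)
    next
      case False
      then show ?thesis unfolding kflip[OF False] by (intro wt_scale(2) ki) simp
    qed
    then show "AE s in N. integrable lborel (\<lambda>u. case (s, u) of (s, u) \<Rightarrow> wt p u * k \<sigma> (u * s))" by simp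
  qed measurable
  have "(LINT u|lborel. LINT s|N. wt p u * k \<sigma> (u * s)) = (LINT s|N. LINT u|lborel. wt p u * k \<sigma> (u * s))"
    by (rule P.Fubini_integral[OF prod])
  moreover have "0 \<le> (LINT s|N. LINT u|lborel. wt p u * k \<sigma> (u * s))"
  proof (rule Bochner_Integration.integral_nonneg)
    fix s :: real
    show "0 \<le> (LINT u|lborel. wt p u * k \<sigma> (u * s))"
    proof (cases "s = 0")
      case False
      have "(LINT u|lborel. wt p u * k \<sigma> (u * s)) = \<bar>s\<bar> powr p * K (sgn s * \<sigma>)"
        unfolding kflip[OF False] K_def by (rule wt_scale(1)) (use False in simp)
      then show ?thesis using K0[of "sgn s * \<sigma>"] False \<sigma> by (auto simp: abs_mult abs_sgn_eq)
    qed (simp add: k_def)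
  qed
  moreover have "(LINT s|N. wt p u * k \<sigma> (u * s)) = wt p u * (\<tau> * (1 - Re (char N u)) + \<sigma> * Im (char N u))" for u
  proof -
    have ic: "integrable N (\<lambda>x. cos (u * x))" by (rule N.integrable_const_bound[where B = 1]) auto
    have isin: "integrable N (\<lambda>x. sin (u * x))" by (rule N.integrable_const_bound[where B = 1]) auto
    have "(LINT s|N. k \<sigma> (u * s)) = (LINT s|N. (\<tau> - \<tau> * cos (u * s)) + (\<sigma> * sin (u * s) - (\<sigma> * u) * (c * s)))"
      unfolding k_def by (rule arg_cong[where f = "integral\<^sup>L N"]) (simp add: fun_eq_iff algebra_simps)
    also have "\<dots> = \<tau> - \<tau> * Re (char N u) + (\<sigma> * Im (char N u) - (\<sigma> * u) * (LINT s|N. c * s))"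
      using ic isin s1 N.prob_space by (simp add: Re_Im_char[OF N] del: integral_mult_right_zero)
    also have "(LINT s|N. c * s) = 0" using m by (cases "c = 0") auto
    finally have "(LINT s|N. k \<sigma> (u * s)) = \<tau> * (1 - Re (char N u)) + \<sigma> * Im (char N u)" by (simp add: algebra_simps)
    then show ?thesis by simp
  qed
  ultimately show ?thesis unfolding \<tau>_def by (simp only:)
qed

text \<open>The inequality of \<open>char_moment_ineq\<close> multiplied by
  \<open>\<kappa> - p\<close>. On (0, 1] the first order expansion of the characteristic function
  contributes a multiple of \<open>1 / (\<kappa> - p)\<close>, which alone survives as
  \<open>p\<close> increases to \<open>\<kappa>\<close>; the quadratic remainder and the range
  beyond 1 contribute the terms collected in the last bracket.\<close>

lemma homogeneous_char_ineq_at: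
  assumes N: "real_distribution N" and c: "c \<in> {0, 1}" and p: "c < p" "p < \<kappa>" and \<kappa>: "\<kappa> < c + 1"
    and ch: "\<And>u. u > 0 \<Longrightarrow> char N u = exp (of_real (u powr \<kappa>) * \<psi>)" and \<sigma>: "\<sigma> \<in> {1, -1::real}"
  shows "0 \<le> \<bar>tan (p * pi / 2)\<bar> * (- Re \<psi>) + \<sigma> * Im \<psi> + (\<kappa> - p) *
     ((\<bar>tan (p * pi / 2)\<bar> + 1) * (cmod \<psi>)\<^sup>2 / (2 * \<kappa> - p) + (2 * \<bar>tan (p * pi / 2)\<bar> + 1) / p)"
proof -
  interpret N: real_distribution N by fact
  define \<tau> where "\<tau> = \<bar>tan (p * pi / 2)\<bar>"
  define f where "f u = \<tau> * (1 - Re (char N u)) + \<sigma> * Im (char N u)" for u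
  define A where "A = \<tau> * (- Re \<psi>) + \<sigma> * Im \<psi>"
  define B where "B = (\<tau> + 1) * (cmod \<psi>)\<^sup>2"
  have p0: "0 < p" "p < 2" using c p \<kappa> by auto
  have \<tau>: "0 \<le> \<tau>" unfolding \<tau>_def by simp
  have Re\<psi>: "Re \<psi> \<le> 0"
    using N.cmod_char_le_1[of 1] ch[of 1] by simp
  have near1: "cmod (1 - char N u) \<le> cmod \<psi> * u powr \<kappa>" if "u > 0" for u
    using norm_one_minus_exp_le[of "- (of_real (u powr \<kappa>) * \<psi>)"] Re\<psi> ch[OF that]
    by (simp add: norm_mult mult_nonpos_nonneg mult.commute)
  have near2: "cmod (1 - char N u + of_real (u powr \<kappa>) * \<psi>) \<le> (cmod \<psi>)\<^sup>2 * u powr (2 * \<kappa>)" if "u > 0" for u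
  proof -
    have "cmod (cexp 1 (- (of_real (u powr \<kappa>) * \<psi>))) \<le> (cmod (of_real (u powr \<kappa>) * \<psi>)) powr 2"
      using norm_cexp_near[of 1 "- (of_real (u powr \<kappa>) * \<psi>)"] Re\<psi> by (simp add: mult_nonneg_nonpos)
    also have "\<dots> = (cmod \<psi>)\<^sup>2 * (u powr \<kappa>)\<^sup>2"
      by (simp add: norm_mult power_mult_distrib)
    also have "(u powr \<kappa>)\<^sup>2 = u powr (2 * \<kappa>)"
      using that by (simp add: power2_eq_square powr_add[symmetric])
    finally show ?thesis using ch[OF that] by (simp add: cexp_def)
  qed
  have far: "cmod (1 - char N u) \<le> 2" for u
    using norm_triangle_ineq4[of 1 "char N u"] N.cmod_char_le_1[of u] by simp
  have i1: "integrable lborel (\<lambda>u. wt p u *\<^sub>R (1 - char N u))"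
    by (rule integrable_wt_dominated[where A = "cmod \<psi>" and B = 2 and a = \<kappa> and b = 0])
      (use near1 far p p0 in \<open>auto simp del: of_real_mult\<close>)
  then have i: "integrable lborel (\<lambda>u. wt p u * (1 - Re (char N u)))"
    using integrable_Re[OF i1] by simp
  have ii: "integrable lborel (\<lambda>u. wt p u * Im (char N u))"
    using Bochner_Integration.integrable_minus[OF integrable_Im[OF i1]] by simp
  then have fi: "integrable lborel (\<lambda>u. wt p u * f u)"
    using Bochner_Integration.integrable_add[OF integrable_mult_right[OF i, of \<tau>] integrable_mult_right[OF ii, of \<sigma>]]
    by (simp add: f_def algebra_simps)
  \<comment> \<open>The mean is the limit of \<open>n * Im (char N (1 / n))\<close> by dominated
    convergence; the homogeneous exponent makes this of order \<open>n powr (1 - \<kappa>)\<close>,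
    which vanishes since \<open>\<kappa> > 1\<close> when \<open>c \<noteq> 0\<close>.\<close>
  have m0: "(LINT s|N. s) = 0" if "c \<noteq> 0"
  proof -
    have p1: "1 < p" "1 < \<kappa>" using that c p by auto
    have si: "integrable N (\<lambda>s. \<bar>s\<bar> powr p)" by (rule integrable_abs_powr_of_char[OF N p0 i])
    have s1: "integrable N (\<lambda>s. \<bar>s\<bar>)"
    proof (rule Bochner_Integration.integrable_bound)
      show "integrable N (\<lambda>s. 1 + \<bar>s\<bar> powr p)" using si by simp
      show "AE s in N. norm \<bar>s\<bar> \<le> norm (1 + \<bar>s\<bar> powr p)"
      proof (rule AE_I2)
        fix s :: real
        show "norm \<bar>s\<bar> \<le> norm (1 + \<bar>s\<bar> powr p)"
        proof (cases "\<bar>s\<bar> \<le> 1")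
          case False
          then have "\<bar>s\<bar> powr 1 \<le> \<bar>s\<bar> powr p" using p1 by (intro powr_mono) auto
          then show ?thesis using False by simp
        qed (simp add: add_increasing2)
      qed
    qed simp
    have "(\<lambda>n. LINT s|N. real (Suc n) * sin (1 / real (Suc n) * s)) \<longlonglongrightarrow> (LINT s|N. s)"
    proof (rule integral_dominated_convergence[OF _ _ s1])
      show "AE s in N. (\<lambda>n. real (Suc n) * sin (1 / real (Suc n) * s)) \<longlonglongrightarrow> s"
      proof (rule AE_I2)
        fix s :: real
        have "((\<lambda>h. sin (h * s) / h) \<longlongrightarrow> s) (at 0)"
        proof -
          have "((\<lambda>h. sin (h * s)) has_field_derivative cos (0 * s) * s) (at 0)"
            by (auto intro!: derivative_eq_intros)
          then show ?thesis unfolding DERIV_def by simp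
        qed
        moreover have "filterlim (\<lambda>n. 1 / real (Suc n)) (at 0) sequentially"
          unfolding filterlim_at using LIMSEQ_inverse_real_of_nat by (auto simp: inverse_eq_divide)
        ultimately have "(\<lambda>n. sin (1 / real (Suc n) * s) / (1 / real (Suc n))) \<longlonglongrightarrow> s"
          by (rule filterlim_compose)
        then show "(\<lambda>n. real (Suc n) * sin (1 / real (Suc n) * s)) \<longlonglongrightarrow> s" by (simp add: mult.commute)
      qed
      show "AE s in N. norm (real (Suc n) * sin (1 / real (Suc n) * s)) \<le> \<bar>s\<bar>" for n
      proof (rule AE_I2)
        fix s :: real
        have "real (Suc n) * \<bar>sin (1 / real (Suc n) * s)\<bar> \<le> real (Suc n) * \<bar>1 / real (Suc n) * s\<bar>"
          by (intro mult_left_mono abs_sin_x_le_abs_x) simp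
        also have "\<dots> = \<bar>s\<bar>" by (simp add: abs_mult)
        finally show "norm (real (Suc n) * sin (1 / real (Suc n) * s)) \<le> \<bar>s\<bar>" by (simp add: abs_mult)
      qed
    qed auto
    moreover have "(LINT s|N. real (Suc n) * sin (1 / real (Suc n) * s)) = real (Suc n) * Im (char N (1 / real (Suc n)))" for n
      unfolding Re_Im_char[OF N] by (rule integral_mult_right_zero)
    moreover have "(\<lambda>n. real (Suc n) * Im (char N (1 / real (Suc n)))) \<longlonglongrightarrow> 0"
    proof (rule Lim_null_comparison[OF always_eventually])
      show "\<forall>n. norm (real (Suc n) * Im (char N (1 / real (Suc n)))) \<le> cmod \<psi> * real (Suc n) powr (1 - \<kappa>)"
      proof
        fix n
        have "\<bar>Im (char N (1 / real (Suc n)))\<bar> = \<bar>Im (1 - char N (1 / real (Suc n)))\<bar>" by simp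
        also have "\<dots> \<le> cmod (1 - char N (1 / real (Suc n)))" by (rule abs_Im_le_cmod)
        also have "\<dots> \<le> cmod \<psi> * (1 / real (Suc n)) powr \<kappa>" by (rule near1) simp
        finally have "real (Suc n) * \<bar>Im (char N (1 / real (Suc n)))\<bar> \<le> real (Suc n) * (cmod \<psi> * (1 / real (Suc n)) powr \<kappa>)"
          by (intro mult_left_mono) auto
        also have "\<dots> = cmod \<psi> * real (Suc n) powr (1 - \<kappa>)"
          by (simp add: powr_divide powr_diff)
        finally show "norm (real (Suc n) * Im (char N (1 / real (Suc n)))) \<le> cmod \<psi> * real (Suc n) powr (1 - \<kappa>)"
          by (simp add: abs_mult)
      qed
      have "(\<lambda>n. cmod \<psi> * real (Suc n) powr (1 - \<kappa>)) \<longlonglongrightarrow> cmod \<psi> * 0"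
        using p1 by (intro tendsto_intros tendsto_neg_powr filterlim_compose[OF filterlim_real_sequentially filterlim_Suc]) auto
      then show "(\<lambda>n. cmod \<psi> * real (Suc n) powr (1 - \<kappa>)) \<longlonglongrightarrow> 0" by simp
    qed
    ultimately show ?thesis using LIMSEQ_unique by simp
  qed
  \<comment> \<open>The majorant: leading term and quadratic remainder on (0, 1], and beyond 1 the
    crude bound \<open>2 * \<tau> + 1\<close> for \<open>f\<close>.\<close>
  have "has_bochner_integral lborel (\<lambda>u. A * (indicator {0<..1} u * u powr (\<kappa> - 1 - p)) + B * (indicator {0<..1} u * u powr (2 * \<kappa> - 1 - p))
        + (2 * \<tau> + 1) * (indicator {1<..} u * u powr (- 1 - p)))
      (A * (1 / (\<kappa> - 1 - p + 1)) + B * (1 / (2 * \<kappa> - 1 - p + 1)) + (2 * \<tau> + 1) * (- 1 / (- 1 - p + 1)))"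
    using p p0 by (intro has_bochner_integral_add has_bochner_integral_mult_right has_bochner_integral_powr_0_1 has_bochner_integral_powr_1_inf) auto
  then have hg: "has_bochner_integral lborel (\<lambda>u. A * (indicator {0<..1} u * u powr (\<kappa> - 1 - p)) + B * (indicator {0<..1} u * u powr (2 * \<kappa> - 1 - p))
        + (2 * \<tau> + 1) * (indicator {1<..} u * u powr (- 1 - p))) (A / (\<kappa> - p) + B / (2 * \<kappa> - p) + (2 * \<tau> + 1) / p)"
    by simp
  have "0 \<le> (LINT u|lborel. wt p u * f u)"
    using char_moment_ineq[OF N c p(1) _ i m0 \<sigma>] p \<kappa> unfolding f_def \<tau>_def by simp
  also have "\<dots> \<le> (LINT u|lborel. A * (indicator {0<..1} u * u powr (\<kappa> - 1 - p)) + B * (indicator {0<..1} u * u powr (2 * \<kappa> - 1 - p))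
        + (2 * \<tau> + 1) * (indicator {1<..} u * u powr (- 1 - p)))"
  proof (rule integral_mono[OF fi])
    show "integrable lborel (\<lambda>u. A * (indicator {0<..1} u * u powr (\<kappa> - 1 - p)) + B * (indicator {0<..1} u * u powr (2 * \<kappa> - 1 - p))
        + (2 * \<tau> + 1) * (indicator {1<..} u * u powr (- 1 - p)))"
      using hg by (rule has_bochner_integral_iff[THEN iffD1, THEN conjunct1])
    fix u :: real
    consider "u \<le> 0" | "0 < u" "u \<le> 1" | "1 < u" by linarith
    then show "wt p u * f u \<le> A * (indicator {0<..1} u * u powr (\<kappa> - 1 - p)) + B * (indicator {0<..1} u * u powr (2 * \<kappa> - 1 - p))
        + (2 * \<tau> + 1) * (indicator {1<..} u * u powr (- 1 - p))"
    proof cases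
      case 1
      then show ?thesis by (simp add: wt_def)
    next
      case 2
      define w where "w = 1 - char N u + of_real (u powr \<kappa>) * \<psi>"
      have "f u = A * u powr \<kappa> + (\<tau> * Re w + (- \<sigma>) * Im w)"
        unfolding f_def A_def w_def by (simp add: algebra_simps)
      also have "\<tau> * Re w + (- \<sigma>) * Im w \<le> \<tau> * cmod w + cmod w"
        using \<sigma> abs_Re_le_cmod[of w] abs_Im_le_cmod[of w] by (intro add_mono mult_left_mono \<tau>) auto
      also have "\<dots> \<le> B * u powr (2 * \<kappa>)"
        using mult_left_mono[OF near2[OF 2(1)], of "\<tau> + 1"] \<tau> unfolding w_def B_def by (simp add: algebra_simps)
      finally have "wt p u * f u \<le> wt p u * (A * u powr \<kappa> + B * u powr (2 * \<kappa>))"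
        by (intro mult_left_mono) auto
      also have "\<dots> = A * (u powr (- 1 - p) * u powr \<kappa>) + B * (u powr (- 1 - p) * u powr (2 * \<kappa>))"
        using 2 by (simp add: wt_def algebra_simps)
      also have "\<dots> = A * u powr (\<kappa> - 1 - p) + B * u powr (2 * \<kappa> - 1 - p)"
        unfolding powr_add[symmetric] by (simp add: algebra_simps)
      finally show ?thesis using 2 by simp
    next
      case 3
      have "f u \<le> \<tau> * 2 + 1"
        unfolding f_def
      proof (intro add_mono mult_left_mono \<tau>)
        show "1 - Re (char N u) \<le> 2" using abs_Re_le_cmod[of "char N u"] N.cmod_char_le_1[of u] by linarith
        show "\<sigma> * Im (char N u) \<le> 1" using abs_Im_le_cmod[of "char N u"] N.cmod_char_le_1[of u] \<sigma> by auto
      qed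
      then have "wt p u * f u \<le> wt p u * (2 * \<tau> + 1)" by (intro mult_left_mono) auto
      then show ?thesis using 3 by (simp add: wt_def mult.commute)
    qed
  qed
  also have "\<dots> = A / (\<kappa> - p) + B / (2 * \<kappa> - p) + (2 * \<tau> + 1) / p"
    using hg by (rule has_bochner_integral_integral_eq)
  finally have "0 \<le> (\<kappa> - p) * (A / (\<kappa> - p) + B / (2 * \<kappa> - p) + (2 * \<tau> + 1) / p)"
    using p by simp
  also have "\<dots> = A + (\<kappa> - p) * (B / (2 * \<kappa> - p) + (2 * \<tau> + 1) / p)"
    using p by (simp add: distrib_left)
  finally show ?thesis unfolding A_def B_def \<tau>_def .
qed

text \<open>Let \<open>p\<close> increase to \<open>\<kappa>\<close>: the bracket stays bounded
  because \<open>\<kappa>\<close> is not 1, so the factor \<open>\<kappa> - p\<close> removes it.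
  The two signs of \<open>\<sigma>\<close> give the absolute value.\<close>

lemma homogeneous_char_ineq:
  assumes N: "real_distribution N" and c: "c \<in> {0, 1}" and \<kappa>: "c < \<kappa>" "\<kappa> < c + 1"
    and ch: "\<And>u. u > 0 \<Longrightarrow> char N u = exp (of_real (u powr \<kappa>) * \<psi>)"
  shows "\<bar>Im \<psi>\<bar> \<le> \<bar>tan (pi * \<kappa> / 2)\<bar> * (- Re \<psi>)" "tan (pi * \<kappa> / 2) \<noteq> 0"
proof -
  have cs: "cos (\<kappa> * pi / 2) \<noteq> 0" "sin (\<kappa> * pi / 2) \<noteq> 0"
  proof -
    show "cos (\<kappa> * pi / 2) \<noteq> 0"
    proof (cases "c = 0")
      case True
      then have "0 < \<kappa> * pi / 2" "\<kappa> * pi / 2 < pi / 2" using \<kappa> by auto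
      then show ?thesis using cos_gt_zero_pi[of "\<kappa> * pi / 2"] by auto
    next
      case False
      then have "pi / 2 < \<kappa> * pi / 2" "\<kappa> * pi / 2 < pi" using \<kappa> c by auto
      then have "cos (\<kappa> * pi / 2) < cos (pi / 2)" by (intro cos_monotone_0_pi) auto
      then show ?thesis by simp
    qed
    have "0 < \<kappa> * pi / 2" "\<kappa> * pi / 2 < pi" using \<kappa> c by auto
    then show "sin (\<kappa> * pi / 2) \<noteq> 0" using sin_gt_zero by fastforce
  qed
  then show "tan (pi * \<kappa> / 2) \<noteq> 0" by (simp add: tan_def mult.commute)
  have "0 \<le> \<bar>tan (\<kappa> * pi / 2)\<bar> * (- Re \<psi>) + \<sigma> * Im \<psi> + (\<kappa> - \<kappa>) *
     ((\<bar>tan (\<kappa> * pi / 2)\<bar> + 1) * (cmod \<psi>)\<^sup>2 / (2 * \<kappa> - \<kappa>) + (2 * \<bar>tan (\<kappa> * pi / 2)\<bar> + 1) / \<kappa>)"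
    if \<sigma>: "\<sigma> \<in> {1, -1}" for \<sigma> :: real
  proof (rule tendsto_lowerbound[where F = "at_left \<kappa>"])
    show "((\<lambda>p. \<bar>tan (p * pi / 2)\<bar> * (- Re \<psi>) + \<sigma> * Im \<psi> + (\<kappa> - p) *
       ((\<bar>tan (p * pi / 2)\<bar> + 1) * (cmod \<psi>)\<^sup>2 / (2 * \<kappa> - p) + (2 * \<bar>tan (p * pi / 2)\<bar> + 1) / p)) \<longlongrightarrow>
       \<bar>tan (\<kappa> * pi / 2)\<bar> * (- Re \<psi>) + \<sigma> * Im \<psi> + (\<kappa> - \<kappa>) *
     ((\<bar>tan (\<kappa> * pi / 2)\<bar> + 1) * (cmod \<psi>)\<^sup>2 / (2 * \<kappa> - \<kappa>) + (2 * \<bar>tan (\<kappa> * pi / 2)\<bar> + 1) / \<kappa>)) (at_left \<kappa>)"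
      using cs \<kappa> c by (intro tendsto_intros) auto
    have "\<forall>\<^sub>F p in at_left \<kappa>. p \<in> {c<..<\<kappa>}"
      by (rule eventually_at_left_real) (rule \<kappa>)
    then show "\<forall>\<^sub>F p in at_left \<kappa>. 0 \<le> \<bar>tan (p * pi / 2)\<bar> * (- Re \<psi>) + \<sigma> * Im \<psi> + (\<kappa> - p) *
       ((\<bar>tan (p * pi / 2)\<bar> + 1) * (cmod \<psi>)\<^sup>2 / (2 * \<kappa> - p) + (2 * \<bar>tan (p * pi / 2)\<bar> + 1) / p)"
      by eventually_elim (rule homogeneous_char_ineq_at[OF N c _ _ \<kappa>(2) ch \<sigma>], auto)
  qed simp
  from this[of 1] this[of "-1"]
  show "\<bar>Im \<psi>\<bar> \<le> \<bar>tan (pi * \<kappa> / 2)\<bar> * (- Re \<psi>)" by (simp add: mult.commute abs_le_iff)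
qed

text \<open>Matching exponents: \<open>- Re \<psi>\<close> is the scale to the power
  \<open>\<kappa>\<close>, and the skewness is \<open>Im \<psi>\<close> divided by
  \<open>- Re \<psi> * tan (pi * \<kappa> / 2)\<close>, at most 1 in modulus by
  \<open>homogeneous_char_ineq\<close>. The location is 0.\<close>

theorem stable_law_of_homogeneous_char:
  assumes N: "real_distribution N" and \<kappa>: "0 < \<kappa> \<and> \<kappa> < 1 \<or> 1 < \<kappa> \<and> \<kappa> < 2"
    and ch: "\<And>u. u > 0 \<Longrightarrow> char N u = exp (of_real (u powr \<kappa>) * \<psi>)"
  shows "stable_law \<kappa> N"
proof -
  interpret N: real_distribution N by fact
  define T where "T = tan (pi * \<kappa> / 2)"
  obtain c where c: "c \<in> {0, 1::real}" "c < \<kappa>" "\<kappa> < c + 1"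
    using \<kappa> by (metis add.left_neutral insert_iff one_add_one)
  have I: "\<bar>Im \<psi>\<bar> \<le> \<bar>T\<bar> * (- Re \<psi>)" "T \<noteq> 0"
    unfolding T_def using homogeneous_char_ineq[OF N c ch] by auto
  then have R: "Re \<psi> \<le> 0" by (smt (verit) zero_less_abs_iff mult_pos_neg)
  define \<sigma> where "\<sigma> = (- Re \<psi>) powr (1 / \<kappa>)"
  \<comment> \<open>If \<open>Re \<psi> = 0\<close>, division by 0 gives \<open>\<beta> = 0\<close>;
    then \<open>Im \<psi> = 0\<close> as well, and the degenerate law is covered with scale
    0.\<close>
  define \<beta> where "\<beta> = Im \<psi> / (- Re \<psi> * T)"
  have \<sigma>: "\<sigma> powr \<kappa> = - Re \<psi>" unfolding \<sigma>_def using R \<kappa> by (auto simp: powr_powr)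
  have \<beta>: "\<bar>\<beta>\<bar> \<le> 1"
  proof (cases "Re \<psi> = 0")
    case False
    then have "\<bar>Re \<psi> * T\<bar> > 0" using I by simp
    moreover have "\<bar>Im \<psi>\<bar> \<le> \<bar>Re \<psi> * T\<bar>" using I(1) R by (simp add: abs_mult mult.commute)
    ultimately show ?thesis unfolding \<beta>_def by (simp add: abs_mult abs_divide divide_le_eq_1)
  qed (simp add: \<beta>_def)
  have im: "- Re \<psi> * \<beta> * T = Im \<psi>"
  proof (cases "Re \<psi> = 0")
    case True
    then show ?thesis using I by simp
  qed (use I in \<open>simp add: \<beta>_def\<close>)
  have psi: "\<psi> = - (of_real (\<sigma> powr \<kappa>) * (1 - \<i> * of_real (\<beta> * T)))"
    using im unfolding \<sigma> by (simp add: complex_eq_iff algebra_simps)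
  have main: "char N t = exp (- complex_of_real (\<sigma> powr \<kappa> * \<bar>t\<bar> powr \<kappa>) * (1 - \<i> * complex_of_real (\<beta> * sgn t * T)) + \<i> * complex_of_real (0 * t))" for t
  proof -
    consider "t = 0" | "t > 0" | "t < 0" by linarith
    then show ?thesis
    proof cases
      case 1
      then show ?thesis by (simp add: N.char_zero)
    next
      case 2
      show ?thesis unfolding ch[OF 2] by (subst psi) (use 2 in \<open>simp add: algebra_simps\<close>)
    next
      case 3
      have "char N t = cnj (char N (- t))"
        using Re_Im_char[OF N, of t] Re_Im_char[OF N, of "- t"] by (simp add: complex_eq_iff)
      also have "\<dots> = exp (cnj (of_real ((- t) powr \<kappa>) * \<psi>))"
        using 3 ch[of "- t"] by (simp add: exp_cnj)
      also have "\<dots> = exp (- complex_of_real (\<sigma> powr \<kappa> * \<bar>t\<bar> powr \<kappa>) * (1 - \<i> * complex_of_real (\<beta> * sgn t * T)) + \<i> * complex_of_real (0 * t))"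
        by (subst psi, rule arg_cong[where f = exp]) (use 3 in \<open>simp add: algebra_simps\<close>)
      finally show ?thesis .
    qed
  qed
  have "\<kappa> \<noteq> 1" using \<kappa> by auto
  then show ?thesis
    unfolding stable_law_def using \<kappa> N.prob_space_axioms \<beta> main[unfolded T_def]
    by (intro conjI exI[of _ \<sigma>] exI[of _ \<beta>] exI[of _ 0]) (auto simp: \<sigma>_def abs_le_iff)
qed

subsection \<open>Moments of regularly varying variables\<close>

text \<open>The limits of ever closer approximations form a Cauchy sequence, and its limit is the
  one sought. No candidate has to be named, which suits functionals for which only the existence of
  a limit is known.\<close>

lemma tendsto_of_approximations:
  fixes f :: "'b \<Rightarrow> 'c::banach"
  assumes F: "F \<noteq> bot"
    and ap: "\<And>e. e > 0 \<Longrightarrow> \<exists>g l. (g \<longlongrightarrow> l) F \<and> (\<forall>\<^sub>F x in F. norm (f x - g x) \<le> e)"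
  shows "\<exists>l. (f \<longlongrightarrow> l) F"
proof -
  have "\<exists>g l. (g \<longlongrightarrow> l) F \<and> (\<forall>\<^sub>F x in F. norm (f x - g x) \<le> 1 / real (Suc n))" for n
    by (rule ap) simp
  then obtain g l where g: "\<And>n. (g n \<longlongrightarrow> l n) F" and ev: "\<And>n. \<forall>\<^sub>F x in F. norm (f x - g n x) \<le> 1 / real (Suc n)"
    by metis
  have d: "norm (l n - l m) \<le> 1 / real (Suc n) + 1 / real (Suc m)" for n m
  proof (rule tendsto_upperbound[OF _ _ F])
    show "((\<lambda>x. norm (g n x - g m x)) \<longlongrightarrow> norm (l n - l m)) F" by (intro tendsto_intros g)
    show "\<forall>\<^sub>F x in F. norm (g n x - g m x) \<le> 1 / real (Suc n) + 1 / real (Suc m)"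
      using ev[of n] ev[of m]
    proof eventually_elim
      case (elim x)
      have "norm (g n x - g m x) \<le> norm (f x - g n x) + norm (f x - g m x)"
        using norm_triangle_ineq4[of "f x - g m x" "f x - g n x"] by simp
      then show ?case using elim by linarith
    qed
  qed
  have "Cauchy l"
  proof (rule metric_CauchyI)
    fix e :: real assume "e > 0"
    then obtain N where N: "1 / real (Suc N) < e / 2" using nat_approx_posE[of "e/2"] by auto
    show "\<exists>M. \<forall>m\<ge>M. \<forall>n\<ge>M. dist (l m) (l n) < e"
    proof (intro exI[of _ N] allI impI)
      fix m n assume "m \<ge> N" "n \<ge> N"
      then have "1 / real (Suc m) \<le> 1 / real (Suc N)" "1 / real (Suc n) \<le> 1 / real (Suc N)"
        by (auto intro!: divide_left_mono)
      then show "dist (l m) (l n) < e" using d[of m n] N by (simp add: dist_norm)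
    qed
  qed
  then obtain L where L: "l \<longlonglongrightarrow> L" using Cauchy_convergent convergent_def by blast
  have "(f \<longlongrightarrow> L) F"
  proof (rule tendstoI)
    fix e :: real assume e: "e > 0"
    have "\<forall>\<^sub>F n in sequentially. dist (l n) L < e / 3" using L e by (intro tendstoD) auto
    moreover have "\<forall>\<^sub>F n in sequentially. 1 / real (Suc n) < e / 3"
      using LIMSEQ_inverse_real_of_nat e by (intro order_tendstoD(2)[of _ 0]) (auto simp: inverse_eq_divide)
    ultimately have "\<forall>\<^sub>F n in sequentially. dist (l n) L < e / 3 \<and> 1 / real (Suc n) < e / 3" by (rule eventually_conj)
    then obtain n where n: "dist (l n) L < e / 3" "1 / real (Suc n) < e / 3"
      by (auto simp: eventually_sequentially)
    have "\<forall>\<^sub>F x in F. dist (g n x) (l n) < e / 3" using g e by (intro tendstoD) auto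
    then show "\<forall>\<^sub>F x in F. dist (f x) L < e" using ev[of n]
    proof eventually_elim
      case (elim x)
      have "dist (f x) L \<le> dist (f x) (g n x) + dist (g n x) (l n) + dist (l n) L"
        using dist_triangle[of "f x" L "g n x"] dist_triangle[of "g n x" L "l n"] by linarith
      moreover have "dist (f x) (g n x) \<le> 1 / real (Suc n)" using elim by (simp add: dist_norm)
      ultimately show ?case using elim n by linarith
    qed
  qed
  then show ?thesis by blast
qed

text \<open>Karamata-type bounds for a regularly varying tail, obtained by induction along dyadic scales.\<close>
locale rv_tail = prob_space M for M :: "'a measure" +
  fixes Y :: "'a \<Rightarrow> real" and \<kappa> :: real
  assumes Y [measurable]: "Y \<in> borel_measurable M" and Y0: "\<And>\<omega>. 0 \<le> Y \<omega>" and \<kappa>0: "\<kappa> > 0"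
    and tail_ratio: "\<And>y. y > 0 \<Longrightarrow> ((\<lambda>x. prob {\<omega>\<in>space M. Y \<omega> > y * x} / prob {\<omega>\<in>space M. Y \<omega> > x}) \<longlongrightarrow> y powr (-\<kappa>)) at_top"
    and tail_pos: "\<And>x. 0 < prob {\<omega>\<in>space M. Y \<omega> > x}"
begin

definition T :: "real \<Rightarrow> real" where "T x = prob {\<omega>\<in>space M. Y \<omega> > x}"

lemma T_pos: "0 < T x" unfolding T_def by (rule tail_pos)

lemma T_antimono: "x \<le> y \<Longrightarrow> T y \<le> T x"
  unfolding T_def by (rule finite_measure_mono) auto

lemma T_ratio: "y > 0 \<Longrightarrow> ((\<lambda>x. T (y * x) / T x) \<longlongrightarrow> y powr (-\<kappa>)) at_top"
  unfolding T_def by (rule tail_ratio)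

lemma prob_tail [simp]: "prob ({\<omega>. x < Y \<omega>} \<inter> space M) = T x"
  unfolding T_def by (rule arg_cong[where f = prob]) auto

lemma integrable_indicator_tail: "integrable M (\<lambda>\<omega>. indicator {\<omega>. Y \<omega> > x} \<omega> :: real)"
  by (rule integrable_const_bound[where B = 1]) auto

text \<open>One half of Karamata's theorem. Passing from \<open>x / 2\<close> to \<open>x\<close>
  costs at most \<open>x ^ q * T (x / 2)\<close>, and \<open>T (x / 2) \<le> D * T x\<close> with
  \<open>D < 2 ^ q\<close>; the factor \<open>D / 2 ^ q < 1\<close> lets one constant reproduce
  itself along the doubling.\<close>

lemma truncated_moment_bound:
  fixes q :: nat
  assumes q: "\<kappa> < real q"
  obtains C x0 where "x0 > 0" "C > 0" "\<And>x. x \<ge> x0 \<Longrightarrow> expectation (\<lambda>\<omega>. (min (Y \<omega>) x) ^ q) \<le> C * x ^ q * T x"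
proof -
  define D where "D = (2 powr \<kappa> + 2 ^ q) / 2"
  have "2 powr \<kappa> < 2 powr real q" using q by simp
  then have k: "2 powr \<kappa> < (2::real) ^ q" by (simp add: powr_realpow)
  have D: "2 powr \<kappa> < D" "D < 2 ^ q" "D > 0" using k unfolding D_def by (auto intro: add_pos_pos)
  have "1 / D < 2 powr (-\<kappa>)" using D by (simp add: powr_minus field_simps)
  then have "\<forall>\<^sub>F x in at_top. 1 / D < T (2 * x) / T x" using T_ratio[of 2] by (intro order_tendstoD(1)) auto
  then obtain x1 where x1: "\<And>x. x \<ge> x1 \<Longrightarrow> 1 / D < T (2 * x) / T x" by (auto simp: eventually_at_top_linorder)
  define x0 where "x0 = max 1 x1"
  have x0: "x0 > 0" unfolding x0_def by simp
  have dbl: "T x \<le> D * T (2 * x)" if "x \<ge> x0" for x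
    using x1[of x] that T_pos[of x] D unfolding x0_def by (simp add: field_simps)
  \<comment> \<open>The first entry starts the induction on \<open>x0 \<le> x \<le> 2 * x0\<close>,
    the second gives \<open>C * D / 2 ^ q + D \<le> C\<close> for the step.\<close>
  define C where "C = max (1 / T (2 * x0)) (D / (1 - D / 2 ^ q))"
  have Dq: "D / 2 ^ q < 1" using D by simp
  have C: "C > 0" "C \<ge> 1 / T (2 * x0)" "D \<le> C * (1 - D / 2 ^ q)"
  proof -
    show "C > 0" unfolding C_def using T_pos by (simp add: less_max_iff_disj)
    show "C \<ge> 1 / T (2 * x0)" unfolding C_def by simp
    have "C \<ge> D / (1 - D / 2 ^ q)" unfolding C_def by simp
    then show "D \<le> C * (1 - D / 2 ^ q)" using Dq by (simp add: pos_divide_le_eq)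
  qed
  have int: "integrable M (\<lambda>\<omega>. (min (Y \<omega>) x) ^ q)" if "x > 0" for x
    by (rule integrable_const_bound[where B = "x ^ q"]) (use that Y0 in \<open>auto intro!: power_mono\<close>)
  have main: "\<forall>x. x0 \<le> x \<and> x \<le> 2 ^ Suc n * x0 \<longrightarrow> expectation (\<lambda>\<omega>. (min (Y \<omega>) x) ^ q) \<le> C * x ^ q * T x" for n
  proof (induction n)
    case 0
    show ?case
    proof (intro allI impI)
      fix x assume x: "x0 \<le> x \<and> x \<le> 2 ^ Suc 0 * x0"
      have "expectation (\<lambda>\<omega>. (min (Y \<omega>) x) ^ q) \<le> expectation (\<lambda>\<omega>. x ^ q)"
        by (rule integral_mono) (use x x0 int Y0 in \<open>auto intro!: power_mono\<close>)
      also have "\<dots> = 1 * x ^ q" using prob_space by simp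
      also have "\<dots> \<le> (C * T x) * x ^ q"
      proof (rule mult_right_mono)
        have "1 \<le> C * T (2 * x0)" using C(2) T_pos[of "2 * x0"] by (simp add: pos_divide_le_eq)
        also have "\<dots> \<le> C * T x" using C T_antimono[of x "2 * x0"] x by (intro mult_left_mono) auto
        finally show "1 \<le> C * T x" .
      qed (use x x0 in auto)
      finally show "expectation (\<lambda>\<omega>. (min (Y \<omega>) x) ^ q) \<le> C * x ^ q * T x" by (simp add: mult_ac)
    qed
  next
    case (Suc n)
    show ?case
    proof (intro allI impI)
      fix x assume x: "x0 \<le> x \<and> x \<le> 2 ^ Suc (Suc n) * x0"
      show "expectation (\<lambda>\<omega>. (min (Y \<omega>) x) ^ q) \<le> C * x ^ q * T x"
      proof (cases "x \<le> 2 ^ Suc n * x0")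
        case True
        then show ?thesis using Suc x by blast
      next
        case False
        define y where "y = x / 2"
        have "2 * x0 \<le> 2 ^ Suc n * x0" using x0 by simp
        then have y: "x = 2 * y" "x0 \<le> y" "y \<le> 2 ^ Suc n * x0" using False x by (auto simp: y_def)
        have "expectation (\<lambda>\<omega>. (min (Y \<omega>) x) ^ q) \<le> expectation (\<lambda>\<omega>. (min (Y \<omega>) y) ^ q + x ^ q * indicator {\<omega>. Y \<omega> > y} \<omega>)"
        proof (rule integral_mono)
          show "integrable M (\<lambda>\<omega>. (min (Y \<omega>) y) ^ q + x ^ q * indicator {\<omega>. Y \<omega> > y} \<omega>)"
            using int[of y] y x0 integrable_indicator_tail by (intro Bochner_Integration.integrable_add integrable_mult_right) auto
          show "(min (Y \<omega>) x) ^ q \<le> (min (Y \<omega>) y) ^ q + x ^ q * indicator {\<omega>. Y \<omega> > y} \<omega>" for \<omega>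
          proof (cases "Y \<omega> > y")
            case True
            have "(min (Y \<omega>) x) ^ q \<le> x ^ q" using Y0[of \<omega>] y x0 by (intro power_mono) auto
            moreover have "0 \<le> (min (Y \<omega>) y) ^ q" using Y0[of \<omega>] y x0 by auto
            ultimately show ?thesis using True by simp
          next
            case f: False
            then show ?thesis using y x0 by (simp add: min_def)
          qed
        qed (use int x x0 in auto)
        also have "\<dots> = expectation (\<lambda>\<omega>. (min (Y \<omega>) y) ^ q) + x ^ q * T y"
          using int[of y] y x0 integrable_indicator_tail[of y] by simp
        also have "\<dots> \<le> C * y ^ q * T y + x ^ q * T y" using Suc y by auto
        also have "\<dots> = (C / 2 ^ q + 1) * x ^ q * T y" by (simp add: y_def power_divide algebra_simps)
        also have "\<dots> \<le> (C / 2 ^ q + 1) * x ^ q * (D * T x)"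
          using dbl[OF y(2)] y C x0 by (intro mult_left_mono mult_nonneg_nonneg add_nonneg_nonneg) auto
        also have "\<dots> = (C - (C * (1 - D / 2 ^ q) - D)) * (x ^ q * T x)" by (simp add: algebra_simps)
        also have "\<dots> \<le> C * (x ^ q * T x)"
          using C(3) T_pos[of x] x x0 by (intro mult_right_mono) auto
        finally show ?thesis by (simp add: mult.assoc)
      qed
    qed
  qed
  have "expectation (\<lambda>\<omega>. (min (Y \<omega>) x) ^ q) \<le> C * x ^ q * T x" if x: "x \<ge> x0" for x
  proof -
    obtain n where "x / x0 < 2 ^ n" using real_arch_pow[of 2 "x / x0"] by auto
    then have "x < 2 ^ n * x0" using x0 by (simp add: pos_divide_less_eq)
    also have "\<dots> \<le> 2 ^ Suc n * x0" using x0 by simp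
    finally show ?thesis using main[of n] x by auto
  qed
  then show ?thesis using that x0 C by blast
qed

text \<open>The other half: the moment above \<open>x\<close> is at most
  \<open>(2 * x) powr p * T x\<close> plus the moment above \<open>2 * x\<close>, and
  \<open>T (2 * x) \<le> D * T x\<close> with \<open>2 powr p * D < 1\<close>.\<close>

lemma tail_moment_bound:
  assumes p: "0 < p" "p < \<kappa>"
  obtains C x0 where "x0 > 0" "C > 0" "integrable M (\<lambda>\<omega>. Y \<omega> powr p)"
    "\<And>x. x \<ge> x0 \<Longrightarrow> expectation (\<lambda>\<omega>. indicator {\<omega>. Y \<omega> > x} \<omega> * Y \<omega> powr p) \<le> C * x powr p * T x"
proof -
  define D where "D = (2 powr (-\<kappa>) + 2 powr (-p)) / 2"
  have "2 powr (-\<kappa>) < 2 powr (-p)" using p by simp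
  then have D: "2 powr (-\<kappa>) < D" "D < 2 powr (-p)" "D > 0" unfolding D_def by (auto intro: add_pos_pos)
  have "\<forall>\<^sub>F x in at_top. T (2 * x) / T x < D" using T_ratio[of 2] D by (intro order_tendstoD(2)) auto
  then obtain x1 where x1: "\<And>x. x \<ge> x1 \<Longrightarrow> T (2 * x) / T x < D" by (auto simp: eventually_at_top_linorder)
  define x0 where "x0 = max 1 x1"
  have x0: "x0 > 0" unfolding x0_def by simp
  have dbl: "T (2 * x) \<le> D * T x" if "x \<ge> x0" for x
    using x1[of x] that T_pos[of x] unfolding x0_def by (simp add: pos_divide_less_eq)
  have Dp: "2 powr p * D < 1"
    using mult_strict_left_mono[OF D(2), of "2 powr p"] by (simp add: powr_add[symmetric])
  \<comment> \<open>The fixed point of \<open>C = 2 powr p + C * (2 powr p * D)\<close>, the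
    recursion for the constant.\<close>
  define C where "C = 2 powr p / (1 - 2 powr p * D)"
  have C1: "C \<ge> 1" "C > 0" "2 powr p + C * (2 powr p * D) = C"
  proof -
    have "1 \<le> 2 powr p" using p by (simp add: ge_one_powr_ge_zero)
    moreover have "0 < 2 powr p * D" using D by simp
    ultimately show "C \<ge> 1" unfolding C_def using Dp by (simp add: le_divide_eq)
    then show "C > 0" by simp
    have "C * (1 - 2 powr p * D) = 2 powr p" unfolding C_def using Dp by simp
    then show "2 powr p + C * (2 powr p * D) = C" by (simp add: algebra_simps)
  qed
  \<comment> \<open>Capping at \<open>2 ^ N * x\<close> makes the moments finite before
    integrability is known and provides the induction on \<open>N\<close>; Fatou's lemma removes the
    cap.\<close>
  define f where "f N x \<omega> = indicator {\<omega>. Y \<omega> > x} \<omega> * (min (Y \<omega>) (2 ^ N * x)) powr p" for N :: nat and x \<omega>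
  have f0: "0 \<le> f N x \<omega>" for N x \<omega> unfolding f_def by simp
  have fm[measurable]: "f N x \<in> borel_measurable M" for N x unfolding f_def by measurable
  have int: "integrable M (f N x)" if "x > 0" for N x
  proof (rule integrable_const_bound[where B = "(2 ^ N * x) powr p"])
    show "AE \<omega> in M. norm (f N x \<omega>) \<le> (2 ^ N * x) powr p"
      using Y0 that p by (auto simp: f_def indicator_def intro!: powr_mono2)
  qed simp
  have main: "expectation (f N x) \<le> C * x powr p * T x" if "x \<ge> x0" for N x
    using that
  proof (induction N arbitrary: x)
    case 0
    have "expectation (f 0 x) \<le> expectation (\<lambda>\<omega>. x powr p * indicator {\<omega>. Y \<omega> > x} \<omega>)"
    proof (rule integral_mono)
      show "f 0 x \<omega> \<le> x powr p * indicator {\<omega>. Y \<omega> > x} \<omega>" for \<omega>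
        by (auto simp: f_def indicator_def)
    qed (use int 0 x0 integrable_indicator_tail in auto)
    also have "\<dots> = 1 * (x powr p * T x)" by simp
    also have "\<dots> \<le> C * (x powr p * T x)" using C1 T_pos[of x] by (intro mult_right_mono) auto
    finally show ?case by (simp add: mult.assoc)
  next
    case (Suc N)
    have xp: "x > 0" using Suc.prems x0 by simp
    have "expectation (f (Suc N) x) \<le> expectation (\<lambda>\<omega>. (2 * x) powr p * indicator {\<omega>. Y \<omega> > x} \<omega> + f N (2 * x) \<omega>)"
    proof (rule integral_mono)
      show "f (Suc N) x \<omega> \<le> (2 * x) powr p * indicator {\<omega>. Y \<omega> > x} \<omega> + f N (2 * x) \<omega>" for \<omega>
      proof (cases "Y \<omega> > 2 * x")
        case True
        then have "f (Suc N) x \<omega> = f N (2 * x) \<omega>" using xp by (simp add: f_def mult_ac)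
        then show ?thesis by simp
      next
        case False
        then have "(min (Y \<omega>) (2 ^ Suc N * x)) powr p \<le> (2 * x) powr p"
          using Y0[of \<omega>] xp p by (intro powr_mono2) auto
        then show ?thesis using False by (auto simp: f_def indicator_def)
      qed
    qed (use int xp integrable_indicator_tail in auto)
    also have "\<dots> = (2 * x) powr p * T x + expectation (f N (2 * x))"
      using int xp integrable_indicator_tail by simp
    also have "\<dots> \<le> (2 * x) powr p * T x + C * (2 * x) powr p * T (2 * x)"
      using Suc.IH[of "2 * x"] Suc.prems xp by auto
    also have "\<dots> \<le> (2 * x) powr p * T x + C * (2 * x) powr p * (D * T x)"
      using dbl[OF Suc.prems] C1 by (intro add_left_mono mult_left_mono) auto
    also have "\<dots> = (2 powr p + C * (2 powr p * D)) * (x powr p * T x)"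
      using xp by (simp add: powr_mult algebra_simps)
    also have "\<dots> = C * x powr p * T x" unfolding C1(3) by (simp add: mult.assoc)
    finally show ?case .
  qed
  have lim: "integrable M (\<lambda>\<omega>. indicator {\<omega>. Y \<omega> > x} \<omega> * Y \<omega> powr p) \<and>
     expectation (\<lambda>\<omega>. indicator {\<omega>. Y \<omega> > x} \<omega> * Y \<omega> powr p) \<le> C * x powr p * T x" if x: "x \<ge> x0" for x
  proof -
    have xp: "x > 0" using x x0 by simp
    define h where "h \<omega> = indicator {\<omega>. Y \<omega> > x} \<omega> * Y \<omega> powr p" for \<omega>
    have hm[measurable]: "h \<in> borel_measurable M" unfolding h_def by measurable
    have ev: "\<forall>\<^sub>F N in sequentially. f N x \<omega> = h \<omega>" for \<omega>
    proof -
      obtain n where n: "Y \<omega> / x < 2 ^ n" using real_arch_pow[of 2 "Y \<omega> / x"] by auto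
      show ?thesis
      proof (rule eventually_sequentiallyI[of n])
        fix N assume "n \<le> N"
        then have "(2::real) ^ n \<le> 2 ^ N" by simp
        then have "Y \<omega> / x \<le> 2 ^ N" using n by linarith
        then have "Y \<omega> \<le> 2 ^ N * x" using xp by (simp add: pos_divide_le_eq)
        then show "f N x \<omega> = h \<omega>" by (simp add: f_def h_def min_def)
      qed
    qed
    have "(\<integral>\<^sup>+\<omega>. ennreal (h \<omega>) \<partial>M) = (\<integral>\<^sup>+\<omega>. liminf (\<lambda>N. ennreal (f N x \<omega>)) \<partial>M)"
    proof (rule nn_integral_cong)
      fix \<omega>
      have "(\<lambda>N. ennreal (f N x \<omega>)) \<longlonglongrightarrow> ennreal (h \<omega>)"
        by (rule tendsto_eventually) (use ev[of \<omega>] in \<open>eventually_elim, simp\<close>)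
      then show "ennreal (h \<omega>) = liminf (\<lambda>N. ennreal (f N x \<omega>))"
        by (rule lim_imp_Liminf[OF sequentially_bot, symmetric])
    qed
    also have "\<dots> \<le> liminf (\<lambda>N. \<integral>\<^sup>+\<omega>. ennreal (f N x \<omega>) \<partial>M)"
      by (rule nn_integral_liminf) simp
    also have "\<dots> = liminf (\<lambda>N. ennreal (expectation (f N x)))"
      using int[OF xp] f0 by (subst nn_integral_eq_integral) auto
    also have "\<dots> \<le> liminf (\<lambda>N. ennreal (C * x powr p * T x))"
      by (rule Liminf_mono) (use main[OF x] in \<open>auto intro!: always_eventually ennreal_leI\<close>)
    also have "\<dots> = ennreal (C * x powr p * T x)" by (simp add: Liminf_const)
    finally have le: "(\<integral>\<^sup>+\<omega>. ennreal (h \<omega>) \<partial>M) \<le> ennreal (C * x powr p * T x)" .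
    have hi: "integrable M h"
      by (rule integrableI_nonneg) (use le in \<open>auto simp: h_def top.extremum_strict intro: le_less_trans\<close>)
    have "ennreal (expectation h) \<le> ennreal (C * x powr p * T x)"
      using le hi by (subst (asm) nn_integral_eq_integral) (auto simp: h_def)
    then have "expectation h \<le> C * x powr p * T x"
      using C1 T_pos[of x] by (subst (asm) ennreal_le_iff) auto
    then show ?thesis using hi unfolding h_def by simp
  qed
  have "integrable M (\<lambda>\<omega>. x0 powr p + indicator {\<omega>. Y \<omega> > x0} \<omega> * Y \<omega> powr p)"
    using lim[of x0] by simp
  then have "integrable M (\<lambda>\<omega>. Y \<omega> powr p)"
  proof (rule Bochner_Integration.integrable_bound)
    show "AE \<omega> in M. norm (Y \<omega> powr p) \<le> norm (x0 powr p + indicator {\<omega>. Y \<omega> > x0} \<omega> * Y \<omega> powr p)"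
      using Y0 p by (auto simp: indicator_def intro!: powr_mono2)
  qed simp
  then show ?thesis using that x0 C1 lim by blast
qed

text \<open>The constant is independent of \<open>\<epsilon>\<close>: the ratio
  \<open>T (\<epsilon> * x) / T x\<close> costs at most
  \<open>2 * \<epsilon> powr (- \<kappa>)\<close> for large \<open>x\<close>. Thus values below
  \<open>\<epsilon> * x\<close> become negligible as \<open>\<epsilon>\<close> tends to 0. It serves
  for the powers 1 and 2.\<close>

lemma truncated_second_moment_ratio:
  fixes q :: nat
  assumes q: "\<kappa> < real q"
  obtains C where "C > 0" "\<And>\<epsilon>. \<epsilon> > 0 \<Longrightarrow> \<forall>\<^sub>F x in at_top. expectation (\<lambda>\<omega>. (min (Y \<omega> / x) \<epsilon>) ^ q) / T x \<le> C * \<epsilon> powr (real q - \<kappa>)"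
proof -
  obtain C x0 where C: "x0 > 0" "C > 0" "\<And>x. x \<ge> x0 \<Longrightarrow> expectation (\<lambda>\<omega>. (min (Y \<omega>) x) ^ q) \<le> C * x ^ q * T x"
    using truncated_moment_bound[OF q] by blast
  show ?thesis
  proof (rule that[of "2 * C"])
    fix \<epsilon> :: real assume e: "\<epsilon> > 0"
    have "\<forall>\<^sub>F x in at_top. T (\<epsilon> * x) / T x < 2 * \<epsilon> powr (-\<kappa>)"
      by (rule order_tendstoD(2)[OF T_ratio[OF e]]) (use e in simp)
    moreover have "\<forall>\<^sub>F x in at_top. x \<ge> max 1 (x0 / \<epsilon>)" by (rule eventually_ge_at_top)
    ultimately show "\<forall>\<^sub>F x in at_top. expectation (\<lambda>\<omega>. (min (Y \<omega> / x) \<epsilon>) ^ q) / T x \<le> 2 * C * \<epsilon> powr (real q - \<kappa>)"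
    proof eventually_elim
      case (elim x)
      then have x: "x > 0" "\<epsilon> * x \<ge> x0" using e by (auto simp: pos_divide_le_eq mult.commute)
      have "expectation (\<lambda>\<omega>. (min (Y \<omega> / x) \<epsilon>) ^ q) = expectation (\<lambda>\<omega>. (min (Y \<omega>) (\<epsilon> * x)) ^ q / x ^ q)"
      proof (rule Bochner_Integration.integral_cong[OF refl])
        fix \<omega>
        have "min (Y \<omega> / x) \<epsilon> = min (Y \<omega>) (\<epsilon> * x) / x" using x by (simp add: min_def field_simps)
        then show "(min (Y \<omega> / x) \<epsilon>) ^ q = (min (Y \<omega>) (\<epsilon> * x)) ^ q / x ^ q" by (simp add: power_divide)
      qed
      also have "\<dots> = expectation (\<lambda>\<omega>. (min (Y \<omega>) (\<epsilon> * x)) ^ q) / x ^ q" by simp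
      also have "\<dots> \<le> C * (\<epsilon> * x) ^ q * T (\<epsilon> * x) / x ^ q"
        using C(3)[OF x(2)] x by (intro divide_right_mono) auto
      also have "\<dots> = C * \<epsilon> ^ q * T (\<epsilon> * x)" using x by (simp add: power_mult_distrib)
      finally have "expectation (\<lambda>\<omega>. (min (Y \<omega> / x) \<epsilon>) ^ q) / T x \<le> C * \<epsilon> ^ q * (T (\<epsilon> * x) / T x)"
        using T_pos[of x] by (simp add: divide_right_mono)
      also have "\<dots> \<le> C * \<epsilon> ^ q * (2 * \<epsilon> powr (-\<kappa>))"
        using elim C e by (intro mult_left_mono) auto
      also have "\<dots> = 2 * C * \<epsilon> powr (real q - \<kappa>)"
        using e by (simp add: powr_diff powr_minus powr_realpow divide_inverse)
      finally show ?case .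
    qed
  qed (use C in simp)
qed

text \<open>Here the constant may depend on \<open>\<epsilon>\<close>: the estimate is used with
  \<open>\<epsilon>\<close> fixed, against a factor that is made small separately.\<close>

lemma tail_moment_ratio:
  assumes p: "0 < p" "p < \<kappa>" and e: "\<epsilon> > 0"
  obtains C where "C > 0" "\<forall>\<^sub>F x in at_top. expectation (\<lambda>\<omega>. indicator {\<omega>. Y \<omega> > \<epsilon> * x} \<omega> * (Y \<omega> / x) powr p) / T x \<le> C"
proof -
  obtain C x0 where C: "x0 > 0" "C > 0"
    "\<And>x. x \<ge> x0 \<Longrightarrow> expectation (\<lambda>\<omega>. indicator {\<omega>. Y \<omega> > x} \<omega> * Y \<omega> powr p) \<le> C * x powr p * T x"
    using tail_moment_bound[OF p] by blast
  show ?thesis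
  proof (rule that[of "C * \<epsilon> powr p * (2 * \<epsilon> powr (-\<kappa>))"])
    have "\<forall>\<^sub>F x in at_top. T (\<epsilon> * x) / T x < 2 * \<epsilon> powr (-\<kappa>)"
      by (rule order_tendstoD(2)[OF T_ratio[OF e]]) (use e in simp)
    moreover have "\<forall>\<^sub>F x in at_top. x \<ge> max 1 (x0 / \<epsilon>)" by (rule eventually_ge_at_top)
    ultimately show "\<forall>\<^sub>F x in at_top. expectation (\<lambda>\<omega>. indicator {\<omega>. Y \<omega> > \<epsilon> * x} \<omega> * (Y \<omega> / x) powr p) / T x
        \<le> C * \<epsilon> powr p * (2 * \<epsilon> powr (-\<kappa>))"
    proof eventually_elim
      case (elim x)
      then have x: "x > 0" "\<epsilon> * x \<ge> x0" using e by (auto simp: pos_divide_le_eq mult.commute)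
      have "expectation (\<lambda>\<omega>. indicator {\<omega>. Y \<omega> > \<epsilon> * x} \<omega> * (Y \<omega> / x) powr p)
          = expectation (\<lambda>\<omega>. indicator {\<omega>. Y \<omega> > \<epsilon> * x} \<omega> * Y \<omega> powr p / x powr p)"
        using x Y0 by (intro Bochner_Integration.integral_cong refl) (simp add: powr_divide)
      also have "\<dots> = expectation (\<lambda>\<omega>. indicator {\<omega>. Y \<omega> > \<epsilon> * x} \<omega> * Y \<omega> powr p) / x powr p" by simp
      also have "\<dots> \<le> C * (\<epsilon> * x) powr p * T (\<epsilon> * x) / x powr p"
        using C(3)[OF x(2)] by (intro divide_right_mono) auto
      also have "\<dots> = C * \<epsilon> powr p * T (\<epsilon> * x)" using x e by (simp add: powr_mult)
      finally have "expectation (\<lambda>\<omega>. indicator {\<omega>. Y \<omega> > \<epsilon> * x} \<omega> * (Y \<omega> / x) powr p) / T x \<le> C * \<epsilon> powr p * (T (\<epsilon> * x) / T x)"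
        using T_pos[of x] by (simp add: divide_right_mono)
      also have "\<dots> \<le> C * \<epsilon> powr p * (2 * \<epsilon> powr (-\<kappa>))"
        using elim C e by (intro mult_left_mono) auto
      finally show ?case .
    qed
  qed (use C e in simp)
qed

end

subsection \<open>Stationary regularly varying processes\<close>

lemma cmod_iexp_diff_le: "cmod (iexp a - iexp b) \<le> \<bar>a - b\<bar>"
proof -
  have "iexp a - iexp b = iexp a * (1 - exp (- (\<i> * of_real (a - b))))"
    by (simp add: right_diff_distrib exp_add[symmetric])
  then have "cmod (iexp a - iexp b) = cmod (1 - exp (- (\<i> * of_real (a - b))))"
    by (simp add: norm_mult)
  also have "\<dots> \<le> cmod (\<i> * of_real (a - b))" by (rule norm_one_minus_exp_le) simp
  finally show ?thesis by (simp add: norm_mult del: of_real_diff)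
qed

lemma cmod_iexp_diff_le_2: "cmod (iexp a - iexp b) \<le> 2"
  using norm_triangle_ineq4[of "iexp a" "iexp b"] by simp

lemma cmod_iexp_taylor: "cmod (iexp a - 1 - \<i> * of_real a) \<le> a\<^sup>2"
proof -
  have "cmod (cexp 1 (- (\<i> * of_real a))) \<le> cmod (- (\<i> * of_real a)) powr (1 + 1)"
    by (rule norm_cexp_near) auto
  also have "\<dots> = a\<^sup>2" by (simp add: norm_mult)
  also have "cexp 1 (- (\<i> * of_real a)) = - (iexp a - 1 - \<i> * of_real a)" by (simp add: cexp_def)
  finally show ?thesis by (simp only: norm_minus_cancel)
qed

definition phase :: "real \<Rightarrow> real \<Rightarrow> real \<Rightarrow> complex" where
  "phase u v y = iexp (u * y + v * y\<^sup>2)"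

text \<open>One constant for both regimes: \<open>\<bar>u\<bar> + \<bar>v\<bar>\<close> bounds the
  slope for \<open>\<bar>y\<bar> \<le> 1\<close>, and 2 bounds the distance of two points of the
  unit circle beyond. It is strictly positive, so that one may divide by it.\<close>

definition phase_const :: "real \<Rightarrow> real \<Rightarrow> real" where
  "phase_const u v = 2 + \<bar>u\<bar> + \<bar>v\<bar>"

lemma measurable_phase [measurable]: "phase u v \<in> borel_measurable borel"
  unfolding phase_def by measurable

lemma cmod_phase [simp]: "cmod (phase u v y) = 1"
  by (simp add: phase_def del: of_real_add)

lemma phase_const_pos: "0 < phase_const u v" by (simp add: phase_const_def)

lemma cmod_phase_minus_1_le: "cmod (phase u v y - 1) \<le> phase_const u v * min \<bar>y\<bar> 1"
proof (cases "\<bar>y\<bar> \<le> 1")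
  case True
  have y2: "y\<^sup>2 \<le> \<bar>y\<bar>" using True by (metis abs_ge_zero mult_left_le power2_abs power2_eq_square)
  have "cmod (phase u v y - 1) \<le> \<bar>u * y + v * y\<^sup>2\<bar>"
    using cmod_iexp_diff_le[of "u * y + v * y\<^sup>2" 0] by (simp add: phase_def)
  also have "\<dots> \<le> \<bar>u\<bar> * \<bar>y\<bar> + \<bar>v\<bar> * y\<^sup>2" by (rule order_trans[OF abs_triangle_ineq]) (simp add: abs_mult)
  also have "\<dots> \<le> \<bar>u\<bar> * \<bar>y\<bar> + \<bar>v\<bar> * \<bar>y\<bar>" using y2 by (intro add_left_mono mult_left_mono) auto
  also have "\<dots> \<le> phase_const u v * \<bar>y\<bar>" by (simp add: phase_const_def algebra_simps)
  finally show ?thesis using True by (simp add: min_def)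
next
  case False
  have "cmod (phase u v y - 1) \<le> 2"
    using cmod_iexp_diff_le_2[of "u * y + v * y\<^sup>2" 0] by (simp add: phase_def)
  then show ?thesis using False by (simp add: min_def phase_const_def)
qed

lemma cmod_phase_taylor:
  assumes "\<bar>y\<bar> \<le> 1"
  shows "cmod (phase u v y - 1 - \<i> * of_real (u * y)) \<le> ((\<bar>u\<bar> + \<bar>v\<bar>)\<^sup>2 + \<bar>v\<bar>) * y\<^sup>2"
proof -
  have y2: "y\<^sup>2 \<le> \<bar>y\<bar>" using assms by (metis abs_ge_zero mult_left_le power2_abs power2_eq_square)
  define a where "a = u * y + v * y\<^sup>2"
  have "\<bar>a\<bar> \<le> \<bar>u\<bar> * \<bar>y\<bar> + \<bar>v\<bar> * y\<^sup>2" unfolding a_def by (rule order_trans[OF abs_triangle_ineq]) (simp add: abs_mult)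
  also have "\<dots> \<le> \<bar>u\<bar> * \<bar>y\<bar> + \<bar>v\<bar> * \<bar>y\<bar>" using y2 by (intro add_left_mono mult_left_mono) auto
  also have "\<dots> = \<bar>(\<bar>u\<bar> + \<bar>v\<bar>) * y\<bar>" unfolding abs_mult by (simp add: distrib_right)
  finally have "\<bar>a\<bar> \<le> \<bar>(\<bar>u\<bar> + \<bar>v\<bar>) * y\<bar>" .
  then have a2: "a\<^sup>2 \<le> (\<bar>u\<bar> + \<bar>v\<bar>)\<^sup>2 * y\<^sup>2" by (metis abs_le_square_iff power_mult_distrib)
  have "phase u v y - 1 - \<i> * of_real (u * y) = (iexp a - 1 - \<i> * of_real a) + \<i> * of_real (v * y\<^sup>2)"
    by (simp add: phase_def a_def algebra_simps)
  then have "cmod (phase u v y - 1 - \<i> * of_real (u * y)) \<le> cmod (iexp a - 1 - \<i> * of_real a) + cmod (\<i> * of_real (v * y\<^sup>2))"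
    by (metis norm_triangle_ineq)
  also have "\<dots> \<le> a\<^sup>2 + \<bar>v\<bar> * y\<^sup>2"
    by (intro add_mono cmod_iexp_taylor) (simp add: norm_mult abs_mult norm_power)
  finally show ?thesis using a2 by (simp add: algebra_simps)
qed

lemma cmod_prod_phase_minus_1_le:
  assumes "finite I"
  shows "cmod ((\<Prod>t\<in>I. phase u v (y t)) - 1) \<le> phase_const u v * (\<Sum>t\<in>I. min \<bar>y t\<bar> 1)"
proof -
  have "cmod ((\<Prod>t\<in>I. phase u v (y t)) - (\<Prod>t\<in>I. 1)) \<le> (\<Sum>t\<in>I. cmod (phase u v (y t) - 1))"
    by (rule norm_prod_diff) auto
  also have "\<dots> \<le> (\<Sum>t\<in>I. phase_const u v * min \<bar>y t\<bar> 1)" by (intro sum_mono cmod_phase_minus_1_le)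
  finally show ?thesis by (simp add: sum_distrib_left)
qed

lemma prod_phase_eq_iexp:
  assumes "finite I"
  shows "(\<Prod>t\<in>I. phase u v (y t)) = iexp (u * (\<Sum>t\<in>I. y t) + v * (\<Sum>t\<in>I. (y t)\<^sup>2))"
proof -
  have "(\<Prod>t\<in>I. phase u v (y t)) = exp (\<Sum>t\<in>I. \<i> * of_real (u * y t + v * (y t)\<^sup>2))"
    unfolding phase_def by (rule exp_sum[OF assms, symmetric])
  also have "(\<Sum>t\<in>I. \<i> * complex_of_real (u * y t + v * (y t)\<^sup>2)) = \<i> * of_real (\<Sum>t\<in>I. u * y t + v * (y t)\<^sup>2)"
    by (simp only: of_real_sum sum_distrib_left)
  also have "(\<Sum>t\<in>I. u * y t + v * (y t)\<^sup>2) = u * (\<Sum>t\<in>I. y t) + v * (\<Sum>t\<in>I. (y t)\<^sup>2)"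
    by (simp add: sum.distrib sum_distrib_left)
  finally show ?thesis .
qed

text \<open>Replaces the amplitude \<open>s\<close> by the left end of its cell, with error
  \<open>w\<close> inside the grid and at most 1 above its last point. The function
  \<open>\<phi>\<close> and the error \<open>w\<close> will depend on the sample while the grid does
  not: each term of the sum is then a bounded functional of the normalised path times a difference
  of exceedance indicators.\<close>

lemma step_approximation:
  fixes \<phi> :: "real \<Rightarrow> complex" and y :: "nat \<Rightarrow> real"
  assumes mono: "mono y" and w: "0 \<le> w"
    and close: "\<And>j. j < N \<Longrightarrow> y j < s \<Longrightarrow> s \<le> y (Suc j) \<Longrightarrow> cmod (\<phi> s - \<phi> (y j)) \<le> w" and b: "cmod (\<phi> s) \<le> 1"
  shows "cmod (indicator {y 0<..} s * \<phi> s - (\<Sum>j<N. (indicator {y j<..} s - indicator {y (Suc j)<..} s) * \<phi> (y j)))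
     \<le> indicator {y 0<..} s * w + indicator {y N<..} s"
proof -
  define d where "d j = (indicator {y j<..} s - indicator {y (Suc j)<..} s :: real)" for j
  have d01: "d j = (if y j < s \<and> s \<le> y (Suc j) then 1 else 0)" for j
    using monoD[OF mono, of j "Suc j"] by (auto simp: d_def indicator_def)
  have tel: "(\<Sum>j<n. d j) = indicator {y 0<..} s - indicator {y n<..} s" for n
    unfolding d_def by (rule sum_lessThan_telescope')
  have dc: "(indicator {y j<..} s - indicator {y (Suc j)<..} s) = complex_of_real (d j)" for j
    by (simp add: d_def of_real_indicator)
  have i: "(indicator {y j<..} s :: complex) = of_real (indicator {y j<..} s)" for j
    by (simp add: of_real_indicator)
  have "indicator {y 0<..} s * \<phi> s - (\<Sum>j<N. (indicator {y j<..} s - indicator {y (Suc j)<..} s) * \<phi> (y j))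
     = (\<Sum>j<N. of_real (d j) * (\<phi> s - \<phi> (y j))) + of_real (indicator {y N<..} s) * \<phi> s"
  proof -
    have "(\<Sum>j<N. of_real (d j) * (\<phi> s - \<phi> (y j))) = of_real (\<Sum>j<N. d j) * \<phi> s - (\<Sum>j<N. of_real (d j) * \<phi> (y j))"
      by (simp add: right_diff_distrib sum_subtractf sum_distrib_right)
    then show ?thesis unfolding dc unfolding i tel by (simp add: algebra_simps)
  qed
  also have "cmod \<dots> \<le> (\<Sum>j<N. cmod (of_real (d j) * (\<phi> s - \<phi> (y j)))) + cmod (of_real (indicator {y N<..} s) * \<phi> s)"
    by (rule order_trans[OF norm_triangle_ineq]) (intro add_right_mono norm_sum)
  also have "\<dots> \<le> (\<Sum>j<N. d j * w) + indicator {y N<..} s"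
  proof (rule add_mono)
    show "(\<Sum>j<N. cmod (of_real (d j) * (\<phi> s - \<phi> (y j)))) \<le> (\<Sum>j<N. d j * w)"
    proof (rule sum_mono)
      fix j assume "j \<in> {..<N}"
      then show "cmod (of_real (d j) * (\<phi> s - \<phi> (y j))) \<le> d j * w"
        using close[of j] by (auto simp: d01)
    qed
    show "cmod (of_real (indicator {y N<..} s) * \<phi> s) \<le> indicator {y N<..} s"
      using b by (auto simp: indicator_def)
  qed
  also have "\<dots> = (indicator {y 0<..} s - indicator {y N<..} s) * w + indicator {y N<..} s"
    by (simp add: sum_distrib_right[symmetric] tel)
  also have "\<dots> \<le> indicator {y 0<..} s * w + indicator {y N<..} s"
    using w by (auto simp: indicator_def)
  finally show ?thesis .
qed

section \<open>Regular variation of the modulus and spectral limits\<close>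

locale rv_stationary = prob_space M for M :: "'a measure" +
  fixes X :: "int \<Rightarrow> 'a \<Rightarrow> real" and \<kappa> :: real
  assumes X [measurable]: "\<And>t. X t \<in> borel_measurable M"
    and stat: "stationary_process M X" and rv: "rv_process M X \<kappa>"
    and \<kappa>: "(0 < \<kappa> \<and> \<kappa> < 1) \<or> (1 < \<kappa> \<and> \<kappa> < 2)"
begin

lemma stationary_expectation:
  fixes F :: "(nat \<Rightarrow> real) \<Rightarrow> 'c::{banach, second_countable_topology}"
  assumes F: "F \<in> borel_measurable (PiM {..<k} (\<lambda>_. borel))"
  shows "expectation (\<lambda>\<omega>. F (\<lambda>i\<in>{..<k}. X (s + int i) \<omega>)) = expectation (\<lambda>\<omega>. F (\<lambda>i\<in>{..<k}. X (int i) \<omega>))"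
proof -
  have m: "(\<lambda>\<omega>. \<lambda>i\<in>{..<k}. X (s + int i) \<omega>) \<in> M \<rightarrow>\<^sub>M PiM {..<k} (\<lambda>_. borel)" for s
    by measurable
  have m0: "(\<lambda>\<omega>. \<lambda>i\<in>{..<k}. X (int i) \<omega>) \<in> M \<rightarrow>\<^sub>M PiM {..<k} (\<lambda>_. borel)"
    by measurable
  have "expectation (\<lambda>\<omega>. F (\<lambda>i\<in>{..<k}. X (s + int i) \<omega>)) = integral\<^sup>L (distr M (PiM {..<k} (\<lambda>_. borel)) (\<lambda>\<omega>. \<lambda>i\<in>{..<k}. X (s + int i) \<omega>)) F"
    by (rule integral_distr[OF m F, symmetric])
  also have "\<dots> = integral\<^sup>L (distr M (PiM {..<k} (\<lambda>_. borel)) (\<lambda>\<omega>. \<lambda>i\<in>{..<k}. X (int i) \<omega>)) F"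
    using stat unfolding stationary_process_def by simp
  also have "\<dots> = expectation (\<lambda>\<omega>. F (\<lambda>i\<in>{..<k}. X (int i) \<omega>))"
    by (rule integral_distr[OF m0 F])
  finally show ?thesis .
qed

lemma stationary_single:
  fixes f :: "real \<Rightarrow> 'c::{banach, second_countable_topology}"
  assumes [measurable]: "f \<in> borel_measurable borel"
  shows "expectation (\<lambda>\<omega>. f (X t \<omega>)) = expectation (\<lambda>\<omega>. f (X 0 \<omega>))"
  using stationary_expectation[of "\<lambda>x. f (x 0)" 1 t] by simp

lemma stationary_pair:
  fixes f :: "real \<Rightarrow> real \<Rightarrow> 'c::{banach, second_countable_topology}"
  assumes f: "(\<lambda>z. f (fst z) (snd z)) \<in> borel_measurable (borel \<Otimes>\<^sub>M borel)"
  shows "expectation (\<lambda>\<omega>. f (X s \<omega>) (X (s + int k) \<omega>)) = expectation (\<lambda>\<omega>. f (X 0 \<omega>) (X (int k) \<omega>))"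
proof -
  have m: "(\<lambda>x. (x 0, x k)) \<in> PiM {..<Suc k} (\<lambda>_. borel) \<rightarrow>\<^sub>M (borel \<Otimes>\<^sub>M borel)" by measurable
  have "(\<lambda>x. f (x 0) (x k)) \<in> borel_measurable (PiM {..<Suc k} (\<lambda>_. borel))"
    using measurable_compose[OF m f] by simp
  from stationary_expectation[OF this, of s] show ?thesis by simp
qed

lemma \<kappa>_pos: "0 < \<kappa>" "\<kappa> < 2" using \<kappa> by auto

text \<open>Since the tail balance weights add up to 1, the tail of the modulus is equivalent to
  \<open>L x * x powr (- \<kappa>)\<close>, whose ratios converge by slow variation. Positivity for
  large \<open>x\<close> extends to all \<open>x\<close> by monotonicity.\<close>

lemma tail_facts:
  shows "y > 0 \<Longrightarrow> ((\<lambda>x. prob {\<omega>\<in>space M. \<bar>X 0 \<omega>\<bar> > y * x} / prob {\<omega>\<in>space M. \<bar>X 0 \<omega>\<bar> > x}) \<longlongrightarrow> y powr (-\<kappa>)) at_top"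
    and "0 < prob {\<omega>\<in>space M. \<bar>X 0 \<omega>\<bar> > x}"
proof -
  obtain L pp pm where L: "slowly_varying L" and pm: "pp + pm = 1"
    and l1: "((\<lambda>x. prob {\<omega>\<in>space M. X 0 \<omega> > x} / (L x * x powr (-\<kappa>))) \<longlongrightarrow> pp) at_top"
    and l2: "((\<lambda>x. prob {\<omega>\<in>space M. X 0 \<omega> < - x} / (L x * x powr (-\<kappa>))) \<longlongrightarrow> pm) at_top"
    using rv unfolding rv_process_def rv_variable_def by blast
  define T where "T x = prob {\<omega>\<in>space M. \<bar>X 0 \<omega>\<bar> > x}" for x
  define V where "V x = L x * x powr (-\<kappa>)" for x
  have Teq: "T x = prob {\<omega>\<in>space M. X 0 \<omega> > x} + prob {\<omega>\<in>space M. X 0 \<omega> < - x}" if "x \<ge> 0" for x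
  proof -
    have "{\<omega>\<in>space M. \<bar>X 0 \<omega>\<bar> > x} = {\<omega>\<in>space M. X 0 \<omega> > x} \<union> {\<omega>\<in>space M. X 0 \<omega> < - x}" by auto
    then show ?thesis unfolding T_def using that by (simp only:) (rule finite_measure_Union, auto)
  qed
  have "((\<lambda>x. prob {\<omega>\<in>space M. X 0 \<omega> > x} / V x + prob {\<omega>\<in>space M. X 0 \<omega> < - x} / V x) \<longlongrightarrow> pp + pm) at_top"
    unfolding V_def by (rule tendsto_add[OF l1 l2])
  then have TV: "((\<lambda>x. T x / V x) \<longlongrightarrow> 1) at_top"
    unfolding pm by (rule Lim_transform_eventually)
      (use eventually_ge_at_top[of 0] in \<open>eventually_elim, simp add: Teq add_divide_distrib\<close>)
  have Lpos: "\<forall>\<^sub>F x in at_top. L x > 0" and Llim: "\<And>c. c > 0 \<Longrightarrow> ((\<lambda>x. L (c * x) / L x) \<longlongrightarrow> 1) at_top"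
    using L unfolding slowly_varying_def by auto
  have Vpos: "\<forall>\<^sub>F x in at_top. V x > 0"
    using Lpos eventually_gt_at_top[of 0] by eventually_elim (simp add: V_def)
  have "\<forall>\<^sub>F x in at_top. T x / V x > 0" using TV by (rule order_tendstoD) simp
  then have ev: "\<forall>\<^sub>F x in at_top. T x > 0" using Vpos by eventually_elim (simp add: zero_less_divide_iff)
  then obtain x1 where x1: "\<And>x. x \<ge> x1 \<Longrightarrow> T x > 0" by (auto simp: eventually_at_top_linorder)
  have Tp: "T x > 0" for x
  proof -
    have "T (max x x1) \<le> T x" unfolding T_def by (rule finite_measure_mono) auto
    then show ?thesis using x1[of "max x x1"] by simp
  qed
  show "0 < prob {\<omega>\<in>space M. \<bar>X 0 \<omega>\<bar> > x}" using Tp unfolding T_def .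
  assume y: "y > 0"
  have fl: "filterlim (\<lambda>x. y * x) at_top at_top" by (rule filterlim_tendsto_pos_mult_at_top[OF tendsto_const y filterlim_ident])
  have "((\<lambda>x. T (y * x) / V (y * x) * (L (y * x) / L x * y powr (-\<kappa>)) / (T x / V x)) \<longlongrightarrow> 1 * (1 * y powr (-\<kappa>)) / 1) at_top"
    by (intro tendsto_intros TV Llim y filterlim_compose[OF TV fl]) simp
  then have "((\<lambda>x. T (y * x) / T x) \<longlongrightarrow> 1 * (1 * y powr (-\<kappa>)) / 1) at_top"
  proof (rule Lim_transform_eventually)
    have "\<forall>\<^sub>F x in at_top. V (y * x) > 0" using Vpos fl by (rule eventually_compose_filterlim)
    then show "\<forall>\<^sub>F x in at_top. T (y * x) / V (y * x) * (L (y * x) / L x * y powr (-\<kappa>)) / (T x / V x) = T (y * x) / T x"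
      using Vpos eventually_gt_at_top[of 0] Lpos
    proof eventually_elim
      case (elim x)
      define R where "R = L (y * x) / L x * y powr (-\<kappa>)"
      have VR: "V (y * x) = R * V x" using elim y by (simp add: V_def R_def powr_mult)
      then have "R \<noteq> 0" "V x \<noteq> 0" using elim by auto
      then show ?case unfolding R_def[symmetric] VR by simp
    qed
  qed
  then show "((\<lambda>x. prob {\<omega>\<in>space M. \<bar>X 0 \<omega>\<bar> > y * x} / prob {\<omega>\<in>space M. \<bar>X 0 \<omega>\<bar> > x}) \<longlongrightarrow> y powr (-\<kappa>)) at_top"
    unfolding T_def by simp
qed

sublocale rv_tail M "\<lambda>\<omega>. \<bar>X 0 \<omega>\<bar>" \<kappa>
  using tail_facts \<kappa>_pos by unfold_locales auto

text \<open>The normalised path on a window, padded by 0 in the way \<open>rv_process\<close>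
  phrases its test functionals, so that windows of every width share one function space.\<close>

definition \<Theta> :: "nat \<Rightarrow> 'a \<Rightarrow> int \<Rightarrow> real" where
  "\<Theta> h \<omega> = (\<lambda>i. if - int h \<le> i \<and> i \<le> int h then X i \<omega> / \<bar>X 0 \<omega>\<bar> else 0)"

lemma measurable_\<Theta> [measurable]: "\<Theta> h \<in> borel_measurable M"
  unfolding \<Theta>_def by (rule measurable_coordinatewise_then_product) measurable

text \<open>Moving the threshold from \<open>x\<close> to \<open>y * x\<close> only multiplies the
  limit by \<open>y powr (- \<kappa>)\<close>, by the ratio of the tails; complex values are handled
  through real and imaginary parts.\<close>

lemma spectral_conv:
  fixes g :: "(int \<Rightarrow> real) \<Rightarrow> complex"
  assumes g: "continuous_on UNIV g" and b: "\<And>\<theta>. cmod (g \<theta>) \<le> B" and y: "y > 0"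
  shows "\<exists>l. ((\<lambda>x. expectation (\<lambda>\<omega>. indicator {\<omega>. \<bar>X 0 \<omega>\<bar> > y * x} \<omega> * g (\<Theta> h \<omega>)) / T x) \<longlongrightarrow> l) at_top"
proof -
  have [measurable]: "g \<in> borel_measurable borel" by (rule borel_measurable_continuous_onI[OF g])
  have real: "\<exists>l. ((\<lambda>x. expectation (\<lambda>\<omega>. indicator {\<omega>. \<bar>X 0 \<omega>\<bar> > x} \<omega> * f (\<Theta> h \<omega>)) / T x) \<longlongrightarrow> l) at_top"
    if "continuous_on UNIV f" "bounded (range f)" for f :: "(int \<Rightarrow> real) \<Rightarrow> real"
  proof -
    have "expectation (\<lambda>\<omega>. indicator {\<omega>\<in>space M. \<bar>X 0 \<omega>\<bar> > x} \<omega> * f (\<Theta> h \<omega>)) = expectation (\<lambda>\<omega>. indicator {\<omega>. \<bar>X 0 \<omega>\<bar> > x} \<omega> * f (\<Theta> h \<omega>))" for x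
      by (rule Bochner_Integration.integral_cong) (auto simp: indicator_def)
    moreover obtain Q where "\<And>g :: (int \<Rightarrow> real) \<Rightarrow> real. continuous_on UNIV g \<Longrightarrow> bounded (range g) \<Longrightarrow>
           ((\<lambda>x. expectation (\<lambda>\<omega>. indicator {\<omega>\<in>space M. \<bar>X 0 \<omega>\<bar> > x} \<omega> * g (\<Theta> h \<omega>)) / T x)
             \<longlongrightarrow> (\<integral>\<theta>. g (\<lambda>i. if - int h \<le> i \<and> i \<le> int h then \<theta> i else 0) \<partial>Q)) at_top"
      using rv unfolding rv_process_def \<Theta>_def[symmetric] T_def[symmetric] by blast
    from this[OF that] have "\<exists>l. ((\<lambda>x. expectation (\<lambda>\<omega>. indicator {\<omega>\<in>space M. \<bar>X 0 \<omega>\<bar> > x} \<omega> * f (\<Theta> h \<omega>)) / T x) \<longlongrightarrow> l) at_top"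
      by (rule exI)
    ultimately show ?thesis by simp
  qed
  have bR: "bounded (range (\<lambda>\<theta>. Re (g \<theta>)))" "bounded (range (\<lambda>\<theta>. Im (g \<theta>)))"
    unfolding bounded_iff
    by (auto intro!: exI[of _ B] order_trans[OF abs_Re_le_cmod b] order_trans[OF abs_Im_le_cmod b])
  obtain l1 where l1: "((\<lambda>x. expectation (\<lambda>\<omega>. indicator {\<omega>. \<bar>X 0 \<omega>\<bar> > x} \<omega> * Re (g (\<Theta> h \<omega>))) / T x) \<longlongrightarrow> l1) at_top"
    using real[OF _ bR(1)] g by (auto intro: continuous_intros)
  obtain l2 where l2: "((\<lambda>x. expectation (\<lambda>\<omega>. indicator {\<omega>. \<bar>X 0 \<omega>\<bar> > x} \<omega> * Im (g (\<Theta> h \<omega>))) / T x) \<longlongrightarrow> l2) at_top"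
    using real[OF _ bR(2)] g by (auto intro: continuous_intros)
  have int: "integrable M (\<lambda>\<omega>. indicator {\<omega>. \<bar>X 0 \<omega>\<bar> > x} \<omega> * g (\<Theta> h \<omega>))" for x
    by (rule integrable_const_bound[where B = "max B 0"]) (use b in \<open>auto simp: indicator_def le_max_iff_disj\<close>)
  have eq: "expectation (\<lambda>\<omega>. indicator {\<omega>. \<bar>X 0 \<omega>\<bar> > x} \<omega> * g (\<Theta> h \<omega>)) / T x
     = Complex (expectation (\<lambda>\<omega>. indicator {\<omega>. \<bar>X 0 \<omega>\<bar> > x} \<omega> * Re (g (\<Theta> h \<omega>))) / T x)
       (expectation (\<lambda>\<omega>. indicator {\<omega>. \<bar>X 0 \<omega>\<bar> > x} \<omega> * Im (g (\<Theta> h \<omega>))) / T x)" for x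
  proof -
    have "Re (indicator A \<omega> * z) = indicator A \<omega> * Re z" "Im (indicator A \<omega> * z) = indicator A \<omega> * Im z" for A and \<omega> :: 'a and z
      by (auto simp: indicator_def)
    then show ?thesis
      using integral_Re[OF int[of x]] integral_Im[OF int[of x]] by (simp add: complex_eq_iff)
  qed
  have lim: "((\<lambda>x. expectation (\<lambda>\<omega>. indicator {\<omega>. \<bar>X 0 \<omega>\<bar> > x} \<omega> * g (\<Theta> h \<omega>)) / T x) \<longlongrightarrow> Complex l1 l2) at_top"
    unfolding eq by (rule tendsto_Complex[OF l1 l2])
  have fl: "filterlim (\<lambda>x. y * x) at_top at_top" by (rule filterlim_tendsto_pos_mult_at_top[OF tendsto_const y filterlim_ident])
  have "((\<lambda>x. expectation (\<lambda>\<omega>. indicator {\<omega>. \<bar>X 0 \<omega>\<bar> > y * x} \<omega> * g (\<Theta> h \<omega>)) / T (y * x) * of_real (T (y * x) / T x)) \<longlongrightarrow> Complex l1 l2 * of_real (y powr (-\<kappa>))) at_top"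
    by (intro tendsto_mult filterlim_compose[OF lim fl] tendsto_of_real T_ratio y)
  also have "(\<lambda>x. expectation (\<lambda>\<omega>. indicator {\<omega>. \<bar>X 0 \<omega>\<bar> > y * x} \<omega> * g (\<Theta> h \<omega>)) / T (y * x) * of_real (T (y * x) / T x))
     = (\<lambda>x. expectation (\<lambda>\<omega>. indicator {\<omega>. \<bar>X 0 \<omega>\<bar> > y * x} \<omega> * g (\<Theta> h \<omega>)) / T x)"
    using T_pos by (auto simp: fun_eq_iff less_imp_neq[THEN not_sym])
  finally show ?thesis by blast
qed

text \<open>A modulus of continuity in the mean. The functional \<open>H\<close> may be unbounded,
  but \<open>min 2 (\<delta> * H)\<close> is a bounded continuous test; its integral under the
  spectral law tends to 0 with \<open>\<delta>\<close> by dominated convergence, and the conditional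
  means inherit the smallness for large \<open>x\<close>.\<close>

lemma spectral_modulus:
  fixes H :: "(int \<Rightarrow> real) \<Rightarrow> real"
  assumes H: "continuous_on UNIV H" "\<And>\<theta>. 0 \<le> H \<theta>" and y: "y > 0" and e: "e > 0"
  obtains \<delta> where "\<delta> > 0"
    "\<forall>\<^sub>F x in at_top. expectation (\<lambda>\<omega>. indicator {\<omega>. \<bar>X 0 \<omega>\<bar> > y * x} \<omega> * min 2 (\<delta> * H (\<Theta> h \<omega>))) / T x < e"
proof -
  obtain Q where Q: "prob_space Q" "sets Q = sets (PiM UNIV (\<lambda>_::int. borel :: real measure))"
    and conv: "\<And>g :: (int \<Rightarrow> real) \<Rightarrow> real. continuous_on UNIV g \<Longrightarrow> bounded (range g) \<Longrightarrow>
           ((\<lambda>x. (\<integral>\<omega>. indicator {\<omega>\<in>space M. \<bar>X 0 \<omega>\<bar> > x} \<omega> *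
                        g (\<lambda>i. if - int h \<le> i \<and> i \<le> int h then X i \<omega> / \<bar>X 0 \<omega>\<bar> else 0) \<partial>M)
                  / measure M {\<omega>\<in>space M. \<bar>X 0 \<omega>\<bar> > x})
             \<longlongrightarrow> (\<integral>\<theta>. g (\<lambda>i. if - int h \<le> i \<and> i \<le> int h then \<theta> i else 0) \<partial>Q)) at_top"
    using rv unfolding rv_process_def by blast
  interpret Q: prob_space Q by fact
  define \<tau> where "\<tau> \<theta> = (\<lambda>i. if - int h \<le> i \<and> i \<le> int h then \<theta> i else 0)" for \<theta> :: "int \<Rightarrow> real"
  define W where "W n \<theta> = min 2 (1 / real (Suc n) * H \<theta>)" for n \<theta>
  have Hm[measurable]: "H \<in> borel_measurable borel" by (rule borel_measurable_continuous_onI[OF H(1)])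
  have sQ[measurable_cong]: "sets Q = sets borel" using Q(2) by (simp add: sets_PiM_equal_borel)
  have \<tau>m[measurable]: "\<tau> \<in> borel_measurable borel"
    unfolding \<tau>_def
  proof (rule measurable_coordinatewise_then_product)
    fix i :: int
    have "(\<lambda>\<theta> :: int \<Rightarrow> real. \<theta> i) \<in> borel_measurable borel"
      by (rule borel_measurable_continuous_onI) (rule continuous_on_product_coordinates)
    then show "(\<lambda>\<theta>. if - int h \<le> i \<and> i \<le> int h then \<theta> i else 0) \<in> borel_measurable borel" by simp
  qed
  have Wc: "continuous_on UNIV (W n)" for n
    unfolding W_def by (intro continuous_intros H)
  have Wb: "0 \<le> W n \<theta>" "W n \<theta> \<le> 2" for n \<theta> unfolding W_def using H(2) by auto
  have "(\<lambda>n. \<integral>\<theta>. W n (\<tau> \<theta>) \<partial>Q) \<longlonglongrightarrow> (\<integral>\<theta>. 0 \<partial>Q)"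
  proof (rule integral_dominated_convergence[where w = "\<lambda>_. 2"])
    show "AE \<theta> in Q. (\<lambda>n. W n (\<tau> \<theta>)) \<longlonglongrightarrow> 0"
    proof (rule AE_I2)
      fix \<theta>
      have "(\<lambda>n. min 2 (inverse (real (Suc n)) * H (\<tau> \<theta>))) \<longlonglongrightarrow> min 2 (0 * H (\<tau> \<theta>))"
        by (intro tendsto_intros LIMSEQ_inverse_real_of_nat)
      then show "(\<lambda>n. W n (\<tau> \<theta>)) \<longlonglongrightarrow> 0" by (simp add: W_def inverse_eq_divide)
    qed
    show "(\<lambda>\<theta>. W n (\<tau> \<theta>)) \<in> borel_measurable Q" for n unfolding W_def by measurable
  qed (use Wb in auto)
  then have "(\<lambda>n. (\<integral>\<theta>. W n (\<tau> \<theta>) \<partial>Q) * y powr (-\<kappa>)) \<longlonglongrightarrow> 0 * y powr (-\<kappa>)"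
    by (intro tendsto_mult tendsto_const) simp
  then have "\<forall>\<^sub>F n in sequentially. (\<integral>\<theta>. W n (\<tau> \<theta>) \<partial>Q) * y powr (-\<kappa>) < e"
    by (rule order_tendstoD) (use e in simp)
  then obtain n where n: "(\<integral>\<theta>. W n (\<tau> \<theta>) \<partial>Q) * y powr (-\<kappa>) < e" by (auto simp: eventually_sequentially)
  have "bounded (range (W n))" unfolding bounded_iff using Wb by (auto intro!: exI[of _ 2])
  from conv[OF Wc this]
  have lim: "((\<lambda>x. expectation (\<lambda>\<omega>. indicator {\<omega>\<in>space M. \<bar>X 0 \<omega>\<bar> > x} \<omega> * W n (\<Theta> h \<omega>)) / T x) \<longlongrightarrow> (\<integral>\<theta>. W n (\<tau> \<theta>) \<partial>Q)) at_top"
    unfolding \<Theta>_def T_def \<tau>_def .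
  have "expectation (\<lambda>\<omega>. indicator {\<omega>\<in>space M. \<bar>X 0 \<omega>\<bar> > x} \<omega> * W n (\<Theta> h \<omega>)) = expectation (\<lambda>\<omega>. indicator {\<omega>. \<bar>X 0 \<omega>\<bar> > x} \<omega> * W n (\<Theta> h \<omega>))" for x
    by (rule Bochner_Integration.integral_cong) (auto simp: indicator_def)
  then have lim: "((\<lambda>x. expectation (\<lambda>\<omega>. indicator {\<omega>. \<bar>X 0 \<omega>\<bar> > x} \<omega> * W n (\<Theta> h \<omega>)) / T x) \<longlongrightarrow> (\<integral>\<theta>. W n (\<tau> \<theta>) \<partial>Q)) at_top"
    using lim by simp
  have fl: "filterlim (\<lambda>x. y * x) at_top at_top" by (rule filterlim_tendsto_pos_mult_at_top[OF tendsto_const y filterlim_ident])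
  have "((\<lambda>x. expectation (\<lambda>\<omega>. indicator {\<omega>. \<bar>X 0 \<omega>\<bar> > y * x} \<omega> * W n (\<Theta> h \<omega>)) / T (y * x) * (T (y * x) / T x)) \<longlongrightarrow> (\<integral>\<theta>. W n (\<tau> \<theta>) \<partial>Q) * y powr (-\<kappa>)) at_top"
    by (intro tendsto_mult filterlim_compose[OF lim fl] T_ratio y)
  also have "(\<lambda>x. expectation (\<lambda>\<omega>. indicator {\<omega>. \<bar>X 0 \<omega>\<bar> > y * x} \<omega> * W n (\<Theta> h \<omega>)) / T (y * x) * (T (y * x) / T x))
     = (\<lambda>x. expectation (\<lambda>\<omega>. indicator {\<omega>. \<bar>X 0 \<omega>\<bar> > y * x} \<omega> * W n (\<Theta> h \<omega>)) / T x)"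
    using T_pos by (auto simp: fun_eq_iff less_imp_neq[THEN not_sym])
  finally have "\<forall>\<^sub>F x in at_top. expectation (\<lambda>\<omega>. indicator {\<omega>. \<bar>X 0 \<omega>\<bar> > y * x} \<omega> * W n (\<Theta> h \<omega>)) / T x < e"
    by (rule order_tendstoD) (rule n)
  then show ?thesis unfolding W_def by (intro that[of "1 / real (Suc n)"]) auto
qed

lemma continuous_coordinate: "continuous_on UNIV (\<lambda>\<theta> :: int \<Rightarrow> real. \<theta> i)"
  by (rule continuous_on_product_coordinates)

text \<open>The path is the amplitude \<open>\<bar>X 0\<bar> / x\<close> times the shape
  \<open>\<Theta>\<close>, and the spectral limit controls functionals of the shape above fixed
  levels of the amplitude. Cutting the amplitude at a large \<open>K\<close> and replacing it by
  grid points gives sums to which \<open>spectral_conv\<close> applies.\<close>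

lemma exp_functional_conv:
  fixes A B :: "(int \<Rightarrow> real) \<Rightarrow> real"
  assumes A: "continuous_on UNIV A" and B: "continuous_on UNIV B" and \<epsilon>: "\<epsilon> > 0"
  shows "\<exists>l. ((\<lambda>x. expectation (\<lambda>\<omega>. indicator {\<omega>. \<bar>X 0 \<omega>\<bar> > \<epsilon> * x} \<omega> *
     iexp (\<bar>X 0 \<omega>\<bar> / x * A (\<Theta> h \<omega>) + (\<bar>X 0 \<omega>\<bar> / x)\<^sup>2 * B (\<Theta> h \<omega>))) / T x) \<longlongrightarrow> l) at_top"
proof (rule tendsto_of_approximations)
  fix e :: real assume e: "e > 0"
  have [measurable]: "A \<in> borel_measurable borel" "B \<in> borel_measurable borel"
    using A B by (auto intro: borel_measurable_continuous_onI)
  define \<phi> where "\<phi> \<theta> y = iexp (y * A \<theta> + y\<^sup>2 * B \<theta>)" for \<theta> y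
  have \<phi>1: "cmod (\<phi> \<theta> y) = 1" for \<theta> y unfolding \<phi>_def by (simp del: of_real_add)
  have \<phi>m[measurable]: "(\<lambda>\<omega>. \<phi> (\<Theta> h \<omega>) (f \<omega>)) \<in> borel_measurable M" if [measurable]: "f \<in> borel_measurable M" for f
    unfolding \<phi>_def by measurable
  \<comment> \<open>Amplitudes above \<open>K\<close> have asymptotic mass
    \<open>K powr (- \<kappa>)\<close> relative to \<open>T x\<close>, so a large \<open>K\<close>
    makes them negligible.\<close>
  have "((\<lambda>K. K powr (-\<kappa>)) \<longlongrightarrow> 0) at_top"
    by (rule tendsto_neg_powr) (use \<kappa>_pos filterlim_ident in auto)
  then have "\<forall>\<^sub>F K in at_top. K powr (-\<kappa>) < e / 2" by (rule order_tendstoD) (use e in simp)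
  then have "\<forall>\<^sub>F K in at_top. K powr (-\<kappa>) < e / 2 \<and> K > \<epsilon>"
    using eventually_gt_at_top[of \<epsilon>] by (rule eventually_conj)
  then obtain K where K: "K powr (-\<kappa>) < e / 2" "K > \<epsilon>" by (auto simp: eventually_at_top_linorder)
  \<comment> \<open>A Lipschitz constant, in the amplitude up to \<open>K\<close>, for the argument
    of the exponential: squares of amplitudes vary at most \<open>2 * K\<close> times as
    fast.\<close>
  define H where "H \<theta> = \<bar>A \<theta>\<bar> + 2 * K * \<bar>B \<theta>\<bar>" for \<theta>
  have Hc: "continuous_on UNIV H" unfolding H_def by (intro continuous_intros A B)
  have H0: "0 \<le> H \<theta>" for \<theta> unfolding H_def using K \<epsilon> by simp
  have [measurable]: "H \<in> borel_measurable borel" using Hc by (rule borel_measurable_continuous_onI)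
  obtain \<delta> where \<delta>: "\<delta> > 0"
    and W: "\<forall>\<^sub>F x in at_top. expectation (\<lambda>\<omega>. indicator {\<omega>. \<bar>X 0 \<omega>\<bar> > \<epsilon> * x} \<omega> * min 2 (\<delta> * H (\<Theta> h \<omega>))) / T x < e / 2"
    using spectral_modulus[OF Hc H0 \<epsilon>, of "e/2" h] e by auto
  \<comment> \<open>Chosen so that the mesh of the grid from \<open>\<epsilon>\<close> to
    \<open>K\<close> is at most \<open>\<delta>\<close>.\<close>
  obtain N :: nat where N: "(K - \<epsilon>) / \<delta> < real N" using reals_Archimedean2 by blast
  have N0: "N > 0"
  proof (rule ccontr)
    assume "\<not> N > 0"
    then show False using N K \<delta> by (auto simp: divide_less_0_iff)
  qed
  define y where "y j = \<epsilon> + real j * ((K - \<epsilon>) / real N)" for j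
  have st: "(K - \<epsilon>) / real N \<ge> 0" using K by simp
  have ymono: "mono y"
    unfolding y_def mono_def using st by (intro allI impI add_left_mono mult_right_mono) auto
  have y0: "y 0 = \<epsilon>" and yN: "y N = K" unfolding y_def using N0 by auto
  have ystep: "y (Suc j) - y j \<le> \<delta>" for j
  proof -
    have "(K - \<epsilon>) / real N \<le> \<delta>" using N N0 \<delta> by (simp add: field_simps)
    then show ?thesis unfolding y_def by (simp add: algebra_simps add_divide_distrib diff_divide_distrib)
  qed
  have ypos: "y j \<ge> \<epsilon>" for j unfolding y_def using mult_nonneg_nonneg[OF of_nat_0_le_iff[of j] st] by simp
  define S where "S x \<omega> = (\<Sum>j<N. (indicator {\<omega>. \<bar>X 0 \<omega>\<bar> > y j * x} \<omega> - indicator {\<omega>. \<bar>X 0 \<omega>\<bar> > y (Suc j) * x} \<omega>) * \<phi> (\<Theta> h \<omega>) (y j))" for x \<omega>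
  have trm: "\<exists>l. ((\<lambda>x. expectation (\<lambda>\<omega>. indicator {\<omega>. \<bar>X 0 \<omega>\<bar> > z * x} \<omega> * \<phi> (\<Theta> h \<omega>) s) / T x) \<longlongrightarrow> l) at_top" if "z > 0" for z s
    by (rule spectral_conv[where B = 1]) (use that A B in \<open>auto simp: \<phi>_def intro!: continuous_intros simp del: of_real_add\<close>)
  have tint: "integrable M (\<lambda>\<omega>. indicator {\<omega>. \<bar>X 0 \<omega>\<bar> > z} \<omega> * \<phi> (\<Theta> h \<omega>) (s \<omega>))" if "s \<in> borel_measurable M" for z s
    by (rule integrable_const_bound[where B = 1]) (use that \<phi>1 in \<open>auto simp: indicator_def\<close>)
  have ES: "expectation (S x) = (\<Sum>j<N. expectation (\<lambda>\<omega>. indicator {\<omega>. \<bar>X 0 \<omega>\<bar> > y j * x} \<omega> * \<phi> (\<Theta> h \<omega>) (y j))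
       - expectation (\<lambda>\<omega>. indicator {\<omega>. \<bar>X 0 \<omega>\<bar> > y (Suc j) * x} \<omega> * \<phi> (\<Theta> h \<omega>) (y j)))" for x
    unfolding S_def left_diff_distrib using tint by (subst Bochner_Integration.integral_sum) auto
  have "\<exists>l. ((\<lambda>x. expectation (S x) / T x) \<longlongrightarrow> l) at_top"
  proof -
    have "\<forall>j. \<exists>l. ((\<lambda>x. expectation (\<lambda>\<omega>. indicator {\<omega>. \<bar>X 0 \<omega>\<bar> > y j * x} \<omega> * \<phi> (\<Theta> h \<omega>) (y j)) / T x) \<longlongrightarrow> l) at_top"
      by (intro allI trm less_le_trans[OF \<epsilon> ypos])
    from choice[OF this] obtain l1 where l1: "\<forall>j. ((\<lambda>x. expectation (\<lambda>\<omega>. indicator {\<omega>. \<bar>X 0 \<omega>\<bar> > y j * x} \<omega> * \<phi> (\<Theta> h \<omega>) (y j)) / T x) \<longlongrightarrow> l1 j) at_top"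
      by (rule exE)
    have "\<forall>j. \<exists>l. ((\<lambda>x. expectation (\<lambda>\<omega>. indicator {\<omega>. \<bar>X 0 \<omega>\<bar> > y (Suc j) * x} \<omega> * \<phi> (\<Theta> h \<omega>) (y j)) / T x) \<longlongrightarrow> l) at_top"
      by (intro allI trm less_le_trans[OF \<epsilon> ypos])
    from choice[OF this] obtain l2 where l2: "\<forall>j. ((\<lambda>x. expectation (\<lambda>\<omega>. indicator {\<omega>. \<bar>X 0 \<omega>\<bar> > y (Suc j) * x} \<omega> * \<phi> (\<Theta> h \<omega>) (y j)) / T x) \<longlongrightarrow> l2 j) at_top"
      by (rule exE)
    have "((\<lambda>x. \<Sum>j<N. expectation (\<lambda>\<omega>. indicator {\<omega>. \<bar>X 0 \<omega>\<bar> > y j * x} \<omega> * \<phi> (\<Theta> h \<omega>) (y j)) / T x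
       - expectation (\<lambda>\<omega>. indicator {\<omega>. \<bar>X 0 \<omega>\<bar> > y (Suc j) * x} \<omega> * \<phi> (\<Theta> h \<omega>) (y j)) / T x) \<longlongrightarrow> (\<Sum>j<N. l1 j - l2 j)) at_top"
      by (intro tendsto_sum tendsto_diff l1[rule_format] l2[rule_format])
    then show ?thesis unfolding ES by (auto simp: sum_divide_distrib diff_divide_distrib)
  qed
  then obtain l where l: "((\<lambda>x. expectation (S x) / T x) \<longlongrightarrow> l) at_top" by blast
  define f where "f x \<omega> = indicator {\<omega>. \<bar>X 0 \<omega>\<bar> > \<epsilon> * x} \<omega> * \<phi> (\<Theta> h \<omega>) (\<bar>X 0 \<omega>\<bar> / x)" for x \<omega>
  have fi: "integrable M (f x)" for x unfolding f_def by (rule tint) measurable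
  have Si: "integrable M (S x)" for x unfolding S_def left_diff_distrib using tint by (intro Bochner_Integration.integrable_sum Bochner_Integration.integrable_diff) auto
  define w where "w \<omega> = min 2 (\<delta> * H (\<Theta> h \<omega>))" for \<omega>
  have wm[measurable]: "w \<in> borel_measurable M" unfolding w_def by measurable
  have w0: "0 \<le> w \<omega>" "w \<omega> \<le> 2" for \<omega> unfolding w_def using H0 \<delta> by auto
  have pt: "cmod (f x \<omega> - S x \<omega>) \<le> indicator {\<omega>. \<bar>X 0 \<omega>\<bar> > \<epsilon> * x} \<omega> * w \<omega> + indicator {\<omega>. \<bar>X 0 \<omega>\<bar> > K * x} \<omega>" if x: "x > 0" for x \<omega>
  proof -
    define s where "s = \<bar>X 0 \<omega>\<bar> / x"
    have i: "indicator {\<omega>. \<bar>X 0 \<omega>\<bar> > z * x} \<omega> = indicator {z<..} s" for z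
      unfolding s_def using x by (auto simp: indicator_def pos_less_divide_eq)
    have "cmod (indicator {y 0<..} s * \<phi> (\<Theta> h \<omega>) s - (\<Sum>j<N. (indicator {y j<..} s - indicator {y (Suc j)<..} s) * \<phi> (\<Theta> h \<omega>) (y j)))
       \<le> indicator {y 0<..} s * w \<omega> + indicator {y N<..} s"
    proof (rule step_approximation[OF ymono w0(1)])
      fix j assume j: "j < N" "y j < s" "s \<le> y (Suc j)"
      have sK: "s \<le> K" using j monoD[OF ymono, of "Suc j" N] yN by simp
      have yj: "0 < y j" using \<epsilon> ypos[of j] by simp
      have sd: "s - y j \<le> \<delta>" using j ystep[of j] by simp
      have "s\<^sup>2 - (y j)\<^sup>2 = (s - y j) * (s + y j)" by (simp add: power2_eq_square algebra_simps)
      also have "\<dots> \<le> \<delta> * (2 * K)" using sd sK j yj by (intro mult_mono) auto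
      finally have sq: "s\<^sup>2 - (y j)\<^sup>2 \<le> \<delta> * (2 * K)" .
      have sq0: "s\<^sup>2 - (y j)\<^sup>2 \<ge> 0" using j yj by (simp add: power_mono)
      have "cmod (\<phi> (\<Theta> h \<omega>) s - \<phi> (\<Theta> h \<omega>) (y j)) \<le> \<bar>(s * A (\<Theta> h \<omega>) + s\<^sup>2 * B (\<Theta> h \<omega>)) - (y j * A (\<Theta> h \<omega>) + (y j)\<^sup>2 * B (\<Theta> h \<omega>))\<bar>"
        unfolding \<phi>_def by (rule cmod_iexp_diff_le)
      also have "\<dots> = \<bar>(s - y j) * A (\<Theta> h \<omega>) + (s\<^sup>2 - (y j)\<^sup>2) * B (\<Theta> h \<omega>)\<bar>"
        by (simp add: algebra_simps)
      also have "\<dots> \<le> (s - y j) * \<bar>A (\<Theta> h \<omega>)\<bar> + (s\<^sup>2 - (y j)\<^sup>2) * \<bar>B (\<Theta> h \<omega>)\<bar>"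
        using j sq0 by (intro order_trans[OF abs_triangle_ineq]) (simp add: abs_mult)
      also have "\<dots> \<le> \<delta> * \<bar>A (\<Theta> h \<omega>)\<bar> + \<delta> * (2 * K) * \<bar>B (\<Theta> h \<omega>)\<bar>"
        using sd sq by (intro add_mono mult_right_mono) auto
      also have "\<dots> = \<delta> * H (\<Theta> h \<omega>)" by (simp add: H_def algebra_simps)
      finally have "cmod (\<phi> (\<Theta> h \<omega>) s - \<phi> (\<Theta> h \<omega>) (y j)) \<le> \<delta> * H (\<Theta> h \<omega>)" .
      moreover have "cmod (\<phi> (\<Theta> h \<omega>) s - \<phi> (\<Theta> h \<omega>) (y j)) \<le> 2"
        unfolding \<phi>_def by (rule cmod_iexp_diff_le_2)
      ultimately show "cmod (\<phi> (\<Theta> h \<omega>) s - \<phi> (\<Theta> h \<omega>) (y j)) \<le> w \<omega>"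
        unfolding w_def by simp
    qed (simp add: \<phi>1)
    then show ?thesis unfolding f_def S_def i y0 yN s_def[symmetric] .
  qed
  have lim: "((\<lambda>x. T (K * x) / T x) \<longlongrightarrow> K powr (-\<kappa>)) at_top" by (rule T_ratio) (use K \<epsilon> in simp)
  have "\<forall>\<^sub>F x in at_top. T (K * x) / T x < e / 2" by (rule order_tendstoD(2)[OF lim K(1)])
  then have "\<forall>\<^sub>F x in at_top. cmod (expectation (f x) / T x - expectation (S x) / T x) \<le> e"
    using W eventually_gt_at_top[of 0]
  proof eventually_elim
    case (elim x)
    have wi: "integrable M (\<lambda>\<omega>. indicator {\<omega>. \<bar>X 0 \<omega>\<bar> > \<epsilon> * x} \<omega> * w \<omega>)"
      by (rule integrable_const_bound[where B = 2]) (use w0 in \<open>auto simp: indicator_def\<close>)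
    have "cmod (expectation (f x) - expectation (S x)) = cmod (expectation (\<lambda>\<omega>. f x \<omega> - S x \<omega>))"
      using fi Si by simp
    also have "\<dots> \<le> expectation (\<lambda>\<omega>. indicator {\<omega>. \<bar>X 0 \<omega>\<bar> > \<epsilon> * x} \<omega> * w \<omega> + indicator {\<omega>. \<bar>X 0 \<omega>\<bar> > K * x} \<omega>)"
      by (rule order_trans[OF integral_norm_bound integral_mono])
        (use fi Si wi integrable_indicator_tail[of "K * x"] pt[OF elim(3)] in auto)
    also have "\<dots> = expectation (\<lambda>\<omega>. indicator {\<omega>. \<bar>X 0 \<omega>\<bar> > \<epsilon> * x} \<omega> * w \<omega>) + T (K * x)"
      using wi integrable_indicator_tail[of "K * x"] by simp
    finally have "cmod (expectation (f x) - expectation (S x)) / T x \<le>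
       expectation (\<lambda>\<omega>. indicator {\<omega>. \<bar>X 0 \<omega>\<bar> > \<epsilon> * x} \<omega> * w \<omega>) / T x + T (K * x) / T x"
      using T_pos[of x] by (simp add: divide_right_mono add_divide_distrib[symmetric])
    also have "\<dots> \<le> e" using elim(1,2) unfolding w_def by linarith
    finally show ?case
      using T_pos[of x] by (simp add: diff_divide_distrib[symmetric] norm_divide)
  qed
  then show "\<exists>g l. (g \<longlongrightarrow> l) at_top \<and> (\<forall>\<^sub>F x in at_top. cmod (expectation (\<lambda>\<omega>. indicator {\<omega>. \<bar>X 0 \<omega>\<bar> > \<epsilon> * x} \<omega> *
     iexp (\<bar>X 0 \<omega>\<bar> / x * A (\<Theta> h \<omega>) + (\<bar>X 0 \<omega>\<bar> / x)\<^sup>2 * B (\<Theta> h \<omega>))) / T x - g x) \<le> e)"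
    using l unfolding f_def \<phi>_def by (intro exI[of _ "\<lambda>x. expectation (S x) / T x"] exI[of _ l] conjI)
qed simp

section \<open>Compensated increments\<close>

definition cen :: real where "cen = (if \<kappa> > 1 then 1 else 0)"

text \<open>A term of the telescoping sum without its linear part. For \<open>\<kappa> > 1\<close>
  the subtraction leaves, for a small observation at time 0, squares and products of observations,
  whose truncated moments are manageable; for \<open>\<kappa> < 1\<close> the first order is already
  negligible.\<close>

definition increment :: "real \<Rightarrow> real \<Rightarrow> nat \<Rightarrow> real \<Rightarrow> 'a \<Rightarrow> complex" where
  "increment u v k x \<omega> = (phase u v (X 0 \<omega> / x) - 1) * (\<Prod>t\<in>{1..k}. phase u v (X (int t) \<omega> / x)) - \<i> * of_real (cen * u * (X 0 \<omega> / x))"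

lemma integrable_X0: "\<kappa> > 1 \<Longrightarrow> integrable M (X 0)"
proof -
  assume k: "\<kappa> > 1"
  define p where "p = (1 + \<kappa>) / 2"
  have p: "0 < p" "p < \<kappa>" "1 < p" using k by (auto simp: p_def)
  obtain C where "integrable M (\<lambda>\<omega>. \<bar>X 0 \<omega>\<bar> powr p)" using tail_moment_bound[OF p(1,2)] by blast
  then have "integrable M (\<lambda>\<omega>. 1 + \<bar>X 0 \<omega>\<bar> powr p)" by simp
  then show ?thesis
  proof (rule Bochner_Integration.integrable_bound)
    show "AE \<omega> in M. norm (X 0 \<omega>) \<le> norm (1 + \<bar>X 0 \<omega>\<bar> powr p)"
    proof (rule AE_I2)
      fix \<omega>
      show "norm (X 0 \<omega>) \<le> norm (1 + \<bar>X 0 \<omega>\<bar> powr p)"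
      proof (cases "\<bar>X 0 \<omega>\<bar> \<le> 1")
        case False
        then have "\<bar>X 0 \<omega>\<bar> powr 1 \<le> \<bar>X 0 \<omega>\<bar> powr p" using p by (intro powr_mono) auto
        then show ?thesis using False by simp
      qed (simp add: add_increasing2)
    qed
  qed simp
qed

lemma integrable_cen_X0: "integrable M (\<lambda>\<omega>. cen * X 0 \<omega>)"
  using integrable_X0 by (cases "\<kappa> > 1") (auto simp: cen_def)

lemma increment_integrable: "integrable M (increment u v k x)"
proof -
  have 1: "integrable M (\<lambda>\<omega>. (phase u v (X 0 \<omega> / x) - 1) * (\<Prod>t\<in>{1..k}. phase u v (X (int t) \<omega> / x)))"
  proof (rule integrable_const_bound[where B = 2])
    show "AE \<omega> in M. cmod ((phase u v (X 0 \<omega> / x) - 1) * (\<Prod>t\<in>{1..k}. phase u v (X (int t) \<omega> / x))) \<le> 2"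
    proof (rule AE_I2)
      fix \<omega>
      have "cmod (phase u v (X 0 \<omega> / x) - 1) \<le> 2"
        using norm_triangle_ineq4[of "phase u v (X 0 \<omega> / x)" 1] by simp
      then show "cmod ((phase u v (X 0 \<omega> / x) - 1) * (\<Prod>t\<in>{1..k}. phase u v (X (int t) \<omega> / x))) \<le> 2"
        by (simp add: norm_mult prod_norm[symmetric])
    qed
  qed measurable
  have 2: "integrable M (\<lambda>\<omega>. \<i> * of_real (u / x * (cen * X 0 \<omega>)) :: complex)"
    by (intro integrable_mult_right integrable_of_real integrable_cen_X0)
  have "integrable M (\<lambda>\<omega>. (phase u v (X 0 \<omega> / x) - 1) * (\<Prod>t\<in>{1..k}. phase u v (X (int t) \<omega> / x)) - \<i> * of_real (u / x * (cen * X 0 \<omega>)))"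
    by (rule Bochner_Integration.integrable_diff[OF 1 2])
  also have "(\<lambda>\<omega>. (phase u v (X 0 \<omega> / x) - 1) * (\<Prod>t\<in>{1..k}. phase u v (X (int t) \<omega> / x)) - \<i> * of_real (u / x * (cen * X 0 \<omega>))) = increment u v k x"
    by (simp add: increment_def fun_eq_iff mult_ac)
  finally show ?thesis .
qed

lemma second_moment_bound:
  obtains C where "C > 0" "\<And>\<epsilon> t. \<epsilon> > 0 \<Longrightarrow> \<forall>\<^sub>F x in at_top. expectation (\<lambda>\<omega>. (min \<bar>X t \<omega> / x\<bar> \<epsilon>)\<^sup>2) / T x \<le> C * \<epsilon> powr (2 - \<kappa>)"
proof -
  obtain C where C: "C > 0" "\<And>\<epsilon>. \<epsilon> > 0 \<Longrightarrow> \<forall>\<^sub>F x in at_top. expectation (\<lambda>\<omega>. (min (\<bar>X 0 \<omega>\<bar> / x) \<epsilon>)\<^sup>2) / T x \<le> C * \<epsilon> powr (real 2 - \<kappa>)"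
    using truncated_second_moment_ratio[of 2] \<kappa>_pos by auto
  have "\<forall>\<^sub>F x in at_top. expectation (\<lambda>\<omega>. (min \<bar>X t \<omega> / x\<bar> \<epsilon>)\<^sup>2) / T x \<le> C * \<epsilon> powr (2 - \<kappa>)" if "\<epsilon> > 0" for \<epsilon> t
    using C(2)[OF that] eventually_gt_at_top[of 0]
  proof eventually_elim
    case (elim x)
    have "expectation (\<lambda>\<omega>. (min \<bar>X t \<omega> / x\<bar> \<epsilon>)\<^sup>2) = expectation (\<lambda>\<omega>. (min \<bar>X 0 \<omega> / x\<bar> \<epsilon>)\<^sup>2)"
      by (rule stationary_single) measurable
    then show ?case using elim by (simp add: abs_divide)
  qed
  then show ?thesis using that C(1) by blast
qed

lemma first_moment_bound:
  assumes "\<kappa> < 1"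
  obtains C where "C > 0" "\<And>\<epsilon>. \<epsilon> > 0 \<Longrightarrow> \<forall>\<^sub>F x in at_top. expectation (\<lambda>\<omega>. min \<bar>X 0 \<omega> / x\<bar> \<epsilon>) / T x \<le> C * \<epsilon> powr (1 - \<kappa>)"
proof -
  obtain C where C: "C > 0" "\<And>\<epsilon>. \<epsilon> > 0 \<Longrightarrow> \<forall>\<^sub>F x in at_top. expectation (\<lambda>\<omega>. (min (\<bar>X 0 \<omega>\<bar> / x) \<epsilon>) ^ 1) / T x \<le> C * \<epsilon> powr (real 1 - \<kappa>)"
    using truncated_second_moment_ratio[of 1] assms by auto
  have "\<forall>\<^sub>F x in at_top. expectation (\<lambda>\<omega>. min \<bar>X 0 \<omega> / x\<bar> \<epsilon>) / T x \<le> C * \<epsilon> powr (1 - \<kappa>)" if "\<epsilon> > 0" for \<epsilon>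
    using C(2)[OF that] eventually_gt_at_top[of 0] by eventually_elim (simp add: abs_divide)
  then show ?thesis using that C(1) by blast
qed

end

subsection \<open>Limits of the telescoping increments\<close>

lemma exists_small_powr:
  fixes s d :: real
  assumes "s > 0" "d > 0"
  obtains \<epsilon> where "0 < \<epsilon>" "\<epsilon> \<le> 1" "\<epsilon> powr s \<le> d"
proof (rule that[of "min 1 (d powr (1 / s))"])
  have "(min 1 (d powr (1 / s))) powr s \<le> (d powr (1 / s)) powr s"
    using assms by (intro powr_mono2) auto
  also have "\<dots> = d" using assms by (simp add: powr_powr)
  finally show "(min 1 (d powr (1 / s))) powr s \<le> d" .
qed (use assms in auto)

text \<open>\<open>m * sin (x / m)\<close> is a bounded substitute for the linear compensator, and a
  combination of two exponentials. The error carries the small factor \<open>m powr (1 - p)\<close>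
  in front of a power of order \<open>p\<close>; with \<open>1 < p < \<kappa>\<close> that moment is
  finite.\<close>

lemma abs_sine_remainder_le:
  fixes x m p :: real
  assumes m: "m > 0" and p: "1 < p" "p \<le> 2"
  shows "\<bar>x - m * sin (x / m)\<bar> \<le> 2 * m powr (1 - p) * \<bar>x\<bar> powr p"
proof -
  define z where "z = x / m"
  have x: "x = m * z" using m by (simp add: z_def)
  have "\<bar>z - sin z\<bar> \<le> 2 * \<bar>z\<bar> powr p"
  proof (cases "\<bar>z\<bar> \<le> 1")
    case True
    have "\<bar>z - sin z\<bar> = \<bar>Im (iexp z - 1 - \<i> * of_real z)\<bar>" by (simp add: Im_exp)
    also have "\<dots> \<le> cmod (iexp z - 1 - \<i> * of_real z)" by (rule abs_Im_le_cmod)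
    also have "\<dots> \<le> z\<^sup>2" by (rule cmod_iexp_taylor)
    also have "z\<^sup>2 = \<bar>z\<bar>\<^sup>2" by simp
    also have "\<dots> \<le> \<bar>z\<bar> powr p"
    proof (cases "z = 0")
      case False
      have "\<bar>z\<bar>\<^sup>2 = \<bar>z\<bar> powr 2" using False by (simp add: powr_numeral)
      also have "\<dots> \<le> \<bar>z\<bar> powr p" using True p False by (intro powr_mono') auto
      finally show ?thesis .
    qed simp
    finally show ?thesis using powr_ge_zero[of "\<bar>z\<bar>" p] by linarith
  next
    case False
    have "\<bar>z - sin z\<bar> \<le> \<bar>z\<bar> + 1" using abs_sin_le_one[of z] by linarith
    moreover have "\<bar>z\<bar> powr 1 \<le> \<bar>z\<bar> powr p" using False p by (intro powr_mono) auto
    ultimately show ?thesis using False by simp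
  qed
  then have "m * \<bar>z - sin z\<bar> \<le> m * (2 * \<bar>z\<bar> powr p)" using m by simp
  moreover have "\<bar>x - m * sin (x / m)\<bar> = m * \<bar>z - sin z\<bar>"
    unfolding x using m by (simp add: abs_mult right_diff_distrib[symmetric])
  moreover have "m * (2 * \<bar>z\<bar> powr p) = 2 * m powr (1 - p) * \<bar>x\<bar> powr p"
    unfolding x using m by (simp add: abs_mult powr_mult powr_diff)
  ultimately show ?thesis by simp
qed

context rv_stationary
begin

text \<open>Without compensator the increment is bounded by a multiple of
  \<open>min \<bar>X 0 / x\<bar> 1\<close>, and for \<open>\<kappa> < 1\<close> the first moment
  truncated at \<open>\<epsilon>\<close> is of order
  \<open>\<epsilon> powr (1 - \<kappa>)\<close>.\<close>

lemma increment_small_le_1: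
  assumes k1: "\<kappa> < 1" and e: "e > 0"
  shows "\<exists>\<epsilon>>0. \<forall>\<^sub>F x in at_top. expectation (\<lambda>\<omega>. indicator {\<omega>. \<bar>X 0 \<omega>\<bar> \<le> \<epsilon> * x} \<omega> * cmod (increment u v k x \<omega>)) / T x \<le> e"
proof -
  obtain C where C: "C > 0" "\<And>\<epsilon>. \<epsilon> > 0 \<Longrightarrow> \<forall>\<^sub>F x in at_top. expectation (\<lambda>\<omega>. min \<bar>X 0 \<omega> / x\<bar> \<epsilon>) / T x \<le> C * \<epsilon> powr (1 - \<kappa>)"
    using first_moment_bound[OF k1] by blast
  define K where "K = phase_const u v"
  have K: "K > 0" unfolding K_def by (rule phase_const_pos)
  obtain \<epsilon> where \<epsilon>: "0 < \<epsilon>" "\<epsilon> \<le> 1" "\<epsilon> powr (1 - \<kappa>) \<le> e / (K * C)"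
    using exists_small_powr[of "1 - \<kappa>" "e / (K * C)"] k1 e K C by auto
  have "\<forall>\<^sub>F x in at_top. expectation (\<lambda>\<omega>. indicator {\<omega>. \<bar>X 0 \<omega>\<bar> \<le> \<epsilon> * x} \<omega> * cmod (increment u v k x \<omega>)) / T x \<le> e"
    using C(2)[OF \<epsilon>(1)] eventually_gt_at_top[of 0]
  proof eventually_elim
    case (elim x)
    have mi: "integrable M (\<lambda>\<omega>. min \<bar>X 0 \<omega> / x\<bar> \<epsilon>)"
      by (rule integrable_const_bound[where B = \<epsilon>]) (use \<epsilon> in auto)
    have "expectation (\<lambda>\<omega>. indicator {\<omega>. \<bar>X 0 \<omega>\<bar> \<le> \<epsilon> * x} \<omega> * cmod (increment u v k x \<omega>)) \<le> expectation (\<lambda>\<omega>. K * min \<bar>X 0 \<omega> / x\<bar> \<epsilon>)"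
    proof (rule integral_mono')
      show "integrable M (\<lambda>\<omega>. K * min \<bar>X 0 \<omega> / x\<bar> \<epsilon>)" using mi by simp
      fix \<omega>
      show "0 \<le> K * min \<bar>X 0 \<omega> / x\<bar> \<epsilon>" using K \<epsilon> by simp
      show "indicator {\<omega>. \<bar>X 0 \<omega>\<bar> \<le> \<epsilon> * x} \<omega> * cmod (increment u v k x \<omega>) \<le> K * min \<bar>X 0 \<omega> / x\<bar> \<epsilon>"
      proof (cases "\<bar>X 0 \<omega>\<bar> \<le> \<epsilon> * x")
        case True
        then have s: "\<bar>X 0 \<omega> / x\<bar> \<le> \<epsilon>" using elim by (simp add: abs_divide pos_divide_le_eq)
        have "cmod (increment u v k x \<omega>) = cmod (phase u v (X 0 \<omega> / x) - 1)"
          using k1 by (simp add: increment_def cen_def norm_mult prod_norm[symmetric])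
        also have "\<dots> \<le> K * min \<bar>X 0 \<omega> / x\<bar> 1" unfolding K_def by (rule cmod_phase_minus_1_le)
        also have "min \<bar>X 0 \<omega> / x\<bar> 1 = min \<bar>X 0 \<omega> / x\<bar> \<epsilon>" using s \<epsilon> by simp
        finally show ?thesis using True by simp
      next
        case False
        then show ?thesis using K \<epsilon> by simp
      qed
    qed
    also have "\<dots> = K * expectation (\<lambda>\<omega>. min \<bar>X 0 \<omega> / x\<bar> \<epsilon>)" by simp
    finally have "expectation (\<lambda>\<omega>. indicator {\<omega>. \<bar>X 0 \<omega>\<bar> \<le> \<epsilon> * x} \<omega> * cmod (increment u v k x \<omega>)) / T x \<le> K * (expectation (\<lambda>\<omega>. min \<bar>X 0 \<omega> / x\<bar> \<epsilon>) / T x)"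
      using T_pos[of x] by (simp add: divide_right_mono)
    also have "\<dots> \<le> K * (C * \<epsilon> powr (1 - \<kappa>))" using elim K by (intro mult_left_mono) auto
    also have "\<dots> \<le> K * (C * (e / (K * C)))" using \<epsilon> K C by (intro mult_left_mono) auto
    also have "\<dots> = e" using K C by simp
    finally show ?case .
  qed
  then show ?thesis using \<epsilon> by blast
qed

text \<open>With \<open>P\<close> the product of the later factors, the increment is
  \<open>(phase u v (y 0) - 1) * (P - 1)\<close> plus a compensated factor that is quadratic in
  \<open>y 0\<close>. The first term is bilinear in the small \<open>y 0\<close> and in the later
  observations, which need not be small; a weighted inequality between products and squares puts the
  large weight on \<open>y 0\<close>.\<close>

lemma increment_small_gt_1:
  assumes k1: "\<kappa> > 1" and e: "e > 0"
  shows "\<exists>\<epsilon>>0. \<forall>\<^sub>F x in at_top. expectation (\<lambda>\<omega>. indicator {\<omega>. \<bar>X 0 \<omega>\<bar> \<le> \<epsilon> * x} \<omega> * cmod (increment u v k x \<omega>)) / T x \<le> e"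
proof -
  obtain C where C: "C > 0" "\<And>\<epsilon> t. \<epsilon> > 0 \<Longrightarrow> \<forall>\<^sub>F x in at_top. expectation (\<lambda>\<omega>. (min \<bar>X t \<omega> / x\<bar> \<epsilon>)\<^sup>2) / T x \<le> C * \<epsilon> powr (2 - \<kappa>)"
    using second_moment_bound by blast
  define K where "K = (phase_const u v)\<^sup>2"
  define K1 where "K1 = (\<bar>u\<bar> + \<bar>v\<bar>)\<^sup>2 + \<bar>v\<bar>"
  have K: "K > 0" unfolding K_def using phase_const_pos[of u v] by simp
  have K1: "K1 \<ge> 0" unfolding K1_def by simp
  \<comment> \<open>The weight in
    \<open>2 * x * y \<le> \<rho> * x\<^sup>2 + y\<^sup>2 / \<rho>\<close>, so large that the later
    observations contribute at most \<open>e / 2\<close>; the added 1 keeps it positive when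
    \<open>k = 0\<close>.\<close>
  define \<rho> where "\<rho> = 2 * real k * K * C / e + 1"
  have \<rho>: "\<rho> > 0" unfolding \<rho>_def using K C e by (simp add: add_nonneg_pos)
  \<comment> \<open>The total coefficient of \<open>(y 0)\<^sup>2\<close>, with 1 added for
    positivity; \<open>\<epsilon>\<close> is then chosen against it.\<close>
  define D where "D = K1 + real k * K * \<rho> + 1"
  have D: "D > 0" unfolding D_def using K1 K \<rho> by (simp add: add_nonneg_pos)
  obtain \<epsilon> where \<epsilon>: "0 < \<epsilon>" "\<epsilon> \<le> 1" "\<epsilon> powr (2 - \<kappa>) \<le> e / (2 * D * C)"
    using exists_small_powr[of "2 - \<kappa>" "e / (2 * D * C)"] \<kappa>_pos e D C by auto
  have all: "\<forall>\<^sub>F x in at_top. \<forall>t\<in>{1..k}. expectation (\<lambda>\<omega>. (min \<bar>X (int t) \<omega> / x\<bar> 1)\<^sup>2) / T x \<le> C"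
  proof (rule eventually_ball_finite)
    show "\<forall>t\<in>{1..k}. \<forall>\<^sub>F x in at_top. expectation (\<lambda>\<omega>. (min \<bar>X (int t) \<omega> / x\<bar> 1)\<^sup>2) / T x \<le> C"
      using C(2)[of 1] by simp
  qed simp
  have mi: "integrable M (\<lambda>\<omega>. (min \<bar>X t \<omega> / x\<bar> s)\<^sup>2)" if "s > 0" for t x s
    by (rule integrable_const_bound[where B = "s\<^sup>2"]) (use that in \<open>auto intro!: power_mono\<close>)
  have "\<forall>\<^sub>F x in at_top. expectation (\<lambda>\<omega>. indicator {\<omega>. \<bar>X 0 \<omega>\<bar> \<le> \<epsilon> * x} \<omega> * cmod (increment u v k x \<omega>)) / T x \<le> e"
    using C(2)[OF \<epsilon>(1), of 0] all eventually_gt_at_top[of 0]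
  proof eventually_elim
    case (elim x)
    define b where "b \<omega> = D * (min \<bar>X 0 \<omega> / x\<bar> \<epsilon>)\<^sup>2 + (\<Sum>t\<in>{1..k}. K / \<rho> * (min \<bar>X (int t) \<omega> / x\<bar> 1)\<^sup>2)" for \<omega>
    have b0: "0 \<le> b \<omega>" for \<omega> unfolding b_def using D K \<rho> by (intro add_nonneg_nonneg sum_nonneg) auto
    have bi: "integrable M b"
      unfolding b_def using mi \<epsilon> by (intro Bochner_Integration.integrable_add integrable_mult_right Bochner_Integration.integrable_sum) auto
    have "expectation (\<lambda>\<omega>. indicator {\<omega>. \<bar>X 0 \<omega>\<bar> \<le> \<epsilon> * x} \<omega> * cmod (increment u v k x \<omega>)) \<le> expectation b"
    proof (rule integral_mono'[OF bi])
      fix \<omega>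
      show "0 \<le> b \<omega>" by (rule b0)
      show "indicator {\<omega>. \<bar>X 0 \<omega>\<bar> \<le> \<epsilon> * x} \<omega> * cmod (increment u v k x \<omega>) \<le> b \<omega>"
      proof (cases "\<bar>X 0 \<omega>\<bar> \<le> \<epsilon> * x")
        case True
        define y where "y t = X (int t) \<omega> / x" for t :: nat
        define m where "m t = min \<bar>y t\<bar> 1" for t
        have s: "\<bar>y 0\<bar> \<le> \<epsilon>" unfolding y_def using True elim by (simp add: abs_divide pos_divide_le_eq)
        have m0: "m 0 = \<bar>y 0\<bar>" unfolding m_def using s \<epsilon> by simp
        have m_nonneg: "0 \<le> m 0 * m t" for t unfolding m_def by simp
        define P where "P = (\<Prod>t\<in>{1..k}. phase u v (y t))"
        have "increment u v k x \<omega> = (phase u v (y 0) - 1) * (P - 1) + (phase u v (y 0) - 1 - \<i> * of_real (u * y 0))"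
          using k1 by (simp add: increment_def cen_def P_def y_def algebra_simps)
        then have "cmod (increment u v k x \<omega>) \<le> cmod (phase u v (y 0) - 1) * cmod (P - 1) + cmod (phase u v (y 0) - 1 - \<i> * of_real (u * y 0))"
          by (metis norm_triangle_ineq norm_mult)
        also have "\<dots> \<le> (phase_const u v * m 0) * (phase_const u v * (\<Sum>t\<in>{1..k}. m t)) + K1 * (y 0)\<^sup>2"
        proof (intro add_mono mult_mono)
          show "cmod (phase u v (y 0) - 1) \<le> phase_const u v * m 0" unfolding m_def by (rule cmod_phase_minus_1_le)
          show "cmod (P - 1) \<le> phase_const u v * (\<Sum>t\<in>{1..k}. m t)" unfolding m_def P_def by (rule cmod_prod_phase_minus_1_le) simp
          show "cmod (phase u v (y 0) - 1 - \<i> * of_real (u * y 0)) \<le> K1 * (y 0)\<^sup>2"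
            unfolding K1_def by (rule cmod_phase_taylor) (use s \<epsilon> in simp)
        qed (use phase_const_pos[of u v] in \<open>auto simp: m_def\<close>)
        also have "(phase_const u v * m 0) * (phase_const u v * (\<Sum>t\<in>{1..k}. m t)) = (\<Sum>t\<in>{1..k}. K * (m 0 * m t))"
          by (simp add: K_def power2_eq_square sum_distrib_left mult_ac)
        also have "\<dots> \<le> (\<Sum>t\<in>{1..k}. K * (\<rho> * (m 0)\<^sup>2 + (m t)\<^sup>2 / \<rho>))"
        proof (intro sum_mono mult_left_mono)
          fix t
          have "0 \<le> (\<rho> * m 0 - m t)\<^sup>2" by simp
          then have "2 * \<rho> * (m 0 * m t) \<le> \<rho>\<^sup>2 * (m 0)\<^sup>2 + (m t)\<^sup>2" by (simp add: power2_eq_square algebra_simps)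
          then have "2 * (m 0 * m t) \<le> (\<rho>\<^sup>2 * (m 0)\<^sup>2 + (m t)\<^sup>2) / \<rho>" using \<rho> by (simp add: pos_le_divide_eq mult_ac)
          also have "\<dots> = \<rho> * (m 0)\<^sup>2 + (m t)\<^sup>2 / \<rho>" using \<rho> by (simp add: add_divide_distrib power2_eq_square)
          finally show "m 0 * m t \<le> \<rho> * (m 0)\<^sup>2 + (m t)\<^sup>2 / \<rho>"
            using m_nonneg[of t] by linarith
        qed (use K in simp)
        also have "\<dots> = real k * K * \<rho> * (y 0)\<^sup>2 + (\<Sum>t\<in>{1..k}. K / \<rho> * (m t)\<^sup>2)"
          by (simp add: m0 distrib_left sum.distrib sum_distrib_left mult_ac)
        finally have "cmod (increment u v k x \<omega>) \<le> (K1 + real k * K * \<rho>) * (y 0)\<^sup>2 + (\<Sum>t\<in>{1..k}. K / \<rho> * (m t)\<^sup>2)"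
          by (simp add: algebra_simps)
        also have "\<dots> \<le> D * (y 0)\<^sup>2 + (\<Sum>t\<in>{1..k}. K / \<rho> * (m t)\<^sup>2)"
          unfolding D_def by (intro add_right_mono mult_right_mono) auto
        also have "(y 0)\<^sup>2 = (min \<bar>X 0 \<omega> / x\<bar> \<epsilon>)\<^sup>2"
        proof -
          have "min \<bar>X 0 \<omega> / x\<bar> \<epsilon> = \<bar>y 0\<bar>" using s by (simp add: y_def)
          then show ?thesis by (simp only: power2_abs)
        qed
        finally show ?thesis using True unfolding b_def m_def y_def by simp
      next
        case False
        then show ?thesis using b0 by simp
      qed
    qed
    also have "expectation b = D * expectation (\<lambda>\<omega>. (min \<bar>X 0 \<omega> / x\<bar> \<epsilon>)\<^sup>2) + (\<Sum>t\<in>{1..k}. K / \<rho> * expectation (\<lambda>\<omega>. (min \<bar>X (int t) \<omega> / x\<bar> 1)\<^sup>2))"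
      unfolding b_def using mi[OF \<epsilon>(1)] mi[of 1]
      by (subst Bochner_Integration.integral_add) (auto intro!: Bochner_Integration.integrable_sum)
    finally have "expectation (\<lambda>\<omega>. indicator {\<omega>. \<bar>X 0 \<omega>\<bar> \<le> \<epsilon> * x} \<omega> * cmod (increment u v k x \<omega>)) / T x
      \<le> (D * expectation (\<lambda>\<omega>. (min \<bar>X 0 \<omega> / x\<bar> \<epsilon>)\<^sup>2) + (\<Sum>t\<in>{1..k}. K / \<rho> * expectation (\<lambda>\<omega>. (min \<bar>X (int t) \<omega> / x\<bar> 1)\<^sup>2))) / T x"
      using T_pos[of x] by (intro divide_right_mono) auto
    also have "\<dots> = D * (expectation (\<lambda>\<omega>. (min \<bar>X 0 \<omega> / x\<bar> \<epsilon>)\<^sup>2) / T x) + (\<Sum>t\<in>{1..k}. K / \<rho> * (expectation (\<lambda>\<omega>. (min \<bar>X (int t) \<omega> / x\<bar> 1)\<^sup>2) / T x))"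
      by (simp only: add_divide_distrib sum_divide_distrib times_divide_eq_right)
    also have "\<dots> \<le> D * (C * \<epsilon> powr (2 - \<kappa>)) + (\<Sum>t\<in>{1..k}. K / \<rho> * C)"
      using elim D K \<rho> by (intro add_mono sum_mono mult_left_mono) auto
    also have "\<dots> \<le> D * (C * (e / (2 * D * C))) + (\<Sum>t\<in>{1..k}. K / \<rho> * C)"
      using \<epsilon> D C by (intro add_right_mono mult_left_mono) auto
    also have "\<dots> = e / 2 + real k * K * C / \<rho>" using D C by simp
    also have "\<dots> \<le> e / 2 + e / 2"
    proof (rule add_left_mono)
      have "e * \<rho> = 2 * (real k * K * C) + e" unfolding \<rho>_def using e by (simp add: distrib_left)
      then have "real k * K * C \<le> (e / 2) * \<rho>" using e by simp
      then show "real k * K * C / \<rho> \<le> e / 2" using \<rho> by (simp add: pos_divide_le_eq)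
    qed
    finally show ?case by simp
  qed
  then show ?thesis using \<epsilon> by blast
qed

lemma increment_small:
  assumes "e > 0"
  shows "\<exists>\<epsilon>>0. \<forall>\<^sub>F x in at_top. expectation (\<lambda>\<omega>. indicator {\<omega>. \<bar>X 0 \<omega>\<bar> \<le> \<epsilon> * x} \<omega> * cmod (increment u v k x \<omega>)) / T x \<le> e"
proof (cases "\<kappa> < 1")
  case True
  then show ?thesis using assms by (rule increment_small_le_1)
next
  case False
  then have "\<kappa> > 1" using \<kappa> by auto
  then show ?thesis using assms by (rule increment_small_gt_1)
qed

text \<open>The tail moment above \<open>\<epsilon> * x\<close> is bounded by a constant depending
  on \<open>\<epsilon>\<close>; a large \<open>m = 1 / q\<close> outweighs it through
  \<open>m powr (1 - p)\<close>, with \<open>p\<close> midway between 1 and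
  \<open>\<kappa>\<close>.\<close>

lemma sine_remainder:
  assumes k1: "\<kappa> > 1" and \<epsilon>: "\<epsilon> > 0" and e: "e > 0"
  shows "\<exists>m>0. \<forall>\<^sub>F x in at_top. expectation (\<lambda>\<omega>. indicator {\<omega>. \<bar>X 0 \<omega>\<bar> > \<epsilon> * x} \<omega> * \<bar>X 0 \<omega> / x - m * sin (X 0 \<omega> / x / m)\<bar>) / T x \<le> e"
proof -
  define p where "p = (1 + \<kappa>) / 2"
  have p: "0 < p" "p < \<kappa>" "1 < p" "p \<le> 2" using k1 \<kappa>_pos by (auto simp: p_def)
  have pi: "integrable M (\<lambda>\<omega>. \<bar>X 0 \<omega>\<bar> powr p)" using tail_moment_bound[OF p(1,2)] by blast
  obtain C where C: "C > 0" "\<forall>\<^sub>F x in at_top. expectation (\<lambda>\<omega>. indicator {\<omega>. \<bar>X 0 \<omega>\<bar> > \<epsilon> * x} \<omega> * (\<bar>X 0 \<omega>\<bar> / x) powr p) / T x \<le> C"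
    using tail_moment_ratio[OF p(1,2) \<epsilon>] by blast
  obtain q where q: "0 < q" "q \<le> 1" "q powr (p - 1) \<le> e / (2 * C)"
    using exists_small_powr[of "p - 1" "e / (2 * C)"] p e C by auto
  define m where "m = 1 / q"
  have m: "m > 0" unfolding m_def using q by simp
  have mp: "m powr (1 - p) \<le> e / (2 * C)"
    using q by (simp add: m_def powr_divide powr_minus_divide[symmetric])
  have "\<forall>\<^sub>F x in at_top. expectation (\<lambda>\<omega>. indicator {\<omega>. \<bar>X 0 \<omega>\<bar> > \<epsilon> * x} \<omega> * \<bar>X 0 \<omega> / x - m * sin (X 0 \<omega> / x / m)\<bar>) / T x \<le> e"
    using C(2) eventually_gt_at_top[of 0]
  proof eventually_elim
    case (elim x)
    have bi: "integrable M (\<lambda>\<omega>. indicator {\<omega>. \<bar>X 0 \<omega>\<bar> > \<epsilon> * x} \<omega> * (\<bar>X 0 \<omega>\<bar> / x) powr p)"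
    proof (rule Bochner_Integration.integrable_bound)
      show "integrable M (\<lambda>\<omega>. \<bar>X 0 \<omega>\<bar> powr p / x powr p)" using pi by simp
      show "AE \<omega> in M. norm (indicator {\<omega>. \<bar>X 0 \<omega>\<bar> > \<epsilon> * x} \<omega> * (\<bar>X 0 \<omega>\<bar> / x) powr p) \<le> norm (\<bar>X 0 \<omega>\<bar> powr p / x powr p)"
        using elim by (auto simp: indicator_def powr_divide)
    qed simp
    have "expectation (\<lambda>\<omega>. indicator {\<omega>. \<bar>X 0 \<omega>\<bar> > \<epsilon> * x} \<omega> * \<bar>X 0 \<omega> / x - m * sin (X 0 \<omega> / x / m)\<bar>)
       \<le> expectation (\<lambda>\<omega>. 2 * m powr (1 - p) * (indicator {\<omega>. \<bar>X 0 \<omega>\<bar> > \<epsilon> * x} \<omega> * (\<bar>X 0 \<omega>\<bar> / x) powr p))"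
    proof (rule integral_mono')
      show "indicator {\<omega>. \<bar>X 0 \<omega>\<bar> > \<epsilon> * x} \<omega> * \<bar>X 0 \<omega> / x - m * sin (X 0 \<omega> / x / m)\<bar>
         \<le> 2 * m powr (1 - p) * (indicator {\<omega>. \<bar>X 0 \<omega>\<bar> > \<epsilon> * x} \<omega> * (\<bar>X 0 \<omega>\<bar> / x) powr p)" for \<omega>
        using abs_sine_remainder_le[OF m p(3,4), of "X 0 \<omega> / x"] elim by (auto simp: indicator_def abs_divide)
    qed (use bi in auto)
    also have "\<dots> = 2 * m powr (1 - p) * expectation (\<lambda>\<omega>. indicator {\<omega>. \<bar>X 0 \<omega>\<bar> > \<epsilon> * x} \<omega> * (\<bar>X 0 \<omega>\<bar> / x) powr p)" by simp
    finally have "expectation (\<lambda>\<omega>. indicator {\<omega>. \<bar>X 0 \<omega>\<bar> > \<epsilon> * x} \<omega> * \<bar>X 0 \<omega> / x - m * sin (X 0 \<omega> / x / m)\<bar>) / T x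
      \<le> 2 * m powr (1 - p) * (expectation (\<lambda>\<omega>. indicator {\<omega>. \<bar>X 0 \<omega>\<bar> > \<epsilon> * x} \<omega> * (\<bar>X 0 \<omega>\<bar> / x) powr p) / T x)"
      using T_pos[of x] by (simp add: divide_right_mono)
    also have "\<dots> \<le> 2 * (e / (2 * C)) * C"
      using elim mp C e T_pos[of x] by (intro mult_mono) (auto intro!: divide_nonneg_pos Bochner_Integration.integral_nonneg)
    also have "\<dots> = e" using C by simp
    finally show ?case .
  qed
  then show ?thesis using m by blast
qed

text \<open>Below \<open>\<epsilon> * x\<close> the increment is negligible. Above, it is up to a
  small error a combination of four exponential functionals of the path: the products with and
  without the factor at time 0, and the two exponentials of the sine that stands for the
  compensator.\<close>

lemma increment_conv: "\<exists>l. ((\<lambda>x. expectation (increment u v k x) / T x) \<longlongrightarrow> l) at_top"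
proof (rule tendsto_of_approximations)
  fix e :: real assume e: "e > 0"
  obtain \<epsilon> where \<epsilon>: "\<epsilon> > 0"
    and small: "\<forall>\<^sub>F x in at_top. expectation (\<lambda>\<omega>. indicator {\<omega>. \<bar>X 0 \<omega>\<bar> \<le> \<epsilon> * x} \<omega> * cmod (increment u v k x \<omega>)) / T x \<le> e / 2"
    using increment_small[OF half_gt_zero[OF e], of u v k] by blast
  \<comment> \<open>The summand 1 in \<open>\<bar>u\<bar> + 1\<close> avoids a division by 0; for
    \<open>\<kappa> < 1\<close> the compensator is absent and any positive \<open>m\<close>
    serves.\<close>
  obtain m where m: "m > 0" and rem: "\<forall>\<^sub>F x in at_top. cen * expectation (\<lambda>\<omega>. indicator {\<omega>. \<bar>X 0 \<omega>\<bar> > \<epsilon> * x} \<omega> * \<bar>X 0 \<omega> / x - m * sin (X 0 \<omega> / x / m)\<bar>) / T x \<le> e / (2 * (\<bar>u\<bar> + 1))"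
  proof (cases "\<kappa> > 1")
    case True
    have "e / (2 * (\<bar>u\<bar> + 1)) > 0" using e by (intro divide_pos_pos) auto
    then show ?thesis using sine_remainder[OF True \<epsilon>] that True by (auto simp: cen_def)
  next
    case False
    show ?thesis by (rule that[of 1]) (use False e in \<open>auto simp: cen_def\<close>)
  qed
  define S where "S I \<theta> = (\<Sum>t\<in>I. \<theta> (int t))" for I and \<theta> :: "int \<Rightarrow> real"
  define Sq where "Sq I \<theta> = (\<Sum>t\<in>I. (\<theta> (int t))\<^sup>2)" for I and \<theta> :: "int \<Rightarrow> real"
  have Sc: "continuous_on UNIV (\<lambda>\<theta>. u * S I \<theta>)" "continuous_on UNIV (\<lambda>\<theta>. v * Sq I \<theta>)" for I
    unfolding S_def Sq_def by (intro continuous_intros continuous_coordinate)+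
  define F where "F A B x \<omega> = indicator {\<omega>. \<bar>X 0 \<omega>\<bar> > \<epsilon> * x} \<omega> * iexp (\<bar>X 0 \<omega>\<bar> / x * A (\<Theta> k \<omega>) + (\<bar>X 0 \<omega>\<bar> / x)\<^sup>2 * B (\<Theta> k \<omega>))" for A B :: "(int \<Rightarrow> real) \<Rightarrow> real" and x \<omega>
  have Flim: "\<exists>l. ((\<lambda>x. expectation (F A B x) / T x) \<longlongrightarrow> l) at_top" if "continuous_on UNIV A" "continuous_on UNIV B" for A B
    unfolding F_def by (rule exp_functional_conv[OF that \<epsilon>])
  have Fint: "integrable M (F A B x)" if "continuous_on UNIV A" "continuous_on UNIV B" for A B x
  proof -
    have [measurable]: "A \<in> borel_measurable borel" "B \<in> borel_measurable borel"
      using that by (auto intro: borel_measurable_continuous_onI)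
    show ?thesis unfolding F_def
      by (rule integrable_const_bound[where B = 1]) (auto simp: indicator_def simp del: of_real_add)
  qed
  define f1 where "f1 = F (\<lambda>\<theta>. u * S {0..k} \<theta>) (\<lambda>\<theta>. v * Sq {0..k} \<theta>)"
  define f2 where "f2 = F (\<lambda>\<theta>. u * S {1..k} \<theta>) (\<lambda>\<theta>. v * Sq {1..k} \<theta>)"
  define f3 where "f3 = F (\<lambda>\<theta>. \<theta> 0 / m) (\<lambda>\<theta>. 0)"
  define f4 where "f4 = F (\<lambda>\<theta>. - (\<theta> 0 / m)) (\<lambda>\<theta>. 0)"
  have c0: "continuous_on UNIV (\<lambda>\<theta> :: int \<Rightarrow> real. \<theta> 0 / m)" "continuous_on UNIV (\<lambda>\<theta> :: int \<Rightarrow> real. - (\<theta> 0 / m))"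
    using m by (auto intro!: continuous_intros continuous_coordinate)
  obtain l1 where l1: "((\<lambda>x. expectation (f1 x) / T x) \<longlongrightarrow> l1) at_top" unfolding f1_def using Flim[OF Sc] by blast
  obtain l2 where l2: "((\<lambda>x. expectation (f2 x) / T x) \<longlongrightarrow> l2) at_top" unfolding f2_def using Flim[OF Sc] by blast
  obtain l3 where l3: "((\<lambda>x. expectation (f3 x) / T x) \<longlongrightarrow> l3) at_top" unfolding f3_def using Flim[OF c0(1) continuous_on_const] by blast
  obtain l4 where l4: "((\<lambda>x. expectation (f4 x) / T x) \<longlongrightarrow> l4) at_top" unfolding f4_def using Flim[OF c0(2) continuous_on_const] by blast
  have int: "integrable M (f1 x)" "integrable M (f2 x)" "integrable M (f3 x)" "integrable M (f4 x)" for x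
    unfolding f1_def f2_def f3_def f4_def by (intro Fint Sc c0 continuous_on_const)+
  define c where "c = complex_of_real (cen * u * m / 2)"
  define g where "g x \<omega> = f1 x \<omega> - f2 x \<omega> - c * (f3 x \<omega> - f4 x \<omega>)" for x \<omega>
  have gi: "integrable M (g x)" for x
    unfolding g_def by (intro Bochner_Integration.integrable_diff integrable_mult_right int)
  have Eg: "expectation (g x) / T x = expectation (f1 x) / T x - expectation (f2 x) / T x - c * (expectation (f3 x) / T x - expectation (f4 x) / T x)" for x
    unfolding g_def using int[of x] by (simp add: diff_divide_distrib right_diff_distrib)
  have lim: "((\<lambda>x. expectation (g x) / T x) \<longlongrightarrow> l1 - l2 - c * (l3 - l4)) at_top"
    unfolding Eg by (intro tendsto_intros l1 l2 l3 l4)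
  have pt: "cmod (increment u v k x \<omega> - g x \<omega>) \<le> indicator {\<omega>. \<bar>X 0 \<omega>\<bar> \<le> \<epsilon> * x} \<omega> * cmod (increment u v k x \<omega>)
      + \<bar>u\<bar> * (cen * (indicator {\<omega>. \<bar>X 0 \<omega>\<bar> > \<epsilon> * x} \<omega> * \<bar>X 0 \<omega> / x - m * sin (X 0 \<omega> / x / m)\<bar>))" if x: "x > 0" for x \<omega>
  proof (cases "\<bar>X 0 \<omega>\<bar> \<le> \<epsilon> * x")
    case True
    then have "g x \<omega> = 0" by (simp add: g_def f1_def f2_def f3_def f4_def F_def)
    then show ?thesis using True by simp
  next
    case False
    then have X0: "\<bar>X 0 \<omega>\<bar> > 0" using \<epsilon> x by (smt (verit) mult_pos_pos)
    have rescale: "\<bar>X 0 \<omega>\<bar> / x * \<Theta> k \<omega> (int t) = X (int t) \<omega> / x" if "t \<le> k" for t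
      using that X0 by (simp add: \<Theta>_def)
    have Fe: "F (\<lambda>\<theta>. u * S I \<theta>) (\<lambda>\<theta>. v * Sq I \<theta>) x \<omega> = (\<Prod>t\<in>I. phase u v (X (int t) \<omega> / x))" if I: "I \<subseteq> {0..k}" for I
    proof -
      have fI: "finite I" using I finite_subset by blast
      have a: "\<bar>X 0 \<omega>\<bar> / x * (u * S I (\<Theta> k \<omega>)) = u * (\<Sum>t\<in>I. X (int t) \<omega> / x)"
      proof -
        have "\<bar>X 0 \<omega>\<bar> / x * (u * S I (\<Theta> k \<omega>)) = u * (\<Sum>t\<in>I. \<bar>X 0 \<omega>\<bar> / x * \<Theta> k \<omega> (int t))"
          unfolding S_def sum_distrib_left[symmetric] by (simp only: mult_ac)
        also have "(\<Sum>t\<in>I. \<bar>X 0 \<omega>\<bar> / x * \<Theta> k \<omega> (int t)) = (\<Sum>t\<in>I. X (int t) \<omega> / x)"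
          by (rule sum.cong[OF refl], rule rescale) (use I in auto)
        finally show ?thesis .
      qed
      have b: "(\<bar>X 0 \<omega>\<bar> / x)\<^sup>2 * (v * Sq I (\<Theta> k \<omega>)) = v * (\<Sum>t\<in>I. (X (int t) \<omega> / x)\<^sup>2)"
      proof -
        have "(\<bar>X 0 \<omega>\<bar> / x)\<^sup>2 * (v * Sq I (\<Theta> k \<omega>)) = v * (\<Sum>t\<in>I. (\<bar>X 0 \<omega>\<bar> / x)\<^sup>2 * (\<Theta> k \<omega> (int t))\<^sup>2)"
          unfolding Sq_def sum_distrib_left[symmetric] by (simp only: mult_ac)
        also have "(\<Sum>t\<in>I. (\<bar>X 0 \<omega>\<bar> / x)\<^sup>2 * (\<Theta> k \<omega> (int t))\<^sup>2) = (\<Sum>t\<in>I. (X (int t) \<omega> / x)\<^sup>2)"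
        proof (rule sum.cong[OF refl])
          fix t assume "t \<in> I"
          then have "t \<le> k" using I by auto
          then show "(\<bar>X 0 \<omega>\<bar> / x)\<^sup>2 * (\<Theta> k \<omega> (int t))\<^sup>2 = (X (int t) \<omega> / x)\<^sup>2"
            unfolding power_mult_distrib[symmetric] by (simp only: rescale)
        qed
        finally show ?thesis .
      qed
      show ?thesis unfolding F_def a b prod_phase_eq_iexp[OF fI] using False by simp
    qed
    have f12: "f1 x \<omega> - f2 x \<omega> = (phase u v (X 0 \<omega> / x) - 1) * (\<Prod>t\<in>{1..k}. phase u v (X (int t) \<omega> / x))"
    proof -
      have "{0..k} = insert 0 {1..k}" by auto
      then have "f1 x \<omega> = phase u v (X 0 \<omega> / x) * (\<Prod>t\<in>{1..k}. phase u v (X (int t) \<omega> / x))"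
        unfolding f1_def by (subst Fe) auto
      moreover have "f2 x \<omega> = (\<Prod>t\<in>{1..k}. phase u v (X (int t) \<omega> / x))"
        unfolding f2_def by (rule Fe) auto
      ultimately show ?thesis by (simp add: left_diff_distrib)
    qed
    have th0: "\<bar>X 0 \<omega>\<bar> / x * (\<Theta> k \<omega> 0 / m) = X 0 \<omega> / x / m"
      unfolding times_divide_eq_right using rescale[of 0] by (simp only: of_nat_0 zero_le)
    have f34: "c * (f3 x \<omega> - f4 x \<omega>) = \<i> * of_real (cen * u * (m * sin (X 0 \<omega> / x / m)))"
    proof -
      have "f3 x \<omega> = iexp (X 0 \<omega> / x / m)" unfolding f3_def F_def th0 using False by simp
      moreover have "f4 x \<omega> = iexp (- (X 0 \<omega> / x / m))" unfolding f4_def F_def mult_minus_right th0 using False by simp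
      ultimately have "f3 x \<omega> - f4 x \<omega> = 2 * \<i> * of_real (sin (X 0 \<omega> / x / m))"
        by (simp add: complex_eq_iff Re_exp Im_exp)
      then show ?thesis unfolding c_def by simp
    qed
    have "increment u v k x \<omega> - g x \<omega> = - \<i> * of_real (cen * u * (X 0 \<omega> / x - m * sin (X 0 \<omega> / x / m)))"
      unfolding g_def f12 f34 increment_def by (simp add: algebra_simps)
    then have "cmod (increment u v k x \<omega> - g x \<omega>) = \<bar>cen * u * (X 0 \<omega> / x - m * sin (X 0 \<omega> / x / m))\<bar>"
      by (simp only: norm_mult norm_of_real) simp
    then show ?thesis using False by (simp add: abs_mult cen_def)
  qed
  have ri: "integrable M (\<lambda>\<omega>. cen * (indicator {\<omega>. \<bar>X 0 \<omega>\<bar> > \<epsilon> * x} \<omega> * \<bar>X 0 \<omega> / x - m * sin (X 0 \<omega> / x / m)\<bar>))" for x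
  proof (rule Bochner_Integration.integrable_bound)
    show "integrable M (\<lambda>\<omega>. \<bar>cen * X 0 \<omega>\<bar> / \<bar>x\<bar> + m)" using integrable_cen_X0 by simp
    show "AE \<omega> in M. norm (cen * (indicator {\<omega>. \<bar>X 0 \<omega>\<bar> > \<epsilon> * x} \<omega> * \<bar>X 0 \<omega> / x - m * sin (X 0 \<omega> / x / m)\<bar>)) \<le> norm (\<bar>cen * X 0 \<omega>\<bar> / \<bar>x\<bar> + m)"
    proof (rule AE_I2)
      fix \<omega>
      have "\<bar>X 0 \<omega> / x - m * sin (X 0 \<omega> / x / m)\<bar> \<le> \<bar>X 0 \<omega>\<bar> / \<bar>x\<bar> + m"
      proof -
        have "\<bar>m * sin (X 0 \<omega> / x / m)\<bar> \<le> m * 1" unfolding abs_mult using m by (intro mult_mono) auto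
        then show ?thesis using abs_triangle_ineq4[of "X 0 \<omega> / x" "m * sin (X 0 \<omega> / x / m)"] by (simp add: abs_divide)
      qed
      then show "norm (cen * (indicator {\<omega>. \<bar>X 0 \<omega>\<bar> > \<epsilon> * x} \<omega> * \<bar>X 0 \<omega> / x - m * sin (X 0 \<omega> / x / m)\<bar>)) \<le> norm (\<bar>cen * X 0 \<omega>\<bar> / \<bar>x\<bar> + m)"
        using m by (auto simp: cen_def indicator_def)
    qed
  qed simp
  have "\<forall>\<^sub>F x in at_top. cmod (expectation (increment u v k x) / T x - expectation (g x) / T x) \<le> e"
    using small rem eventually_gt_at_top[of 0]
  proof eventually_elim
    case (elim x)
    have si: "integrable M (\<lambda>\<omega>. indicator {\<omega>. \<bar>X 0 \<omega>\<bar> \<le> \<epsilon> * x} \<omega> * cmod (increment u v k x \<omega>))"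
    proof (rule Bochner_Integration.integrable_bound[OF integrable_norm[OF increment_integrable[of u v k x]]])
      have [measurable]: "increment u v k x \<in> borel_measurable M" using increment_integrable by simp
      show "(\<lambda>\<omega>. indicator {\<omega>. \<bar>X 0 \<omega>\<bar> \<le> \<epsilon> * x} \<omega> * cmod (increment u v k x \<omega>)) \<in> borel_measurable M" by measurable
    qed (auto simp: indicator_def)
    define r where "r \<omega> = indicator {\<omega>. \<bar>X 0 \<omega>\<bar> > \<epsilon> * x} \<omega> * \<bar>X 0 \<omega> / x - m * sin (X 0 \<omega> / x / m)\<bar>" for \<omega>
    have ri': "integrable M (\<lambda>\<omega>. cen * r \<omega>)" unfolding r_def by (rule ri)
    have "cmod (expectation (increment u v k x) - expectation (g x)) = cmod (expectation (\<lambda>\<omega>. increment u v k x \<omega> - g x \<omega>))"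
      using increment_integrable gi by simp
    also have "\<dots> \<le> expectation (\<lambda>\<omega>. indicator {\<omega>. \<bar>X 0 \<omega>\<bar> \<le> \<epsilon> * x} \<omega> * cmod (increment u v k x \<omega>) + \<bar>u\<bar> * (cen * r \<omega>))"
    proof (rule order_trans[OF integral_norm_bound integral_mono])
      show "integrable M (\<lambda>\<omega>. cmod (increment u v k x \<omega> - g x \<omega>))" using increment_integrable gi by (intro integrable_norm Bochner_Integration.integrable_diff)
      show "integrable M (\<lambda>\<omega>. indicator {\<omega>. \<bar>X 0 \<omega>\<bar> \<le> \<epsilon> * x} \<omega> * cmod (increment u v k x \<omega>) + \<bar>u\<bar> * (cen * r \<omega>))"
        by (rule Bochner_Integration.integrable_add[OF si integrable_mult_right[OF ri']])
    qed (use pt[OF elim(3)] in \<open>simp add: r_def\<close>)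
    also have "\<dots> = expectation (\<lambda>\<omega>. indicator {\<omega>. \<bar>X 0 \<omega>\<bar> \<le> \<epsilon> * x} \<omega> * cmod (increment u v k x \<omega>)) + \<bar>u\<bar> * expectation (\<lambda>\<omega>. cen * r \<omega>)"
      by (subst Bochner_Integration.integral_add[OF si integrable_mult_right[OF ri']]) (simp only: integral_mult_right_zero)
    also have "expectation (\<lambda>\<omega>. cen * r \<omega>) = cen * expectation r" by simp
    finally have "cmod (expectation (increment u v k x) - expectation (g x)) / T x
      \<le> expectation (\<lambda>\<omega>. indicator {\<omega>. \<bar>X 0 \<omega>\<bar> \<le> \<epsilon> * x} \<omega> * cmod (increment u v k x \<omega>)) / T x + \<bar>u\<bar> * (cen * expectation r / T x)"
      using T_pos[of x] by (simp add: divide_right_mono add_divide_distrib[symmetric])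
    also have "\<dots> \<le> e / 2 + \<bar>u\<bar> * (e / (2 * (\<bar>u\<bar> + 1)))"
      using elim unfolding r_def by (intro add_mono mult_left_mono) auto
    also have "\<dots> \<le> e / 2 + e / 2"
    proof (rule add_left_mono)
      have "\<bar>u\<bar> * (e / (2 * (\<bar>u\<bar> + 1))) = (\<bar>u\<bar> / (\<bar>u\<bar> + 1)) * (e / 2)" by simp
      also have "\<dots> \<le> 1 * (e / 2)" using e by (intro mult_right_mono) auto
      finally show "\<bar>u\<bar> * (e / (2 * (\<bar>u\<bar> + 1))) \<le> e / 2" by simp
    qed
    finally show ?case
      using T_pos[of x] by (simp add: diff_divide_distrib[symmetric] norm_divide)
  qed
  then show "\<exists>g l. (g \<longlongrightarrow> l) at_top \<and> (\<forall>\<^sub>F x in at_top. cmod (expectation (increment u v k x) / T x - g x) \<le> e)"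
    using lim by (intro exI[of _ "\<lambda>x. expectation (g x) / T x"] exI[of _ "l1 - l2 - c * (l3 - l4)"] conjI)
qed simp

definition increment_lim :: "real \<Rightarrow> real \<Rightarrow> nat \<Rightarrow> complex" where
  "increment_lim u v k = (SOME l. ((\<lambda>x. expectation (increment u v k x) / T x) \<longlongrightarrow> l) at_top)"

lemma increment_lim: "((\<lambda>x. expectation (increment u v k x) / T x) \<longlongrightarrow> increment_lim u v k) at_top"
  unfolding increment_lim_def by (rule someI_ex[OF increment_conv])

text \<open>Scaling \<open>(u, v)\<close> to \<open>(s * u, s\<^sup>2 * v)\<close> is the same as
  replacing \<open>x\<close> by \<open>x / s\<close>, and the normalisation changes by
  \<open>T (x / s) / T x\<close>, which tends to \<open>s powr \<kappa>\<close>.\<close>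

lemma increment_lim_homogeneous:
  assumes s: "s > 0"
  shows "increment_lim (s * u) (s\<^sup>2 * v) k = of_real (s powr \<kappa>) * increment_lim u v k"
proof -
  have "increment (s * u) (s\<^sup>2 * v) k x = increment u v k (1 / s * x)" for x
  proof -
    have "phase (s * u) (s\<^sup>2 * v) (y / x) = phase u v (y / (1 / s * x))" for y
      using s by (simp add: phase_def power_divide power_mult_distrib mult_ac)
    then show ?thesis using s by (simp add: increment_def fun_eq_iff mult_ac)
  qed
  note sc = this
  have fl: "filterlim (\<lambda>x. 1 / s * x) at_top at_top"
    using s by (intro filterlim_tendsto_pos_mult_at_top[OF tendsto_const _ filterlim_ident]) simp
  have "((\<lambda>x. expectation (increment u v k (1 / s * x)) / T (1 / s * x) * of_real (T (1 / s * x) / T x)) \<longlongrightarrow> increment_lim u v k * of_real ((1 / s) powr (-\<kappa>))) at_top"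
    by (intro tendsto_mult filterlim_compose[OF increment_lim fl] tendsto_of_real T_ratio) (use s in simp)
  also have "(\<lambda>x. expectation (increment u v k (1 / s * x)) / T (1 / s * x) * of_real (T (1 / s * x) / T x)) = (\<lambda>x. expectation (increment (s * u) (s\<^sup>2 * v) k x) / T x)"
    unfolding sc using T_pos by (auto simp: fun_eq_iff less_imp_neq[THEN not_sym])
  finally have "increment_lim (s * u) (s\<^sup>2 * v) k = increment_lim u v k * of_real ((1 / s) powr (-\<kappa>))"
    using increment_lim[of "s * u" "s\<^sup>2 * v" k] by (rule tendsto_unique[OF trivial_limit_at_top_linorder, rotated])
  then show ?thesis using s by (simp add: powr_divide powr_minus_divide mult.commute)
qed

subsection \<open>Mixing between blocks\<close>

text \<open>A real \<open>Sup\<close> dominates its elements only for a set bounded above; 2 is a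
  bound, since every expectation involved has modulus at most 1.\<close>

lemma mixing_coeff_bound:
  fixes g1 g2 :: "(nat \<Rightarrow> real) \<Rightarrow> real"
  assumes [measurable]: "g1 \<in> borel_measurable (PiM UNIV (\<lambda>_. borel))" "g2 \<in> borel_measurable (PiM UNIV (\<lambda>_. borel))"
    and b: "\<And>x. \<bar>g1 x\<bar> \<le> 1" "\<And>x. \<bar>g2 x\<bar> \<le> 1"
  shows "\<bar>expectation (\<lambda>\<omega>. g1 (\<lambda>j. X (- int j) \<omega>) * g2 (\<lambda>j. X (int k + int j) \<omega>))
      - expectation (\<lambda>\<omega>. g1 (\<lambda>j. X (- int j) \<omega>)) * expectation (\<lambda>\<omega>. g2 (\<lambda>j. X (int k + int j) \<omega>))\<bar> \<le> strong_mixing_coeff M X k"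
  unfolding strong_mixing_coeff_def
proof (rule cSup_upper)
  let ?S = "{\<bar>expectation (\<lambda>\<omega>. g1 (\<lambda>j. X (- int j) \<omega>) * g2 (\<lambda>j. X (int k + int j) \<omega>))
            - expectation (\<lambda>\<omega>. g1 (\<lambda>j. X (- int j) \<omega>)) * expectation (\<lambda>\<omega>. g2 (\<lambda>j. X (int k + int j) \<omega>))\<bar>
          | g1 g2. g1 \<in> borel_measurable (PiM UNIV (\<lambda>_::nat. borel :: real measure))
                 \<and> g2 \<in> borel_measurable (PiM UNIV (\<lambda>_::nat. borel :: real measure))
                 \<and> (\<forall>x. \<bar>g1 x\<bar> \<le> (1::real)) \<and> (\<forall>x. \<bar>g2 x\<bar> \<le> (1::real))}"
  show "\<bar>expectation (\<lambda>\<omega>. g1 (\<lambda>j. X (- int j) \<omega>) * g2 (\<lambda>j. X (int k + int j) \<omega>))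
      - expectation (\<lambda>\<omega>. g1 (\<lambda>j. X (- int j) \<omega>)) * expectation (\<lambda>\<omega>. g2 (\<lambda>j. X (int k + int j) \<omega>))\<bar> \<in> ?S"
    using assms by blast
  \<comment> \<open>A non-integrable function has integral 0 by convention, so the bound holds for
    it as well.\<close>
  have E1: "\<bar>expectation f\<bar> \<le> 1" if "\<And>\<omega>. \<bar>f \<omega>\<bar> \<le> 1" for f :: "'a \<Rightarrow> real"
  proof (cases "integrable M f")
    case True
    have "\<bar>expectation f\<bar> \<le> expectation (\<lambda>\<omega>. \<bar>f \<omega>\<bar>)" by (rule integral_abs_bound)
    also have "\<dots> \<le> expectation (\<lambda>\<omega>. 1)" by (rule integral_mono) (use True that in auto)
    finally show ?thesis using prob_space by simp
  qed (simp add: not_integrable_integral_eq)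
  show "bdd_above ?S"
  unfolding bdd_above_def
  proof (intro exI[of _ "2::real"] ballI)
    fix x assume "x \<in> ?S"
    then obtain h1 h2 :: "(nat \<Rightarrow> real) \<Rightarrow> real" where x: "x = \<bar>expectation (\<lambda>\<omega>. h1 (\<lambda>j. X (- int j) \<omega>) * h2 (\<lambda>j. X (int k + int j) \<omega>))
            - expectation (\<lambda>\<omega>. h1 (\<lambda>j. X (- int j) \<omega>)) * expectation (\<lambda>\<omega>. h2 (\<lambda>j. X (int k + int j) \<omega>))\<bar>"
      and h: "\<And>x. \<bar>h1 x\<bar> \<le> 1" "\<And>x. \<bar>h2 x\<bar> \<le> 1" by blast
    have a: "\<bar>expectation (\<lambda>\<omega>. h1 (\<lambda>j. X (- int j) \<omega>) * h2 (\<lambda>j. X (int k + int j) \<omega>))\<bar> \<le> 1"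
      by (rule E1) (use h in \<open>auto simp: abs_mult intro!: mult_le_one\<close>)
    have b: "\<bar>expectation (\<lambda>\<omega>. h1 (\<lambda>j. X (- int j) \<omega>)) * expectation (\<lambda>\<omega>. h2 (\<lambda>j. X (int k + int j) \<omega>))\<bar> \<le> 1"
      unfolding abs_mult by (intro mult_le_one E1 h) auto
    show "x \<le> 2" unfolding x using a b by linarith
  qed
qed

definition Phi :: "(real \<Rightarrow> complex) \<Rightarrow> int set \<Rightarrow> complex" where
  "Phi q I = expectation (\<lambda>\<omega>. \<Prod>t\<in>I. q (X t \<omega>))"

lemma cmod_prod_le_1:
  fixes f :: "'i \<Rightarrow> complex"
  assumes "\<And>t. cmod (f t) \<le> 1"
  shows "cmod (\<Prod>t\<in>I. f t) \<le> 1"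
  unfolding prod_norm[symmetric] by (rule prod_le_1) (use assms in auto)

lemma integrable_prod_q:
  assumes [measurable]: "q \<in> borel_measurable borel" and b: "\<And>y. cmod (q y) \<le> 1"
  shows "integrable M (\<lambda>\<omega>. \<Prod>t\<in>I. q (X t \<omega>))"
  by (rule integrable_const_bound[where B = 1]) (use b in \<open>auto intro!: cmod_prod_le_1\<close>)

lemma cmod_expectation_le_1:
  fixes f :: "'a \<Rightarrow> complex"
  assumes "\<And>\<omega>. cmod (f \<omega>) \<le> 1"
  shows "cmod (expectation f) \<le> 1"
proof (cases "integrable M f")
  case True
  have "cmod (expectation f) \<le> expectation (\<lambda>\<omega>. cmod (f \<omega>))" by (rule integral_norm_bound)
  also have "\<dots> \<le> expectation (\<lambda>\<omega>. 1)" by (rule integral_mono) (use True assms in auto)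
  finally show ?thesis using prob_space by simp
qed (simp add: not_integrable_integral_eq)

lemma Phi_le_1:
  assumes "\<And>y. cmod (q y) \<le> 1"
  shows "cmod (Phi q I) \<le> 1"
  unfolding Phi_def by (intro cmod_expectation_le_1 cmod_prod_le_1 assms)

lemma Phi_shift:
  assumes [measurable]: "q \<in> borel_measurable borel" and I: "finite I"
  shows "Phi q ((+) s ` I) = Phi q I"
proof -
  \<comment> \<open>Start of a window of length \<open>K\<close> that contains \<open>I\<close>;
    inserting 0 keeps minimum and maximum meaningful for empty \<open>I\<close>.\<close>
  define lo where "lo = Min (insert 0 I)"
  define K where "K = nat (Max (insert 0 I) - lo + 1)"
  have lo: "lo \<le> t" "nat (t - lo) < K" "int (nat (t - lo)) = t - lo" if "t \<in> I" for t
  proof -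
    show l: "lo \<le> t" unfolding lo_def using I that by (intro Min_le) auto
    then show "int (nat (t - lo)) = t - lo" by simp
    have "t \<le> Max (insert 0 I)" using I that by (intro Max_ge) auto
    then show "nat (t - lo) < K" unfolding K_def using l by linarith
  qed
  define F where "F x = (\<Prod>t\<in>I. q (x (nat (t - lo))))" for x :: "nat \<Rightarrow> real"
  have [measurable]: "F \<in> borel_measurable (PiM {..<K} (\<lambda>_. borel))"
    unfolding F_def
  proof (rule borel_measurable_prod)
    fix t assume "t \<in> I"
    then have [measurable]: "(\<lambda>x. x (nat (t - lo))) \<in> borel_measurable (PiM {..<K} (\<lambda>_. borel :: real measure))"
      using lo(2) by (intro measurable_component_singleton) auto
    show "(\<lambda>x. q (x (nat (t - lo)))) \<in> borel_measurable (PiM {..<K} (\<lambda>_. borel))" by measurable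
  qed
  have *: "Phi q ((+) s ` I) = expectation (\<lambda>\<omega>. F (\<lambda>i\<in>{..<K}. X (lo + s + int i) \<omega>))" for s
  proof -
    have "(\<Prod>t\<in>(+) s ` I. q (X t \<omega>)) = F (\<lambda>i\<in>{..<K}. X (lo + s + int i) \<omega>)" for \<omega>
    proof -
      have "(\<Prod>t\<in>(+) s ` I. q (X t \<omega>)) = (\<Prod>t\<in>I. q (X (s + t) \<omega>))"
        by (subst prod.reindex) (auto simp: inj_on_def comp_def)
      also have "\<dots> = F (\<lambda>i\<in>{..<K}. X (lo + s + int i) \<omega>)"
        unfolding F_def by (rule prod.cong[OF refl]) (use lo in \<open>simp add: algebra_simps\<close>)
      finally show ?thesis .
    qed
    then show ?thesis by (simp add: Phi_def)
  qed
  have "Phi q ((+) s ` I) = Phi q ((+) 0 ` I)"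
    unfolding * by (subst (1 2) stationary_expectation) auto
  then show ?thesis by (simp add: image_def)
qed

text \<open>The mixing coefficient bounds covariances of real functions; a complex covariance
  consists of four of them, from the real and imaginary parts, hence the factor 4. The past is
  enumerated backwards from 0 and the future forwards from \<open>k\<close>, as in
  \<open>strong_mixing_coeff\<close>.\<close>

lemma Phi_mixing_0:
  assumes [measurable]: "q \<in> borel_measurable borel" and b: "\<And>y. cmod (q y) \<le> 1"
    and fin: "finite I" "finite J" and I: "I \<subseteq> {..0}" and J: "J \<subseteq> {int k..}" and k: "k \<ge> 1"
  shows "cmod (Phi q (I \<union> J) - Phi q I * Phi q J) \<le> 4 * strong_mixing_coeff M X k"
proof -
  define g1 where "g1 x = (\<Prod>t\<in>I. q (x (nat (- t))))" for x :: "nat \<Rightarrow> real"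
  define g2 where "g2 x = (\<Prod>t\<in>J. q (x (nat (t - int k))))" for x :: "nat \<Rightarrow> real"
  have [measurable]: "g1 \<in> borel_measurable (PiM UNIV (\<lambda>_. borel))" "g2 \<in> borel_measurable (PiM UNIV (\<lambda>_. borel))"
    unfolding g1_def g2_def by measurable
  have gb: "cmod (g1 x) \<le> 1" "cmod (g2 x) \<le> 1" for x unfolding g1_def g2_def by (intro cmod_prod_le_1 b)+
  define f where "f \<omega> = g1 (\<lambda>j. X (- int j) \<omega>)" for \<omega>
  define h where "h \<omega> = g2 (\<lambda>j. X (int k + int j) \<omega>)" for \<omega>
  have fe: "f \<omega> = (\<Prod>t\<in>I. q (X t \<omega>))" for \<omega>
    unfolding f_def g1_def by (rule prod.cong[OF refl]) (use I in auto)
  have he: "h \<omega> = (\<Prod>t\<in>J. q (X t \<omega>))" for \<omega>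
    unfolding h_def g2_def by (rule prod.cong[OF refl]) (use J in auto)
  have disj: "I \<inter> J = {}" using I J k by fastforce
  have fhm[measurable]: "f \<in> borel_measurable M" "h \<in> borel_measurable M" unfolding fe[abs_def] he[abs_def] by measurable
  have fb: "cmod (f \<omega>) \<le> 1" "cmod (h \<omega>) \<le> 1" for \<omega> unfolding f_def h_def by (rule gb)+
  have ReIm1: "\<bar>Re z\<bar> \<le> 1" "\<bar>Im z\<bar> \<le> 1" if "cmod z \<le> 1" for z
    using that abs_Re_le_cmod[of z] abs_Im_le_cmod[of z] by linarith+
  define cv where "cv A B = expectation (\<lambda>\<omega>. A (f \<omega>) * B (h \<omega>)) - expectation (\<lambda>\<omega>. A (f \<omega>)) * expectation (\<lambda>\<omega>. B (h \<omega>))" for A B :: "complex \<Rightarrow> real"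
  have cvb: "\<bar>cv A B\<bar> \<le> strong_mixing_coeff M X k"
    if [measurable]: "A \<in> borel_measurable borel" "B \<in> borel_measurable borel" and "\<And>z. cmod z \<le> 1 \<Longrightarrow> \<bar>A z\<bar> \<le> 1" "\<And>z. cmod z \<le> 1 \<Longrightarrow> \<bar>B z\<bar> \<le> 1" for A B
    using mixing_coeff_bound[of "\<lambda>x. A (g1 x)" "\<lambda>x. B (g2 x)" k] that gb unfolding cv_def f_def h_def by simp
  have int: "integrable M (\<lambda>\<omega>. A (f \<omega>) * B (h \<omega>))" "integrable M (\<lambda>\<omega>. A (f \<omega>))" "integrable M (\<lambda>\<omega>. B (h \<omega>))"
    if [measurable]: "A \<in> borel_measurable borel" "B \<in> borel_measurable borel" and A: "\<And>z. cmod z \<le> 1 \<Longrightarrow> \<bar>A z\<bar> \<le> 1" and B: "\<And>z. cmod z \<le> 1 \<Longrightarrow> \<bar>B z\<bar> \<le> 1" for A B :: "complex \<Rightarrow> real"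
    by (rule integrable_const_bound[where B = 1]; use A B fb in \<open>auto simp: abs_mult intro!: mult_le_one\<close>)+
  have ii: "integrable M (\<lambda>\<omega>. f \<omega> * h \<omega>)" "integrable M f" "integrable M h"
    by (rule integrable_const_bound[where B = 1]; use fb in \<open>auto simp: norm_mult intro!: mult_le_one\<close>)+
  have "expectation (\<lambda>\<omega>. f \<omega> * h \<omega>) - expectation f * expectation h = Complex (cv Re Re - cv Im Im) (cv Re Im + cv Im Re)"
  proof -
    have "Re (expectation (\<lambda>\<omega>. f \<omega> * h \<omega>)) = expectation (\<lambda>\<omega>. Re (f \<omega>) * Re (h \<omega>)) - expectation (\<lambda>\<omega>. Im (f \<omega>) * Im (h \<omega>))"
      unfolding integral_Re[OF ii(1), symmetric] using int[of Re Re] int[of Im Im] ReIm1 by simp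
    moreover have "Im (expectation (\<lambda>\<omega>. f \<omega> * h \<omega>)) = expectation (\<lambda>\<omega>. Re (f \<omega>) * Im (h \<omega>)) + expectation (\<lambda>\<omega>. Im (f \<omega>) * Re (h \<omega>))"
      unfolding integral_Im[OF ii(1), symmetric] using int[of Re Im] int[of Im Re] ReIm1 by simp
    ultimately show ?thesis
      unfolding cv_def integral_Re[OF ii(2)] integral_Re[OF ii(3)] integral_Im[OF ii(2)] integral_Im[OF ii(3)]
      by (simp add: complex_eq_iff)
  qed
  also have "cmod \<dots> \<le> \<bar>cv Re Re - cv Im Im\<bar> + \<bar>cv Re Im + cv Im Re\<bar>"
    using cmod_le[of "Complex (cv Re Re - cv Im Im) (cv Re Im + cv Im Re)"] by simp
  also have "\<dots> \<le> 4 * strong_mixing_coeff M X k"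
    using cvb[of Re Re] cvb[of Im Im] cvb[of Re Im] cvb[of Im Re] ReIm1 by simp
  also have "expectation (\<lambda>\<omega>. f \<omega> * h \<omega>) = Phi q (I \<union> J)"
    unfolding Phi_def fe he using fin disj by (simp add: prod.union_disjoint)
  also have "expectation f = Phi q I" unfolding Phi_def fe[abs_def] ..
  also have "expectation h = Phi q J" unfolding Phi_def he[abs_def] ..
  finally show ?thesis .
qed

lemma Phi_mixing:
  assumes q: "q \<in> borel_measurable borel" and b: "\<And>y. cmod (q y) \<le> 1"
    and fin: "finite I" "finite J" and I: "I \<subseteq> {..p}" and J: "J \<subseteq> {p + int k..}" and k: "k \<ge> 1"
  shows "cmod (Phi q (I \<union> J) - Phi q I * Phi q J) \<le> 4 * strong_mixing_coeff M X k"
proof -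
  have "cmod (Phi q ((+) (-p) ` I \<union> (+) (-p) ` J) - Phi q ((+) (-p) ` I) * Phi q ((+) (-p) ` J)) \<le> 4 * strong_mixing_coeff M X k"
    by (rule Phi_mixing_0[OF q b _ _ _ _ k]) (use fin I J in auto)
  then show ?thesis
    unfolding image_Un[symmetric] Phi_shift[OF q fin(1)] Phi_shift[OF q fin(2)] Phi_shift[OF q finite_UnI[OF fin]] .
qed

text \<open>Each new block is separated from the union of the earlier ones by a gap, so one
  application of mixing per block is enough; the errors add up because \<open>Phi\<close> has
  modulus at most 1.\<close>

lemma Phi_blocks:
  assumes q: "q \<in> borel_measurable borel" and b: "\<And>y. cmod (q y) \<le> 1"
    and I: "I \<subseteq> {1..int c}" and k: "k \<ge> 1" and gap: "c + k \<le> d + 1"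
  shows "cmod (Phi q (\<Union>j<m. (+) (int (j * d)) ` I) - Phi q I ^ m) \<le> 4 * real m * strong_mixing_coeff M X k"
proof (induction m)
  case 0
  show ?case using prob_space by (simp add: Phi_def)
next
  case (Suc m)
  have fI: "finite I" using I finite_subset by blast
  define U where "U = (\<Union>j<m. (+) (int (j * d)) ` I)"
  define V where "V = (+) (int (m * d)) ` I"
  have fU: "finite U" "finite V" unfolding U_def V_def using fI by auto
  have eq: "(\<Union>j<Suc m. (+) (int (j * d)) ` I) = U \<union> V"
    unfolding U_def V_def by (auto simp: lessThan_Suc)
  \<comment> \<open>The split point: the new block starts at or after
    \<open>m * d + 1 = p + k\<close>, while the earlier blocks end at or before
    \<open>(m - 1) * d + c \<le> p\<close>, which is what \<open>c + k \<le> d + 1\<close>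
    says.\<close>
  define p where "p = int (m * d) + 1 - int k"
  have Up: "U \<subseteq> {..p}"
  proof
    fix t assume "t \<in> U"
    then obtain j i where j: "j < m" "i \<in> I" "t = int (j * d) + i" unfolding U_def by auto
    have "(j + 1) * d \<le> m * d" using j by (intro mult_right_mono) auto
    then have "int (j * d) + int d \<le> int (m * d)" by (metis add_mult_distrib nat_mult_1 of_nat_add of_nat_le_iff)
    moreover have "i \<le> int c" using j I by auto
    ultimately show "t \<in> {..p}" using j gap unfolding p_def by simp
  qed
  have Vp: "V \<subseteq> {p + int k..}" unfolding V_def p_def using I by auto
  have PV: "Phi q V = Phi q I" unfolding V_def by (rule Phi_shift[OF q fI])
  have split: "Phi q (U \<union> V) - Phi q I ^ Suc m = (Phi q (U \<union> V) - Phi q U * Phi q V) + (Phi q U - Phi q I ^ m) * Phi q I"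
    unfolding PV by (simp add: algebra_simps)
  have 1: "cmod (Phi q (U \<union> V) - Phi q I ^ Suc m) \<le> cmod (Phi q (U \<union> V) - Phi q U * Phi q V) + cmod (Phi q U - Phi q I ^ m) * cmod (Phi q I)"
    unfolding split by (rule order_trans[OF norm_triangle_ineq]) (simp add: norm_mult)
  have 2: "cmod (Phi q (U \<union> V) - Phi q U * Phi q V) \<le> 4 * strong_mixing_coeff M X k"
    by (rule Phi_mixing[OF q b fU(1) fU(2) Up Vp k])
  have IH: "cmod (Phi q U - Phi q I ^ m) \<le> 4 * real m * strong_mixing_coeff M X k"
      using Suc.IH unfolding U_def .
  have "cmod (Phi q U - Phi q I ^ m) * cmod (Phi q I) \<le> (4 * real m * strong_mixing_coeff M X k) * 1"
    by (rule mult_mono[OF IH Phi_le_1[OF b] order_trans[OF norm_ge_zero IH] norm_ge_zero])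
  with 1 2 have "cmod (Phi q (U \<union> V) - Phi q I ^ Suc m) \<le> 4 * strong_mixing_coeff M X k + 4 * real m * strong_mixing_coeff M X k"
    by linarith
  also have "\<dots> = 4 * real (Suc m) * strong_mixing_coeff M X k" by (simp add: distrib_left distrib_right)
  finally show ?case unfolding eq .
qed

lemma prod_int_atLeastAtMost: "(\<Prod>t\<in>{1..int j}. f t) = (\<Prod>t\<in>{1..j}. f (int t))"
proof -
  have "{1..int j} = int ` {1..j}" by (simp add: image_int_atLeastAtMost)
  then show ?thesis by (simp add: prod.reindex)
qed

text \<open>Telescoping: removing the first factor of a block and shifting it back by stationarity.\<close>
lemma Phi_telescope:
  assumes q: "q \<in> borel_measurable borel" and b: "\<And>y. cmod (q y) \<le> 1"
  shows "Phi q {1..int n} - 1 = (\<Sum>j<n. expectation (\<lambda>\<omega>. (q (X 0 \<omega>) - 1) * (\<Prod>t\<in>{1..j}. q (X (int t) \<omega>))))"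
proof (induction n)
  case 0
  show ?case using prob_space by (simp add: Phi_def)
next
  case (Suc n)
  have s: "(+) 1 ` {0..int n} = {1..int (Suc n)}" by (simp add: image_add_atLeastAtMost)
  have "Phi q {1..int (Suc n)} = Phi q {0..int n}" unfolding s[symmetric] by (rule Phi_shift[OF q]) simp
  also have "{0..int n} = insert 0 {1..int n}" by auto
  finally have 1: "Phi q {1..int (Suc n)} = expectation (\<lambda>\<omega>. q (X 0 \<omega>) * (\<Prod>t\<in>{1..n}. q (X (int t) \<omega>)))"
    by (simp add: Phi_def prod_int_atLeastAtMost)
  have 2: "Phi q {1..int n} = expectation (\<lambda>\<omega>. \<Prod>t\<in>{1..n}. q (X (int t) \<omega>))"
    unfolding Phi_def prod_int_atLeastAtMost ..
  note q[measurable]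
  have i2: "integrable M (\<lambda>\<omega>. \<Prod>t\<in>{1..n}. q (X (int t) \<omega>))"
    by (rule integrable_const_bound[where B = 1]) (use b in \<open>auto intro!: cmod_prod_le_1\<close>)
  have i1: "integrable M (\<lambda>\<omega>. q (X 0 \<omega>) * (\<Prod>t\<in>{1..n}. q (X (int t) \<omega>)))"
    by (rule integrable_const_bound[where B = 1]) (use b in \<open>auto simp: norm_mult intro!: mult_le_one cmod_prod_le_1\<close>)
  have "Phi q {1..int (Suc n)} - Phi q {1..int n} = expectation (\<lambda>\<omega>. (q (X 0 \<omega>) - 1) * (\<Prod>t\<in>{1..n}. q (X (int t) \<omega>)))"
    unfolding 1 2 left_diff_distrib using i1 i2 by simp
  then show ?case using Suc.IH by (simp add: algebra_simps)
qed

end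

subsection \<open>Characteristic function of a single block\<close>

locale rv_mixing = rv_stationary M X \<kappa> for M :: "'a measure" and X :: "int \<Rightarrow> 'a \<Rightarrow> real" and \<kappa> :: real +
  fixes a :: "nat \<Rightarrow> real" and r l :: "nat \<Rightarrow> nat"
  assumes a_top: "filterlim a at_top sequentially"
    and a_tail: "(\<lambda>n. real n * prob {\<omega>\<in>space M. \<bar>X 0 \<omega>\<bar> > a n}) \<longlonglongrightarrow> 1"
    and r_top: "filterlim r at_top sequentially" and r_o: "(\<lambda>n. real (r n) / real n) \<longlonglongrightarrow> 0"
    and AC: "(\<lambda>k. limsup (\<lambda>n. ereal (real n * (\<Sum>t\<in>{k..r n}.
              expectation (\<lambda>\<omega>. min \<bar>X (int t) \<omega> / a n\<bar> 1 * min \<bar>X 0 \<omega> / a n\<bar> 1))))) \<longlonglongrightarrow> 0"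
    and l_top: "filterlim l at_top sequentially" and l_o: "(\<lambda>n. real (l n) / real (r n)) \<longlonglongrightarrow> 0"
    and mix: "(\<lambda>n. real n / real (r n) * strong_mixing_coeff M X (l n)) \<longlonglongrightarrow> 0"
begin

definition capped_moment :: "nat \<Rightarrow> nat \<Rightarrow> real" where
  "capped_moment n t = expectation (\<lambda>\<omega>. min \<bar>X (int t) \<omega> / a n\<bar> 1 * min \<bar>X 0 \<omega> / a n\<bar> 1)"

definition capped_sum :: "nat \<Rightarrow> nat \<Rightarrow> real" where
  "capped_sum n k = real n * (\<Sum>t\<in>{k..r n}. capped_moment n t)"

lemma capped_moment_nonneg: "0 \<le> capped_moment n t"
  unfolding capped_moment_def by (rule Bochner_Integration.integral_nonneg) auto

lemma capped_sum_small:
  assumes "e > 0"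
  shows "\<exists>K. \<forall>k\<ge>K. \<forall>\<^sub>F n in sequentially. capped_sum n k < e"
proof -
  have "\<forall>\<^sub>F k in sequentially. limsup (\<lambda>n. ereal (capped_sum n k)) < ereal e"
    using AC unfolding capped_sum_def capped_moment_def by (rule order_tendstoD(2)) (use assms in auto)
  then obtain K where K: "\<And>k. k \<ge> K \<Longrightarrow> limsup (\<lambda>n. ereal (capped_sum n k)) < ereal e" by (auto simp: eventually_sequentially)
  have "\<forall>\<^sub>F n in sequentially. capped_sum n k < e" if "k \<ge> K" for k
    using Limsup_lessD[OF K[OF that]] by simp
  then show ?thesis by blast
qed

lemma a_pos: "\<forall>\<^sub>F n in sequentially. a n > 0"
  using a_top by (auto simp: filterlim_at_top_dense)

lemma nT: "(\<lambda>n. real n * T (a n)) \<longlonglongrightarrow> 1"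
  using a_tail unfolding T_def .

text \<open>The sequence \<open>a\<close> inverts the tail: \<open>n * T (a n)\<close> tends to 1,
  so dividing by \<open>T (a n)\<close> is asymptotically multiplying by \<open>n\<close>.\<close>

lemma seq_limit:
  fixes f :: "real \<Rightarrow> complex"
  assumes "((\<lambda>x. f x / T x) \<longlongrightarrow> L) at_top"
  shows "(\<lambda>n. of_nat n * f (a n)) \<longlonglongrightarrow> L"
proof -
  have "(\<lambda>n. f (a n) / T (a n) * of_real (real n * T (a n))) \<longlonglongrightarrow> L * of_real 1"
    by (intro tendsto_mult filterlim_compose[OF assms a_top] tendsto_of_real nT)
  also have "(\<lambda>n. f (a n) / T (a n) * of_real (real n * T (a n))) = (\<lambda>n. of_nat n * f (a n))"
    using T_pos by (auto simp: fun_eq_iff less_imp_neq[THEN not_sym])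
  finally show ?thesis by simp
qed

lemma second_moment_seq:
  obtains C where "C > 0" "\<And>\<epsilon> t. \<epsilon> > 0 \<Longrightarrow> \<forall>\<^sub>F n in sequentially. real n * expectation (\<lambda>\<omega>. (min \<bar>X t \<omega> / a n\<bar> \<epsilon>)\<^sup>2) \<le> C * \<epsilon> powr (2 - \<kappa>)"
proof -
  obtain C where C: "C > 0" "\<And>\<epsilon> t. \<epsilon> > 0 \<Longrightarrow> \<forall>\<^sub>F x in at_top. expectation (\<lambda>\<omega>. (min \<bar>X t \<omega> / x\<bar> \<epsilon>)\<^sup>2) / T x \<le> C * \<epsilon> powr (2 - \<kappa>)"
    using second_moment_bound by blast
  have nT2: "\<forall>\<^sub>F n in sequentially. real n * T (a n) < 2" by (rule order_tendstoD(2)[OF nT]) simp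
  show ?thesis
  proof (rule that[of "2 * C"])
    fix \<epsilon> :: real and t assume e: "\<epsilon> > 0"
    have "\<forall>\<^sub>F n in sequentially. expectation (\<lambda>\<omega>. (min \<bar>X t \<omega> / a n\<bar> \<epsilon>)\<^sup>2) / T (a n) \<le> C * \<epsilon> powr (2 - \<kappa>)"
      by (rule eventually_compose_filterlim[OF C(2)[OF e] a_top])
    then show "\<forall>\<^sub>F n in sequentially. real n * expectation (\<lambda>\<omega>. (min \<bar>X t \<omega> / a n\<bar> \<epsilon>)\<^sup>2) \<le> 2 * C * \<epsilon> powr (2 - \<kappa>)"
      using nT2
    proof eventually_elim
      case (elim n)
      define E where "E = expectation (\<lambda>\<omega>. (min \<bar>X t \<omega> / a n\<bar> \<epsilon>)\<^sup>2)"
      have E0: "0 \<le> E" unfolding E_def by (rule Bochner_Integration.integral_nonneg) simp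
      have "real n * E = (real n * T (a n)) * (E / T (a n))" using T_pos[of "a n"] by simp
      also have "\<dots> \<le> 2 * (C * \<epsilon> powr (2 - \<kappa>))"
        using elim E0 T_pos[of "a n"] unfolding E_def[symmetric] by (intro mult_mono) auto
      finally show ?case by (simp add: E_def)
    qed
  qed (use C in simp)
qed

lemma product_moment_le:
  assumes e: "\<epsilon> > 0"
  shows "expectation (\<lambda>\<omega>. min \<bar>X s \<omega> / a n\<bar> \<epsilon> * min \<bar>X t \<omega> / a n\<bar> \<epsilon>) \<le> expectation (\<lambda>\<omega>. (min \<bar>X 0 \<omega> / a n\<bar> \<epsilon>)\<^sup>2)"
proof -
  have i: "integrable M (\<lambda>\<omega>. (min \<bar>X s \<omega> / a n\<bar> \<epsilon>)\<^sup>2)" for s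
    by (rule integrable_const_bound[where B = "\<epsilon>\<^sup>2"]) (use e in \<open>auto intro!: power_mono\<close>)
  have st: "expectation (\<lambda>\<omega>. (min \<bar>X s \<omega> / a n\<bar> \<epsilon>)\<^sup>2) = expectation (\<lambda>\<omega>. (min \<bar>X 0 \<omega> / a n\<bar> \<epsilon>)\<^sup>2)" for s
    by (rule stationary_single) measurable
  have "expectation (\<lambda>\<omega>. min \<bar>X s \<omega> / a n\<bar> \<epsilon> * min \<bar>X t \<omega> / a n\<bar> \<epsilon>)
     \<le> expectation (\<lambda>\<omega>. (min \<bar>X s \<omega> / a n\<bar> \<epsilon>)\<^sup>2 / 2 + (min \<bar>X t \<omega> / a n\<bar> \<epsilon>)\<^sup>2 / 2)"
  proof (rule integral_mono')
    show "integrable M (\<lambda>\<omega>. (min \<bar>X s \<omega> / a n\<bar> \<epsilon>)\<^sup>2 / 2 + (min \<bar>X t \<omega> / a n\<bar> \<epsilon>)\<^sup>2 / 2)" using i[of s] i[of t] by simp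
    show "x * y \<le> x\<^sup>2 / 2 + y\<^sup>2 / 2" for x y :: real
      using sum_squares_bound[of x y] by simp
  qed simp
  also have "\<dots> = expectation (\<lambda>\<omega>. (min \<bar>X s \<omega> / a n\<bar> \<epsilon>)\<^sup>2) / 2 + expectation (\<lambda>\<omega>. (min \<bar>X t \<omega> / a n\<bar> \<epsilon>)\<^sup>2) / 2"
    using i[of s] i[of t] by simp
  finally show ?thesis using st[of s] st[of t] by simp
qed

text \<open>Lags from some \<open>K\<close> on are controlled by anti-clustering; each of the
  finitely many smaller lags is at most a truncated second moment, which is of order
  \<open>1 / n\<close>.\<close>

lemma capped_sum_bounded: "\<exists>B>0. \<forall>\<^sub>F n in sequentially. capped_sum n 1 \<le> B"
proof -
  obtain K where K: "\<And>k. k \<ge> K \<Longrightarrow> \<forall>\<^sub>F n in sequentially. capped_sum n k < 1" using capped_sum_small[of 1] by auto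
  obtain C where C: "C > 0" "\<And>\<epsilon> t. \<epsilon> > 0 \<Longrightarrow> \<forall>\<^sub>F n in sequentially. real n * expectation (\<lambda>\<omega>. (min \<bar>X t \<omega> / a n\<bar> \<epsilon>)\<^sup>2) \<le> C * \<epsilon> powr (2 - \<kappa>)"
    using second_moment_seq by blast
  have "\<forall>\<^sub>F n in sequentially. capped_sum n 1 \<le> real K * C + 1"
    using K[OF order_refl] C(2)[OF zero_less_one, of 0]
  proof eventually_elim
    case (elim n)
    have "(\<Sum>t\<in>{1..r n}. capped_moment n t) \<le> (\<Sum>t\<in>{1..K} \<union> {K..r n}. capped_moment n t)"
      by (rule sum_mono2) (auto simp: capped_moment_nonneg)
    also have "\<dots> \<le> (\<Sum>t\<in>{1..K}. capped_moment n t) + (\<Sum>t\<in>{K..r n}. capped_moment n t)"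
      by (simp add: sum_Un sum_nonneg capped_moment_nonneg)
    also have "(\<Sum>t\<in>{1..K}. capped_moment n t) \<le> (\<Sum>t\<in>{1..K}. expectation (\<lambda>\<omega>. (min \<bar>X 0 \<omega> / a n\<bar> 1)\<^sup>2))"
      unfolding capped_moment_def by (intro sum_mono product_moment_le) simp
    finally have "(\<Sum>t\<in>{1..r n}. capped_moment n t) \<le> real K * expectation (\<lambda>\<omega>. (min \<bar>X 0 \<omega> / a n\<bar> 1)\<^sup>2) + (\<Sum>t\<in>{K..r n}. capped_moment n t)" by simp
    then have "capped_sum n 1 \<le> real n * (real K * expectation (\<lambda>\<omega>. (min \<bar>X 0 \<omega> / a n\<bar> 1)\<^sup>2) + (\<Sum>t\<in>{K..r n}. capped_moment n t))"
      unfolding capped_sum_def by (intro mult_left_mono) auto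
    also have "\<dots> = real K * (real n * expectation (\<lambda>\<omega>. (min \<bar>X 0 \<omega> / a n\<bar> 1)\<^sup>2)) + capped_sum n K"
      by (simp add: capped_sum_def algebra_simps)
    also have "\<dots> \<le> real K * C + 1" using elim by (intro add_mono mult_left_mono) auto
    finally show ?case .
  qed
  then show ?thesis using C(1) by (intro exI[of _ "real K * C + 1"]) (auto intro: add_nonneg_pos)
qed

definition block_phase :: "real \<Rightarrow> real \<Rightarrow> nat \<Rightarrow> real \<Rightarrow> complex" where
  "block_phase u v n y = phase u v (y / a n)"

definition increment_mean :: "real \<Rightarrow> real \<Rightarrow> nat \<Rightarrow> nat \<Rightarrow> complex" where
  "increment_mean u v n j = expectation (increment u v j (a n))"

definition drift :: "real \<Rightarrow> nat \<Rightarrow> real" where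
  "drift u n = cen * u * expectation (X 0) / a n"

lemma block_phase_measurable [measurable]: "block_phase u v n \<in> borel_measurable borel"
  unfolding block_phase_def by measurable

lemma cmod_block_phase [simp]: "cmod (block_phase u v n y) = 1"
  by (simp add: block_phase_def)

lemma increment_mean_eq: "increment_mean u v n j = expectation (\<lambda>\<omega>. (block_phase u v n (X 0 \<omega>) - 1) * (\<Prod>t\<in>{1..j}. block_phase u v n (X (int t) \<omega>))) - \<i> * of_real (drift u n)"
proof -
  have 1: "integrable M (\<lambda>\<omega>. (block_phase u v n (X 0 \<omega>) - 1) * (\<Prod>t\<in>{1..j}. block_phase u v n (X (int t) \<omega>)))"
  proof (rule integrable_const_bound[where B = 2])
    show "AE \<omega> in M. cmod ((block_phase u v n (X 0 \<omega>) - 1) * (\<Prod>t\<in>{1..j}. block_phase u v n (X (int t) \<omega>))) \<le> 2"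
    proof (rule AE_I2)
      fix \<omega>
      have "cmod (block_phase u v n (X 0 \<omega>) - 1) \<le> 2"
        using norm_triangle_ineq4[of "block_phase u v n (X 0 \<omega>)" 1] by simp
      then show "cmod ((block_phase u v n (X 0 \<omega>) - 1) * (\<Prod>t\<in>{1..j}. block_phase u v n (X (int t) \<omega>))) \<le> 2"
        by (simp add: norm_mult prod_norm[symmetric])
    qed
  qed measurable
  have 2: "integrable M (\<lambda>\<omega>. \<i> * of_real (u / a n * (cen * X 0 \<omega>)) :: complex)"
    by (intro integrable_mult_right integrable_of_real integrable_cen_X0)
  have "increment_mean u v n j = expectation (\<lambda>\<omega>. (block_phase u v n (X 0 \<omega>) - 1) * (\<Prod>t\<in>{1..j}. block_phase u v n (X (int t) \<omega>)) - \<i> * of_real (u / a n * (cen * X 0 \<omega>)))"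
    unfolding increment_mean_def increment_def block_phase_def by (simp add: mult_ac)
  also have "\<dots> = expectation (\<lambda>\<omega>. (block_phase u v n (X 0 \<omega>) - 1) * (\<Prod>t\<in>{1..j}. block_phase u v n (X (int t) \<omega>))) - expectation (\<lambda>\<omega>. \<i> * of_real (u / a n * (cen * X 0 \<omega>)))"
    by (rule Bochner_Integration.integral_diff[OF 1 2])
  also have "expectation (\<lambda>\<omega>. \<i> * complex_of_real (u / a n * (cen * X 0 \<omega>))) = \<i> * of_real (expectation (\<lambda>\<omega>. u / a n * (cen * X 0 \<omega>)))"
    by (simp only: integral_mult_right_zero integral_complex_of_real)
  also have "expectation (\<lambda>\<omega>. u / a n * (cen * X 0 \<omega>)) = drift u n"
    by (simp only: integral_mult_right_zero) (simp add: drift_def)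
  finally show ?thesis .
qed

lemma telescope_increment_mean: "Phi (block_phase u v n) {1..int b} - 1 - \<i> * of_real (real b * drift u n) = (\<Sum>j<b. increment_mean u v n j)"
proof -
  have "Phi (block_phase u v n) {1..int b} - 1 = (\<Sum>j<b. expectation (\<lambda>\<omega>. (block_phase u v n (X 0 \<omega>) - 1) * (\<Prod>t\<in>{1..j}. block_phase u v n (X (int t) \<omega>))))"
    by (rule Phi_telescope) auto
  then show ?thesis unfolding increment_mean_eq by (simp add: sum_subtractf)
qed

text \<open>Dropping the factors at times \<open>Suc k..j\<close> changes the product by at most
  \<open>phase_const u v\<close> times the sum of the capped observations there, and the factor at
  time 0 brings a second capped observation; the expectation is an anti-clustering sum. The linear
  compensators cancel in the difference.\<close>

lemma increment_mean_diff:
  assumes "k \<le> j" "j \<le> r n"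
  shows "real n * cmod (increment_mean u v n j - increment_mean u v n k) \<le> (phase_const u v)\<^sup>2 * capped_sum n (Suc k)"
proof -
  define e where "e t \<omega> = block_phase u v n (X (int t) \<omega>)" for t \<omega>
  have em[measurable]: "e t \<in> borel_measurable M" for t unfolding e_def by measurable
  have e1: "cmod (e t \<omega>) = 1" for t \<omega> unfolding e_def by simp
  have gi: "integrable M (\<lambda>\<omega>. (e 0 \<omega> - 1) * (\<Prod>t\<in>{1..j}. e t \<omega>))" for j
  proof (rule integrable_const_bound[where B = 2])
    show "AE \<omega> in M. cmod ((e 0 \<omega> - 1) * (\<Prod>t\<in>{1..j}. e t \<omega>)) \<le> 2"
    proof (rule AE_I2)
      fix \<omega>
      have "cmod (e 0 \<omega> - 1) \<le> 2" using norm_triangle_ineq4[of "e 0 \<omega>" 1] e1[of 0 \<omega>] by simp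
      then show "cmod ((e 0 \<omega> - 1) * (\<Prod>t\<in>{1..j}. e t \<omega>)) \<le> 2"
        by (simp add: norm_mult prod_norm[symmetric] e1)
    qed
  qed measurable
  have eq: "increment_mean u v n j - increment_mean u v n k = expectation (\<lambda>\<omega>. (e 0 \<omega> - 1) * (\<Prod>t\<in>{1..j}. e t \<omega>) - (e 0 \<omega> - 1) * (\<Prod>t\<in>{1..k}. e t \<omega>))"
    using gi[of j] gi[of k] by (simp add: increment_mean_eq e_def)
  have mi: "integrable M (\<lambda>\<omega>. min \<bar>X (int t) \<omega> / a n\<bar> 1 * min \<bar>X 0 \<omega> / a n\<bar> 1)" for t
    by (rule integrable_const_bound[where B = 1]) (auto simp: abs_mult intro!: mult_le_one)
  have "cmod (increment_mean u v n j - increment_mean u v n k) \<le> expectation (\<lambda>\<omega>. (phase_const u v)\<^sup>2 * (\<Sum>t\<in>{Suc k..j}. min \<bar>X (int t) \<omega> / a n\<bar> 1 * min \<bar>X 0 \<omega> / a n\<bar> 1))"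
    unfolding eq
  proof (rule order_trans[OF integral_norm_bound integral_mono'])
    show "integrable M (\<lambda>\<omega>. (phase_const u v)\<^sup>2 * (\<Sum>t\<in>{Suc k..j}. min \<bar>X (int t) \<omega> / a n\<bar> 1 * min \<bar>X 0 \<omega> / a n\<bar> 1))"
      using mi by (intro integrable_mult_right Bochner_Integration.integrable_sum) auto
    fix \<omega>
    have un: "{1..j} = {1..k} \<union> {Suc k..j}" using assms by auto
    have "(\<Prod>t\<in>{1..j}. e t \<omega>) = (\<Prod>t\<in>{1..k}. e t \<omega>) * (\<Prod>t\<in>{Suc k..j}. e t \<omega>)"
      unfolding un by (rule prod.union_disjoint) auto
    then have "(e 0 \<omega> - 1) * (\<Prod>t\<in>{1..j}. e t \<omega>) - (e 0 \<omega> - 1) * (\<Prod>t\<in>{1..k}. e t \<omega>) = (\<Prod>t\<in>{1..k}. e t \<omega>) * (e 0 \<omega> - 1) * ((\<Prod>t\<in>{Suc k..j}. e t \<omega>) - 1)"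
      by (simp add: algebra_simps)
    then have "cmod ((e 0 \<omega> - 1) * (\<Prod>t\<in>{1..j}. e t \<omega>) - (e 0 \<omega> - 1) * (\<Prod>t\<in>{1..k}. e t \<omega>)) = cmod (e 0 \<omega> - 1) * cmod ((\<Prod>t\<in>{Suc k..j}. e t \<omega>) - 1)"
      by (simp add: norm_mult prod_norm[symmetric] e1)
    also have "\<dots> \<le> (phase_const u v * min \<bar>X 0 \<omega> / a n\<bar> 1) * (phase_const u v * (\<Sum>t\<in>{Suc k..j}. min \<bar>X (int t) \<omega> / a n\<bar> 1))"
    proof (rule mult_mono)
      show "cmod (e 0 \<omega> - 1) \<le> phase_const u v * min \<bar>X 0 \<omega> / a n\<bar> 1"
        using cmod_phase_minus_1_le[of u v "X 0 \<omega> / a n"] by (simp add: e_def block_phase_def)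
      show "cmod ((\<Prod>t\<in>{Suc k..j}. e t \<omega>) - 1) \<le> phase_const u v * (\<Sum>t\<in>{Suc k..j}. min \<bar>X (int t) \<omega> / a n\<bar> 1)"
        unfolding e_def block_phase_def by (rule cmod_prod_phase_minus_1_le) simp
    qed (use phase_const_pos[of u v] in auto)
    also have "\<dots> = (phase_const u v)\<^sup>2 * (\<Sum>t\<in>{Suc k..j}. min \<bar>X (int t) \<omega> / a n\<bar> 1 * min \<bar>X 0 \<omega> / a n\<bar> 1)"
      by (simp add: power2_eq_square sum_distrib_left sum_distrib_right mult_ac)
    finally show "cmod ((e 0 \<omega> - 1) * (\<Prod>t\<in>{1..j}. e t \<omega>) - (e 0 \<omega> - 1) * (\<Prod>t\<in>{1..k}. e t \<omega>))
       \<le> (phase_const u v)\<^sup>2 * (\<Sum>t\<in>{Suc k..j}. min \<bar>X (int t) \<omega> / a n\<bar> 1 * min \<bar>X 0 \<omega> / a n\<bar> 1)" .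
    show "0 \<le> (phase_const u v)\<^sup>2 * (\<Sum>t\<in>{Suc k..j}. min \<bar>X (int t) \<omega> / a n\<bar> 1 * min \<bar>X 0 \<omega> / a n\<bar> 1)"
      by (intro mult_nonneg_nonneg sum_nonneg) auto
  qed
  also have "\<dots> = (phase_const u v)\<^sup>2 * (\<Sum>t\<in>{Suc k..j}. capped_moment n t)"
    unfolding capped_moment_def using mi by (simp only: integral_mult_right_zero) (subst Bochner_Integration.integral_sum, auto)
  also have "\<dots> \<le> (phase_const u v)\<^sup>2 * (\<Sum>t\<in>{Suc k..r n}. capped_moment n t)"
    using assms by (intro mult_left_mono sum_mono2 capped_moment_nonneg) auto
  finally have "real n * cmod (increment_mean u v n j - increment_mean u v n k) \<le> real n * ((phase_const u v)\<^sup>2 * (\<Sum>t\<in>{Suc k..r n}. capped_moment n t))"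
    by (rule mult_left_mono) simp
  then show ?thesis by (simp add: capped_sum_def mult_ac)
qed

section \<open>The exponent, and the asymptotics of one block\<close>

lemma increment_mean_lim: "(\<lambda>n. of_nat n * increment_mean u v n k) \<longlonglongrightarrow> increment_lim u v k"
  unfolding increment_mean_def by (rule seq_limit[OF increment_lim])

lemma r_ge: "\<forall>\<^sub>F n in sequentially. j \<le> r n"
  using r_top by (simp add: filterlim_at_top)

lemma increment_lim_diff:
  assumes e: "\<forall>\<^sub>F n in sequentially. capped_sum n (Suc k) \<le> e" and kj: "k \<le> j"
  shows "cmod (increment_lim u v j - increment_lim u v k) \<le> (phase_const u v)\<^sup>2 * e"
proof (rule tendsto_upperbound)
  show "(\<lambda>n. cmod (of_nat n * increment_mean u v n j - of_nat n * increment_mean u v n k)) \<longlonglongrightarrow> cmod (increment_lim u v j - increment_lim u v k)"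
    by (intro tendsto_intros increment_mean_lim)
  show "\<forall>\<^sub>F n in sequentially. cmod (of_nat n * increment_mean u v n j - of_nat n * increment_mean u v n k) \<le> (phase_const u v)\<^sup>2 * e"
    using e r_ge[of j]
  proof eventually_elim
    case (elim n)
    have "cmod (of_nat n * increment_mean u v n j - of_nat n * increment_mean u v n k) = real n * cmod (increment_mean u v n j - increment_mean u v n k)"
      by (simp add: right_diff_distrib[symmetric] norm_mult)
    also have "\<dots> \<le> (phase_const u v)\<^sup>2 * capped_sum n (Suc k)" by (rule increment_mean_diff[OF kj elim(2)])
    also have "\<dots> \<le> (phase_const u v)\<^sup>2 * e" using elim by (intro mult_left_mono) auto
    finally show ?case .
  qed
qed simp

text \<open>The exponent of the limit law as an iterated limit: in \<open>n\<close> for a fixed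
  number of retained factors, then in that number. \<open>increment_lim_tendsto\<close> shows that
  the outer limit exists.\<close>

definition psi :: "real \<Rightarrow> real \<Rightarrow> complex" where
  "psi u v = lim (increment_lim u v)"

lemma increment_lim_tendsto: "increment_lim u v \<longlonglongrightarrow> psi u v"
proof -
  have "Cauchy (increment_lim u v)"
  proof (rule metric_CauchyI)
    fix e :: real assume e: "e > 0"
    define d where "d = e / (3 * (phase_const u v)\<^sup>2)"
    have d: "d > 0" unfolding d_def using e phase_const_pos[of u v] by simp
    obtain K where K: "\<And>k. k \<ge> K \<Longrightarrow> \<forall>\<^sub>F n in sequentially. capped_sum n k < d" using capped_sum_small[OF d] by auto
    have ev: "\<forall>\<^sub>F n in sequentially. capped_sum n (Suc K) \<le> d" using K[of "Suc K"] by (auto elim: eventually_mono)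
    have "cmod (increment_lim u v j - increment_lim u v K) \<le> e / 3" if "j \<ge> K" for j
      using increment_lim_diff[OF ev that, of u v] phase_const_pos[of u v] by (simp add: d_def)
    note b = this
    show "\<exists>N. \<forall>m\<ge>N. \<forall>n\<ge>N. dist (increment_lim u v m) (increment_lim u v n) < e"
    proof (intro exI[of _ K] allI impI)
      fix m n assume "m \<ge> K" "n \<ge> K"
      then have "dist (increment_lim u v m) (increment_lim u v K) \<le> e / 3" "dist (increment_lim u v n) (increment_lim u v K) \<le> e / 3" using b by (auto simp: dist_norm)
      then show "dist (increment_lim u v m) (increment_lim u v n) < e" using dist_triangle2[of "increment_lim u v m" "increment_lim u v n" "increment_lim u v K"] e by linarith
    qed
  qed
  then show ?thesis unfolding psi_def by (simp add: Cauchy_convergent convergent_LIMSEQ_iff[symmetric])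
qed

lemma psi_approx:
  assumes e: "e > 0"
  obtains k where "\<forall>\<^sub>F n in sequentially. capped_sum n (Suc k) < e" "cmod (increment_lim u v k - psi u v) < e"
proof -
  obtain K where K: "\<And>k. k \<ge> K \<Longrightarrow> \<forall>\<^sub>F n in sequentially. capped_sum n k < e" using capped_sum_small[OF e] by auto
  have "\<forall>\<^sub>F k in sequentially. dist (increment_lim u v k) (psi u v) < e" by (rule tendstoD[OF increment_lim_tendsto e])
  then have "\<forall>\<^sub>F k in sequentially. dist (increment_lim u v k) (psi u v) < e \<and> k \<ge> K"
    using eventually_ge_at_top[of K] by (rule eventually_conj)
  then obtain k where "dist (increment_lim u v k) (psi u v) < e" "k \<ge> K" by (auto simp: eventually_sequentially)
  then show ?thesis using that[of k] K[of "Suc k"] by (simp add: dist_norm)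
qed

lemma psi_homogeneous:
  assumes s: "s > 0"
  shows "psi (s * u) (s\<^sup>2 * v) = of_real (s powr \<kappa>) * psi u v"
proof (rule LIMSEQ_unique[OF increment_lim_tendsto])
  show "increment_lim (s * u) (s\<^sup>2 * v) \<longlonglongrightarrow> of_real (s powr \<kappa>) * psi u v"
    unfolding increment_lim_homogeneous[OF s, abs_def] by (intro tendsto_intros increment_lim_tendsto)
qed

lemma increment_mean_bounded: "\<exists>B>0. \<forall>\<^sub>F n in sequentially. \<forall>j\<le>r n. real n * cmod (increment_mean u v n j) \<le> B"
proof -
  obtain B where B: "B > 0" "\<forall>\<^sub>F n in sequentially. capped_sum n 1 \<le> B" using capped_sum_bounded by blast
  define D where "D = cmod (increment_lim u v 0) + 1"
  have D: "D > 0" unfolding D_def by (simp add: add_nonneg_pos)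
  have "(\<lambda>n. cmod (of_nat n * increment_mean u v n 0)) \<longlonglongrightarrow> cmod (increment_lim u v 0)" by (intro tendsto_intros increment_mean_lim)
  then have "\<forall>\<^sub>F n in sequentially. cmod (of_nat n * increment_mean u v n 0) < D"
    by (rule order_tendstoD) (simp add: D_def)
  then have "\<forall>\<^sub>F n in sequentially. \<forall>j\<le>r n. real n * cmod (increment_mean u v n j) \<le> D + (phase_const u v)\<^sup>2 * B"
    using B(2)
  proof eventually_elim
    case (elim n)
    show ?case
    proof (intro allI impI)
      fix j assume j: "j \<le> r n"
      have "cmod (increment_mean u v n j) \<le> cmod (increment_mean u v n 0) + cmod (increment_mean u v n j - increment_mean u v n 0)"
        by (rule norm_triangle_sub)
      then have "real n * cmod (increment_mean u v n j) \<le> real n * cmod (increment_mean u v n 0) + real n * cmod (increment_mean u v n j - increment_mean u v n 0)"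
        unfolding distrib_left[symmetric] by (rule mult_left_mono) simp
      also have "\<dots> \<le> D + (phase_const u v)\<^sup>2 * capped_sum n (Suc 0)"
        using elim increment_mean_diff[OF _ j, of 0 u v] by (intro add_mono) (auto simp: norm_mult)
      also have "\<dots> \<le> D + (phase_const u v)\<^sup>2 * B" using elim by (intro add_left_mono mult_left_mono) auto
      finally show "real n * cmod (increment_mean u v n j) \<le> D + (phase_const u v)\<^sup>2 * B" .
    qed
  qed
  then show ?thesis using B by (intro exI[of _ "D + (phase_const u v)\<^sup>2 * B"]) (auto intro!: add_pos_nonneg D)
qed

text \<open>The normalised block is the average over \<open>j < b n\<close> of \<open>n\<close>
  times the compensated increment means. For \<open>j \<ge> k\<close> they all lie close to the one
  with index \<open>k\<close>; the first \<open>k\<close> are bounded and get lost in the average,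
  as \<open>b n\<close> tends to infinity.\<close>

lemma block_limit:
  assumes b: "filterlim b at_top sequentially" "\<forall>\<^sub>F n in sequentially. b n \<le> r n"
  shows "(\<lambda>n. of_real (real n / real (b n)) * (Phi (block_phase u v n) {1..int (b n)} - 1 - \<i> * of_real (real (b n) * drift u n))) \<longlonglongrightarrow> psi u v"
proof (rule tendstoI)
  fix \<epsilon> :: real assume \<epsilon>: "\<epsilon> > 0"
  define K where "K = (phase_const u v)\<^sup>2"
  have K: "K > 0" unfolding K_def using phase_const_pos[of u v] by simp
  \<comment> \<open>The errors are \<open>K * e\<close> from anti-clustering and three times
    \<open>e\<close>; the fourth makes the inequality strict.\<close>
  define e where "e = \<epsilon> / (K + 4)"
  have e: "e > 0" unfolding e_def using \<epsilon> K by simp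
  obtain k where k: "\<forall>\<^sub>F n in sequentially. capped_sum n (Suc k) < e" "cmod (increment_lim u v k - psi u v) < e" by (rule psi_approx[OF e])
  obtain B where B: "B > 0" "\<forall>\<^sub>F n in sequentially. \<forall>j\<le>r n. real n * cmod (increment_mean u v n j) \<le> B" using increment_mean_bounded by blast
  \<comment> \<open>Blocks of this length make the first \<open>k\<close> terms contribute at most
    \<open>e\<close>.\<close>
  have bb: "\<forall>\<^sub>F n in sequentially. real k * (2 * B) / e < real (b n)"
    using filterlim_compose[OF filterlim_real_sequentially b(1)] by (simp add: filterlim_at_top_dense)
  have bk: "\<forall>\<^sub>F n in sequentially. Suc k \<le> b n" using b(1) by (simp add: filterlim_at_top)
  have gl: "\<forall>\<^sub>F n in sequentially. dist (of_nat n * increment_mean u v n k) (increment_lim u v k) < e" by (rule tendstoD[OF increment_mean_lim e])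
  show "\<forall>\<^sub>F n in sequentially. dist (of_real (real n / real (b n)) * (Phi (block_phase u v n) {1..int (b n)} - 1 - \<i> * of_real (real (b n) * drift u n))) (psi u v) < \<epsilon>"
    using k(1) B(2) bb bk gl b(2)
  proof eventually_elim
    case (elim n)
    have b0: "b n > 0" using elim by simp
    define c where "c = of_nat n * increment_mean u v n k"
    have "of_real (real n / real (b n)) * (\<Sum>j<b n. increment_mean u v n j) - c = (\<Sum>j<b n. of_nat n * increment_mean u v n j - c) / of_nat (b n)"
      using b0 by (simp add: sum_subtractf sum_distrib_left[symmetric] field_simps)
    then have "cmod (of_real (real n / real (b n)) * (\<Sum>j<b n. increment_mean u v n j) - c) = cmod (\<Sum>j<b n. of_nat n * increment_mean u v n j - c) / real (b n)"
      by (simp add: norm_divide)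
    also have "cmod (\<Sum>j<b n. of_nat n * increment_mean u v n j - c) \<le> (\<Sum>j<b n. cmod (of_nat n * increment_mean u v n j - c))" by (rule norm_sum)
    also have "\<dots> \<le> (\<Sum>j<b n. K * e + (if j < k then 2 * B else 0))"
    proof (rule sum_mono)
      fix j assume j: "j \<in> {..<b n}"
      show "cmod (of_nat n * increment_mean u v n j - c) \<le> K * e + (if j < k then 2 * B else 0)"
      proof (cases "j < k")
        case True
        have "cmod (of_nat n * increment_mean u v n j - c) \<le> cmod (of_nat n * increment_mean u v n j) + cmod c" by (rule norm_triangle_ineq4)
        also have "\<dots> \<le> B + B" using elim j unfolding c_def by (intro add_mono) (auto simp: norm_mult)
        finally show ?thesis using True K e by (simp add: add_increasing)
      next
        case False
        have "cmod (of_nat n * increment_mean u v n j - c) = real n * cmod (increment_mean u v n j - increment_mean u v n k)"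
          unfolding c_def by (simp add: right_diff_distrib[symmetric] norm_mult)
        also have "\<dots> \<le> K * capped_sum n (Suc k)" unfolding K_def by (rule increment_mean_diff) (use False j elim in auto)
        also have "\<dots> \<le> K * e" using elim K by (intro mult_left_mono) auto
        finally show ?thesis using False by simp
      qed
    qed
    also have "\<dots> = real (b n) * (K * e) + (\<Sum>j\<in>{..<b n} \<inter> {j. j < k}. 2 * B)"
      by (simp add: sum.distrib sum.If_cases)
    also have "{..<b n} \<inter> {j. j < k} = {..<k}" using elim by auto
    finally have "cmod (of_real (real n / real (b n)) * (\<Sum>j<b n. increment_mean u v n j) - c) \<le> (real (b n) * (K * e) + real k * (2 * B)) / real (b n)"
      using b0 by (simp add: divide_right_mono)
    also have "\<dots> = K * e + real k * (2 * B) / real (b n)" using b0 by (simp add: add_divide_distrib)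
    also have "real k * (2 * B) / real (b n) \<le> e"
      using elim(3) b0 e by (simp add: field_simps)
    finally have 1: "dist (of_real (real n / real (b n)) * (\<Sum>j<b n. increment_mean u v n j)) c \<le> K * e + e" by (simp add: dist_norm)
    have "dist (of_real (real n / real (b n)) * (\<Sum>j<b n. increment_mean u v n j)) (psi u v) \<le> K * e + e + e + e"
      using 1 elim(5) k(2) dist_triangle[of "of_real (real n / real (b n)) * (\<Sum>j<b n. increment_mean u v n j)" "psi u v" c] dist_triangle[of c "psi u v" "increment_lim u v k"]
      unfolding c_def[symmetric] by (simp add: dist_norm)
    also have "\<dots> < (K + 4) * e" using e by (simp add: algebra_simps)
    also have "\<dots> = \<epsilon>" unfolding e_def using K by simp
    finally show ?case unfolding telescope_increment_mean .
  qed
qed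

text \<open>A bound linear in the block length and uniform over all lengths up to
  \<open>r n\<close>: it serves the gaps and the incomplete last block, where smallness and not a
  precise limit is at stake.\<close>

lemma block_bound: "\<exists>B>0. \<forall>\<^sub>F n in sequentially. \<forall>b\<le>r n. real n * cmod (Phi (block_phase u v n) {1..int b} - 1 - \<i> * of_real (real b * drift u n)) \<le> B * real b"
proof -
  obtain B where B: "B > 0" "\<forall>\<^sub>F n in sequentially. \<forall>j\<le>r n. real n * cmod (increment_mean u v n j) \<le> B" using increment_mean_bounded by blast
  have "\<forall>\<^sub>F n in sequentially. \<forall>b\<le>r n. real n * cmod (Phi (block_phase u v n) {1..int b} - 1 - \<i> * of_real (real b * drift u n)) \<le> B * real b"
    using B(2)
  proof eventually_elim
    case (elim n)
    show ?case
    proof (intro allI impI)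
      fix b assume b: "b \<le> r n"
      have "real n * cmod (\<Sum>j<b. increment_mean u v n j) \<le> real n * (\<Sum>j<b. cmod (increment_mean u v n j))"
        by (intro mult_left_mono norm_sum) simp
      also have "\<dots> = (\<Sum>j<b. real n * cmod (increment_mean u v n j))" by (rule sum_distrib_left)
      also have "\<dots> \<le> (\<Sum>j<b. B)" using elim b by (intro sum_mono) auto
      finally show "real n * cmod (Phi (block_phase u v n) {1..int b} - 1 - \<i> * of_real (real b * drift u n)) \<le> B * real b"
        unfolding telescope_increment_mean by (simp add: mult.commute)
    qed
  qed
  then show ?thesis using B(1) by blast
qed

end

subsection \<open>Convergence of the joint characteristic functions\<close>

text \<open>Modulus at most 1 forces \<open>Re \<psi> \<le> 0\<close>, so the comparison numbers
  \<open>exp (\<psi> / m n)\<close> lie in the unit disc too; there powers of exponent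
  \<open>m n\<close> differ by at most \<open>m n\<close> times the difference of the bases.\<close>

lemma power_limit_exp:
  fixes z :: "nat \<Rightarrow> complex" and m :: "nat \<Rightarrow> nat"
  assumes z: "\<And>n. cmod (z n) \<le> 1" and m: "filterlim m at_top sequentially"
    and lim: "(\<lambda>n. of_nat (m n) * (z n - 1)) \<longlonglongrightarrow> \<psi>"
  shows "(\<lambda>n. z n ^ m n) \<longlonglongrightarrow> exp \<psi>" "Re \<psi> \<le> 0"
proof -
  have "(\<lambda>n. Re (of_nat (m n) * (z n - 1))) \<longlonglongrightarrow> Re \<psi>" by (intro tendsto_intros lim)
  moreover have "Re (of_nat (m n) * (z n - 1)) \<le> 0" for n
    using abs_Re_le_cmod[of "z n"] z[of n] by (auto intro!: mult_nonneg_nonpos)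
  ultimately show R: "Re \<psi> \<le> 0" by (intro tendsto_upperbound[where F = sequentially]) auto
  define w where "w n = exp (\<psi> / of_nat (m n))" for n
  have w1: "cmod (w n) \<le> 1" for n
  proof -
    have "Re (\<psi> / of_nat (m n)) \<le> 0" using R by (simp add: divide_nonpos_nonneg)
    then show ?thesis unfolding w_def by simp
  qed
  have wm: "\<forall>\<^sub>F n in sequentially. w n ^ m n = exp \<psi>"
  proof -
    have "\<forall>\<^sub>F n in sequentially. 1 \<le> m n" using m by (simp add: filterlim_at_top)
    then show ?thesis by eventually_elim (simp add: w_def exp_of_nat_mult[symmetric])
  qed
  have "(\<lambda>n. z n ^ m n - w n ^ m n) \<longlonglongrightarrow> 0"
  proof (rule Lim_null_comparison)
    show "\<forall>\<^sub>F n in sequentially. cmod (z n ^ m n - w n ^ m n) \<le> cmod (of_nat (m n) * (z n - 1) - \<psi>) + (cmod \<psi>)\<^sup>2 / real (m n)"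
    proof -
      have "\<forall>\<^sub>F n in sequentially. 1 \<le> m n" using m by (simp add: filterlim_at_top)
      then show ?thesis
      proof eventually_elim
        case (elim n)
        define y where "y = \<psi> / of_nat (m n)"
        have my: "of_nat (m n) * y = \<psi>" unfolding y_def using elim by simp
        have y2: "cmod (1 - exp y + y) \<le> (cmod y)\<^sup>2"
          using norm_cexp_near[of 1 "- y"] R elim by (simp add: cexp_def y_def divide_nonpos_nonneg)
        have "cmod (z n ^ m n - w n ^ m n) \<le> real (m n) * cmod (z n - w n)"
          by (rule norm_power_diff[OF z w1])
        also have "\<dots> = cmod (of_nat (m n) * (z n - w n))" by (simp add: norm_mult)
        also have "of_nat (m n) * (z n - w n) = (of_nat (m n) * (z n - 1) - \<psi>) + of_nat (m n) * (1 - exp y + y)"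
          unfolding w_def y_def[symmetric] my[symmetric] by (simp add: algebra_simps)
        also have "cmod \<dots> \<le> cmod (of_nat (m n) * (z n - 1) - \<psi>) + real (m n) * (cmod y)\<^sup>2"
          using y2 by (intro order_trans[OF norm_triangle_ineq] add_left_mono) (simp add: norm_mult mult_left_mono)
        also have "real (m n) * (cmod y)\<^sup>2 = (cmod \<psi>)\<^sup>2 / real (m n)"
          using elim by (simp add: y_def norm_divide power2_eq_square)
        finally show ?case .
      qed
    qed
    have "(\<lambda>n. cmod (of_nat (m n) * (z n - 1) - \<psi>) + (cmod \<psi>)\<^sup>2 / real (m n)) \<longlonglongrightarrow> cmod (\<psi> - \<psi>) + 0"
      by (intro tendsto_intros lim tendsto_divide_0[OF tendsto_const] filterlim_at_top_imp_at_infinity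
          filterlim_compose[OF filterlim_real_sequentially m])
    then show "(\<lambda>n. cmod (of_nat (m n) * (z n - 1) - \<psi>) + (cmod \<psi>)\<^sup>2 / real (m n)) \<longlonglongrightarrow> 0" by simp
  qed
  from tendsto_add[OF this tendsto_eventually[OF wm]]
  show "(\<lambda>n. z n ^ m n) \<longlonglongrightarrow> exp \<psi>" by simp
qed

text \<open>In each row every lag occurs at most twice, once on either side of the diagonal.\<close>

lemma toeplitz_sum_le:
  fixes \<gamma> :: "nat \<Rightarrow> real"
  assumes g: "\<And>h. 0 \<le> \<gamma> h"
  shows "(\<Sum>s\<in>{1..R}. \<Sum>t\<in>{1..R}. \<gamma> (if s \<le> t then t - s else s - t)) \<le> 2 * real R * (\<Sum>h\<le>R. \<gamma> h)"
proof -
  have row: "(\<Sum>t\<in>{1..R}. \<gamma> (if s \<le> t then t - s else s - t)) \<le> 2 * (\<Sum>h\<le>R. \<gamma> h)" if s: "s \<in> {1..R}" for s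
  proof -
    have "(\<Sum>t\<in>{1..R}. \<gamma> (if s \<le> t then t - s else s - t)) = (\<Sum>t\<in>{1..<s} \<union> {s..R}. \<gamma> (if s \<le> t then t - s else s - t))"
      using s by (intro sum.cong) auto
    also have "\<dots> = (\<Sum>t\<in>{1..<s}. \<gamma> (if s \<le> t then t - s else s - t)) + (\<Sum>t\<in>{s..R}. \<gamma> (if s \<le> t then t - s else s - t))"
      by (rule sum.union_disjoint) auto
    also have "(\<Sum>t\<in>{s..R}. \<gamma> (if s \<le> t then t - s else s - t)) = (\<Sum>t\<in>{s..R}. \<gamma> (t - s))" by (rule sum.cong) auto
    also have "\<dots> = (\<Sum>h\<in>(\<lambda>t. t - s) ` {s..R}. \<gamma> h)" by (subst sum.reindex) (auto simp: inj_on_def)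
    also have "\<dots> \<le> (\<Sum>h\<le>R. \<gamma> h)" by (rule sum_mono2) (auto simp: g)
    also have "(\<Sum>t\<in>{1..<s}. \<gamma> (if s \<le> t then t - s else s - t)) = (\<Sum>t\<in>{1..<s}. \<gamma> (s - t))" by (rule sum.cong) auto
    also have "\<dots> = (\<Sum>h\<in>(\<lambda>t. s - t) ` {1..<s}. \<gamma> h)" by (subst sum.reindex) (auto simp: inj_on_def)
    also have "\<dots> \<le> (\<Sum>h\<le>R. \<gamma> h)" using s by (intro sum_mono2) (auto simp: g)
    finally show ?thesis by simp
  qed
  have "(\<Sum>s\<in>{1..R}. \<Sum>t\<in>{1..R}. \<gamma> (if s \<le> t then t - s else s - t)) \<le> (\<Sum>s\<in>{1..R}. 2 * (\<Sum>h\<le>R. \<gamma> h))"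
    by (rule sum_mono) (rule row)
  then show ?thesis by simp
qed

text \<open>The factor \<open>exp (- \<i> * s)\<close> cancels the linear term
  \<open>\<i> * s\<close> to first order; what remains is quadratic in \<open>s\<close> or a product
  of \<open>s\<close> with the compensated quantity.\<close>

lemma centering_error:
  fixes F :: complex
  shows "cmod (F * exp (- \<i> * of_real s) - 1 - (F - 1 - \<i> * of_real s)) \<le> 2 * s\<^sup>2 + \<bar>s\<bar> * cmod (F - 1 - \<i> * of_real s)"
proof -
  define E where "E = iexp (- s)"
  have E: "exp (- \<i> * of_real s) = E" by (simp add: E_def)
  have e1: "cmod (E - 1 - \<i> * of_real (- s)) \<le> s\<^sup>2" unfolding E_def using cmod_iexp_taylor[of "- s"] by simp
  have e2: "cmod (E - 1) \<le> \<bar>s\<bar>" unfolding E_def using cmod_iexp_diff_le[of "- s" 0] by simp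
  have e3: "cmod (F - 1) \<le> cmod (F - 1 - \<i> * of_real s) + \<bar>s\<bar>"
    using norm_triangle_ineq[of "F - 1 - \<i> * of_real s" "\<i> * of_real s"] by (simp add: norm_mult)
  have eq: "F * E - 1 - (F - 1 - \<i> * of_real s) = (E - 1 - \<i> * of_real (- s)) + (E - 1) * (F - 1)"
    by (simp add: algebra_simps)
  have "cmod (F * E - 1 - (F - 1 - \<i> * of_real s)) \<le> cmod (E - 1 - \<i> * of_real (- s)) + cmod (E - 1) * cmod (F - 1)"
    unfolding eq by (rule order_trans[OF norm_triangle_ineq]) (simp add: norm_mult)
  moreover have "cmod (E - 1) * cmod (F - 1) \<le> \<bar>s\<bar> * (cmod (F - 1 - \<i> * of_real s) + \<bar>s\<bar>)"
    by (rule mult_mono[OF e2 e3]) auto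
  moreover have "\<bar>s\<bar> * (cmod (F - 1 - \<i> * of_real s) + \<bar>s\<bar>) = \<bar>s\<bar> * cmod (F - 1 - \<i> * of_real s) + s\<^sup>2"
    by (simp add: distrib_left power2_eq_square)
  ultimately show ?thesis unfolding E using e1 by linarith
qed

text \<open>An interval of m periods of length r splits into long blocks of length b and the gaps between them.\<close>
lemma prod_blocks:
  fixes f :: "int \<Rightarrow> complex"
  assumes b: "b \<le> r"
  shows "(\<Prod>t\<in>{1..int (m * r)}. f t) =
    (\<Prod>t\<in>(\<Union>j<m. (+) (int (j * r)) ` {1..int b}). f t) * (\<Prod>t\<in>(\<Union>j<m. (+) (int (j * r)) ` {int b + 1..int r}). f t)"
proof (induction m)
  case 0
  then show ?case by simp
next
  case (Suc m)
  define A where "A = (\<Union>j<m. (+) (int (j * r)) ` {1..int b})"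
  define B where "B = (\<Union>j<m. (+) (int (j * r)) ` {int b + 1..int r})"
  define C where "C = {int (m * r) + 1..int (m * r) + int b}"
  define D where "D = {int (m * r) + int b + 1..int (m * r) + int r}"
  have CD: "(+) (int (m * r)) ` {1..int b} = C" "(+) (int (m * r)) ` {int b + 1..int r} = D"
    unfolding C_def D_def by (simp_all add: image_add_atLeastAtMost add.assoc)
  have up: "int (j * r) + i \<le> int (m * r)" if "j < m" "i \<le> int r" for j i
  proof -
    have "(j + 1) * r \<le> m * r" using that by (intro mult_right_mono) auto
    then have "int (j * r) + int r \<le> int (m * r)" by (metis add_mult_distrib nat_mult_1 of_nat_add of_nat_le_iff)
    then show ?thesis using that by linarith
  qed
  have AC: "A \<inter> C = {}"
  proof -
    have "t \<le> int (m * r)" if "t \<in> A" for t using that up b unfolding A_def by force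
    then show ?thesis unfolding C_def by fastforce
  qed
  have BD: "B \<inter> D = {}"
  proof -
    have "t \<le> int (m * r)" if "t \<in> B" for t using that up unfolding B_def by force
    then show ?thesis unfolding D_def by fastforce
  qed
  have fin: "finite A" "finite B" "finite C" "finite D" unfolding A_def B_def C_def D_def by auto
  have un: "(\<Union>j<Suc m. (+) (int (j * r)) ` {1..int b}) = A \<union> C" "(\<Union>j<Suc m. (+) (int (j * r)) ` {int b + 1..int r}) = B \<union> D"
    unfolding A_def B_def CD[symmetric] by (auto simp: lessThan_Suc)
  have "{1..q + int r} = {1..q} \<union> ({q + 1..q + int b} \<union> {q + int b + 1..q + int r})" if "0 \<le> q" for q
    using b that by auto
  from this[of "int (m * r)"] have I: "{1..int (Suc m * r)} = {1..int (m * r)} \<union> (C \<union> D)"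
    unfolding C_def D_def by (simp add: add.commute)
  have "(\<Prod>t\<in>{1..int (Suc m * r)}. f t) = (\<Prod>t\<in>{1..int (m * r)}. f t) * (\<Prod>t\<in>C \<union> D. f t)"
    unfolding I using fin by (intro prod.union_disjoint) (auto simp: C_def D_def)
  also have "(\<Prod>t\<in>C \<union> D. f t) = (\<Prod>t\<in>C. f t) * (\<Prod>t\<in>D. f t)"
    using fin by (intro prod.union_disjoint) (auto simp: C_def D_def)
  also have "(\<Prod>t\<in>{1..int (m * r)}. f t) = (\<Prod>t\<in>A. f t) * (\<Prod>t\<in>B. f t)" using Suc.IH unfolding A_def B_def .
  finally show ?case unfolding un using fin AC BD by (simp add: prod.union_disjoint)
qed

section \<open>Size of the centering, and the block argument\<close>

context rv_mixing
begin

text \<open>The centering of a block is of order \<open>r n / a n\<close>, and its square summed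
  over \<open>n / r n\<close> blocks must vanish. With \<open>Z\<close> the capped modulus, the
  squared mean of a block sum is at most its second moment, so \<open>n * r n\<close> times the
  squared mean of \<open>Z\<close> is at most twice \<open>n\<close> times the sum of
  \<open>\<gamma>\<close> over all lags. Large lags are small by anti-clustering, small lags because
  the cap \<open>\<epsilon>\<close> makes the second moment small; and \<open>a n\<close> times the
  mean of \<open>Z\<close> approaches the mean of \<open>\<bar>X 0\<bar>\<close>, which dominates
  \<open>\<bar>\<mu>\<bar>\<close>.\<close>

lemma theta_small: "(\<lambda>n. real n * real (r n) * (drift u n)\<^sup>2) \<longlonglongrightarrow> 0"
proof (cases "cen * expectation (X 0) = 0")
  case True
  then have "drift u n = 0" for n by (auto simp: drift_def)
  then show ?thesis by simp
next
  case False
  then have k1: "\<kappa> > 1" by (auto simp: cen_def split: if_splits)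
  define \<mu> where "\<mu> = expectation (X 0)"
  have \<mu>: "\<mu> \<noteq> 0" and c1: "cen = 1" using False k1 by (auto simp: \<mu>_def cen_def)
  have X0i: "integrable M (X 0)" by (rule integrable_X0[OF k1])
  obtain C where C: "C > 0" "\<And>\<epsilon> t. \<epsilon> > 0 \<Longrightarrow> \<forall>\<^sub>F n in sequentially. real n * expectation (\<lambda>\<omega>. (min \<bar>X t \<omega> / a n\<bar> \<epsilon>)\<^sup>2) \<le> C * \<epsilon> powr (2 - \<kappa>)"
    using second_moment_seq by blast
  show ?thesis
  proof (rule tendstoI)
    fix e :: real assume e: "e > 0"
    \<comment> \<open>The constant 16 is 4 times 4: one factor from squaring
      \<open>\<bar>\<mu> / a n\<bar> \<le> 2 * EZ0\<close>, the other from
      \<open>n * r n * EZ0\<^sup>2 \<le> 4 * d\<close>.\<close>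
    define d where "d = e / (16 * (u\<^sup>2 + 1))"
    have u1: "u\<^sup>2 + 1 > 0" by (simp add: add_nonneg_pos)
    have d: "d > 0" unfolding d_def using e u1 by simp
    obtain k where k: "\<forall>\<^sub>F n in sequentially. capped_sum n k < d" using capped_sum_small[OF d] by blast
    obtain \<epsilon> where \<epsilon>: "0 < \<epsilon>" "\<epsilon> \<le> 1" "\<epsilon> powr (2 - \<kappa>) \<le> d / (C * (real k + 1))"
      using exists_small_powr[of "2 - \<kappa>" "d / (C * (real k + 1))"] \<kappa>_pos d C by auto
    define Z where "Z n t \<omega> = min \<bar>X (int t) \<omega> / a n\<bar> \<epsilon>" for n t \<omega>
    have Z0: "0 \<le> Z n t \<omega>" "Z n t \<omega> \<le> \<epsilon>" for n t \<omega> unfolding Z_def using \<epsilon> by auto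
    have Zm[measurable]: "Z n t \<in> borel_measurable M" for n t unfolding Z_def by measurable
    have Zi: "integrable M (Z n t)" for n t by (rule integrable_const_bound[where B = \<epsilon>]) (use Z0 in auto)
    have ZZi: "integrable M (\<lambda>\<omega>. Z n s \<omega> * Z n t \<omega>)" for n s t
      by (rule integrable_const_bound[where B = "\<epsilon> * \<epsilon>"]) (use Z0 \<epsilon> in \<open>auto simp: abs_mult intro!: mult_mono\<close>)
    define \<gamma> where "\<gamma> n h = expectation (\<lambda>\<omega>. Z n 0 \<omega> * Z n h \<omega>)" for n h
    have \<gamma>0: "0 \<le> \<gamma> n h" for n h unfolding \<gamma>_def by (rule Bochner_Integration.integral_nonneg) (use Z0 in auto)
    have pair: "expectation (\<lambda>\<omega>. Z n s \<omega> * Z n t \<omega>) = \<gamma> n (if s \<le> t then t - s else s - t)" for n s t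
    proof -
      have *: "expectation (\<lambda>\<omega>. Z n s \<omega> * Z n (s + h) \<omega>) = \<gamma> n h" for s h
        using stationary_pair[of "\<lambda>x y. min \<bar>x / a n\<bar> \<epsilon> * min \<bar>y / a n\<bar> \<epsilon>" "int s" h] unfolding Z_def \<gamma>_def by simp
      show ?thesis
      proof (cases "s \<le> t")
        case True
        then show ?thesis using *[of s "t - s"] by simp
      next
        case False
        then show ?thesis using *[of t "s - t"] by (simp add: mult.commute)
      qed
    qed
    have EZ: "expectation (Z n t) = expectation (Z n 0)" for n t
      unfolding Z_def by (simp, rule stationary_single, measurable)
    have sq: "real (R) ^ 2 * (expectation (Z n 0))\<^sup>2 \<le> 2 * real R * (\<Sum>h\<le>R. \<gamma> n h)" for n R
    proof -
      define S where "S \<omega> = (\<Sum>t\<in>{1..R}. Z n t \<omega>)" for \<omega>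
      have S2: "(S \<omega>)\<^sup>2 = (\<Sum>s\<in>{1..R}. \<Sum>t\<in>{1..R}. Z n s \<omega> * Z n t \<omega>)" for \<omega>
        unfolding S_def power2_eq_square by (rule sum_product)
      have Si: "integrable M S" unfolding S_def by (intro Bochner_Integration.integrable_sum Zi)
      have S2i: "integrable M (\<lambda>\<omega>. (S \<omega>)\<^sup>2)" unfolding S2 by (intro Bochner_Integration.integrable_sum ZZi)
      have ES: "expectation S = real R * expectation (Z n 0)"
      proof -
        have "expectation S = (\<Sum>t\<in>{1..R}. expectation (Z n t))"
          unfolding S_def by (rule Bochner_Integration.integral_sum[OF Zi])
        also have "\<dots> = (\<Sum>t\<in>{1..R}. expectation (Z n 0))" by (rule sum.cong[OF refl EZ])
        finally show ?thesis by simp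
      qed
      have "(real R * expectation (Z n 0))\<^sup>2 \<le> expectation (\<lambda>\<omega>. (S \<omega>)\<^sup>2)"
        using variance_eq[OF Si S2i] variance_positive[of S] unfolding ES by linarith
      also have "expectation (\<lambda>\<omega>. (S \<omega>)\<^sup>2) = (\<Sum>s\<in>{1..R}. \<Sum>t\<in>{1..R}. \<gamma> n (if s \<le> t then t - s else s - t))"
        unfolding S2 pair[symmetric] using ZZi by (subst Bochner_Integration.integral_sum) (auto intro!: sum.cong Bochner_Integration.integral_sum Bochner_Integration.integrable_sum)
      also have "\<dots> \<le> 2 * real R * (\<Sum>h\<le>R. \<gamma> n h)" by (rule toeplitz_sum_le[OF \<gamma>0])
      finally show ?thesis by (simp add: power_mult_distrib)
    qed
    \<comment> \<open>The cap \<open>\<epsilon> * a n\<close> tends to infinity, so the capped mean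
      approaches the mean of \<open>\<bar>X 0\<bar>\<close>; \<open>max 0\<close> keeps the cap
      nonnegative for the initial \<open>n\<close>, as the domination is required for all
      \<open>n\<close>.\<close>
    have "(\<lambda>n. expectation (\<lambda>\<omega>. min \<bar>X 0 \<omega>\<bar> (\<epsilon> * max 0 (a n)))) \<longlonglongrightarrow> expectation (\<lambda>\<omega>. \<bar>X 0 \<omega>\<bar>)"
    proof (rule integral_dominated_convergence[where w = "\<lambda>\<omega>. \<bar>X 0 \<omega>\<bar>"])
      show "(\<lambda>\<omega>. min \<bar>X 0 \<omega>\<bar> (\<epsilon> * max 0 (a n))) \<in> borel_measurable M" for n by measurable
      show "AE \<omega> in M. (\<lambda>n. min \<bar>X 0 \<omega>\<bar> (\<epsilon> * max 0 (a n))) \<longlonglongrightarrow> \<bar>X 0 \<omega>\<bar>"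
      proof (rule AE_I2)
        fix \<omega>
        have "\<forall>\<^sub>F n in sequentially. a n > \<bar>X 0 \<omega>\<bar> / \<epsilon>" using a_top by (simp add: filterlim_at_top_dense)
        then have "\<forall>\<^sub>F n in sequentially. min \<bar>X 0 \<omega>\<bar> (\<epsilon> * max 0 (a n)) = \<bar>X 0 \<omega>\<bar>"
        proof eventually_elim
          case (elim n)
          then have "\<bar>X 0 \<omega>\<bar> \<le> \<epsilon> * a n" using \<epsilon> by (simp add: pos_divide_less_eq mult.commute)
          also have "\<dots> \<le> \<epsilon> * max 0 (a n)" using \<epsilon> by (intro mult_left_mono) auto
          finally show ?case by simp
        qed
        then show "(\<lambda>n. min \<bar>X 0 \<omega>\<bar> (\<epsilon> * max 0 (a n))) \<longlonglongrightarrow> \<bar>X 0 \<omega>\<bar>" by (rule tendsto_eventually)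
      qed
      show "AE \<omega> in M. norm (min \<bar>X 0 \<omega>\<bar> (\<epsilon> * max 0 (a n))) \<le> \<bar>X 0 \<omega>\<bar>" for n
        using \<epsilon> by (intro AE_I2) (simp add: abs_of_nonneg)
    qed (use X0i in auto)
    moreover have "\<bar>\<mu>\<bar> / 2 < expectation (\<lambda>\<omega>. \<bar>X 0 \<omega>\<bar>)"
      using integral_abs_bound[of M "X 0"] \<mu> unfolding \<mu>_def by linarith
    ultimately have lower: "\<forall>\<^sub>F n in sequentially. \<bar>\<mu>\<bar> / 2 < expectation (\<lambda>\<omega>. min \<bar>X 0 \<omega>\<bar> (\<epsilon> * max 0 (a n)))"
      by (rule order_tendstoD(1))
    show "\<forall>\<^sub>F n in sequentially. dist (real n * real (r n) * (drift u n)\<^sup>2) 0 < e"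
      using lower k C(2)[OF \<epsilon>(1), of 0] a_pos r_ge[of 1]
    proof eventually_elim
      case (elim n)
      define EZ0 where "EZ0 = expectation (Z n 0)"
      have "expectation (\<lambda>\<omega>. min \<bar>X 0 \<omega>\<bar> (\<epsilon> * max 0 (a n))) = expectation (\<lambda>\<omega>. a n * Z n 0 \<omega>)"
      proof (rule Bochner_Integration.integral_cong[OF refl])
        fix \<omega>
        show "min \<bar>X 0 \<omega>\<bar> (\<epsilon> * max 0 (a n)) = a n * Z n 0 \<omega>"
          using elim(4) unfolding Z_def by (simp add: min_def field_simps)
      qed
      then have EZ0: "\<bar>\<mu>\<bar> / 2 < a n * EZ0" using elim(1) unfolding EZ0_def by simp
      have g1: "\<gamma> n h \<le> capped_moment n h" for h
        unfolding \<gamma>_def capped_moment_def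
      proof (rule integral_mono')
        show "integrable M (\<lambda>\<omega>. min \<bar>X (int h) \<omega> / a n\<bar> 1 * min \<bar>X 0 \<omega> / a n\<bar> 1)"
          by (rule integrable_const_bound[where B = 1]) (auto simp: abs_mult intro!: mult_le_one)
        show "Z n 0 \<omega> * Z n h \<omega> \<le> min \<bar>X (int h) \<omega> / a n\<bar> 1 * min \<bar>X 0 \<omega> / a n\<bar> 1" for \<omega>
          unfolding mult.commute[of "Z n 0 \<omega>"] by (rule mult_mono) (use \<epsilon> in \<open>auto simp: Z_def\<close>)
      qed auto
      have g2: "\<gamma> n h \<le> expectation (\<lambda>\<omega>. (min \<bar>X 0 \<omega> / a n\<bar> \<epsilon>)\<^sup>2)" for h
        using product_moment_le[OF \<epsilon>(1), of 0 n "int h"] unfolding \<gamma>_def Z_def by simp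
      have "(\<Sum>h\<le>r n. \<gamma> n h) \<le> (\<Sum>h\<in>{..<k} \<union> {k..r n}. \<gamma> n h)" by (rule sum_mono2) (auto simp: \<gamma>0)
      also have "\<dots> = (\<Sum>h<k. \<gamma> n h) + (\<Sum>h\<in>{k..r n}. \<gamma> n h)" by (rule sum.union_disjoint) auto
      also have "\<dots> \<le> (\<Sum>h<k. expectation (\<lambda>\<omega>. (min \<bar>X 0 \<omega> / a n\<bar> \<epsilon>)\<^sup>2)) + (\<Sum>h\<in>{k..r n}. capped_moment n h)"
        by (intro add_mono sum_mono g1 g2)
      finally have "real n * (\<Sum>h\<le>r n. \<gamma> n h) \<le> real n * (real k * expectation (\<lambda>\<omega>. (min \<bar>X 0 \<omega> / a n\<bar> \<epsilon>)\<^sup>2) + (\<Sum>h\<in>{k..r n}. capped_moment n h))"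
        by (intro mult_left_mono) auto
      also have "\<dots> = real k * (real n * expectation (\<lambda>\<omega>. (min \<bar>X 0 \<omega> / a n\<bar> \<epsilon>)\<^sup>2)) + capped_sum n k"
        by (simp add: capped_sum_def algebra_simps)
      also have "\<dots> \<le> real k * (C * \<epsilon> powr (2 - \<kappa>)) + d" using elim by (intro add_mono mult_left_mono) auto
      also have "\<dots> \<le> real k * (C * (d / (C * (real k + 1)))) + d"
        using \<epsilon> C by (intro add_right_mono mult_left_mono) auto
      also have "real k * (C * (d / (C * (real k + 1)))) = (real k / (real k + 1)) * d" using C by simp
      also have "\<dots> \<le> 1 * d" using d by (intro mult_right_mono) auto
      finally have ng: "real n * (\<Sum>h\<le>r n. \<gamma> n h) \<le> 2 * d" by simp
      have rp: "real (r n) > 0" using elim by simp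
      have "real (r n) * (real (r n) * EZ0\<^sup>2) \<le> real (r n) * (2 * (\<Sum>h\<le>r n. \<gamma> n h))"
        using sq[of "r n" n] unfolding EZ0_def by (simp add: power2_eq_square mult_ac)
      then have "real (r n) * EZ0\<^sup>2 \<le> 2 * (\<Sum>h\<le>r n. \<gamma> n h)" using rp by (rule mult_left_le_imp_le)
      then have "real n * (real (r n) * EZ0\<^sup>2) \<le> real n * (2 * (\<Sum>h\<le>r n. \<gamma> n h))" by (rule mult_left_mono) simp
      then have nr: "real n * real (r n) * EZ0\<^sup>2 \<le> 4 * d" using ng by (simp add: mult_ac)
      have "\<bar>\<mu> / a n\<bar> \<le> 2 * EZ0" using EZ0 elim(4) by (simp add: abs_divide pos_divide_le_eq mult_ac)
      then have "\<bar>\<mu> / a n\<bar>\<^sup>2 \<le> (2 * EZ0)\<^sup>2" by (rule power_mono) simp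
      then have "(\<mu> / a n)\<^sup>2 \<le> 4 * EZ0\<^sup>2" by (simp add: power_mult_distrib del: abs_divide)
      then have "u\<^sup>2 * (\<mu> / a n)\<^sup>2 \<le> u\<^sup>2 * (4 * EZ0\<^sup>2)" by (rule mult_left_mono) simp
      moreover have "(drift u n)\<^sup>2 = u\<^sup>2 * (\<mu> / a n)\<^sup>2" unfolding drift_def c1 \<mu>_def by (simp add: power_mult_distrib power_divide)
      ultimately have "real n * real (r n) * (drift u n)\<^sup>2 \<le> real n * real (r n) * (u\<^sup>2 * (4 * EZ0\<^sup>2))"
        by (intro mult_left_mono) auto
      also have "\<dots> = 4 * u\<^sup>2 * (real n * real (r n) * EZ0\<^sup>2)" by (simp only: mult_ac)
      also have "\<dots> \<le> 4 * u\<^sup>2 * (4 * d)" using nr by (intro mult_left_mono) auto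
      also have "\<dots> = (u\<^sup>2 / (u\<^sup>2 + 1)) * e" unfolding d_def using u1 by (simp add: field_simps)
      also have "\<dots> < 1 * e" using u1 e by (intro mult_strict_right_mono) auto
      finally show ?case by (simp add: dist_norm)
    qed
  qed
qed

lemma r_theta_small: "(\<lambda>n. real (r n) * \<bar>drift u n\<bar>) \<longlonglongrightarrow> 0"
proof -
  have "(\<lambda>n. sqrt (real (r n) / real n * (real n * real (r n) * (drift u n)\<^sup>2))) \<longlonglongrightarrow> sqrt (0 * 0)"
    by (intro tendsto_real_sqrt tendsto_mult r_o theta_small)
  then have "(\<lambda>n. sqrt (real (r n) / real n * (real n * real (r n) * (drift u n)\<^sup>2))) \<longlonglongrightarrow> 0" by simp
  then show ?thesis
  proof (rule Lim_transform_eventually)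
    show "\<forall>\<^sub>F n in sequentially. sqrt (real (r n) / real n * (real n * real (r n) * (drift u n)\<^sup>2)) = real (r n) * \<bar>drift u n\<bar>"
      using eventually_gt_at_top[of 0]
    proof eventually_elim
      case (elim n)
      have "real (r n) / real n * (real n * real (r n) * (drift u n)\<^sup>2) = (real (r n) * drift u n)\<^sup>2"
        using elim by (simp add: power2_eq_square)
      then show ?case by (simp add: abs_mult)
    qed
  qed
qed

text \<open>The centering is distributed over the single factors, so that shift invariance and the
  mixing bounds for \<open>Phi\<close> apply unchanged to the centred sums.\<close>

definition centered_phase :: "real \<Rightarrow> real \<Rightarrow> nat \<Rightarrow> real \<Rightarrow> complex" where
  "centered_phase u v n y = block_phase u v n y * exp (- \<i> * of_real (drift u n))"

lemma centered_phase_measurable [measurable]: "centered_phase u v n \<in> borel_measurable borel"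
  unfolding centered_phase_def by measurable

lemma cmod_centered_phase [simp]: "cmod (centered_phase u v n y) = 1"
  by (simp add: centered_phase_def norm_mult)

lemma Phi_centered_phase: "Phi (centered_phase u v n) {1..int b} = Phi (block_phase u v n) {1..int b} * exp (- \<i> * of_real (real b * drift u n))"
proof -
  have "(\<Prod>t\<in>{1..int b}. exp (- \<i> * complex_of_real (drift u n))) = exp (- \<i> * of_real (drift u n)) ^ b" by simp
  also have "\<dots> = exp (- \<i> * of_real (real b * drift u n))" unfolding exp_of_nat_mult[symmetric] by (simp add: mult_ac)
  finally show ?thesis
    unfolding Phi_def centered_phase_def prod.distrib by simp
qed

lemma centered_error:
  assumes b: "b \<le> r n"
  shows "real n * cmod (Phi (centered_phase u v n) {1..int b} - 1 - (Phi (block_phase u v n) {1..int b} - 1 - \<i> * of_real (real b * drift u n)))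
     \<le> real b * (2 * (real n * real (r n) * (drift u n)\<^sup>2)) + real (r n) * \<bar>drift u n\<bar> * (real n * cmod (Phi (block_phase u v n) {1..int b} - 1 - \<i> * of_real (real b * drift u n)))"
proof -
  define D where "D = cmod (Phi (block_phase u v n) {1..int b} - 1 - \<i> * of_real (real b * drift u n))"
  define s where "s = real b * drift u n"
  have "cmod (Phi (centered_phase u v n) {1..int b} - 1 - (Phi (block_phase u v n) {1..int b} - 1 - \<i> * of_real s)) \<le> 2 * s\<^sup>2 + \<bar>s\<bar> * D"
    unfolding Phi_centered_phase D_def s_def by (rule centering_error)
  also have "\<dots> \<le> 2 * (real b * (real (r n) * (drift u n)\<^sup>2)) + (real (r n) * \<bar>drift u n\<bar>) * D"
  proof (intro add_mono mult_left_mono mult_right_mono)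
    have "s\<^sup>2 = real b * (real b * (drift u n)\<^sup>2)" by (simp add: s_def power2_eq_square)
    also have "\<dots> \<le> real b * (real (r n) * (drift u n)\<^sup>2)" using b by (intro mult_left_mono mult_right_mono) auto
    finally show "s\<^sup>2 \<le> real b * (real (r n) * (drift u n)\<^sup>2)" .
    show "\<bar>s\<bar> \<le> real (r n) * \<bar>drift u n\<bar>" unfolding s_def abs_mult using b by (intro mult_mono) auto
  qed (auto simp: D_def)
  finally have "real n * cmod (Phi (centered_phase u v n) {1..int b} - 1 - (Phi (block_phase u v n) {1..int b} - 1 - \<i> * of_real s)) \<le> real n * (2 * (real b * (real (r n) * (drift u n)\<^sup>2)) + (real (r n) * \<bar>drift u n\<bar>) * D)"
    by (rule mult_left_mono) simp
  also have "\<dots> = real b * (2 * (real n * real (r n) * (drift u n)\<^sup>2)) + real (r n) * \<bar>drift u n\<bar> * (real n * D)"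
    by (simp add: algebra_simps)
  finally show ?thesis unfolding D_def s_def .
qed

lemma centered_block_bound: "\<exists>B>0. \<forall>\<^sub>F n in sequentially. \<forall>b\<le>r n. real n * cmod (Phi (centered_phase u v n) {1..int b} - 1) \<le> B * real b"
proof -
  obtain B where B: "B > 0" "\<forall>\<^sub>F n in sequentially. \<forall>b\<le>r n. real n * cmod (Phi (block_phase u v n) {1..int b} - 1 - \<i> * of_real (real b * drift u n)) \<le> B * real b"
    using block_bound by blast
  have t1: "\<forall>\<^sub>F n in sequentially. real n * real (r n) * (drift u n)\<^sup>2 < 1" by (rule order_tendstoD(2)[OF theta_small]) simp
  have t2: "\<forall>\<^sub>F n in sequentially. real (r n) * \<bar>drift u n\<bar> < 1" by (rule order_tendstoD(2)[OF r_theta_small]) simp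
  have "\<forall>\<^sub>F n in sequentially. \<forall>b\<le>r n. real n * cmod (Phi (centered_phase u v n) {1..int b} - 1) \<le> (2 * B + 2) * real b"
    using B(2) t1 t2
  proof eventually_elim
    case (elim n)
    show ?case
    proof (intro allI impI)
      fix b assume b: "b \<le> r n"
      define A where "A = Phi (block_phase u v n) {1..int b} - 1 - \<i> * of_real (real b * drift u n)"
      define C where "C = Phi (centered_phase u v n) {1..int b} - 1"
      have A: "real n * cmod A \<le> B * real b" using elim(1) b unfolding A_def by blast
      have "real n * cmod C \<le> real n * (cmod A + cmod (C - A))" by (intro mult_left_mono norm_triangle_sub) simp
      also have "\<dots> = real n * cmod A + real n * cmod (C - A)" by (rule distrib_left)
      also have "real n * cmod (C - A) \<le> real b * (2 * (real n * real (r n) * (drift u n)\<^sup>2)) + real (r n) * \<bar>drift u n\<bar> * (real n * cmod A)"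
        unfolding A_def C_def by (rule centered_error[OF b])
      also have "\<dots> \<le> real b * (2 * 1) + 1 * (B * real b)"
      proof (rule add_mono)
        show "real b * (2 * (real n * real (r n) * (drift u n)\<^sup>2)) \<le> real b * (2 * 1)"
          using elim(2) by (intro mult_left_mono) auto
        show "real (r n) * \<bar>drift u n\<bar> * (real n * cmod A) \<le> 1 * (B * real b)"
          by (rule mult_mono) (use elim(3) A B(1) in auto)
      qed
      finally show "real n * cmod (Phi (centered_phase u v n) {1..int b} - 1) \<le> (2 * B + 2) * real b"
        using A unfolding C_def by (simp add: algebra_simps)
    qed
  qed
  then show ?thesis using B(1) by (intro exI[of _ "2 * B + 2"]) auto
qed

lemma centered_block_limit:
  assumes b: "filterlim b at_top sequentially" "\<forall>\<^sub>F n in sequentially. b n \<le> r n"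
  shows "(\<lambda>n. of_real (real n / real (b n)) * (Phi (centered_phase u v n) {1..int (b n)} - 1)) \<longlonglongrightarrow> psi u v"
proof -
  obtain B where B: "B > 0" "\<forall>\<^sub>F n in sequentially. \<forall>b\<le>r n. real n * cmod (Phi (block_phase u v n) {1..int b} - 1 - \<i> * of_real (real b * drift u n)) \<le> B * real b"
    using block_bound by blast
  define A where "A n = Phi (block_phase u v n) {1..int (b n)} - 1 - \<i> * of_real (real (b n) * drift u n)" for n
  define C where "C n = Phi (centered_phase u v n) {1..int (b n)} - 1" for n
  have b1: "\<forall>\<^sub>F n in sequentially. 1 \<le> b n" using b(1) by (simp add: filterlim_at_top)
  have "(\<lambda>n. of_real (real n / real (b n)) * C n - of_real (real n / real (b n)) * A n) \<longlonglongrightarrow> 0"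
  proof (rule Lim_null_comparison)
    show "\<forall>\<^sub>F n in sequentially. cmod (of_real (real n / real (b n)) * C n - of_real (real n / real (b n)) * A n)
        \<le> 2 * (real n * real (r n) * (drift u n)\<^sup>2) + real (r n) * \<bar>drift u n\<bar> * B"
      using B(2) b(2) b1
    proof eventually_elim
      case (elim n)
      have bp: "real (b n) > 0" using elim by simp
      have "cmod (of_real (real n / real (b n)) * C n - of_real (real n / real (b n)) * A n) = real n * cmod (C n - A n) / real (b n)"
        unfolding right_diff_distrib[symmetric] norm_mult norm_of_real by simp
      also have "\<dots> \<le> (real (b n) * (2 * (real n * real (r n) * (drift u n)\<^sup>2)) + real (r n) * \<bar>drift u n\<bar> * (real n * cmod (A n))) / real (b n)"
        unfolding A_def C_def by (intro divide_right_mono centered_error elim) simp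
      also have "\<dots> \<le> (real (b n) * (2 * (real n * real (r n) * (drift u n)\<^sup>2)) + real (r n) * \<bar>drift u n\<bar> * (B * real (b n))) / real (b n)"
        using elim(1,2) unfolding A_def by (intro divide_right_mono add_left_mono mult_left_mono) auto
      also have "\<dots> = 2 * (real n * real (r n) * (drift u n)\<^sup>2) + real (r n) * \<bar>drift u n\<bar> * B"
        using bp by (simp add: add_divide_distrib)
      finally show ?case .
    qed
    have "(\<lambda>n. 2 * (real n * real (r n) * (drift u n)\<^sup>2) + real (r n) * \<bar>drift u n\<bar> * B) \<longlonglongrightarrow> 2 * 0 + 0 * B"
      by (intro tendsto_intros theta_small r_theta_small)
    then show "(\<lambda>n. 2 * (real n * real (r n) * (drift u n)\<^sup>2) + real (r n) * \<bar>drift u n\<bar> * B) \<longlonglongrightarrow> 0" by simp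
  qed
  moreover have "(\<lambda>n. of_real (real n / real (b n)) * A n) \<longlonglongrightarrow> psi u v"
    unfolding A_def by (rule block_limit[OF b])
  ultimately have "(\<lambda>n. (of_real (real n / real (b n)) * C n - of_real (real n / real (b n)) * A n) + of_real (real n / real (b n)) * A n) \<longlonglongrightarrow> 0 + psi u v"
    by (rule tendsto_add)
  then show ?thesis unfolding C_def by simp
qed

text \<open>On the unit circle \<open>(cmod (z - 1))\<^sup>2 = 2 - 2 * Re z\<close>, so a mean close
  to 1 forces \<open>z\<close> itself close to 1 in the mean. In this way the gaps and the
  incomplete last block are dropped from a product although they are not independent of the
  rest.\<close>

lemma expectation_norm_minus_1_le:
  fixes z :: "'a \<Rightarrow> complex"
  assumes [measurable]: "z \<in> borel_measurable M" and z: "\<And>\<omega>. cmod (z \<omega>) = 1"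
  shows "expectation (\<lambda>\<omega>. cmod (z \<omega> - 1)) \<le> sqrt (2 * cmod (expectation z - 1))"
proof -
  have zi: "integrable M z" by (rule integrable_const_bound[where B = 1]) (use z in auto)
  have b2: "cmod (z \<omega> - 1) \<le> 2" for \<omega> using norm_triangle_ineq4[of "z \<omega>" 1] z[of \<omega>] by simp
  have i1: "integrable M (\<lambda>\<omega>. cmod (z \<omega> - 1))" by (rule integrable_const_bound[where B = 2]) (use b2 in auto)
  have sq: "(cmod (z \<omega> - 1))\<^sup>2 = 2 - 2 * Re (z \<omega>)" for \<omega>
  proof -
    have "(Re (z \<omega>))\<^sup>2 + (Im (z \<omega>))\<^sup>2 = 1" using z[of \<omega>] cmod_power2[of "z \<omega>"] by simp
    then show ?thesis unfolding cmod_power2 by (simp add: power2_eq_square algebra_simps)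
  qed
  have i2: "integrable M (\<lambda>\<omega>. (cmod (z \<omega> - 1))\<^sup>2)" unfolding sq using zi by simp
  have "(expectation (\<lambda>\<omega>. cmod (z \<omega> - 1)))\<^sup>2 \<le> expectation (\<lambda>\<omega>. (cmod (z \<omega> - 1))\<^sup>2)"
    using variance_eq[OF i1 i2] variance_positive[of "\<lambda>\<omega>. cmod (z \<omega> - 1)"] by linarith
  also have "\<dots> = 2 - 2 * Re (expectation z)" unfolding sq using zi prob_space by simp
  also have "\<dots> \<le> 2 * cmod (expectation z - 1)"
    using abs_Re_le_cmod[of "expectation z - 1"] by simp
  finally show ?thesis by (rule real_le_rsqrt)
qed

text \<open>Bernstein's blocks: a period of length \<open>r n\<close> consists of a long block of
  length \<open>r n - l n\<close> and a gap of length \<open>l n\<close>. Mixing across the gaps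
  turns the long blocks into a power. The gaps have total length of smaller order, and they are
  themselves separated by the long blocks, so the same argument shows that their factor tends to
  1.\<close>

lemma cf_limit: "(\<lambda>n. Phi (centered_phase u v n) {1..int n}) \<longlonglongrightarrow> exp (psi u v)" "Re (psi u v) \<le> 0"
proof -
  define m where "m n = n div r n" for n
  define b where "b n = r n - l n" for n
  define \<alpha> where "\<alpha> n = strong_mixing_coeff M X (l n)" for n
  define Mn where "Mn n = (\<Union>j<m n. (+) (int (j * r n)) ` {1..int (b n)})" for n
  define Dn where "Dn n = (\<Union>j<m n. (+) (int (j * r n)) ` {int (b n) + 1..int (r n)})" for n
  define Rn where "Rn n = {int (m n * r n) + 1..int n}" for n
  have r1: "\<forall>\<^sub>F n in sequentially. 1 \<le> r n" by (rule r_ge)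
  have l1: "\<forall>\<^sub>F n in sequentially. 1 \<le> l n" using l_top by (simp add: filterlim_at_top)
  \<comment> \<open>A gap takes at most half of the period; hence consecutive gaps are at least
    \<open>l n\<close> apart as well.\<close>
  have lr: "\<forall>\<^sub>F n in sequentially. 2 * l n \<le> r n"
  proof -
    have "\<forall>\<^sub>F n in sequentially. real (l n) / real (r n) < 1 / 2" by (rule order_tendstoD(2)[OF l_o]) simp
    then show ?thesis using r1 by eventually_elim (simp add: field_simps)
  qed
  have rn: "\<forall>\<^sub>F n in sequentially. r n \<le> n"
  proof -
    have "\<forall>\<^sub>F n in sequentially. real (r n) / real n < 1" by (rule order_tendstoD(2)[OF r_o]) simp
    then show ?thesis using eventually_gt_at_top[of 0] by eventually_elim (simp add: field_simps)
  qed
  have qm: "centered_phase u v n \<in> borel_measurable borel" for n by simp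
  have q1: "cmod (centered_phase u v n y) \<le> 1" for n y by simp
  have al0: "0 \<le> \<alpha> n" for n
    using mixing_coeff_bound[of "\<lambda>_. 0" "\<lambda>_. 0" "l n"] unfolding \<alpha>_def by simp
  have mr: "real (m n) * real (r n) \<le> real n" for n
    unfolding m_def of_nat_mult[symmetric] by (simp only: of_nat_le_iff) simp
  have m\<alpha>: "(\<lambda>n. 4 * real (m n) * \<alpha> n) \<longlonglongrightarrow> 0"
  proof (rule tendsto_sandwich[where f = "\<lambda>_. 0" and h = "\<lambda>n. 4 * (real n / real (r n) * \<alpha> n)"])
    show "\<forall>\<^sub>F n in sequentially. 0 \<le> 4 * real (m n) * \<alpha> n" using al0 by simp
    show "\<forall>\<^sub>F n in sequentially. 4 * real (m n) * \<alpha> n \<le> 4 * (real n / real (r n) * \<alpha> n)"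
      using r1
    proof eventually_elim
      case (elim n)
      have "real (m n) \<le> real n / real (r n)" using mr[of n] elim by (simp add: pos_le_divide_eq)
      then have "real (m n) * \<alpha> n \<le> real n / real (r n) * \<alpha> n" by (rule mult_right_mono) (rule al0)
      then show ?case by simp
    qed
    have "(\<lambda>n. 4 * (real n / real (r n) * \<alpha> n)) \<longlonglongrightarrow> 4 * 0" unfolding \<alpha>_def by (intro tendsto_intros mix)
    then show "(\<lambda>n. 4 * (real n / real (r n) * \<alpha> n)) \<longlonglongrightarrow> 0" by simp
  qed simp
  obtain B where B: "B > 0" "\<forall>\<^sub>F n in sequentially. \<forall>b\<le>r n. real n * cmod (Phi (centered_phase u v n) {1..int b} - 1) \<le> B * real b"
    using centered_block_bound by blast

  have main: "(\<lambda>n. Phi (centered_phase u v n) (Mn n) - Phi (centered_phase u v n) {1..int (b n)} ^ m n) \<longlonglongrightarrow> 0"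
  proof (rule Lim_null_comparison[OF _ m\<alpha>])
    show "\<forall>\<^sub>F n in sequentially. cmod (Phi (centered_phase u v n) (Mn n) - Phi (centered_phase u v n) {1..int (b n)} ^ m n) \<le> 4 * real (m n) * \<alpha> n"
      using l1 lr
    proof eventually_elim
      case (elim n)
      show ?case unfolding Mn_def \<alpha>_def
        by (rule Phi_blocks[OF qm q1 order_refl elim(1)]) (use elim in \<open>simp add: b_def\<close>)
    qed
  qed
  have drop: "(\<lambda>n. Phi (centered_phase u v n) (Dn n) - 1) \<longlonglongrightarrow> 0"
  proof (rule Lim_null_comparison)
    show "\<forall>\<^sub>F n in sequentially. cmod (Phi (centered_phase u v n) (Dn n) - 1) \<le> 4 * real (m n) * \<alpha> n + B * (real (l n) / real (r n))"
      using l1 lr B(2) r1 eventually_gt_at_top[of 0]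
    proof eventually_elim
      case (elim n)
      define U where "U = (\<Union>j<m n. (+) (int (j * r n)) ` {1..int (l n)})"
      have fU: "finite U" unfolding U_def by auto
      \<comment> \<open>Shifting back by \<open>b n\<close> puts the gaps at the starts of the
        periods, the form in which \<open>Phi_blocks\<close> is stated.\<close>
      have "Dn n = (+) (int (b n)) ` U"
      proof -
        have "{int (b n) + 1..int (r n)} = (+) (int (b n)) ` {1..int (l n)}"
          using elim unfolding b_def by (simp add: image_add_atLeastAtMost of_nat_diff add.commute)
        then show ?thesis unfolding Dn_def U_def image_UN by (simp only: image_image add.left_commute[of "int (b n)"])
      qed
      then have e1: "Phi (centered_phase u v n) (Dn n) = Phi (centered_phase u v n) U" using Phi_shift[OF qm fU] by simp
      have e2: "cmod (Phi (centered_phase u v n) U - Phi (centered_phase u v n) {1..int (l n)} ^ m n) \<le> 4 * real (m n) * \<alpha> n"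
        unfolding U_def \<alpha>_def by (rule Phi_blocks[OF qm q1 order_refl elim(1)]) (use elim in simp)
      have "cmod (Phi (centered_phase u v n) {1..int (l n)} ^ m n - 1 ^ m n) \<le> real (m n) * cmod (Phi (centered_phase u v n) {1..int (l n)} - 1)"
        by (rule norm_power_diff) (auto intro!: Phi_le_1)
      also have "\<dots> \<le> (real n / real (r n)) * cmod (Phi (centered_phase u v n) {1..int (l n)} - 1)"
        using mr[of n] elim by (intro mult_right_mono) (auto simp: pos_le_divide_eq)
      also have "\<dots> = (real n * cmod (Phi (centered_phase u v n) {1..int (l n)} - 1)) / real (r n)" by simp
      also have "\<dots> \<le> (B * real (l n)) / real (r n)" using elim by (intro divide_right_mono) auto
      finally have e3: "cmod (Phi (centered_phase u v n) {1..int (l n)} ^ m n - 1) \<le> B * (real (l n) / real (r n))" by simp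
      show ?case unfolding e1
        using norm_triangle_ineq[of "Phi (centered_phase u v n) U - Phi (centered_phase u v n) {1..int (l n)} ^ m n" "Phi (centered_phase u v n) {1..int (l n)} ^ m n - 1"] e2 e3 by simp
    qed
    have "(\<lambda>n. 4 * real (m n) * \<alpha> n + B * (real (l n) / real (r n))) \<longlonglongrightarrow> 0 + B * 0"
      by (intro tendsto_intros m\<alpha> l_o)
    then show "(\<lambda>n. 4 * real (m n) * \<alpha> n + B * (real (l n) / real (r n))) \<longlonglongrightarrow> 0" by simp
  qed
  have rem: "(\<lambda>n. Phi (centered_phase u v n) (Rn n) - 1) \<longlonglongrightarrow> 0"
  proof (rule Lim_null_comparison)
    show "\<forall>\<^sub>F n in sequentially. cmod (Phi (centered_phase u v n) (Rn n) - 1) \<le> B * (real (r n) / real n)"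
      using B(2) r1 eventually_gt_at_top[of 0]
    proof eventually_elim
      case (elim n)
      define c where "c = n mod r n"
      have n: "n = m n * r n + c" unfolding m_def c_def by simp
      have c: "c \<le> r n" unfolding c_def using elim by simp
      have "Rn n = (+) (int (m n * r n)) ` {1..int c}"
        unfolding Rn_def by (subst (2) n) (simp add: image_add_atLeastAtMost)
      then have "Phi (centered_phase u v n) (Rn n) = Phi (centered_phase u v n) {1..int c}" by (simp only: Phi_shift[OF qm finite_atLeastAtMost_int])
      moreover have "real n * cmod (Phi (centered_phase u v n) {1..int c} - 1) \<le> B * real c" by (rule elim(1)[rule_format, OF c])
      moreover have "B * real c \<le> B * real (r n)" using c B by (intro mult_left_mono) auto
      ultimately have "real n * cmod (Phi (centered_phase u v n) (Rn n) - 1) \<le> B * real (r n)" by simp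
      then show ?case using elim by (simp add: pos_le_divide_eq mult.commute)
    qed
    have "(\<lambda>n. B * (real (r n) / real n)) \<longlonglongrightarrow> B * 0" by (intro tendsto_intros r_o)
    then show "(\<lambda>n. B * (real (r n) / real n)) \<longlonglongrightarrow> 0" by simp
  qed

  have b_top: "filterlim b at_top sequentially"
    unfolding filterlim_at_top
  proof
    fix Z
    show "\<forall>\<^sub>F n in sequentially. Z \<le> b n"
      using r_ge[of "2 * Z"] lr by eventually_elim (simp add: b_def)
  qed
  have m_top: "filterlim m at_top sequentially"
    unfolding filterlim_at_top
  proof
    fix Z
    have "\<forall>\<^sub>F n in sequentially. real (r n) / real n < 1 / (real Z + 1)" by (rule order_tendstoD(2)[OF r_o]) simp
    then show "\<forall>\<^sub>F n in sequentially. Z \<le> m n"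
      using r1 eventually_gt_at_top[of 0]
    proof eventually_elim
      case (elim n)
      then have "real (r n) * (real Z + 1) < real n" by (simp add: field_simps)
      then have "real (Z * r n) \<le> real n" by (simp add: algebra_simps)
      then have "Z * r n \<le> n" by (simp only: of_nat_le_iff)
      then show "Z \<le> m n" unfolding m_def using elim by (simp add: less_eq_div_iff_mult_less_eq)
    qed
  qed
  \<comment> \<open>The long blocks cover asymptotically all of the interval, because
    \<open>r n / n\<close> and \<open>l n / r n\<close> vanish; this converts the normalisation
    \<open>n / b n\<close> of a single block into the exponent \<open>m n\<close>.\<close>
  have ratio: "(\<lambda>n. real (m n) * real (b n) / real n) \<longlonglongrightarrow> 1"
  proof (rule tendsto_sandwich[where f = "\<lambda>n. (1 - real (r n) / real n) * (1 - real (l n) / real (r n))" and h = "\<lambda>_. 1"])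
    show "\<forall>\<^sub>F n in sequentially. (1 - real (r n) / real n) * (1 - real (l n) / real (r n)) \<le> real (m n) * real (b n) / real n"
      using r1 lr rn eventually_gt_at_top[of 0]
    proof eventually_elim
      case (elim n)
      have "n < m n * r n + r n" unfolding m_def using elim
        by (metis add.commute add_less_cancel_left div_mult_mod_eq mod_less_divisor less_le_trans zero_less_one)
      then have "real n - real (r n) \<le> real (m n) * real (r n)"
        by (metis diff_le_eq less_imp_le of_nat_add of_nat_le_iff of_nat_mult)
      then have "1 - real (r n) / real n \<le> real (m n) * real (r n) / real n"
      proof -
        have "1 - real (r n) / real n = (real n - real (r n)) / real n" using elim by (simp add: diff_divide_distrib)
        also have "\<dots> \<le> real (m n) * real (r n) / real n" using \<open>real n - real (r n) \<le> real (m n) * real (r n)\<close> by (rule divide_right_mono) simp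
        finally show ?thesis .
      qed
      moreover have "0 \<le> 1 - real (l n) / real (r n)" using elim by (simp add: field_simps)
      ultimately have "(1 - real (r n) / real n) * (1 - real (l n) / real (r n)) \<le> real (m n) * real (r n) / real n * (1 - real (l n) / real (r n))"
        by (rule mult_right_mono)
      also have "\<dots> = real (m n) * real (b n) / real n"
        using elim by (simp add: b_def of_nat_diff field_simps)
      finally show ?case .
    qed
    show "\<forall>\<^sub>F n in sequentially. real (m n) * real (b n) / real n \<le> 1"
      using eventually_gt_at_top[of 0]
    proof eventually_elim
      case (elim n)
      have "real (m n) * real (b n) \<le> real (m n) * real (r n)" by (intro mult_left_mono) (auto simp: b_def)
      then show ?case using mr[of n] elim by (simp add: divide_le_eq)
    qed
    have "(\<lambda>n. (1 - real (r n) / real n) * (1 - real (l n) / real (r n))) \<longlonglongrightarrow> (1 - 0) * (1 - 0)"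
      by (intro tendsto_intros r_o l_o)
    then show "(\<lambda>n. (1 - real (r n) / real n) * (1 - real (l n) / real (r n))) \<longlonglongrightarrow> 1" by simp
  qed simp
  have "(\<lambda>n. of_real (real (m n) * real (b n) / real n) * (of_real (real n / real (b n)) * (Phi (centered_phase u v n) {1..int (b n)} - 1))) \<longlonglongrightarrow> of_real 1 * psi u v"
    by (intro tendsto_mult tendsto_of_real ratio centered_block_limit b_top) (simp add: b_def)
  then have "(\<lambda>n. of_nat (m n) * (Phi (centered_phase u v n) {1..int (b n)} - 1)) \<longlonglongrightarrow> of_real 1 * psi u v"
  proof (rule Lim_transform_eventually)
    have "\<forall>\<^sub>F n in sequentially. 1 \<le> b n" using b_top by (simp add: filterlim_at_top)
    then show "\<forall>\<^sub>F n in sequentially. of_real (real (m n) * real (b n) / real n) * (of_real (real n / real (b n)) * (Phi (centered_phase u v n) {1..int (b n)} - 1)) = of_nat (m n) * (Phi (centered_phase u v n) {1..int (b n)} - 1)"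
      using eventually_gt_at_top[of 0] by eventually_elim simp
  qed
  then have lim: "(\<lambda>n. of_nat (m n) * (Phi (centered_phase u v n) {1..int (b n)} - 1)) \<longlonglongrightarrow> psi u v" by simp
  have Ple: "cmod (Phi (centered_phase u v n) {1..int (b n)}) \<le> 1" for n by (rule Phi_le_1) simp
  have pow: "(\<lambda>n. Phi (centered_phase u v n) {1..int (b n)} ^ m n) \<longlonglongrightarrow> exp (psi u v)" and Re: "Re (psi u v) \<le> 0"
    by (rule power_limit_exp[OF Ple m_top lim])+
  show "Re (psi u v) \<le> 0" by (rule Re)
  \<comment> \<open>All factors have modulus 1, so removing gaps and remainder costs at most the sum
    of their mean distances from 1.\<close>
  have all: "(\<lambda>n. Phi (centered_phase u v n) {1..int n} - Phi (centered_phase u v n) (Mn n)) \<longlonglongrightarrow> 0"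
  proof (rule Lim_null_comparison)
    show "\<forall>\<^sub>F n in sequentially. cmod (Phi (centered_phase u v n) {1..int n} - Phi (centered_phase u v n) (Mn n)) \<le> sqrt (2 * cmod (Phi (centered_phase u v n) (Dn n) - 1)) + sqrt (2 * cmod (Phi (centered_phase u v n) (Rn n) - 1))"
    proof (rule always_eventually, rule allI)
      fix n
      define P where "P I \<omega> = (\<Prod>t\<in>I. centered_phase u v n (X t \<omega>))" for I \<omega>
      have Pm[measurable]: "P I \<in> borel_measurable M" for I unfolding P_def by measurable
      have P1: "cmod (P I \<omega>) = 1" for I \<omega> unfolding P_def by (simp add: prod_norm[symmetric])
      have Pi: "integrable M (P I)" for I by (rule integrable_const_bound[where B = 1]) (use P1 in auto)
      have PE: "Phi (centered_phase u v n) I = expectation (P I)" for I unfolding Phi_def P_def ..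
      have n: "n = m n * r n + n mod r n" unfolding m_def by simp
      have le: "int (m n * r n) \<le> int n" by (subst (3) n) simp
      have "{1..int n} = {1..q} \<union> {q + 1..int n}" if "0 \<le> q" "q \<le> int n" for q
        using that by auto
      from this[OF of_nat_0_le_iff le] have I: "{1..int n} = {1..int (m n * r n)} \<union> Rn n" unfolding Rn_def .
      have split: "P {1..int n} \<omega> = P (Mn n) \<omega> * P (Dn n) \<omega> * P (Rn n) \<omega>" for \<omega>
      proof -
        have "P {1..int n} \<omega> = P {1..int (m n * r n)} \<omega> * P (Rn n) \<omega>"
          unfolding P_def I by (rule prod.union_disjoint) (auto simp: Rn_def)
        also have "P {1..int (m n * r n)} \<omega> = P (Mn n) \<omega> * P (Dn n) \<omega>"
          unfolding P_def Mn_def Dn_def by (rule prod_blocks) (simp add: b_def)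
        finally show ?thesis .
      qed
      have "cmod (expectation (P {1..int n}) - expectation (P (Mn n))) = cmod (expectation (\<lambda>\<omega>. P {1..int n} \<omega> - P (Mn n) \<omega>))"
        using Pi by simp
      also have "\<dots> \<le> expectation (\<lambda>\<omega>. cmod (P (Dn n) \<omega> - 1) + cmod (P (Rn n) \<omega> - 1))"
      proof (rule order_trans[OF integral_norm_bound integral_mono])
        show "integrable M (\<lambda>\<omega>. cmod (P {1..int n} \<omega> - P (Mn n) \<omega>))" using Pi by simp
        show "integrable M (\<lambda>\<omega>. cmod (P (Dn n) \<omega> - 1) + cmod (P (Rn n) \<omega> - 1))" using Pi by simp
        fix \<omega>
        have "P {1..int n} \<omega> - P (Mn n) \<omega> = P (Mn n) \<omega> * (P (Dn n) \<omega> * (P (Rn n) \<omega> - 1) + (P (Dn n) \<omega> - 1))"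
          unfolding split by (simp add: algebra_simps)
        then have "cmod (P {1..int n} \<omega> - P (Mn n) \<omega>) = cmod (P (Dn n) \<omega> * (P (Rn n) \<omega> - 1) + (P (Dn n) \<omega> - 1))"
          by (simp only: norm_mult P1 mult_1_left)
        also have "\<dots> \<le> cmod (P (Rn n) \<omega> - 1) + cmod (P (Dn n) \<omega> - 1)"
          by (rule order_trans[OF norm_triangle_ineq]) (simp add: norm_mult P1)
        finally show "cmod (P {1..int n} \<omega> - P (Mn n) \<omega>) \<le> cmod (P (Dn n) \<omega> - 1) + cmod (P (Rn n) \<omega> - 1)" by simp
      qed
      also have "\<dots> = expectation (\<lambda>\<omega>. cmod (P (Dn n) \<omega> - 1)) + expectation (\<lambda>\<omega>. cmod (P (Rn n) \<omega> - 1))"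
        using Pi by simp
      also have "\<dots> \<le> sqrt (2 * cmod (expectation (P (Dn n)) - 1)) + sqrt (2 * cmod (expectation (P (Rn n)) - 1))"
        by (intro add_mono expectation_norm_minus_1_le P1 Pm)
      finally show "cmod (Phi (centered_phase u v n) {1..int n} - Phi (centered_phase u v n) (Mn n)) \<le> sqrt (2 * cmod (Phi (centered_phase u v n) (Dn n) - 1)) + sqrt (2 * cmod (Phi (centered_phase u v n) (Rn n) - 1))"
        unfolding PE .
    qed
    have "(\<lambda>n. sqrt (2 * cmod (Phi (centered_phase u v n) (Dn n) - 1)) + sqrt (2 * cmod (Phi (centered_phase u v n) (Rn n) - 1))) \<longlonglongrightarrow> sqrt (2 * cmod 0) + sqrt (2 * cmod 0)"
      by (intro tendsto_add tendsto_real_sqrt tendsto_mult tendsto_const tendsto_norm drop rem)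
    then show "(\<lambda>n. sqrt (2 * cmod (Phi (centered_phase u v n) (Dn n) - 1)) + sqrt (2 * cmod (Phi (centered_phase u v n) (Rn n) - 1))) \<longlonglongrightarrow> 0" by simp
  qed
  from tendsto_add[OF tendsto_add[OF all main] pow]
  show "(\<lambda>n. Phi (centered_phase u v n) {1..int n}) \<longlonglongrightarrow> exp (psi u v)" by simp
qed

text \<open>\<open>centered_phase\<close> centres the linear part only, so the squares first appear
  without centering. The two sums of squares, divided by \<open>(a n)\<^sup>2\<close>, differ in the
  mean by a term of order \<open>n / (a n)\<^sup>2\<close>; for \<open>\<mu> \<noteq> 0\<close> this
  vanishes by \<open>theta_small\<close>, as \<open>r n \<ge> 1\<close> eventually.\<close>

lemma joint_cf_limit:
  defines "\<mu> \<equiv> cen * expectation (X 0)"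
  shows "(\<lambda>n. expectation (\<lambda>\<omega>. iexp (u * ((\<Sum>t\<in>{1..int n}. X t \<omega> - \<mu>) / a n) + v * ((\<Sum>t\<in>{1..int n}. (X t \<omega> - \<mu>)\<^sup>2) / (a n)\<^sup>2)))) \<longlonglongrightarrow> exp (psi u v)"
proof -
  define S where "S n \<omega> = (\<Sum>t\<in>{1..int n}. X t \<omega> - \<mu>) / a n" for n \<omega>
  define Q where "Q n \<omega> = (\<Sum>t\<in>{1..int n}. (X t \<omega>)\<^sup>2) / (a n)\<^sup>2" for n \<omega>
  define Q' where "Q' n \<omega> = (\<Sum>t\<in>{1..int n}. (X t \<omega> - \<mu>)\<^sup>2) / (a n)\<^sup>2" for n \<omega>
  have [measurable]: "S n \<in> borel_measurable M" "Q n \<in> borel_measurable M" "Q' n \<in> borel_measurable M" for n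
    unfolding S_def Q_def Q'_def by measurable
  have prod: "(\<Prod>t\<in>{1..int n}. centered_phase u v n (X t \<omega>)) = iexp (u * S n \<omega> + v * Q n \<omega>)" for n \<omega>
  proof -
    have "(\<Prod>t\<in>{1..int n}. centered_phase u v n (X t \<omega>)) = (\<Prod>t\<in>{1..int n}. phase u v (X t \<omega> / a n)) * (\<Prod>t\<in>{1..int n}. exp (- \<i> * of_real (drift u n)))"
      unfolding centered_phase_def block_phase_def prod.distrib ..
    also have "(\<Prod>t\<in>{1..int n}. exp (- \<i> * complex_of_real (drift u n))) = exp (- \<i> * of_real (drift u n)) ^ n" by simp
    also have "\<dots> = iexp (- (real n * drift u n))" unfolding exp_of_nat_mult[symmetric] by (simp add: mult_ac)
    also have "(\<Prod>t\<in>{1..int n}. phase u v (X t \<omega> / a n)) = iexp (u * (\<Sum>t\<in>{1..int n}. X t \<omega> / a n) + v * (\<Sum>t\<in>{1..int n}. (X t \<omega> / a n)\<^sup>2))"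
      by (rule prod_phase_eq_iexp) simp
    also have "\<dots> * iexp (- (real n * drift u n)) = iexp (u * (\<Sum>t\<in>{1..int n}. X t \<omega> / a n) + v * (\<Sum>t\<in>{1..int n}. (X t \<omega> / a n)\<^sup>2) - real n * drift u n)"
      by (simp add: exp_add[symmetric] algebra_simps)
    also have "u * (\<Sum>t\<in>{1..int n}. X t \<omega> / a n) + v * (\<Sum>t\<in>{1..int n}. (X t \<omega> / a n)\<^sup>2) - real n * drift u n = u * S n \<omega> + v * Q n \<omega>"
      unfolding S_def Q_def drift_def \<mu>_def
      by (simp add: sum_subtractf power_divide sum_divide_distrib[symmetric] diff_divide_distrib right_diff_distrib mult_ac)
    finally show ?thesis .
  qed
  have P: "Phi (centered_phase u v n) {1..int n} = expectation (\<lambda>\<omega>. iexp (u * S n \<omega> + v * Q n \<omega>))" for n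
    unfolding Phi_def prod ..
  have "(\<lambda>n. expectation (\<lambda>\<omega>. iexp (u * S n \<omega> + v * Q' n \<omega>)) - expectation (\<lambda>\<omega>. iexp (u * S n \<omega> + v * Q n \<omega>))) \<longlonglongrightarrow> 0"
  proof (cases "\<mu> = 0")
    case True
    then show ?thesis by (simp add: Q_def Q'_def)
  next
    case False
    then have k1: "\<kappa> > 1" and c1: "cen = 1" by (auto simp: \<mu>_def cen_def split: if_splits)
    have Xi: "integrable M (X t)" for t
    proof -
      have X0i: "integrable M (X 0)" by (rule integrable_X0[OF k1])
      have eq: "distr M borel (X t) = distr M borel (X 0)"
      proof (rule measure_eqI)
        fix A assume "A \<in> sets (distr M borel (X t))"
        then have [measurable]: "A \<in> sets borel" by simp
        have "expectation (\<lambda>\<omega>. indicator A (X t \<omega>) :: real) = expectation (\<lambda>\<omega>. indicator A (X 0 \<omega>))"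
          by (rule stationary_single) measurable
        then have "measure (distr M borel (X t)) A = measure (distr M borel (X 0)) A"
          by (simp add: measure_distr indicator_vimage[symmetric] Int_def vimage_def flip: indicator_def)
        then show "emeasure (distr M borel (X t)) A = emeasure (distr M borel (X 0)) A"
          by (simp add: emeasure_distr emeasure_eq_measure measure_distr)
      qed simp
      have "integrable (distr M borel (X s)) (\<lambda>x. x) \<longleftrightarrow> integrable M (X s)" for s
        by (rule integrable_distr_eq) auto
      from this[of t] this[of 0] show ?thesis using X0i unfolding eq by blast
    qed
    have EX: "expectation (\<lambda>\<omega>. \<bar>X t \<omega>\<bar>) = expectation (\<lambda>\<omega>. \<bar>X 0 \<omega>\<bar>)" for t
      by (rule stationary_single) measurable
    define c where "c = \<bar>v\<bar> * (2 * \<bar>\<mu>\<bar> * expectation (\<lambda>\<omega>. \<bar>X 0 \<omega>\<bar>) + \<mu>\<^sup>2)"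
    have na: "(\<lambda>n. real n / (a n)\<^sup>2) \<longlonglongrightarrow> 0"
    proof (rule tendsto_sandwich[where f = "\<lambda>_. 0" and h = "\<lambda>n. real n * real (r n) * (drift 1 n)\<^sup>2 / \<mu>\<^sup>2"])
      show "\<forall>\<^sub>F n in sequentially. real n / (a n)\<^sup>2 \<le> real n * real (r n) * (drift 1 n)\<^sup>2 / \<mu>\<^sup>2"
        using r_ge[of 1]
      proof eventually_elim
        case (elim n)
        have "real n * real (r n) * (drift 1 n)\<^sup>2 / \<mu>\<^sup>2 = real (r n) * (real n / (a n)\<^sup>2)"
          using False unfolding drift_def \<mu>_def by (simp add: power_mult_distrib power_divide)
        moreover have "1 * (real n / (a n)\<^sup>2) \<le> real (r n) * (real n / (a n)\<^sup>2)" using elim by (intro mult_right_mono) auto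
        ultimately show ?case by simp
      qed
      have "(\<lambda>n. real n * real (r n) * (drift 1 n)\<^sup>2 / \<mu>\<^sup>2) \<longlonglongrightarrow> 0 / \<mu>\<^sup>2" using False by (intro tendsto_intros theta_small) auto
      then show "(\<lambda>n. real n * real (r n) * (drift 1 n)\<^sup>2 / \<mu>\<^sup>2) \<longlonglongrightarrow> 0" by simp
    qed auto
    show ?thesis
    proof (rule Lim_null_comparison)
      show "\<forall>\<^sub>F n in sequentially. cmod (expectation (\<lambda>\<omega>. iexp (u * S n \<omega> + v * Q' n \<omega>)) - expectation (\<lambda>\<omega>. iexp (u * S n \<omega> + v * Q n \<omega>))) \<le> c * (real n / (a n)\<^sup>2)"
      proof (rule always_eventually, rule allI)
        fix n
        have i: "integrable M (\<lambda>\<omega>. iexp (u * S n \<omega> + v * Q' n \<omega>))" "integrable M (\<lambda>\<omega>. iexp (u * S n \<omega> + v * Q n \<omega>))"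
          by (rule integrable_const_bound[where B = 1]; simp del: of_real_add)+
        define W where "W \<omega> = \<bar>v\<bar> / (a n)\<^sup>2 * (\<Sum>t\<in>{1..int n}. 2 * \<bar>\<mu>\<bar> * \<bar>X t \<omega>\<bar> + \<mu>\<^sup>2)" for \<omega>
        have Wi: "integrable M W" unfolding W_def using Xi by (intro integrable_mult_right Bochner_Integration.integrable_sum Bochner_Integration.integrable_add) auto
        have "cmod (expectation (\<lambda>\<omega>. iexp (u * S n \<omega> + v * Q' n \<omega>)) - expectation (\<lambda>\<omega>. iexp (u * S n \<omega> + v * Q n \<omega>)))
           = cmod (expectation (\<lambda>\<omega>. iexp (u * S n \<omega> + v * Q' n \<omega>) - iexp (u * S n \<omega> + v * Q n \<omega>)))"
          using i by (simp del: of_real_add)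
        also have "\<dots> \<le> expectation W"
        proof (rule order_trans[OF integral_norm_bound integral_mono'[OF Wi]])
          fix \<omega>
          show "0 \<le> W \<omega>" unfolding W_def by (intro mult_nonneg_nonneg sum_nonneg) auto
          have "cmod (iexp (u * S n \<omega> + v * Q' n \<omega>) - iexp (u * S n \<omega> + v * Q n \<omega>)) \<le> \<bar>(u * S n \<omega> + v * Q' n \<omega>) - (u * S n \<omega> + v * Q n \<omega>)\<bar>"
            by (rule cmod_iexp_diff_le)
          also have "(u * S n \<omega> + v * Q' n \<omega>) - (u * S n \<omega> + v * Q n \<omega>) = v / (a n)\<^sup>2 * (\<Sum>t\<in>{1..int n}. (X t \<omega> - \<mu>)\<^sup>2 - (X t \<omega>)\<^sup>2)"
            unfolding Q_def Q'_def by (simp add: sum_subtractf right_diff_distrib diff_divide_distrib)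
          also have "\<bar>\<dots>\<bar> = \<bar>v\<bar> / (a n)\<^sup>2 * \<bar>\<Sum>t\<in>{1..int n}. (X t \<omega> - \<mu>)\<^sup>2 - (X t \<omega>)\<^sup>2\<bar>" by (simp add: abs_mult)
          also have "\<dots> \<le> W \<omega>"
            unfolding W_def
          proof (intro mult_left_mono order_trans[OF sum_abs] sum_mono)
            fix t
            have "(X t \<omega> - \<mu>)\<^sup>2 - (X t \<omega>)\<^sup>2 = \<mu>\<^sup>2 - 2 * (\<mu> * X t \<omega>)" by (simp add: power2_eq_square algebra_simps)
            then have "\<bar>(X t \<omega> - \<mu>)\<^sup>2 - (X t \<omega>)\<^sup>2\<bar> \<le> \<mu>\<^sup>2 + 2 * (\<bar>\<mu>\<bar> * \<bar>X t \<omega>\<bar>)"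
              using abs_triangle_ineq4[of "\<mu>\<^sup>2" "2 * (\<mu> * X t \<omega>)"] by (simp add: abs_mult)
            then show "\<bar>(X t \<omega> - \<mu>)\<^sup>2 - (X t \<omega>)\<^sup>2\<bar> \<le> 2 * \<bar>\<mu>\<bar> * \<bar>X t \<omega>\<bar> + \<mu>\<^sup>2" by simp
          qed simp
          finally show "cmod (iexp (u * S n \<omega> + v * Q' n \<omega>) - iexp (u * S n \<omega> + v * Q n \<omega>)) \<le> W \<omega>" .
        qed
        also have "expectation W = \<bar>v\<bar> / (a n)\<^sup>2 * (\<Sum>t\<in>{1..int n}. 2 * \<bar>\<mu>\<bar> * expectation (\<lambda>\<omega>. \<bar>X t \<omega>\<bar>) + \<mu>\<^sup>2)"
          unfolding W_def integral_mult_right_zero using Xi prob_space by (subst Bochner_Integration.integral_sum) auto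
        also have "\<dots> = \<bar>v\<bar> / (a n)\<^sup>2 * (\<Sum>t\<in>{1..int n}. 2 * \<bar>\<mu>\<bar> * expectation (\<lambda>\<omega>. \<bar>X 0 \<omega>\<bar>) + \<mu>\<^sup>2)"
          using EX by (intro arg_cong[where f = "\<lambda>x. \<bar>v\<bar> / (a n)\<^sup>2 * x"] sum.cong) auto
        also have "\<dots> = c * (real n / (a n)\<^sup>2)" by (simp add: c_def)
        finally show "cmod (expectation (\<lambda>\<omega>. iexp (u * S n \<omega> + v * Q' n \<omega>)) - expectation (\<lambda>\<omega>. iexp (u * S n \<omega> + v * Q n \<omega>))) \<le> c * (real n / (a n)\<^sup>2)" .
      qed
      have "(\<lambda>n. c * (real n / (a n)\<^sup>2)) \<longlonglongrightarrow> c * 0" by (intro tendsto_intros na)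
      then show "(\<lambda>n. c * (real n / (a n)\<^sup>2)) \<longlonglongrightarrow> 0" by simp
    qed
  qed
  from tendsto_add[OF this cf_limit(1)[of u v, unfolded P]]
  show ?thesis unfolding S_def Q'_def by simp
qed

subsection \<open>Positivity of the limiting sum of squares\<close>

lemma prob_exceed: "prob {\<omega>\<in>space M. \<bar>X t \<omega>\<bar> > x} = T x"
proof -
  have "prob {\<omega>\<in>space M. \<bar>X t \<omega>\<bar> > x} = expectation (\<lambda>\<omega>. indicator {y. \<bar>y\<bar> > x} (X t \<omega>))" for t
  proof -
    have "expectation (\<lambda>\<omega>. indicator {y. \<bar>y\<bar> > x} (X t \<omega>)) = expectation (indicator {\<omega>\<in>space M. \<bar>X t \<omega>\<bar> > x})"
      by (rule Bochner_Integration.integral_cong) (auto simp: indicator_def)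
    also have "\<dots> = prob {\<omega>\<in>space M. \<bar>X t \<omega>\<bar> > x}" by simp
    finally show ?thesis by (rule sym)
  qed
  moreover have "expectation (\<lambda>\<omega>. indicator {y. \<bar>y\<bar> > x} (X t \<omega>) :: real) = expectation (\<lambda>\<omega>. indicator {y. \<bar>y\<bar> > x} (X 0 \<omega>))"
    by (rule stationary_single) measurable
  ultimately show ?thesis unfolding T_def by simp
qed

lemma prob_exceed_pair_le:
  assumes a: "a n > 0"
  shows "prob {\<omega>\<in>space M. \<bar>X s \<omega>\<bar> > a n \<and> \<bar>X (s + int h) \<omega>\<bar> > a n} \<le> capped_moment n h"
proof -
  define f where "f x y = min \<bar>y / a n\<bar> 1 * min \<bar>x / a n\<bar> 1" for x y
  have fm: "(\<lambda>z. f (fst z) (snd z)) \<in> borel_measurable (borel \<Otimes>\<^sub>M borel)" unfolding f_def by measurable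
  have "prob {\<omega>\<in>space M. \<bar>X s \<omega>\<bar> > a n \<and> \<bar>X (s + int h) \<omega>\<bar> > a n}
     = expectation (indicator {\<omega>\<in>space M. \<bar>X s \<omega>\<bar> > a n \<and> \<bar>X (s + int h) \<omega>\<bar> > a n})" by simp
  also have "\<dots> \<le> expectation (\<lambda>\<omega>. f (X s \<omega>) (X (s + int h) \<omega>))"
  proof (rule integral_mono')
    show "integrable M (\<lambda>\<omega>. f (X s \<omega>) (X (s + int h) \<omega>))"
      unfolding f_def by (rule integrable_const_bound[where B = 1]) (auto simp: mult_le_one)
    show "0 \<le> f (X s \<omega>) (X (s + int h) \<omega>)" for \<omega> by (simp add: f_def)
    show "indicator {\<omega>\<in>space M. \<bar>X s \<omega>\<bar> > a n \<and> \<bar>X (s + int h) \<omega>\<bar> > a n} \<omega> \<le> f (X s \<omega>) (X (s + int h) \<omega>)" for \<omega>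
    proof (cases "\<bar>X s \<omega>\<bar> > a n \<and> \<bar>X (s + int h) \<omega>\<bar> > a n")
      case True
      then have "f (X s \<omega>) (X (s + int h) \<omega>) = 1" using a by (simp add: f_def)
      then show ?thesis by (simp add: indicator_def)
    next
      case False
      then show ?thesis by (auto simp: f_def)
    qed
  qed
  also have "\<dots> = expectation (\<lambda>\<omega>. f (X 0 \<omega>) (X (int h) \<omega>))" by (rule stationary_pair[OF fm])
  finally show ?thesis unfolding capped_moment_def f_def .
qed

text \<open>Bonferroni along the sparse grid of multiples of \<open>k\<close>; anti-clustering controls the pairs.\<close>
lemma prob_block_exceed_ge:
  assumes a: "a n > 0" and k: "k \<ge> 1"
  shows "q * k \<le> r n \<Longrightarrow> real q * (T (a n) - (\<Sum>h\<in>{k..r n}. capped_moment n h)) \<le> prob (\<Union>i<q. {\<omega>\<in>space M. \<bar>X (int (Suc i * k)) \<omega>\<bar> > a n})"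
proof (induction q)
  case 0
  show ?case by simp
next
  case (Suc q)
  define A where "A i = {\<omega>\<in>space M. \<bar>X (int (Suc i * k)) \<omega>\<bar> > a n}" for i
  define U where "U = (\<Union>i<q. A i)"
  have [measurable]: "A i \<in> sets M" for i unfolding A_def by measurable
  have [measurable]: "U \<in> sets M" unfolding U_def by measurable
  have qk: "q * k \<le> r n" using Suc.prems by simp
  have IH: "real q * (T (a n) - (\<Sum>h\<in>{k..r n}. capped_moment n h)) \<le> prob U" using Suc.IH[OF qk] unfolding U_def A_def .
  have pair: "prob (A i \<inter> A q) \<le> capped_moment n ((q - i) * k)" if "i < q" for i
  proof -
    have e: "int (Suc i * k) + int ((q - i) * k) = int (Suc q * k)"
      using that by (simp add: algebra_simps of_nat_diff flip: of_nat_add of_nat_mult)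
    have "A i \<inter> A q = {\<omega>\<in>space M. \<bar>X (int (Suc i * k)) \<omega>\<bar> > a n \<and> \<bar>X (int (Suc i * k) + int ((q - i) * k)) \<omega>\<bar> > a n}"
      unfolding e A_def by auto
    then show ?thesis using prob_exceed_pair_le[OF a, of "int (Suc i * k)" "(q - i) * k"] by (simp only:)
  qed
  have "prob (U \<inter> A q) = prob (\<Union>i<q. A i \<inter> A q)" unfolding U_def by (simp add: Int_UN_distrib2)
  also have "\<dots> \<le> (\<Sum>i<q. prob (A i \<inter> A q))" by (rule finite_measure_subadditive_finite) auto
  also have "\<dots> \<le> (\<Sum>i<q. capped_moment n ((q - i) * k))" by (intro sum_mono pair) simp
  \<comment> \<open>Distances from the last grid point are distinct multiples of \<open>k\<close>
    between \<open>k\<close> and \<open>r n\<close>, so each lag of the anti-clustering sum is used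
    at most once.\<close>
  also have "\<dots> = (\<Sum>h\<in>(\<lambda>i. (q - i) * k) ` {..<q}. capped_moment n h)"
    using k by (subst sum.reindex) (auto simp: inj_on_def)
  also have "\<dots> \<le> (\<Sum>h\<in>{k..r n}. capped_moment n h)"
  proof (rule sum_mono2)
    show "(\<lambda>i. (q - i) * k) ` {..<q} \<subseteq> {k..r n}"
    proof (intro image_subsetI)
      fix i assume "i \<in> {..<q}"
      then have "1 * k \<le> (q - i) * k" "(q - i) * k \<le> q * k" by (intro mult_le_mono1; simp)+
      then have "k \<le> (q - i) * k" "(q - i) * k \<le> r n" using qk by linarith+
      then show "(q - i) * k \<in> {k..r n}" by (simp only: atLeastAtMost_iff)
    qed
  qed (auto simp: capped_moment_nonneg)
  finally have i: "prob (U \<inter> A q) \<le> (\<Sum>h\<in>{k..r n}. capped_moment n h)" .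
  have "prob (U \<union> A q) = prob U + prob (A q) - prob (U \<inter> A q)"
    by (rule measure_Un3) (auto simp: fmeasurable_eq_sets)
  moreover have "prob (A q) = T (a n)" unfolding A_def by (rule prob_exceed)
  ultimately have "real (Suc q) * (T (a n) - (\<Sum>h\<in>{k..r n}. capped_moment n h)) \<le> prob (U \<union> A q)"
    using IH i by (simp add: algebra_simps)
  also have "U \<union> A q = (\<Union>i<Suc q. A i)" unfolding U_def by (auto simp: lessThan_Suc)
  finally show ?case unfolding A_def .
qed

definition block_squares :: "nat \<Rightarrow> 'a \<Rightarrow> real" where
  "block_squares n \<omega> = (\<Sum>t\<in>{1..int (r n)}. (X t \<omega> / a n)\<^sup>2)"

lemma measurable_block_squares [measurable]: "block_squares n \<in> borel_measurable M"
  unfolding block_squares_def by measurable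

lemma block_squares_nonneg: "0 \<le> block_squares n \<omega>" unfolding block_squares_def by (intro sum_nonneg) simp

text \<open>A single exceedance makes the sum of squares at least 1. About \<open>r n / k\<close>
  grid points lie in a block, each with exceedance probability about \<open>1 / n\<close>, and for
  large \<open>k\<close> the pairs remove only a fraction of this.\<close>

lemma prob_block_squares_ge: "\<exists>c>0. \<forall>\<^sub>F n in sequentially. c \<le> real n / real (r n) * prob {\<omega>\<in>space M. 1 \<le> block_squares n \<omega>}"
proof -
  obtain K where K: "\<And>k. k \<ge> K \<Longrightarrow> \<forall>\<^sub>F n in sequentially. capped_sum n k < 1 / 4" using capped_sum_small[of "1/4"] by auto
  define k where "k = max 1 K"
  have k: "k \<ge> 1" "k \<ge> K" by (auto simp: k_def)
  have t: "\<forall>\<^sub>F n in sequentially. real n * T (a n) > 1 / 2" by (rule order_tendstoD(1)[OF nT]) simp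
  \<comment> \<open>The constant is \<open>1 / (2 * k)\<close>, from
    \<open>r n \<le> 2 * q * k\<close>, times \<open>1 / 4\<close>, the margin between the bounds
    \<open>1 / 2\<close> for \<open>n * T (a n)\<close> and \<open>1 / 4\<close> for
    \<open>capped_sum n k\<close>.\<close>
  have "\<forall>\<^sub>F n in sequentially. 1 / (8 * real k) \<le> real n / real (r n) * prob {\<omega>\<in>space M. 1 \<le> block_squares n \<omega>}"
    using K[OF k(2)] t a_pos r_ge[of k]
  proof eventually_elim
    case (elim n)
    define q where "q = r n div k"
    define D where "D = T (a n) - (\<Sum>h\<in>{k..r n}. capped_moment n h)"
    have q: "q * k \<le> r n" unfolding q_def by simp
    have q1: "1 \<le> q" unfolding q_def using elim(4) k by (simp add: Suc_le_eq div_greater_zero_iff)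
    have "r n < Suc q * k" unfolding q_def using k dividend_less_times_div[of k "r n"] by (simp add: mult.commute)
    then have "r n \<le> Suc q * k" by simp
    also have "\<dots> \<le> (2 * q) * k" using q1 by (intro mult_le_mono1) simp
    finally have "real (r n) \<le> real (2 * q * k)" by (rule of_nat_mono)
    then have rq: "real (r n) \<le> 2 * real q * real k" by simp
    have D: "real n * D \<ge> 1 / 4" using elim(1,2) unfolding D_def capped_sum_def by (simp add: right_diff_distrib)
    have "real q * D \<le> prob (\<Union>i<q. {\<omega>\<in>space M. \<bar>X (int (Suc i * k)) \<omega>\<bar> > a n})"
      unfolding D_def by (rule prob_block_exceed_ge[OF elim(3) k(1) q])
    also have "\<dots> \<le> prob {\<omega>\<in>space M. 1 \<le> block_squares n \<omega>}"
    proof (rule finite_measure_mono)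
      show "(\<Union>i<q. {\<omega>\<in>space M. \<bar>X (int (Suc i * k)) \<omega>\<bar> > a n}) \<subseteq> {\<omega>\<in>space M. 1 \<le> block_squares n \<omega>}"
      proof safe
        fix i \<omega> assume i: "i < q" and x: "\<bar>X (int (Suc i * k)) \<omega>\<bar> > a n"
        define t where "t = int (Suc i * k)"
        have "Suc i * k \<le> q * k" using i by (intro mult_le_mono1) simp
        then have s2: "Suc i * k \<le> r n" using q by simp
        have s1: "1 \<le> Suc i * k" using k(1) by simp
        have tr: "t \<in> {1..int (r n)}" unfolding t_def using s1 s2 by (simp only: atLeastAtMost_iff of_nat_le_iff of_nat_1[symmetric, where 'a = int])
        have "1 \<le> \<bar>X t \<omega> / a n\<bar>" using x elim(3) unfolding t_def by (simp add: abs_divide)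
        then have "1 \<le> (X t \<omega> / a n)\<^sup>2" by (metis one_le_power power2_abs)
        also have "\<dots> \<le> block_squares n \<omega>" unfolding block_squares_def by (rule member_le_sum[OF tr]) auto
        finally show "1 \<le> block_squares n \<omega>" .
      qed
    qed measurable
    finally have P: "real q * D \<le> prob {\<omega>\<in>space M. 1 \<le> block_squares n \<omega>}" .
    have r0: "real (r n) > 0" using elim(4) k(1) by simp
    have "1 / (8 * real k) = real q / (2 * real q * real k) * (1 / 4)" using q1 k(1) by simp
    also have "\<dots> \<le> real q / real (r n) * (real n * D)"
      using rq r0 D q1 k(1) by (intro mult_mono divide_left_mono mult_pos_pos) auto
    also have "\<dots> = real n / real (r n) * (real q * D)" by simp
    also have "\<dots> \<le> real n / real (r n) * prob {\<omega>\<in>space M. 1 \<le> block_squares n \<omega>}" using P by (intro mult_left_mono) auto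
    finally show ?case .
  qed
  then show ?thesis using k(1) by (intro exI[of _ "1 / (8 * real k)"]) auto
qed

lemma drift_0 [simp]: "drift 0 n = 0" by (simp add: drift_def)

lemma Phi_block_squares: "Phi (block_phase 0 g n) {1..int (r n)} = char (distr M borel (block_squares n)) g"
proof -
  have "Phi (block_phase 0 g n) {1..int (r n)} = expectation (\<lambda>\<omega>. iexp (g * block_squares n \<omega>))"
    unfolding Phi_def block_phase_def block_squares_def by (subst prod_phase_eq_iexp) auto
  also have "\<dots> = char (distr M borel (block_squares n)) g"
    unfolding char_def by (subst integral_distr) auto
  finally show ?thesis .
qed

lemma block_squares_char_limit: "(\<lambda>n. real n / real (r n) * (1 - Re (char (distr M borel (block_squares n)) g))) \<longlonglongrightarrow> - Re (psi 0 g)"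
proof -
  have "(\<lambda>n. of_real (real n / real (r n)) * (Phi (block_phase 0 g n) {1..int (r n)} - 1 - \<i> * of_real (real (r n) * drift 0 n))) \<longlonglongrightarrow> psi 0 g"
    by (rule block_limit[OF r_top]) simp
  then have "(\<lambda>n. - Re (of_real (real n / real (r n)) * (Phi (block_phase 0 g n) {1..int (r n)} - 1))) \<longlonglongrightarrow> - Re (psi 0 g)"
    by (intro tendsto_minus tendsto_Re) simp
  moreover have "- Re (of_real (real n / real (r n)) * (Phi (block_phase 0 g n) {1..int (r n)} - 1)) = real n / real (r n) * (1 - Re (char (distr M borel (block_squares n)) g))" for n
    unfolding Phi_block_squares Re_complex_of_real times_complex.simps by (simp add: right_diff_distrib)
  ultimately show ?thesis by simp
qed

text \<open>Supplies the dominating function for the Gaussian average: with \<open>u = 0\<close> the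
  phase minus 1 is of second order, so truncated second moments suffice, and the dependence on
  \<open>g\<close> is polynomial, hence integrable against the Gaussian law.\<close>

lemma block_squares_char_bound: "\<exists>C>0. \<forall>\<^sub>F n in sequentially. \<forall>g. real n / real (r n) * cmod (char (distr M borel (block_squares n)) g - 1) \<le> (2 * g\<^sup>2 + 3) * C"
proof -
  obtain C where C: "C > 0" "\<And>\<epsilon> t. \<epsilon> > 0 \<Longrightarrow> \<forall>\<^sub>F n in sequentially. real n * expectation (\<lambda>\<omega>. (min \<bar>X t \<omega> / a n\<bar> \<epsilon>)\<^sup>2) \<le> C * \<epsilon> powr (2 - \<kappa>)"
    using second_moment_seq by blast
  have "\<forall>\<^sub>F n in sequentially. \<forall>g. real n / real (r n) * cmod (char (distr M borel (block_squares n)) g - 1) \<le> (2 * g\<^sup>2 + 3) * C"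
    using C(2)[OF zero_less_one, of 0] r_ge[of 1]
  proof eventually_elim
    case (elim n)
    define E where "E = expectation (\<lambda>\<omega>. (min \<bar>X 0 \<omega> / a n\<bar> 1)\<^sup>2)"
    have nE: "real n * E \<le> C" using elim unfolding E_def by simp
    have st: "expectation (\<lambda>\<omega>. (min \<bar>X t \<omega> / a n\<bar> 1)\<^sup>2) = E" for t
      unfolding E_def by (rule stationary_single) measurable
    have i: "integrable M (\<lambda>\<omega>. (min \<bar>X t \<omega> / a n\<bar> 1)\<^sup>2)" for t
      by (rule integrable_const_bound[where B = 1]) (auto intro!: power_le_one)
    show ?case
    proof
      fix g :: real
      define W where "W = 2 * g\<^sup>2 + 3"
      have W0: "W \<ge> 0" by (simp add: W_def)
      have e1: "cmod (phase 0 g y - 1) \<le> W * (min \<bar>y\<bar> 1)\<^sup>2" for y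
      proof (cases "\<bar>y\<bar> \<le> 1")
        case True
        have g: "\<bar>g\<bar> \<le> g\<^sup>2 + 1"
          using sum_squares_bound[of "\<bar>g\<bar>" 1] by simp
        have "cmod (phase 0 g y - 1 - \<i> * of_real (0 * y)) \<le> ((\<bar>0\<bar> + \<bar>g\<bar>)\<^sup>2 + \<bar>g\<bar>) * y\<^sup>2" by (rule cmod_phase_taylor[OF True])
        also have "\<dots> \<le> W * y\<^sup>2" using g by (intro mult_right_mono) (auto simp: W_def)
        finally show ?thesis using True by (simp add: min_def)
      next
        case False
        have "cmod (phase 0 g y - 1) \<le> 2" using norm_triangle_ineq4[of "phase 0 g y" 1] by simp
        also have "\<dots> \<le> W" by (simp add: W_def)
        finally show ?thesis using False by (simp add: min_def)
      qed
      have qi: "integrable M (\<lambda>\<omega>. \<Prod>t\<in>{1..int (r n)}. block_phase 0 g n (X t \<omega>))" by (rule integrable_prod_q) auto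
      have "Phi (block_phase 0 g n) {1..int (r n)} - 1 = expectation (\<lambda>\<omega>. (\<Prod>t\<in>{1..int (r n)}. block_phase 0 g n (X t \<omega>)) - 1)"
        unfolding Phi_def using qi prob_space by (subst Bochner_Integration.integral_diff) auto
      then have "cmod (Phi (block_phase 0 g n) {1..int (r n)} - 1) \<le> expectation (\<lambda>\<omega>. cmod ((\<Prod>t\<in>{1..int (r n)}. block_phase 0 g n (X t \<omega>)) - 1))"
        using integral_norm_bound[of M "\<lambda>\<omega>. (\<Prod>t\<in>{1..int (r n)}. block_phase 0 g n (X t \<omega>)) - 1"] by simp
      also have "\<dots> \<le> expectation (\<lambda>\<omega>. \<Sum>t\<in>{1..int (r n)}. W * (min \<bar>X t \<omega> / a n\<bar> 1)\<^sup>2)"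
      proof (rule integral_mono')
        show "integrable M (\<lambda>\<omega>. \<Sum>t\<in>{1..int (r n)}. W * (min \<bar>X t \<omega> / a n\<bar> 1)\<^sup>2)"
          using i by (intro Bochner_Integration.integrable_sum integrable_mult_right)
        fix \<omega>
        show "0 \<le> (\<Sum>t\<in>{1..int (r n)}. W * (min \<bar>X t \<omega> / a n\<bar> 1)\<^sup>2)" using W0 by (intro sum_nonneg) auto
        have "cmod ((\<Prod>t\<in>{1..int (r n)}. block_phase 0 g n (X t \<omega>)) - (\<Prod>t\<in>{1..int (r n)}. 1)) \<le> (\<Sum>t\<in>{1..int (r n)}. cmod (block_phase 0 g n (X t \<omega>) - 1))"
          by (rule norm_prod_diff) auto
        also have "\<dots> \<le> (\<Sum>t\<in>{1..int (r n)}. W * (min \<bar>X t \<omega> / a n\<bar> 1)\<^sup>2)"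
          unfolding block_phase_def by (intro sum_mono e1)
        finally show "cmod ((\<Prod>t\<in>{1..int (r n)}. block_phase 0 g n (X t \<omega>)) - 1) \<le> (\<Sum>t\<in>{1..int (r n)}. W * (min \<bar>X t \<omega> / a n\<bar> 1)\<^sup>2)" by simp
      qed
      also have "\<dots> = (\<Sum>t\<in>{1..int (r n)}. W * E)"
        using i by (subst Bochner_Integration.integral_sum) (auto simp: st simp del: abs_divide sum_constant intro!: sum.cong)
      also have "\<dots> = real (r n) * (W * E)" by simp
      finally have "real n / real (r n) * cmod (Phi (block_phase 0 g n) {1..int (r n)} - 1) \<le> real n / real (r n) * (real (r n) * (W * E))"
        by (intro mult_left_mono) auto
      also have "\<dots> = W * (real n * E)" using elim(2) by simp
      also have "\<dots> \<le> W * C" using nE W0 by (rule mult_left_mono)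
      finally show "real n / real (r n) * cmod (char (distr M borel (block_squares n)) g - 1) \<le> (2 * g\<^sup>2 + 3) * C"
        unfolding Phi_block_squares W_def .
    qed
  qed
  then show ?thesis using C(1) by blast
qed

text \<open>If the real part of the exponent vanished, the Gaussian average of the block characteristic functions would
  force blocks with a large square sum to have probability of smaller order than the block length over \<open>n\<close>.\<close>
lemma Re_psi_neg: "Re (psi 0 1) < 0"
proof (rule ccontr)
  assume "\<not> Re (psi 0 1) < 0"
  then have z: "Re (psi 0 1) = 0" using cf_limit(2)[of 0 1] by simp
  \<comment> \<open>Homogeneity carries the vanishing from 1 to every positive argument; conjugation
    will carry it to the negative ones.\<close>
  have zp: "Re (psi 0 g) = 0" if "g > 0" for g
    using psi_homogeneous[of "sqrt g" 0 1] that z by simp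
  have rd: "real_distribution (distr M borel (block_squares n))" for n by (rule real_distribution_distr) measurable
  have even: "Re (psi 0 (- g)) = Re (psi 0 g)" for g
  proof (rule LIMSEQ_unique)
    show "(\<lambda>n. - (real n / real (r n) * (1 - Re (char (distr M borel (block_squares n)) (- g))))) \<longlonglongrightarrow> Re (psi 0 (- g))"
      using tendsto_minus[OF block_squares_char_limit[of "- g"]] by simp
    have "char (distr M borel (block_squares n)) (- g) = cnj (char (distr M borel (block_squares n)) g)" for n
      using Re_Im_char[OF rd, of n g] Re_Im_char[OF rd, of n "- g"] by (simp add: complex_eq_iff)
    then show "(\<lambda>n. - (real n / real (r n) * (1 - Re (char (distr M borel (block_squares n)) (- g))))) \<longlonglongrightarrow> Re (psi 0 g)"
      using tendsto_minus[OF block_squares_char_limit[of "g"]] by simp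
  qed
  have z0: "Re (psi 0 g) = 0" if "g \<noteq> 0" for g
    using zp[of g] zp[of "- g"] even[of g] that by (cases "g > 0") auto
  define S where "S = std_normal_distribution"
  interpret S: real_distribution S unfolding S_def by (rule real_dist_normal_dist)
  obtain C where C: "C > 0" "\<forall>\<^sub>F n in sequentially. \<forall>g. real n / real (r n) * cmod (char (distr M borel (block_squares n)) g - 1) \<le> (2 * g\<^sup>2 + 3) * C"
    using block_squares_char_bound by blast
  then obtain n0 where n0: "\<And>n g. n \<ge> n0 \<Longrightarrow> real n / real (r n) * cmod (char (distr M borel (block_squares n)) g - 1) \<le> (2 * g\<^sup>2 + 3) * C"
    by (auto simp: eventually_sequentially)
  have cm: "char (distr M borel (block_squares n)) \<in> borel_measurable borel" for n
    by (rule real_distribution.char_measurable[OF rd])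
  define f where "f n g = real n / real (r n) * (1 - Re (char (distr M borel (block_squares n)) g))" for n g
  \<comment> \<open>The domination holds from \<open>n0\<close> on, hence the shifted
    sequence.\<close>
  have lim: "(\<lambda>n. LINT g|S. f (n + n0) g) \<longlonglongrightarrow> (LINT g|S. 0)"
  proof (rule integral_dominated_convergence[where w = "\<lambda>g. (2 * g\<^sup>2 + 3) * C"])
    show "integrable S (\<lambda>g. (2 * g\<^sup>2 + 3) * C)"
      using integrable_std_normal_distribution_moment[of 2] by (auto simp: S_def[symmetric])
    show "(\<lambda>g. f (n + n0) g) \<in> borel_measurable S" for n
      using cm unfolding f_def by measurable
    have "AE g in lborel. g \<noteq> (0::real)" by (rule AE_lborel_singleton)
    then have "AE g in S. g \<noteq> 0" unfolding S_def by (subst AE_density) auto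
    then show "AE g in S. (\<lambda>n. f (n + n0) g) \<longlonglongrightarrow> 0"
    proof (rule eventually_mono)
      fix g :: real assume "g \<noteq> 0"
      then have "(\<lambda>n. f n g) \<longlonglongrightarrow> 0" using block_squares_char_limit[of g] z0[of g] unfolding f_def by simp
      then show "(\<lambda>n. f (n + n0) g) \<longlonglongrightarrow> 0" by (rule LIMSEQ_ignore_initial_segment)
    qed
    show "AE g in S. norm (f (n + n0) g) \<le> (2 * g\<^sup>2 + 3) * C" for n
    proof (rule AE_I2)
      fix g
      have "norm (f (n + n0) g) = real (n + n0) / real (r (n + n0)) * \<bar>Re (char (distr M borel (block_squares (n + n0))) g - 1)\<bar>"
        unfolding f_def by (simp add: abs_mult abs_minus_commute)
      also have "\<dots> \<le> real (n + n0) / real (r (n + n0)) * cmod (char (distr M borel (block_squares (n + n0))) g - 1)"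
        by (intro mult_left_mono abs_Re_le_cmod) auto
      also have "\<dots> \<le> (2 * g\<^sup>2 + 3) * C" by (rule n0) simp
      finally show "norm (f (n + n0) g) \<le> (2 * g\<^sup>2 + 3) * C" .
    qed
  qed measurable
  obtain c where c: "c > 0" "\<forall>\<^sub>F n in sequentially. c \<le> real n / real (r n) * prob {\<omega>\<in>space M. 1 \<le> block_squares n \<omega>}" using prob_block_squares_ge by blast
  have ex: "0 < 1 - exp (- 1 / 2 :: real)" by simp
  have "\<forall>\<^sub>F n in sequentially. (1 - exp (- 1 / 2)) * c \<le> (LINT g|S. f n g)"
    using c(2)
  proof (eventually_elim)
    case (elim n)
    define p where "p = real n / real (r n)"
    have ci: "integrable S (char (distr M borel (block_squares n)))"
      by (rule S.integrable_const_bound[where B = 1])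
        (use cm real_distribution.cmod_char_le_1[OF rd] in \<open>auto simp: measurable_def S_def\<close>)
    have "prob {\<omega>\<in>space M. 1 \<le> block_squares n \<omega>} = measure (distr M borel (block_squares n)) {x. 1 / 1 \<le> \<bar>x\<bar>}"
      using block_squares_nonneg by (subst measure_distr) (auto intro!: arg_cong[where f = prob])
    then have "(1 - exp (- 1 / 2)) * prob {\<omega>\<in>space M. 1 \<le> block_squares n \<omega>} \<le> 1 - Re (LINT g|S. char (distr M borel (block_squares n)) g)"
      using tail_le_gauss_average[OF rd, of 1 n] unfolding S_def by simp
    also have "\<dots> = (LINT g|S. 1 - Re (char (distr M borel (block_squares n)) g))"
      using ci S.prob_space by (subst Bochner_Integration.integral_diff) (auto simp: integral_Re)
    finally have "p * ((1 - exp (- 1 / 2)) * prob {\<omega>\<in>space M. 1 \<le> block_squares n \<omega>}) \<le> p * (LINT g|S. 1 - Re (char (distr M borel (block_squares n)) g))"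
      unfolding p_def by (intro mult_left_mono) auto
    also have "\<dots> = (LINT g|S. f n g)" unfolding f_def p_def by simp
    finally have "(1 - exp (- 1 / 2)) * (p * prob {\<omega>\<in>space M. 1 \<le> block_squares n \<omega>}) \<le> (LINT g|S. f n g)" by (simp add: mult_ac)
    moreover have "(1 - exp (- 1 / 2)) * c \<le> (1 - exp (- 1 / 2)) * (p * prob {\<omega>\<in>space M. 1 \<le> block_squares n \<omega>})"
      using elim unfolding p_def by (intro mult_left_mono) auto
    ultimately show ?case by (rule order_trans[rotated])
  qed
  moreover have "(\<lambda>n. LINT g|S. f n g) \<longlonglongrightarrow> 0"
    by (rule LIMSEQ_offset[where k = n0]) (use lim in simp)
  ultimately have "(1 - exp (- 1 / 2)) * c \<le> 0"
    by (intro tendsto_lowerbound[where f = "\<lambda>n. LINT g|S. f n g" and F = sequentially]) auto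
  then show False using mult_pos_pos[OF ex c(1)] by simp
qed

subsection \<open>The limit law\<close>

lemma psi_0_0 [simp]: "psi 0 0 = 0"
proof -
  have "of_real (2 powr \<kappa>) * psi 0 0 = psi 0 0" using psi_homogeneous[of 2 0 0] by simp
  then have "of_real (2 powr \<kappa> - 1) * psi 0 0 = 0" by (simp add: left_diff_distrib)
  moreover have "2 powr \<kappa> \<noteq> (1::real)" using \<kappa>_pos by (simp add: powr_eq_one_iff_gen)
  ultimately show ?thesis by simp
qed

lemma psi_u_pos:
  assumes "u > 0"
  shows "psi u 0 = of_real (u powr \<kappa>) * psi 1 0"
  using psi_homogeneous[OF assms, of 1 0] by simp

lemma psi_v_pos:
  assumes "v > 0"
  shows "psi 0 v = of_real (v powr (\<kappa> / 2)) * psi 0 1"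
proof -
  have "sqrt v powr \<kappa> = v powr (\<kappa> / 2)" using assms by (simp add: powr_half_sqrt[symmetric] powr_powr)
  then show ?thesis using psi_homogeneous[of "sqrt v" 0 1] assms by simp
qed

lemma cmod_psi_u_le: "cmod (psi u 0) \<le> \<bar>u\<bar> powr \<kappa> * (cmod (psi 1 0) + cmod (psi (-1) 0))"
proof (cases u "0::real" rule: linorder_cases)
  case less
  then have "psi u 0 = of_real (\<bar>u\<bar> powr \<kappa>) * psi (-1) 0" using psi_homogeneous[of "\<bar>u\<bar>" "-1" 0] by simp
  then show ?thesis by (simp add: norm_mult distrib_left)
next
  case greater
  then show ?thesis unfolding psi_u_pos[OF greater] by (simp add: norm_mult distrib_left)
qed simp

lemma cmod_psi_v_le: "cmod (psi 0 v) \<le> \<bar>v\<bar> powr (\<kappa> / 2) * (cmod (psi 0 1) + cmod (psi 0 (-1)))"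
proof (cases v "0::real" rule: linorder_cases)
  case less
  have "sqrt \<bar>v\<bar> powr \<kappa> = \<bar>v\<bar> powr (\<kappa> / 2)" using less by (simp add: powr_half_sqrt[symmetric] powr_powr)
  then have "psi 0 v = of_real (\<bar>v\<bar> powr (\<kappa> / 2)) * psi 0 (-1)" using psi_homogeneous[of "sqrt \<bar>v\<bar>" 0 "-1"] less by simp
  then show ?thesis by (simp add: norm_mult distrib_left)
next
  case greater
  then show ?thesis unfolding psi_v_pos[OF greater] by (simp add: norm_mult distrib_left)
qed simp

lemma exp_tendsto_1:
  assumes b: "\<And>u. cmod (f u) \<le> \<bar>u\<bar> powr s * C" and s: "s > 0"
  shows "((\<lambda>u::real. exp (f u)) \<longlongrightarrow> (1::complex)) (at 0)"
proof -
  have "(f \<longlongrightarrow> 0) (at 0)"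
  proof (rule Lim_null_comparison)
    show "\<forall>\<^sub>F u in at 0. norm (f u) \<le> \<bar>u\<bar> powr s * C" using b by (intro always_eventually) auto
    have "((\<lambda>u::real. \<bar>u\<bar> powr s) \<longlongrightarrow> \<bar>0\<bar> powr s) (at 0)"
      by (intro tendsto_powr' tendsto_rabs tendsto_ident_at) (use s in auto)
    from tendsto_mult_right[OF this, of C] show "((\<lambda>u. \<bar>u\<bar> powr s * C) \<longlongrightarrow> 0) (at 0)" using s by simp
  qed
  from tendsto_exp[OF this] show ?thesis by simp
qed

text \<open>For \<open>v > 0\<close> the real part of the exponent is
  \<open>Re (psi 0 1) * v powr (\<kappa> / 2)\<close>, which tends to minus infinity; this decay
  will rule out an atom at 0 in the limit of the squares.\<close>

lemma psi_square_char_vanishes: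
  shows "((\<lambda>v. exp (psi 0 v)) \<longlongrightarrow> 0) at_top"
proof (rule tendsto_norm_zero_cancel)
  have "filterlim (\<lambda>v::real. v powr (\<kappa> / 2)) at_top at_top" using \<kappa>_pos by real_asymp
  then have "filterlim (\<lambda>v::real. - Re (psi 0 1) * v powr (\<kappa> / 2)) at_top at_top"
    by (intro filterlim_tendsto_pos_mult_at_top[OF tendsto_const]) (use Re_psi_neg in auto)
  then have "filterlim (\<lambda>v::real. Re (psi 0 1) * v powr (\<kappa> / 2)) at_bot at_top" by (simp add: filterlim_uminus_at_bot)
  then have "((\<lambda>v. exp (Re (psi 0 1) * v powr (\<kappa> / 2))) \<longlongrightarrow> 0) at_top"
    by (rule filterlim_compose[OF exp_at_bot])
  then show "((\<lambda>v. norm (exp (psi 0 v))) \<longlongrightarrow> 0) at_top"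
  proof (rule Lim_transform_eventually)
    show "\<forall>\<^sub>F v in at_top. exp (Re (psi 0 1) * v powr (\<kappa> / 2)) = norm (exp (psi 0 v))"
      using eventually_gt_at_top[of 0]
    proof eventually_elim
      case (elim v)
      show ?case unfolding psi_v_pos[OF elim] by (simp add: norm_exp_eq_Re mult.commute)
    qed
  qed
qed

text \<open>The limit is found for the pair with the squares divided by
  \<open>(a n)\<^sup>2\<close>, and then mapped by \<open>h\<close>. Since \<open>sqrt\<close> is
  defined and continuous on all reals, \<open>h\<close> is continuous on the whole plane and
  convergence transfers directly.\<close>

lemma self_normalized_limit:
  defines "\<mu> \<equiv> cen * expectation (X 0)"
  shows "\<exists>\<nu>. prob_space \<nu> \<and> sets \<nu> = sets (borel :: (real \<times> real) measure)
     \<and> conv_distr_R2 M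
         (\<lambda>n \<omega>. ((\<Sum>t\<in>{1..int n}. X t \<omega> - \<mu>) / a n,
                  sqrt (\<Sum>t\<in>{1..int n}. (X t \<omega> - \<mu>)\<^sup>2) / a n)) \<nu>
     \<and> stable_law \<kappa> (distr \<nu> borel fst)
     \<and> measure \<nu> {z. snd z > 0} = 1
     \<and> stable_law (\<kappa> / 2) (distr \<nu> borel (\<lambda>z. (snd z)\<^sup>2))"
proof -
  define Y where "Y n \<omega> = ((\<Sum>t\<in>{1..int n}. X t \<omega> - \<mu>) / a n, (\<Sum>t\<in>{1..int n}. (X t \<omega> - \<mu>)\<^sup>2) / (a n)\<^sup>2)" for n \<omega>
  have Ym [measurable]: "Y n \<in> borel_measurable M" for n unfolding Y_def by measurable
  obtain N where N: "prob_space N" and sN: "sets N = sets borel"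
    and ch: "\<And>u v. (LINT z|N. iexp (u * fst z + v * snd z)) = exp (psi u v)" and conv: "conv_distr_R2 M Y N"
  proof (rule levy_continuity_R2[OF prob_space_axioms Ym])
    show "(\<lambda>n. expectation (\<lambda>\<omega>. iexp (u * fst (Y n \<omega>) + v * snd (Y n \<omega>)))) \<longlonglongrightarrow> exp (psi u v)" for u v
      using joint_cf_limit[of u v, folded \<mu>_def] unfolding Y_def by simp
    show "((\<lambda>u. exp (psi u 0)) \<longlongrightarrow> 1) (at 0)" by (rule exp_tendsto_1[OF cmod_psi_u_le]) (use \<kappa>_pos in auto)
    show "((\<lambda>v. exp (psi 0 v)) \<longlongrightarrow> 1) (at 0)" by (rule exp_tendsto_1[OF cmod_psi_v_le]) (use \<kappa>_pos in auto)
    fix \<nu> :: "(real \<times> real) measure"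
    assume "prob_space \<nu>" "sets \<nu> = sets borel" "\<And>u v. (LINT z|\<nu>. iexp (u * fst z + v * snd z)) = exp (psi u v)" "conv_distr_R2 M Y \<nu>"
    then show thesis by (rule that)
  qed
  interpret N: prob_space N by fact
  note sN [measurable_cong]
  have spN: "space N = UNIV" using sets_eq_imp_space_eq[OF sN] by simp
  have ch1: "char (distr N borel fst) u = exp (psi u 0)" for u
    unfolding char_def using ch[of u 0] by (subst integral_distr) auto
  have ch2: "char (distr N borel snd) v = exp (psi 0 v)" for v
    unfolding char_def using ch[of 0 v] by (subst integral_distr) auto
  have rd1: "real_distribution (distr N borel fst)" and rd2: "real_distribution (distr N borel snd)"
    by (auto intro!: N.real_distribution_distr)
  \<comment> \<open>A bounded continuous test function that is positive exactly where the second
    coordinate is negative has mean 0 along the sequence, hence in the limit.\<close>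
  have sq0: "AE z in N. 0 \<le> snd z"
  proof -
    define f where "f z = min 1 (max 0 (- snd z))" for z :: "real \<times> real"
    have fc: "continuous_on UNIV f" unfolding f_def by (intro continuous_intros)
    have [measurable]: "f \<in> borel_measurable borel" by (rule borel_measurable_continuous_onI[OF fc])
    have "bounded (range f)" by (rule boundedI[where B = 1]) (auto simp: f_def)
    then have "(\<lambda>n. expectation (\<lambda>\<omega>. f (Y n \<omega>))) \<longlonglongrightarrow> (LINT z|N. f z)" using conv fc unfolding conv_distr_R2_def by blast
    moreover have "f (Y n \<omega>) = 0" for n \<omega>
    proof -
      have "0 \<le> snd (Y n \<omega>)" unfolding Y_def by (auto intro!: divide_nonneg_nonneg sum_nonneg)
      then show ?thesis by (simp add: f_def)
    qed
    ultimately have "(LINT z|N. f z) = 0" by (simp add: LIMSEQ_const_iff)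
    moreover have "integrable N f" by (rule N.integrable_const_bound[where B = 1]) (auto simp: f_def)
    ultimately have "AE z in N. f z = 0"
      by (subst (asm) integral_nonneg_eq_0_iff_AE) (auto simp: f_def)
    then show ?thesis by (rule eventually_mono) (auto simp: f_def min_def max_def split: if_splits)
  qed
  \<comment> \<open>An atom at 0 is incompatible with a transform that vanishes at infinity; the
    decay at minus infinity follows by conjugation.\<close>
  have "measure (distr N borel snd) {0} = 0"
  proof (rule no_atom_of_char_vanishing[OF rd2])
    show top: "(char (distr N borel snd) \<longlongrightarrow> 0) at_top" unfolding ch2[abs_def] by (rule psi_square_char_vanishes)
    have "char (distr N borel snd) (- t) = cnj (char (distr N borel snd) t)" for t
      using Re_Im_char[OF rd2, of t] Re_Im_char[OF rd2, of "- t"] by (simp add: complex_eq_iff)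
    then have "((\<lambda>t. char (distr N borel snd) (- t)) \<longlongrightarrow> 0) at_top"
      using tendsto_cnj[OF top] by simp
    then show "(char (distr N borel snd) \<longlongrightarrow> 0) at_bot" by (simp add: filterlim_at_bot_mirror)
  qed
  then have "N.prob {z. snd z = 0} = 0"
    by (subst (asm) measure_distr) (auto simp: vimage_def spN)
  then have "AE z in N. snd z \<noteq> 0"
    by (subst (asm) N.prob_eq_0) (auto simp: sN)
  with sq0 have sqp: "AE z in N. 0 < snd z" by eventually_elim simp
  define h where "h z = (fst z, sqrt (snd z))" for z :: "real \<times> real"
  have hc: "continuous_on UNIV h" unfolding h_def by (intro continuous_intros)
  have hm [measurable]: "h \<in> borel_measurable borel" by (rule borel_measurable_continuous_onI[OF hc])
  define \<nu> where "\<nu> = distr N borel h"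
  interpret V: prob_space \<nu> unfolding \<nu>_def by (rule N.prob_space_distr) measurable
  have "conv_distr_R2 M
         (\<lambda>n \<omega>. ((\<Sum>t\<in>{1..int n}. X t \<omega> - \<mu>) / a n, sqrt (\<Sum>t\<in>{1..int n}. (X t \<omega> - \<mu>)\<^sup>2) / a n)) \<nu>"
    unfolding conv_distr_R2_def
  proof (intro allI impI)
    fix f :: "real \<times> real \<Rightarrow> real" assume f: "continuous_on UNIV f \<and> bounded (range f)"
    then have fm [measurable]: "f \<in> borel_measurable borel" by (intro borel_measurable_continuous_onI) simp
    have "continuous_on UNIV (f \<circ> h)" by (rule continuous_on_compose[OF hc]) (use f in \<open>auto intro: continuous_on_subset\<close>)
    moreover have "bounded (range (f \<circ> h))" by (rule bounded_subset[of "range f"]) (use f in auto)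
    ultimately have "(\<lambda>n. expectation (\<lambda>\<omega>. (f \<circ> h) (Y n \<omega>))) \<longlonglongrightarrow> (LINT z|N. (f \<circ> h) z)"
      using conv unfolding conv_distr_R2_def by blast
    moreover have "(LINT z|N. (f \<circ> h) z) = (LINT z|\<nu>. f z)" unfolding \<nu>_def by (subst integral_distr) (auto simp: comp_def)
    ultimately have lim: "(\<lambda>n. expectation (\<lambda>\<omega>. (f \<circ> h) (Y n \<omega>))) \<longlonglongrightarrow> (LINT z|\<nu>. f z)" by simp
    show "(\<lambda>n. expectation (\<lambda>\<omega>. f ((\<Sum>t\<in>{1..int n}. X t \<omega> - \<mu>) / a n, sqrt (\<Sum>t\<in>{1..int n}. (X t \<omega> - \<mu>)\<^sup>2) / a n))) \<longlonglongrightarrow> (LINT z|\<nu>. f z)"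
    proof (rule Lim_transform_eventually[OF lim])
      show "\<forall>\<^sub>F n in sequentially. expectation (\<lambda>\<omega>. (f \<circ> h) (Y n \<omega>))
         = expectation (\<lambda>\<omega>. f ((\<Sum>t\<in>{1..int n}. X t \<omega> - \<mu>) / a n, sqrt (\<Sum>t\<in>{1..int n}. (X t \<omega> - \<mu>)\<^sup>2) / a n))"
        using a_pos by eventually_elim (simp add: h_def Y_def real_sqrt_divide)
    qed
  qed
  moreover have "stable_law \<kappa> (distr \<nu> borel fst)"
  proof -
    have "distr \<nu> borel fst = distr N borel fst" unfolding \<nu>_def by (subst distr_distr) (auto simp: h_def comp_def)
    moreover have "stable_law \<kappa> (distr N borel fst)"
      by (rule stable_law_of_homogeneous_char[OF rd1 \<kappa>]) (unfold ch1, erule arg_cong[OF psi_u_pos])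
    ultimately show ?thesis by simp
  qed
  moreover have "measure \<nu> {z. snd z > 0} = 1"
  proof -
    have "measure \<nu> {z. snd z > 0} = N.prob {z. snd z > 0}"
      unfolding \<nu>_def by (subst measure_distr) (auto simp: h_def spN vimage_def)
    moreover have "N.prob {z \<in> space N. snd z > 0} = 1"
      by (rule N.prob_Collect_eq_1[THEN iffD2]) (use sqp in measurable)
    ultimately show ?thesis by (simp add: spN)
  qed
  moreover have "stable_law (\<kappa> / 2) (distr \<nu> borel (\<lambda>z. (snd z)\<^sup>2))"
  proof -
    \<comment> \<open>Squaring undoes the root almost surely, so the law in question is the second
      marginal of \<open>N\<close>. Its exponent is homogeneous of index
      \<open>\<kappa> / 2\<close>, which lies in (0, 1) and thus within
      \<open>stable_law_of_homogeneous_char\<close>.\<close>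
    have "distr \<nu> borel (\<lambda>z. (snd z)\<^sup>2) = distr N borel (\<lambda>z. (sqrt (snd z))\<^sup>2)"
      unfolding \<nu>_def by (subst distr_distr) (auto simp: h_def comp_def)
    also have "\<dots> = distr N borel snd"
    proof (rule distr_cong_AE)
      show "AE z in N. (sqrt (snd z))\<^sup>2 = snd z" using sq0 by eventually_elim simp
    qed measurable
    moreover have "stable_law (\<kappa> / 2) (distr N borel snd)"
      by (rule stable_law_of_homogeneous_char[OF rd2]) (use \<kappa>_pos in simp, unfold ch2, erule arg_cong[OF psi_v_pos])
    ultimately show ?thesis by simp
  qed
  ultimately show ?thesis using V.prob_space_axioms by (intro exI[of _ \<nu>]) (simp add: \<nu>_def)
qed

end

theorem theorem2:
  fixes M :: "'a measure" and X :: "int \<Rightarrow> 'a \<Rightarrow> real" and \<kappa> :: real and a :: "nat \<Rightarrow> real"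
  assumes "prob_space M"
    and "\<And>t. X t \<in> borel_measurable M"
    and "stationary_process M X"
    and RV: "rv_process M X \<kappa>" "(0 < \<kappa> \<and> \<kappa> < 1) \<or> (1 < \<kappa> \<and> \<kappa> < 2)"
    and an: "filterlim a at_top sequentially"
      "(\<lambda>n. real n * measure M {\<omega>\<in>space M. \<bar>X 0 \<omega>\<bar> > a n}) \<longlonglongrightarrow> 1"
    and ACMX: "\<exists>r :: nat \<Rightarrow> nat. filterlim r at_top sequentially
        \<and> (\<lambda>n. real (r n) / real n) \<longlonglongrightarrow> 0
        \<and> ((\<lambda>k. limsup (\<lambda>n. ereal (real n * (\<Sum>t\<in>{k..r n}.
              \<integral>\<omega>. min \<bar>X (int t) \<omega> / a n\<bar> 1 * min \<bar>X 0 \<omega> / a n\<bar> 1 \<partial>M))))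
            \<longlonglongrightarrow> 0)
        \<and> (\<exists>l :: nat \<Rightarrow> nat. filterlim l at_top sequentially
             \<and> (\<lambda>n. real (l n) / real (r n)) \<longlonglongrightarrow> 0
             \<and> (\<lambda>n. real n / real (r n) * strong_mixing_coeff M X (l n)) \<longlonglongrightarrow> 0)"
  defines "\<mu> \<equiv> (if \<kappa> > 1 then (\<integral>\<omega>. X 0 \<omega> \<partial>M) else 0)"
  shows "\<exists>\<nu>. prob_space \<nu> \<and> sets \<nu> = sets (borel :: (real \<times> real) measure)
     \<and> conv_distr_R2 M
         (\<lambda>n \<omega>. ((\<Sum>t\<in>{1..int n}. X t \<omega> - \<mu>) / a n,
                  sqrt (\<Sum>t\<in>{1..int n}. (X t \<omega> - \<mu>)\<^sup>2) / a n)) \<nu>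
     \<and> stable_law \<kappa> (distr \<nu> borel fst)
     \<and> measure \<nu> {z. snd z > 0} = 1
     \<and> stable_law (\<kappa> / 2) (distr \<nu> borel (\<lambda>z. (snd z)\<^sup>2))"
proof -
  obtain r :: "nat \<Rightarrow> nat" and l :: "nat \<Rightarrow> nat" where
    "filterlim r at_top sequentially" "(\<lambda>n. real (r n) / real n) \<longlonglongrightarrow> 0"
    "(\<lambda>k. limsup (\<lambda>n. ereal (real n * (\<Sum>t\<in>{k..r n}.
        \<integral>\<omega>. min \<bar>X (int t) \<omega> / a n\<bar> 1 * min \<bar>X 0 \<omega> / a n\<bar> 1 \<partial>M)))) \<longlonglongrightarrow> 0"
    "filterlim l at_top sequentially" "(\<lambda>n. real (l n) / real (r n)) \<longlonglongrightarrow> 0"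
    "(\<lambda>n. real n / real (r n) * strong_mixing_coeff M X (l n)) \<longlonglongrightarrow> 0"
    using ACMX by (elim exE conjE)
  then interpret rv_mixing M X \<kappa> a r l
    using assms(1-7) by (auto intro!: rv_mixing.intro rv_stationary.intro rv_mixing_axioms.intro rv_stationary_axioms.intro)
  have "\<mu> = cen * expectation (X 0)" by (simp add: \<mu>_def cen_def)
  then show ?thesis using self_normalized_limit by simp
qed

end
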